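(* Let $\mathcal{P}^k=\mathcal{P}^k(2)$, $k\ge 0$, be the levels of the Monster tower over $\mathbb{R}^3$, and let local diffeomorphisms $\Phi$ of $\mathbb{R}^3$ act on $\mathcal{P}^k$ by their $k$-fold prolongations $\Phi^k$. The number of orbits of this action at each of the first four levels is as follows: $\mathcal{P}^1$ has exactly $1$ orbit, $\mathcal{P}^2$ has exactly $2$ orbits, $\mathcal{P}^3$ has exactly $7$ orbits, and $\mathcal{P}^4$ has exactly $34$ orbits.
   Context: Everything is in the real-analytic category. Cartan prolongation. Let $Z$ be a manifold with a distribution (linear subbundle) $\Delta\subset TZ$ of rank $r$. Its prolongation is the pair $(Z^1,\Delta_1)$, where $Z^1=\mathbb{P}(\Delta)$ is the projectivization of $\Delta$, i.e. the set of pairs $(p,\ell)$ with $p\in Z$ and $\ell\subset\Delta(p)$ a one-dimensional linear subspace, and $\Delta_1(p,\ell)=(d\pi_{(p,\ell)})^{-1}(\ell)\subset T_{(p,\ell)}Z^1$, where $\pi:Z^1\to Z$, $\pi(p,\ell)=p$. The distribution $\Delta_1$ again has rank $r$. Monster tower ($n=2$). Put $\mathcal{P}^0=\mathbb{R}^3$, $\Delta_0=T\mathbb{R}^3$, and let $(\mathcal{P}^{k},\Delta_{k})$ be the prolongation of $(\mathcal{P}^{k-1},\Delta_{k-1})$ for $k\ge 1$. Thus $\Delta_k$ has rank $3$, $\dim\mathcal{P}^k=3+2k$, and $\mathcal{P}^k\to\mathcal{P}^{k-1}$ is a bundle with fiber the real projective plane $\mathbb{P}^2$. Prolongation of diffeomorphisms.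 If $\Phi$ is a (local) diffeomorphism of $Z$ preserving $\Delta$, its prolongation is the (local) diffeomorphism $\Phi^1(p,\ell)=(\Phi(p),d\Phi_p(\ell))$ of $Z^1$, which preserves $\Delta_1$. For a local diffeomorphism $\Phi$ of $\mathbb{R}^3$, $\Phi^k$ denotes the local diffeomorphism of $\mathcal{P}^k$ obtained by prolonging $k$ times. Orbits. Two points $p,q\in\mathcal{P}^k$ are equivalent (lie in the same orbit) if there is a local diffeomorphism (diffeomorphism germ) $\Phi$ of $\mathbb{R}^3$, defined near the projection of $p$ to $\mathbb{R}^3$, such that $\Phi^k(p)=q$. *)

theory Defs
  imports "HOL-Analysis.Analysis"
begin

(* Manifolds are embedded submanifolds Z of some real^'n, and a distribution on Z assigns to each
   p in Z a linear subspace of tangent_space Z p. A one-dimensional subspace L of real^'n is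
   encoded by the matrix of the orthogonal projection onto L (closest_point L is that projection).
   This is the standard analytic embedding of the projective space of real^'n into the n x n
   matrices, and it makes the projectivization of a distribution on Z an embedded submanifold of
   real^'n x real^'n^'n. The index type 'n + 'n \<times> 'n presents the latter space again as
   a coordinate space, so that the construction can be iterated. *)

type_synonym 'n prol = "'n + 'n \<times> 'n"

definition orth_proj :: "(real^'n) set \<Rightarrow> real^'n^'n" where
  "orth_proj L = matrix (closest_point L)"

definition line_elt :: "real^'n \<Rightarrow> (real^'n) set \<Rightarrow> real^('n prol)" where
  "line_elt p L = (\<chi> i. case i of Inl j \<Rightarrow> p $ j | Inr (j, k) \<Rightarrow> orth_proj L $ j $ k)"

definition base_pt :: "real^('n prol) \<Rightarrow> real^'n" where
  "base_pt q = (\<chi> j. q $ Inl j)"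

definition line_of :: "real^('n prol) \<Rightarrow> (real^'n) set" where
  "line_of q = range (\<lambda>v. (\<chi> j k. q $ Inr (j, k)) *v v)"

lemma base_pt_line_elt [simp]: "base_pt (line_elt p L) = p"
  by (simp add: base_pt_def line_elt_def vec_eq_iff)

lemma closest_point_span_singleton:
  fixes u :: "'a::euclidean_space"
  assumes "norm u = 1"
  shows "closest_point (span {u}) x = (x \<bullet> u) *\<^sub>R u"
proof -
  have uu: "u \<bullet> u = 1" using assms by (simp add: norm_eq_1)
  have "dist x ((x \<bullet> u) *\<^sub>R u) \<le> dist x y" if "y \<in> span {u}" for y
  proof -
    obtain c where c: "y = c *\<^sub>R u" using \<open>y \<in> span {u}\<close> by (auto simp: span_singleton)
    have "(norm (x - c *\<^sub>R u))\<^sup>2 - (norm (x - (x \<bullet> u) *\<^sub>R u))\<^sup>2 = (c - x \<bullet> u)\<^sup>2"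
      unfolding power2_norm_eq_inner
      by (simp add: inner_diff_left inner_diff_right uu inner_commute power2_eq_square algebra_simps)
    then have "(norm (x - (x \<bullet> u) *\<^sub>R u))\<^sup>2 \<le> (norm (x - c *\<^sub>R u))\<^sup>2"
      by (smt (verit) zero_le_power2)
    then show ?thesis unfolding c dist_norm by (rule power2_le_imp_le) simp
  qed
  then have "(x \<bullet> u) *\<^sub>R u = closest_point (span {u}) x"
    by (intro closest_point_unique)
      (auto simp: subspace_imp_convex closed_subspace
        intro: span_mul span_base)
  then show ?thesis by simp
qed

lemma line_of_line_elt:
  assumes "subspace L" "dim L = 1"
  shows "line_of (line_elt p L) = L"
proof -
  obtain w where w: "w \<in> L" "w \<noteq> 0"
    using assms by (metis dim_eq_0 subsetI singletonI zero_neq_one singleton_iff)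
  define u where "u = w /\<^sub>R norm w"
  have nu: "norm u = 1" and "u \<in> L"
    using w assms by (auto simp: u_def subspace_mul)
  have L: "L = span {u}"
  proof -
    have "independent {u}" using nu by (auto simp: dependent_single)
    then have "dim (span {u}) = 1" by (metis card_1_singleton_iff dim_eq_card_independent dim_span One_nat_def)
    moreover have "span {u} \<subseteq> L" using \<open>u \<in> L\<close> assms by (simp add: span_minimal)
    ultimately show ?thesis
      using assms subspace_dim_equal[OF subspace_span assms(1), of "{u}"] by auto
  qed
  have cp: "closest_point L = (\<lambda>x. (x \<bullet> u) *\<^sub>R u)"
    using closest_point_span_singleton[OF nu] L by auto
  have lin: "linear (\<lambda>x. (x \<bullet> u) *\<^sub>R u)"
    by (intro linearI) (auto simp: inner_add_left algebra_simps)
  have "(\<chi> j k. line_elt p L $ Inr (j, k)) = orth_proj L"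
    by (simp add: line_elt_def vec_eq_iff)
  then have "line_of (line_elt p L) = range (\<lambda>x. (x \<bullet> u) *\<^sub>R u)"
    using lin by (simp add: line_of_def orth_proj_def cp)
  also have "\<dots> = L"
  proof -
    have "c *\<^sub>R u \<in> range (\<lambda>x. (x \<bullet> u) *\<^sub>R u)" for c
      using nu by (intro range_eqI[of _ _ "c *\<^sub>R u"]) (simp add: norm_eq_1)
    then show ?thesis unfolding L span_singleton by auto
  qed
  finally show ?thesis .
qed

(* The velocities at p of curves in Z. *)
definition tangent_space :: "'a::real_normed_vector set \<Rightarrow> 'a \<Rightarrow> 'a set" where
  "tangent_space Z p =
     {v. \<exists>\<gamma> :: real \<Rightarrow> 'a. \<gamma> 0 = p \<and> range \<gamma> \<subseteq> Z \<and> (\<gamma> has_vector_derivative v) (at 0)}"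

definition prol_space :: "(real^'n) set \<Rightarrow> (real^'n \<Rightarrow> (real^'n) set) \<Rightarrow> (real^('n prol)) set" where
  "prol_space Z \<Delta> = {line_elt p L | p L. p \<in> Z \<and> subspace L \<and> dim L = 1 \<and> L \<subseteq> \<Delta> p}"

(* The projection (p, L) \<mapsto> p is the restriction of the linear map base_pt, so base_pt is also
   its differential. *)
definition prol_dist ::
  "(real^'n) set \<Rightarrow> (real^'n \<Rightarrow> (real^'n) set) \<Rightarrow> real^('n prol) \<Rightarrow> (real^('n prol)) set" where
  "prol_dist Z \<Delta> q = {w \<in> tangent_space (prol_space Z \<Delta>) q. base_pt w \<in> line_of q}"

(* A derivative of \<Phi> at p within Z need not be unique on all of real^'n, but any two of them
   agree on tangent_space Z p, which is the only place where it is used. *)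
definition prol_map ::
  "(real^'n) set \<Rightarrow> (real^'n \<Rightarrow> real^'n) \<Rightarrow> real^('n prol) \<Rightarrow> real^('n prol)" where
  "prol_map Z \<Phi> q =
     line_elt (\<Phi> (base_pt q)) (frechet_derivative \<Phi> (at (base_pt q) within Z) ` line_of q)"

abbreviation "P0 \<equiv> (UNIV :: (real^3) set)"
abbreviation "\<Delta>0 \<equiv> (\<lambda>p :: real^3. UNIV :: (real^3) set)"

definition "P1 = prol_space P0 \<Delta>0"
definition "\<Delta>1 = prol_dist P0 \<Delta>0"
definition "P2 = prol_space P1 \<Delta>1"
definition "\<Delta>2 = prol_dist P1 \<Delta>1"
definition "P3 = prol_space P2 \<Delta>2"
definition "\<Delta>3 = prol_dist P2 \<Delta>2"
definition "P4 = prol_space P3 \<Delta>3"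

definition "lift1 \<Phi> = prol_map P0 \<Phi>"
definition "lift2 \<Phi> = prol_map P1 (lift1 \<Phi>)"
definition "lift3 \<Phi> = prol_map P2 (lift2 \<Phi>)"
definition "lift4 \<Phi> = prol_map P3 (lift3 \<Phi>)"

(* Near each point of U, f is the sum of a power series; \<alpha> ranges over the multi-indices. *)
definition real_analytic_on :: "(real^'n \<Rightarrow> 'b::real_normed_vector) \<Rightarrow> (real^'n) set \<Rightarrow> bool"
    (infixl \<open>real'_analytic'_on\<close> 50) where
  "f real_analytic_on U \<longleftrightarrow>
     (\<forall>a\<in>U. \<exists>c :: ('n \<Rightarrow> nat) \<Rightarrow> 'b. \<exists>r>0. \<forall>x\<in>ball a r.
        ((\<lambda>\<alpha>. (\<Prod>i\<in>UNIV. (x $ i - a $ i) ^ \<alpha> i) *\<^sub>R c \<alpha>) has_sum f x) UNIV)"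

definition local_diffeo :: "(real^'n) set \<Rightarrow> (real^'n \<Rightarrow> real^'n) \<Rightarrow> bool" where
  "local_diffeo U \<Phi> \<longleftrightarrow> open U \<and> open (\<Phi> ` U) \<and> inj_on \<Phi> U \<and>
     \<Phi> real_analytic_on U \<and> inv_into U \<Phi> real_analytic_on (\<Phi> ` U)"

(* The orbits in P, where \<pi> is the projection of P to real^3 and lift \<Phi> is the prolongation of
   \<Phi> to P. The values of \<Phi> outside U do not affect lift \<Phi> over U. *)
definition orbits ::
  "'p set \<Rightarrow> ('p \<Rightarrow> real^3) \<Rightarrow> ((real^3 \<Rightarrow> real^3) \<Rightarrow> 'p \<Rightarrow> 'p) \<Rightarrow> 'p set set" where
  "orbits P \<pi> lift =
     P // {(p, q). p \<in> P \<and> q \<in> P \<and> (\<exists>U \<Phi>. local_diffeo U \<Phi> \<and> \<pi> p \<in> U \<and> lift \<Phi> p = q)}"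

end

theory Submission imports Defs begin

text \<open>A level of the tower is handled through a finite set of representatives of its orbits. If the
  stabilizer of each representative \<open>m\<close> has finitely many orbits on the lines of \<open>\<Delta> m\<close>, the pairs of a
  representative and a line from such a list represent the orbits of the next level; so the count is
  a matter of knowing the stabilizers' actions on the three-dimensional spaces \<open>\<Delta> m\<close>. Every line is
  normalized by polynomial automorphisms, and lines are told apart by subspaces that all
  symmetries preserve: the vertical plane, and the velocities of prolongations of invariant families of
  curves, such as the lines and conics in a projective fiber. The action on \<open>\<Delta> m\<close> is computed by
  prolonging a curve through \<open>m\<close> and its image: when the two agree to a certain order, the leading
  term of their difference passes from level to level by applying \<open>vert\<close>.

  Analyticity enters only at the two ends: analytic maps are smooth, which is all that is needed to separate
  orbits, and the maps that join points of an orbit are polynomial.\<close>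

subsection \<open>Smooth maps\<close>

text \<open>The totals are 7 = 2 + 5 and 34 = 2 + 5 + 4 + 7 + 5 + 4 + 7, one summand for each orbit
  one level below. One local picture recurs at every regular direction: the stabilizer shears the
  lifted direction, contains a three-parameter torus and is transitive on the vertical lines. The
  locale \<open>vn\<close> isolates it and is established over three consecutive levels. At most of
  the seven points the prolongation of an invariant fiber line supplies a preserved direction, and
  the action becomes triangular or diagonal. Two points differ. After regular, vertical, regular no
  direction outside the vertical plane is preserved; the cusp \<open>rb\<close> only provides a
  reference direction, and two polynomial maps are found that move it by any vertical amount. The
  directions tangent to the fiber split into two orbits, because symmetries act on fibers
  projectively: the velocity of a prolonged line is never taken to that of the conic, and the conic
  itself is preserved only to low order. Points are joined by global polynomial automorphisms but
  separated by all smooth maps with injective differentials, so that the count inverts polynomial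
  maps only.\<close>

primrec Ck :: "nat \<Rightarrow> 'a::euclidean_space set \<Rightarrow> ('a \<Rightarrow> 'b::real_normed_vector) \<Rightarrow> bool" where
  "Ck 0 S f \<longleftrightarrow> True"
| "Ck (Suc n) S f \<longleftrightarrow>
     (\<exists>f'. (\<forall>x\<in>S. (f has_derivative f' x) (at x)) \<and> (\<forall>v. Ck n S (\<lambda>x. f' x v)))"

definition smooth :: "'a::euclidean_space set \<Rightarrow> ('a \<Rightarrow> 'b::real_normed_vector) \<Rightarrow> bool" where
  "smooth S f \<longleftrightarrow> (\<forall>n. Ck n S f)"

named_theorems smooth_intros

lemma Ck_subset: "Ck n S f \<Longrightarrow> T \<subseteq> S \<Longrightarrow> Ck n T f"
proof (induction n arbitrary: f)
  case (Suc n)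
  then show ?case by (simp only: Ck.simps) (meson in_mono)
qed simp

lemma Ck_cong:
  assumes "open S" "\<And>x. x \<in> S \<Longrightarrow> f x = g x" "Ck n S f"
  shows "Ck n S g"
proof (cases n)
  case (Suc m)
  then obtain f' where f': "\<And>x. x \<in> S \<Longrightarrow> (f has_derivative f' x) (at x)" "\<And>v. Ck m S (\<lambda>x. f' x v)"
    using assms(3) by auto
  have "(g has_derivative f' x) (at x)" if "x \<in> S" for x
    using has_derivative_transform_within_open[OF f'(1)[OF that] assms(1) that] assms(2) by blast
  then show ?thesis using f'(2) Suc by auto
qed simp

lemma Ck_SucD: "Ck (Suc n) S f \<Longrightarrow> Ck n S f"
proof (induction n arbitrary: f)
  case (Suc n)
  then show ?case by (simp only: Ck.simps) blast
qed simp

lemma Ck_const: "Ck n S (\<lambda>x. c)"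
  by (induction n arbitrary: c) (auto intro!: exI[of _ "\<lambda>x v. 0"])

lemma Ck_bounded_linear:
  assumes "bounded_linear f" shows "Ck n S f"
  using assms by (cases n) (auto intro!: exI[of _ "\<lambda>x. f"] bounded_linear_imp_has_derivative Ck_const)

lemma Ck_add:
  "Ck n S f \<Longrightarrow> Ck n S g \<Longrightarrow> Ck n S (\<lambda>x. f x + g x)"
proof (induction n arbitrary: f g)
  case (Suc n)
  from Suc.prems obtain f' g' where
    "\<And>x. x \<in> S \<Longrightarrow> (f has_derivative f' x) (at x)" "\<And>v. Ck n S (\<lambda>x. f' x v)"
    "\<And>x. x \<in> S \<Longrightarrow> (g has_derivative g' x) (at x)" "\<And>v. Ck n S (\<lambda>x. g' x v)" by (simp only: Ck.simps) blast
  then show ?case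
    by (auto intro!: exI[of _ "\<lambda>x v. f' x v + g' x v"] has_derivative_add Suc.IH)
qed simp

lemma Ck_bilinear:
  assumes "bounded_bilinear p"
  shows "Ck n S f \<Longrightarrow> Ck n S g \<Longrightarrow> Ck n S (\<lambda>x. p (f x) (g x))"
proof (induction n arbitrary: f g)
  case (Suc n)
  from Suc.prems obtain f' g' where
    "\<And>x. x \<in> S \<Longrightarrow> (f has_derivative f' x) (at x)" "\<And>v. Ck n S (\<lambda>x. f' x v)"
    "\<And>x. x \<in> S \<Longrightarrow> (g has_derivative g' x) (at x)" "\<And>v. Ck n S (\<lambda>x. g' x v)" by (simp only: Ck.simps) blast
  then show ?case
    using Ck_SucD[OF Suc.prems(1)] Ck_SucD[OF Suc.prems(2)]
    by (auto intro!: exI[of _ "\<lambda>x v. p (f x) (g' x v) + p (f' x v) (g x)"]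
        bounded_bilinear.FDERIV[OF assms] Suc.IH Ck_add)
qed simp

lemma Ck_linear_compose:
  assumes "bounded_linear h"
  shows "Ck n S f \<Longrightarrow> Ck n S (\<lambda>x. h (f x))"
proof (induction n arbitrary: f)
  case (Suc n)
  from Suc.prems obtain f' where
    "\<And>x. x \<in> S \<Longrightarrow> (f has_derivative f' x) (at x)" "\<And>v. Ck n S (\<lambda>x. f' x v)" by auto
  then show ?case
    by (auto intro!: exI[of _ "\<lambda>x v. h (f' x v)"] bounded_linear.has_derivative[OF assms] Suc.IH)
qed simp

lemma Ck_sum: "(\<And>i. i \<in> I \<Longrightarrow> Ck n S (f i)) \<Longrightarrow> Ck n S (\<lambda>x. \<Sum>i\<in>I. f i x)"
  by (induction I rule: infinite_finite_induct) (auto intro: Ck_const Ck_add)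

lemma linear_as_sum:
  fixes v :: "'a::euclidean_space"
  assumes "linear f" shows "f v = (\<Sum>b\<in>Basis. (v \<bullet> b) *\<^sub>R f b)"
proof -
  have "f v = f (\<Sum>b\<in>Basis. (v \<bullet> b) *\<^sub>R b)" by (simp add: euclidean_representation)
  then show ?thesis using assms by (simp add: linear_sum linear_scale)
qed

text \<open>\<open>Ck\<close> controls the derivative along fixed vectors only, which avoids a norm
  on linear maps. A direction that varies with x is expanded in the standard basis, where the
  vectors are fixed and the coefficients are functions.\<close>

lemma Ck_apply:
  fixes g :: "'a::euclidean_space \<Rightarrow> 'c::euclidean_space"
  assumes "\<And>x. x \<in> S \<Longrightarrow> linear (f' x)" "\<And>v. Ck n S (\<lambda>x. f' x v)" "Ck n S g" "open S"
  shows "Ck n S (\<lambda>x. f' x (g x))"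
proof -
  have "Ck n S (\<lambda>x. \<Sum>b\<in>Basis. (g x \<bullet> b) *\<^sub>R f' x b)"
    by (intro Ck_sum Ck_bilinear[OF bounded_bilinear_scaleR] Ck_linear_compose[OF bounded_linear_inner_left] assms)
  then show ?thesis by (rule Ck_cong[rotated 2]) (auto simp: linear_as_sum[OF assms(1)] assms(4))
qed

lemma Ck_compose:
  fixes f :: "'a::euclidean_space \<Rightarrow> 'c::euclidean_space"
  assumes "open S"
  shows "Ck n T g \<Longrightarrow> Ck n S f \<Longrightarrow> f ` S \<subseteq> T \<Longrightarrow> Ck n S (\<lambda>x. g (f x))"
proof (induction n arbitrary: g)
  case (Suc n)
  from Suc.prems obtain f' g' where
    f': "\<And>x. x \<in> S \<Longrightarrow> (f has_derivative f' x) (at x)" "\<And>v. Ck n S (\<lambda>x. f' x v)" and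
    g': "\<And>x. x \<in> T \<Longrightarrow> (g has_derivative g' x) (at x)" "\<And>v. Ck n T (\<lambda>x. g' x v)" by (simp only: Ck.simps) blast
  have "((\<lambda>x. g (f x)) has_derivative (\<lambda>v. g' (f x) (f' x v))) (at x)" if "x \<in> S" for x
    using has_derivative_compose[OF f'(1)[OF that] g'(1)] that Suc.prems(3) by blast
  moreover have "Ck n S (\<lambda>x. g' (f x) (f' x v))" for v
  proof (rule Ck_apply[where f' = "\<lambda>x. g' (f x)" and g = "\<lambda>x. f' x v", OF _ _ f'(2) assms])
    show "linear (g' (f x))" if "x \<in> S" for x
      using g'(1) Suc.prems(3) that by (blast intro: has_derivative_linear)
    show "Ck n S (\<lambda>x. g' (f x) w)" for w
      by (rule Suc.IH[OF g'(2) Ck_SucD[OF Suc.prems(2)] Suc.prems(3)])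
  qed
  ultimately show ?case by (auto intro!: exI[of _ "\<lambda>x v. g' (f x) (f' x v)"])
qed simp

lemma Ck_inverse_real: "Ck n (- {0::real}) inverse"
proof (induction n)
  case (Suc n)
  have "Ck n (- {0::real}) (\<lambda>x. - (inverse x * v * inverse x))" for v
    by (intro Ck_linear_compose[OF bounded_linear_minus[OF bounded_linear_ident]]
        Ck_bilinear[OF bounded_bilinear_mult] Suc Ck_const)
  then show ?case
    by (auto intro!: exI[of _ "\<lambda>x v. - (inverse x * v * inverse x)"] has_derivative_inverse')
qed simp

lemma smooth_subset: "smooth S f \<Longrightarrow> T \<subseteq> S \<Longrightarrow> smooth T f"
  by (auto simp: smooth_def intro: Ck_subset)

lemma smooth_cong: "open S \<Longrightarrow> (\<And>x. x \<in> S \<Longrightarrow> f x = g x) \<Longrightarrow> smooth S f \<Longrightarrow> smooth S g"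
  unfolding smooth_def using Ck_cong by blast

lemma smooth_const [smooth_intros]: "smooth S (\<lambda>x. c)"
  by (simp add: smooth_def Ck_const)

lemma smooth_id [smooth_intros]: "smooth S (\<lambda>x. x)"
  by (simp add: smooth_def Ck_bounded_linear)

lemma smooth_linear_compose: "bounded_linear h \<Longrightarrow> smooth S f \<Longrightarrow> smooth S (\<lambda>x. h (f x))"
  by (simp add: smooth_def Ck_linear_compose)

lemma smooth_add [smooth_intros]: "smooth S f \<Longrightarrow> smooth S g \<Longrightarrow> smooth S (\<lambda>x. f x + g x)"
  by (simp add: smooth_def Ck_add)

lemma smooth_sum [smooth_intros]:
  "(\<And>i. i \<in> I \<Longrightarrow> smooth S (f i)) \<Longrightarrow> smooth S (\<lambda>x. \<Sum>i\<in>I. f i x)"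
  by (simp add: smooth_def Ck_sum)

lemma smooth_minus [smooth_intros]: "smooth S f \<Longrightarrow> smooth S (\<lambda>x. - f x)"
  by (rule smooth_linear_compose[OF bounded_linear_minus[OF bounded_linear_ident]])

lemma smooth_diff [smooth_intros]: "smooth S f \<Longrightarrow> smooth S g \<Longrightarrow> smooth S (\<lambda>x. f x - g x)"
  using smooth_add[of S f "\<lambda>x. - g x"] smooth_minus[of S g] by simp

lemma smooth_bilinear:
  "bounded_bilinear p \<Longrightarrow> smooth S f \<Longrightarrow> smooth S g \<Longrightarrow> smooth S (\<lambda>x. p (f x) (g x))"
  by (simp add: smooth_def Ck_bilinear)

lemmas smooth_scaleR [smooth_intros] = smooth_bilinear[OF bounded_bilinear_scaleR]
lemmas smooth_inner [smooth_intros] = smooth_bilinear[OF bounded_bilinear_inner]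
lemmas smooth_mult [smooth_intros] = smooth_bilinear[OF bounded_bilinear_mult]

lemma smooth_power [smooth_intros]:
  fixes f :: "'a::euclidean_space \<Rightarrow> real"
  shows "smooth S f \<Longrightarrow> smooth S (\<lambda>x. f x ^ n)"
  by (induction n) (auto intro: smooth_intros)

lemma smooth_compose:
  fixes f :: "'a::euclidean_space \<Rightarrow> 'c::euclidean_space"
  shows "open S \<Longrightarrow> smooth T g \<Longrightarrow> smooth S f \<Longrightarrow> f ` S \<subseteq> T \<Longrightarrow> smooth S (\<lambda>x. g (f x))"
  unfolding smooth_def using Ck_compose by blast

lemma smooth_inverse [smooth_intros]:
  fixes f :: "'a::euclidean_space \<Rightarrow> real"
  assumes "smooth S f" "open S" "\<And>x. x \<in> S \<Longrightarrow> f x \<noteq> 0"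
  shows "smooth S (\<lambda>x. inverse (f x))"
  by (rule smooth_compose[of S "- {0}" inverse f]) (use assms in \<open>auto simp: smooth_def Ck_inverse_real\<close>)

lemma smooth_divide [smooth_intros]:
  fixes f :: "'a::euclidean_space \<Rightarrow> real"
  assumes "smooth S g" "smooth S f" "open S" "\<And>x. x \<in> S \<Longrightarrow> f x \<noteq> 0"
  shows "smooth S (\<lambda>x. g x / f x)"
  unfolding divide_inverse by (intro smooth_intros assms)

text \<open>Each order n comes with its own witness for the derivative. Uniqueness of derivatives
  identifies all of them with \<open>frechet_derivative\<close>, which then serves for every n at
  once.\<close>

lemma smooth_deriv:
  assumes "smooth S f" "open S"
  obtains f' where "\<And>x. x \<in> S \<Longrightarrow> (f has_derivative f' x) (at x)" "\<And>v. smooth S (\<lambda>x. f' x v)"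
proof
  have *: "\<exists>f'. (\<forall>x\<in>S. (f has_derivative f' x) (at x)) \<and> (\<forall>v. Ck n S (\<lambda>x. f' x v))" for n
    using assms(1)[unfolded smooth_def, rule_format, of "Suc n"] by simp
  show d: "(f has_derivative frechet_derivative f (at x)) (at x)" if "x \<in> S" for x
    using *[of 0] that frechet_derivative_works differentiable_def by blast
  show "smooth S (\<lambda>x. frechet_derivative f (at x) v)" for v
    unfolding smooth_def
  proof
    fix n
    obtain f' where f': "\<forall>x\<in>S. (f has_derivative f' x) (at x)" "\<forall>v. Ck n S (\<lambda>x. f' x v)" using *[of n] by auto
    show "Ck n S (\<lambda>x. frechet_derivative f (at x) v)"
      by (rule Ck_cong[OF assms(2) _ f'(2)[rule_format, of v]]) (metis f'(1) d has_derivative_unique)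
  qed
qed

lemma smooth_apply:
  fixes g :: "'a::euclidean_space \<Rightarrow> 'c::euclidean_space"
  assumes "\<And>x. x \<in> S \<Longrightarrow> linear (f' x)" "\<And>v. smooth S (\<lambda>x. f' x v)" "smooth S g" "open S"
  shows "smooth S (\<lambda>x. f' x (g x))"
  using assms by (simp add: smooth_def Ck_apply)

lemma smooth_has_derivative:
  assumes "smooth S f" "open S" "x \<in> S" shows "(f has_derivative frechet_derivative f (at x)) (at x)"
  using smooth_deriv[OF assms(1,2)] assms(3) frechet_derivative_works differentiable_def by metis

lemma smooth_isCont:
  assumes "smooth S f" "open S" "x \<in> S" shows "isCont f x"
  using smooth_has_derivative[OF assms] by (rule has_derivative_continuous)

lemma smooth_open_neq_0:
  assumes "smooth S f" "open S" shows "open {x\<in>S. f x \<noteq> 0}"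
proof -
  have "continuous_on S f" using smooth_isCont[OF assms] by (simp add: continuous_at_imp_continuous_on)
  then have "open (S \<inter> f -` (- {0}))" using assms(2) by (intro continuous_open_preimage) auto
  then show ?thesis by (simp add: vimage_def Int_def conj_commute)
qed

lemma smooth_vector_derivative:
  fixes g :: "real \<Rightarrow> 'b::real_normed_vector"
  assumes "smooth S g" "open S"
  obtains g' where "smooth S g'" "\<And>t. t \<in> S \<Longrightarrow> (g has_vector_derivative g' t) (at t)"
proof -
  obtain f' where f': "\<And>x. x \<in> S \<Longrightarrow> (g has_derivative f' x) (at x)" "\<And>v. smooth S (\<lambda>x. f' x v)"
    using smooth_deriv[OF assms] by blast
  show thesis
  proof (rule that[of "\<lambda>x. f' x 1"])
    fix t assume t: "t \<in> S"
    have "f' t x = x *\<^sub>R f' t 1" for x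
      using linear_scale[OF has_derivative_linear[OF f'(1)[OF t]], of x 1] by simp
    then show "(g has_vector_derivative f' t 1) (at t)"
      using f'(1)[OF t] unfolding has_vector_derivative_def by (metis (no_types, lifting) ext)
  qed (rule f')
qed

lemma smooth_real_polynomial: "real_polynomial_function f \<Longrightarrow> smooth S f"
  by (induction rule: real_polynomial_function.induct)
    (use smooth_linear_compose[OF _ smooth_id] in \<open>auto intro: smooth_const smooth_add smooth_mult\<close>)

lemma smooth_polynomial:
  fixes f :: "'a::euclidean_space \<Rightarrow> 'b::euclidean_space"
  assumes "polynomial_function f" shows "smooth S f"
proof -
  have "smooth S (\<lambda>x. \<Sum>b\<in>Basis. (f x \<bullet> b) *\<^sub>R b)"
    using assms by (intro smooth_intros smooth_real_polynomial) (auto simp: polynomial_function_iff_Basis_inner)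
  then show ?thesis by (simp add: euclidean_representation)
qed

subsection \<open>Line elements and vertical vectors\<close>

definition emb :: "real^'n \<Rightarrow> real^('n prol)" where
  "emb v = (\<chi> i. case i of Inl j \<Rightarrow> v $ j | Inr _ \<Rightarrow> 0)"

definition tens :: "real^'n \<Rightarrow> real^'n \<Rightarrow> real^('n prol)" where
  "tens u v = (\<chi> i. case i of Inl _ \<Rightarrow> 0 | Inr (j, k) \<Rightarrow> u $ j * v $ k)"

text \<open>The projection onto the line of u has the matrix u u^T / (u . u), so any nonzero u
  describes its line and no unit vector has to be chosen. For u = 0 the matrix part is 0.\<close>

definition le :: "real^'n \<Rightarrow> real^'n \<Rightarrow> real^('n prol)" where
  "le p u = emb p + (1 / (u \<bullet> u)) *\<^sub>R tens u u"

text \<open>The derivative of \<open>le p\<close> at \<open>u\<close> in direction \<open>v\<close>.\<close>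
definition vert :: "real^'n \<Rightarrow> real^'n \<Rightarrow> real^('n prol)" where
  "vert u v = (1 / (u \<bullet> u)) *\<^sub>R (tens u v + tens v u) - (2 * (u \<bullet> v) / (u \<bullet> u)\<^sup>2) *\<^sub>R tens u u"

text \<open>Applying the matrix part to a fixed vector that is not orthogonal to the line produces a
  generator of the line that depends linearly on the line element; this is how vectors are recovered
  smoothly from lines.\<close>

definition mt :: "real^('n prol) \<Rightarrow> real^'n \<Rightarrow> real^'n" where
  "mt q x = (\<chi> j k. q $ Inr (j, k)) *v x"

lemma bounded_linear_emb: "bounded_linear emb"
  by (intro linear_conv_bounded_linear[THEN iffD1] linearI)
    (auto simp: emb_def vec_eq_iff split: sum.split)

lemma bounded_bilinear_tens: "bounded_bilinear tens"
  by (intro bilinear_conv_bounded_bilinear[THEN iffD1])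
    (auto simp: bilinear_def tens_def vec_eq_iff algebra_simps intro!: linearI split: sum.split)

lemma bounded_linear_base_pt: "bounded_linear base_pt"
  by (intro linear_conv_bounded_linear[THEN iffD1] linearI) (auto simp: base_pt_def vec_eq_iff)

lemma bounded_bilinear_mt: "bounded_bilinear mt"
  by (intro bilinear_conv_bounded_bilinear[THEN iffD1])
    (auto simp: bilinear_def mt_def vec_eq_iff matrix_vector_mult_def algebra_simps sum.distrib sum_distrib_left intro!: linearI)

lemmas emb_simps = linear_add[OF bounded_linear.linear[OF bounded_linear_emb]]
  linear_diff[OF bounded_linear.linear[OF bounded_linear_emb]]
  linear_scale[OF bounded_linear.linear[OF bounded_linear_emb]]
  linear_0[OF bounded_linear.linear[OF bounded_linear_emb]]
lemmas base_pt_simps [simp] = linear_add[OF bounded_linear.linear[OF bounded_linear_base_pt]]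
  linear_diff[OF bounded_linear.linear[OF bounded_linear_base_pt]]
  linear_scale[OF bounded_linear.linear[OF bounded_linear_base_pt]]
  linear_0[OF bounded_linear.linear[OF bounded_linear_base_pt]]
lemmas tens_simps = bounded_bilinear.add_left[OF bounded_bilinear_tens]
  bounded_bilinear.add_right[OF bounded_bilinear_tens] bounded_bilinear.scaleR_left[OF bounded_bilinear_tens]
  bounded_bilinear.scaleR_right[OF bounded_bilinear_tens] bounded_bilinear.zero_left[OF bounded_bilinear_tens]
  bounded_bilinear.zero_right[OF bounded_bilinear_tens]
lemmas mt_simps [simp] = bounded_bilinear.add_left[OF bounded_bilinear_mt]
  bounded_bilinear.diff_left[OF bounded_bilinear_mt] bounded_bilinear.scaleR_left[OF bounded_bilinear_mt]
  bounded_bilinear.zero_left[OF bounded_bilinear_mt] bounded_bilinear.zero_right[OF bounded_bilinear_mt]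

lemma base_pt_emb [simp]: "base_pt (emb v) = v"
  by (simp add: base_pt_def emb_def vec_eq_iff)
lemma base_pt_tens [simp]: "base_pt (tens u v) = 0"
  by (simp add: base_pt_def tens_def vec_eq_iff)
lemma mt_emb [simp]: "mt (emb v) x = 0"
  by (simp add: mt_def emb_def vec_eq_iff matrix_vector_mult_def)
lemma mt_tens [simp]: "mt (tens u v) x = (v \<bullet> x) *\<^sub>R u"
  by (simp add: mt_def tens_def vec_eq_iff matrix_vector_mult_def inner_vec_def sum_distrib_left sum_distrib_right mult_ac)
lemma base_pt_le [simp]: "base_pt (le p u) = p" by (simp add: le_def)
lemma base_pt_vert [simp]: "base_pt (vert u v) = 0" by (simp add: vert_def)
lemma mt_le: "mt (le p u) x = ((u \<bullet> x) / (u \<bullet> u)) *\<^sub>R u" by (simp add: le_def)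
lemma mt_vert: "mt (vert u v) x =
   (1 / (u \<bullet> u)) *\<^sub>R ((v \<bullet> x) *\<^sub>R u + (u \<bullet> x) *\<^sub>R v) - (2 * (u \<bullet> v) / (u \<bullet> u)\<^sup>2 * (u \<bullet> x)) *\<^sub>R u"
  by (simp add: vert_def)

lemma vert_add: "vert u (v + w) = vert u v + vert u w"
  by (simp add: vert_def tens_simps inner_add_right algebra_simps add_divide_distrib)
lemma vert_scale_right: "vert u (c *\<^sub>R v) = c *\<^sub>R vert u v"
  by (simp add: vert_def tens_simps algebra_simps)
lemma vert_diff: "vert u (v - w) = vert u v - vert u w"
  using vert_add[of u v "(-1) *\<^sub>R w"] unfolding vert_scale_right by simp
lemma vert_0 [simp]: "vert u 0 = 0"
  using vert_scale_right[of u 0 0] by simp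
lemma vert_self [simp]: "vert u u = 0"
  by (cases "u = 0") (simp_all add: vert_def tens_simps power2_eq_square flip: scaleR_2)
text \<open>c u + t v spans the same line as u + (t / c) v, so the curve in the fiber is the same up
  to the speed 1 / c.\<close>

lemma vert_scale_left: "c \<noteq> 0 \<Longrightarrow> vert (c *\<^sub>R u) v = (1 / c) *\<^sub>R vert u v"
  by (simp add: vert_def tens_simps power2_eq_square algebra_simps)
lemma vert_sum: "vert u (\<Sum>i\<in>I. f i) = (\<Sum>i\<in>I. vert u (f i))"
  by (induction I rule: infinite_finite_induct) (auto simp: vert_add)
lemmas vert_simps = vert_add vert_diff vert_scale_right

text \<open>Applying the matrix of \<open>vert u v\<close> to u leaves exactly the component of v
  orthogonal to u.\<close>

lemma vert_eq_0D:
  assumes "vert u v = 0" "u \<noteq> 0" shows "v = ((u \<bullet> v) / (u \<bullet> u)) *\<^sub>R u"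
proof -
  have "0 = mt (vert u v) u" using assms by simp
  also have "\<dots> = v - ((u \<bullet> v) / (u \<bullet> u)) *\<^sub>R u"
    using assms(2) by (simp add: mt_vert power2_eq_square algebra_simps inner_commute flip: scaleR_add_left)
  finally show ?thesis by simp
qed

lemma le_scale [simp]: "c \<noteq> 0 \<Longrightarrow> le p (c *\<^sub>R u) = le p u"
  by (simp add: le_def tens_simps)

lemma le_eqD:
  assumes "le p u = le q v" "u \<noteq> 0" "v \<noteq> 0"
  obtains c where "p = q" "c \<noteq> 0" "u = c *\<^sub>R v"
proof -
  have "p = q" using assms(1) by (metis base_pt_le)
  have "u = mt (le p u) u" using assms(2) by (simp add: mt_le)
  also have "\<dots> = ((v \<bullet> u) / (v \<bullet> v)) *\<^sub>R v" by (simp add: assms(1) mt_le)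
  finally show ?thesis using that[of "(v \<bullet> u) / (v \<bullet> v)"] \<open>p = q\<close> assms(2) by fastforce
qed

lemma line_elt_le:
  assumes "u \<noteq> 0" shows "line_elt p (span {u}) = le p u"
proof -
  define e where "e = (1 / norm u) *\<^sub>R u"
  have e: "norm e = 1" using assms by (simp add: e_def)
  have "u = norm u *\<^sub>R e" using assms by (simp add: e_def)
  then have "u \<in> span {e}" unfolding span_singleton by (rule range_eqI)
  moreover have "e \<in> span {u}" unfolding span_singleton e_def by blast
  ultimately have sp: "span {e} = span {u}" by (simp add: span_eq)
  have ux: "(x \<bullet> e) *\<^sub>R e = ((u \<bullet> x) / (u \<bullet> u)) *\<^sub>R u" for x
    by (simp add: e_def dot_square_norm power2_eq_square inner_commute)
  have "matrix (closest_point (span {u})) $ j $ k = u $ j * u $ k / (u \<bullet> u)" for j k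
    by (simp add: matrix_def closest_point_span_singleton[OF e] ux inner_axis flip: sp)
  then show ?thesis
    by (auto simp: line_elt_def orth_proj_def le_def emb_def tens_def vec_eq_iff split: sum.split)
qed

lemma line_of_le:
  assumes "u \<noteq> 0" shows "line_of (le p u) = span {u}"
proof -
  have "line_of (le p u) = range (mt (le p u))" by (simp add: line_of_def mt_def)
  also have "\<dots> = range (\<lambda>c. c *\<^sub>R u)"
  proof (intro subset_antisym subsetI)
    fix y assume "y \<in> range (\<lambda>c. c *\<^sub>R u)"
    then obtain c where "y = c *\<^sub>R u" by blast
    then have "y = mt (le p u) (c *\<^sub>R u)" using assms by (simp add: mt_le)
    then show "y \<in> range (mt (le p u))" by blast
  qed (auto simp: mt_le)
  finally show ?thesis by (simp add: span_singleton)
qed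

lemma mem_span_singleton: "x \<in> span {u} \<longleftrightarrow> (\<exists>c. x = c *\<^sub>R u)"
  by (auto simp: span_singleton)

lemma dim_span_singleton:
  assumes "u \<noteq> 0" shows "dim (span {u}) = 1"
proof -
  have "independent {u}" using assms by (simp add: dependent_single)
  then show ?thesis using dim_eq_card_independent[of "{u}"] by (simp add: dim_span)
qed

lemma dim_1_span:
  fixes L :: "'a::euclidean_space set"
  assumes "subspace L" "dim L = 1" obtains u where "u \<noteq> 0" "L = span {u}"
proof -
  obtain u where u: "u \<in> L" "u \<noteq> 0"
    using assms by (metis dim_eq_0 subsetI singletonI zero_neq_one singleton_iff)
  then have "span {u} \<subseteq> L" using assms(1) by (simp add: span_minimal)
  then have "span {u} = L"
    using subspace_dim_equal[OF subspace_span assms(1), of "{u}"] assms(2) dim_span_singleton[OF u(2)] by simp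
  then show thesis using that u(2) by blast
qed

lemma le_has_vector_derivative:
  assumes "(p has_vector_derivative p') (at t)" "(u has_vector_derivative u') (at t)" "u t \<noteq> 0"
  shows "((\<lambda>s. le (p s) (u s)) has_vector_derivative (emb p' + vert (u t) u')) (at t)"
proof -
  have a: "((\<lambda>s. emb (p s)) has_vector_derivative emb p') (at t)"
    by (rule bounded_linear.has_vector_derivative[OF bounded_linear_emb assms(1)])
  have b: "((\<lambda>s. tens (u s) (u s)) has_vector_derivative (tens (u t) u' + tens u' (u t))) (at t)"
    by (rule bounded_bilinear.has_vector_derivative[OF bounded_bilinear_tens assms(2,2)])
  have "((\<lambda>s. u s \<bullet> u s) has_vector_derivative (u t \<bullet> u' + u' \<bullet> u t)) (at t)"
    by (rule bounded_bilinear.has_vector_derivative[OF bounded_bilinear_inner assms(2,2)])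
  then have "((\<lambda>s. u s \<bullet> u s) has_real_derivative (2 * (u t \<bullet> u'))) (at t)"
    by (simp add: has_real_derivative_iff_has_vector_derivative inner_commute)
  then have c: "((\<lambda>s. 1 / (u s \<bullet> u s)) has_real_derivative (- (2 * (u t \<bullet> u')) / (u t \<bullet> u t)\<^sup>2)) (at t)"
    using assms(3) by (auto intro!: derivative_eq_intros simp: power2_eq_square)
  show ?thesis unfolding le_def
    by (rule has_vector_derivative_eq_rhs[OF has_vector_derivative_add[OF a has_vector_derivative_scaleR[OF c b]]])
      (simp add: vert_def)
qed

lemma smooth_emb [smooth_intros]: "smooth S f \<Longrightarrow> smooth S (\<lambda>x. emb (f x))"
  by (rule smooth_linear_compose[OF bounded_linear_emb])
lemma smooth_base_pt [smooth_intros]: "smooth S f \<Longrightarrow> smooth S (\<lambda>x. base_pt (f x))"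
  by (rule smooth_linear_compose[OF bounded_linear_base_pt])
lemmas smooth_tens [smooth_intros] = smooth_bilinear[OF bounded_bilinear_tens]
lemmas smooth_mt [smooth_intros] = smooth_bilinear[OF bounded_bilinear_mt]

lemma smooth_le [smooth_intros]:
  "smooth S p \<Longrightarrow> smooth S u \<Longrightarrow> open S \<Longrightarrow> (\<And>x. x \<in> S \<Longrightarrow> u x \<noteq> 0) \<Longrightarrow> smooth S (\<lambda>x. le (p x) (u x))"
  unfolding le_def by (intro smooth_intros) auto

lemma smooth_vert [smooth_intros]:
  "smooth S u \<Longrightarrow> smooth S v \<Longrightarrow> open S \<Longrightarrow> (\<And>x. x \<in> S \<Longrightarrow> u x \<noteq> 0) \<Longrightarrow> smooth S (\<lambda>x. vert (u x) (v x))"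
  unfolding vert_def by (intro smooth_intros) auto

subsection \<open>Regular distributions\<close>

lemma has_vector_derivative_compose:
  assumes "(c has_vector_derivative w) (at t)" "(F has_derivative F') (at (c t))"
  shows "((\<lambda>s. F (c s)) has_vector_derivative F' w) (at t)"
proof -
  have "((\<lambda>s. F (c s)) has_derivative (\<lambda>s. F' (s *\<^sub>R w))) (at t)"
    using has_derivative_compose[OF assms(1)[unfolded has_vector_derivative_def] assms(2)] .
  then show ?thesis
    using has_derivative_linear[OF assms(2)] by (simp add: has_vector_derivative_def linear_scale)
qed

lemma has_vector_derivative_isCont: "(c has_vector_derivative w) (at t) \<Longrightarrow> isCont c t"
  unfolding has_vector_derivative_def by (rule has_derivative_continuous)

lemma curve_eventually_in:
  assumes "(c has_vector_derivative w) (at t)" "open W" "c t \<in> W"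
  shows "\<forall>\<^sub>F s in nhds t. c s \<in> W"
proof -
  have "(c \<longlongrightarrow> c t) (nhds t)"
    using has_vector_derivative_isCont[OF assms(1)] by (simp add: isCont_def tendsto_at_iff_tendsto_nhds)
  then show ?thesis using assms(2,3) by (rule topological_tendstoD)
qed

lemma has_vector_derivative_cong_ev:
  assumes "\<forall>\<^sub>F s in nhds t. c s = d s" "(c has_vector_derivative w) (at t)"
  shows "(d has_vector_derivative w) (at t)"
proof -
  have "\<forall>\<^sub>F s in at t. c s = d s" 
    using assms(1) unfolding eventually_at_filter by (rule eventually_mono) simp
  moreover have "c t = d t" using assms(1) by (rule eventually_nhds_x_imp_x)
  ultimately show ?thesis
    using has_derivative_transform_eventually[OF assms(2)[unfolded has_vector_derivative_def]]
    by (simp add: has_vector_derivative_def)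
qed

lemma tangent_spaceI:
  assumes "c 0 = p" "\<forall>\<^sub>F t in nhds 0. c t \<in> Z" "(c has_vector_derivative v) (at 0)"
  shows "v \<in> tangent_space Z p"
proof -
  \<comment> \<open>\<open>tangent_space\<close> asks for a curve that stays in Z for all times, so
    the curve is replaced by the constant p wherever it leaves Z; this does not affect the
    derivative at 0.\<close>
  define d where "d t = (if c t \<in> Z then c t else p)" for t
  have p: "p \<in> Z" using eventually_nhds_x_imp_x[OF assms(2)] assms(1) by simp
  have "(d has_vector_derivative v) (at 0)"
    by (rule has_vector_derivative_cong_ev[OF _ assms(3)])
      (rule eventually_mono[OF assms(2)], simp add: d_def)
  moreover have "d 0 = p" "range d \<subseteq> Z" using assms(1) p by (auto simp: d_def)
  ultimately show ?thesis unfolding tangent_space_def by blast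
qed

lemma tangent_spaceE:
  assumes "v \<in> tangent_space Z p"
  obtains c where "c 0 = p" "\<And>t. c t \<in> Z" "(c has_vector_derivative v) (at 0)"
  using assms unfolding tangent_space_def by blast

text \<open>Velocities are rescaled by running along the curve at speed a, with a = 0 allowed. Sums
  of velocities admit no such argument, as \<open>tangent_space\<close> of an arbitrary set need not
  be a subspace.\<close>

lemma tangent_space_scaleE:
  assumes "v \<in> tangent_space Z p"
  obtains c where "c 0 = p" "\<And>t. c t \<in> Z" "(c has_vector_derivative a *\<^sub>R v) (at 0)"
proof -
  obtain c where c: "c 0 = p" "\<And>t. c t \<in> Z" "(c has_vector_derivative v) (at 0)"
    using tangent_spaceE[OF assms] by blast
  have "((\<lambda>t. c (a * t)) has_vector_derivative a *\<^sub>R v) (at 0)"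
    using vector_diff_chain_at[of "\<lambda>t. a * t" a 0 c v] c(3)
    by (auto simp: o_def has_real_derivative_iff_has_vector_derivative[symmetric] intro!: derivative_eq_intros)
  then show thesis using c by (intro that[of "\<lambda>t. c (a * t)"]) auto
qed

text \<open>The fields live on an open set of the ambient space, where calculus needs no relative
  derivatives, but they span \<Delta> and are dual to each other only over Z. The dual forms are
  kept as vectors and provide coordinates on \<Delta> that are smooth functions.\<close>

definition frame :: "(real^'n) set \<Rightarrow> (real^'n \<Rightarrow> (real^'n) set) \<Rightarrow> (real^'n) set \<Rightarrow>
    (3 \<Rightarrow> real^'n \<Rightarrow> real^'n) \<Rightarrow> (3 \<Rightarrow> real^'n \<Rightarrow> real^'n) \<Rightarrow> bool" where
  "frame Z \<Delta> W E \<theta> \<longleftrightarrow> open W \<and> (\<forall>i. smooth W (E i)) \<and> (\<forall>i. smooth W (\<theta> i)) \<and>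
     (\<forall>q\<in>Z\<inter>W. \<Delta> q = range (\<lambda>c. \<Sum>i\<in>UNIV. c i *\<^sub>R E i q) \<and>
        (\<forall>i j. \<theta> i q \<bullet> E j q = (if i = j then 1 else 0)))"

text \<open>Rank three comes from the index type of the frame. The inclusion in
  \<open>tangent_space\<close> provides a curve in Z for each vector of \<Delta>, and such curves
  are what gets lifted.\<close>

definition regular :: "(real^'n) set \<Rightarrow> (real^'n \<Rightarrow> (real^'n) set) \<Rightarrow> bool" where
  "regular Z \<Delta> \<longleftrightarrow> (\<forall>q\<in>Z. \<Delta> q \<subseteq> tangent_space Z q) \<and> (\<forall>p\<in>Z. \<exists>W E \<theta>. p \<in> W \<and> frame Z \<Delta> W E \<theta>)"

lemma frame_dual_sum:
  assumes "frame Z \<Delta> W E \<theta>" "q \<in> Z" "q \<in> W"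
  shows "\<theta> i q \<bullet> (\<Sum>j\<in>UNIV. c j *\<^sub>R E j q) = c i"
proof -
  have "\<theta> i q \<bullet> (\<Sum>j\<in>UNIV. c j *\<^sub>R E j q) = (\<Sum>j\<in>UNIV. c j * (if i = j then 1 else 0))"
    using assms by (simp add: frame_def inner_sum_right)
  also have "\<dots> = (\<Sum>j\<in>UNIV. if i = j then c j else 0)" by (rule sum.cong) auto
  finally show ?thesis by simp
qed

lemma frame_mem: "frame Z \<Delta> W E \<theta> \<Longrightarrow> q \<in> Z \<Longrightarrow> q \<in> W \<Longrightarrow> (\<Sum>j\<in>UNIV. c j *\<^sub>R E j q) \<in> \<Delta> q"
  by (auto simp: frame_def)

lemma frame_coords:
  assumes "frame Z \<Delta> W E \<theta>" "q \<in> Z" "q \<in> W" "v \<in> \<Delta> q"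
  shows "v = (\<Sum>i\<in>UNIV. (\<theta> i q \<bullet> v) *\<^sub>R E i q)"
proof -
  obtain c where c: "v = (\<Sum>i\<in>UNIV. c i *\<^sub>R E i q)" using assms by (auto simp: frame_def)
  show ?thesis unfolding c frame_dual_sum[OF assms(1-3)] ..
qed

lemma regular_subspace:
  assumes "regular Z \<Delta>" "p \<in> Z" shows "subspace (\<Delta> p)"
proof -
  obtain W E \<theta> where "p \<in> W" "frame Z \<Delta> W E \<theta>" using assms by (auto simp: regular_def)
  then have "\<Delta> p = range (\<lambda>c. \<Sum>i\<in>UNIV. c i *\<^sub>R E i p)" using assms(2) by (auto simp: frame_def)
  moreover have "subspace (range (\<lambda>c. \<Sum>i\<in>(UNIV::3 set). c i *\<^sub>R E i p))"
  proof (rule subspaceI)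
    show "0 \<in> range (\<lambda>c. \<Sum>i\<in>(UNIV::3 set). c i *\<^sub>R E i p)" by (rule range_eqI[of _ _ "\<lambda>i. 0"]) simp
  next
    fix x y assume "x \<in> range (\<lambda>c. \<Sum>i\<in>(UNIV::3 set). c i *\<^sub>R E i p)" "y \<in> range (\<lambda>c. \<Sum>i\<in>(UNIV::3 set). c i *\<^sub>R E i p)"
    then obtain c d where "x = (\<Sum>i\<in>(UNIV::3 set). c i *\<^sub>R E i p)" "y = (\<Sum>i\<in>(UNIV::3 set). d i *\<^sub>R E i p)" by auto
    then show "x + y \<in> range (\<lambda>c. \<Sum>i\<in>(UNIV::3 set). c i *\<^sub>R E i p)"
      by (intro range_eqI[of _ _ "\<lambda>i. c i + d i"]) (simp add: sum.distrib scaleR_add_left)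
  next
    fix a x assume "x \<in> range (\<lambda>c. \<Sum>i\<in>(UNIV::3 set). c i *\<^sub>R E i p)"
    then obtain c where "x = (\<Sum>i\<in>(UNIV::3 set). c i *\<^sub>R E i p)" by auto
    then show "a *\<^sub>R x \<in> range (\<lambda>c. \<Sum>i\<in>(UNIV::3 set). c i *\<^sub>R E i p)"
      by (intro range_eqI[of _ _ "\<lambda>i. a * c i"]) (simp add: scaleR_sum_right)
  qed
  ultimately show ?thesis by simp
qed

lemma prol_space_iff:
  assumes "regular Z \<Delta>"
  shows "Q \<in> prol_space Z \<Delta> \<longleftrightarrow> (\<exists>p u. p \<in> Z \<and> u \<in> \<Delta> p \<and> u \<noteq> 0 \<and> Q = le p u)"
proof
  assume "Q \<in> prol_space Z \<Delta>"
  then obtain p L where pL: "p \<in> Z" "subspace L" "dim L = 1" "L \<subseteq> \<Delta> p" "Q = line_elt p L"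
    by (auto simp: prol_space_def)
  obtain u where u: "u \<noteq> 0" "L = span {u}" using dim_1_span pL(2,3) by metis
  then have "u \<in> \<Delta> p" using pL(4) span_base by blast
  then show "\<exists>p u. p \<in> Z \<and> u \<in> \<Delta> p \<and> u \<noteq> 0 \<and> Q = le p u" using pL u line_elt_le by metis
next
  assume "\<exists>p u. p \<in> Z \<and> u \<in> \<Delta> p \<and> u \<noteq> 0 \<and> Q = le p u"
  then obtain p u where pu: "p \<in> Z" "u \<in> \<Delta> p" "u \<noteq> 0" "Q = le p u" by blast
  have "span {u} \<subseteq> \<Delta> p" using regular_subspace[OF assms pu(1)] pu(2) by (simp add: span_minimal)
  then show "Q \<in> prol_space Z \<Delta>"
    unfolding prol_space_def
    by (intro CollectI exI[of _ p] exI[of _ "span {u}"])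
      (simp add: pu line_elt_le[OF pu(3)] dim_span_singleton[OF pu(3)])
qed

lemma le_mem_prol:
  "regular Z \<Delta> \<Longrightarrow> p \<in> Z \<Longrightarrow> u \<in> \<Delta> p \<Longrightarrow> u \<noteq> 0 \<Longrightarrow> le p u \<in> prol_space Z \<Delta>"
  by (auto simp: prol_space_iff)

lemma prol_distI:
  assumes "c 0 = Q" "\<forall>\<^sub>F t in nhds 0. c t \<in> prol_space Z \<Delta>" "(c has_vector_derivative w) (at 0)"
    "base_pt w \<in> line_of Q"
  shows "w \<in> prol_dist Z \<Delta> Q"
  using tangent_spaceI[OF assms(1-3)] assms(4) by (simp add: prol_dist_def)

lemma sum_UNIV_Plus:
  fixes f :: "'b::finite + 'c::finite \<Rightarrow> 'a::comm_monoid_add"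
  shows "(\<Sum>i\<in>UNIV. f i) = (\<Sum>i\<in>UNIV. f (Inl i)) + (\<Sum>i\<in>UNIV. f (Inr i))"
  by (simp add: UNIV_Plus_UNIV[symmetric] sum.Plus del: UNIV_Plus_UNIV)

lemma emb_inner: "emb a \<bullet> w = a \<bullet> base_pt w"
  by (simp add: inner_vec_def emb_def base_pt_def sum_UNIV_Plus)

text \<open>On lines that are not in the kernel of \<open>\<theta> k\<close>, the functions \<open>b i = \<theta> i / \<theta> k\<close> are affine
  coordinates in the fiber; the frame of the prolonged distribution is dual to \<open>\<theta> k\<close> and the
  differentials of the \<open>b i\<close>.\<close>
lemma prol_frame:
  assumes reg: "regular Z \<Delta>" and p: "p \<in> Z" and v: "v \<in> \<Delta> p" "v \<noteq> 0"
  shows "(\<exists>W E \<theta>. le p v \<in> W \<and> frame (prol_space Z \<Delta>) (prol_dist Z \<Delta>) W E \<theta>) \<and>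
    (\<forall>w\<in>prol_dist Z \<Delta> (le p v). base_pt w = 0 \<longrightarrow> (\<exists>u\<in>\<Delta> p. w = vert v u)) \<and>
    (\<exists>w\<in>prol_dist Z \<Delta> (le p v). base_pt w = v)"
proof -
  obtain W E \<theta> where pW: "p \<in> W" and fr: "frame Z \<Delta> W E \<theta>" using reg p by (auto simp: regular_def)
  have W: "open W" and smE: "\<And>i. smooth W (E i)" and sm\<theta>: "\<And>i. smooth W (\<theta> i)"
    and dual: "\<And>i j q. q \<in> Z \<Longrightarrow> q \<in> W \<Longrightarrow> \<theta> i q \<bullet> E j q = (if i = j then 1 else 0)"
    using fr by (auto simp: frame_def)
  note dsum = frame_dual_sum[OF fr]
  have "\<exists>k. \<theta> k p \<bullet> v \<noteq> 0"
  proof (rule ccontr)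
    assume "\<not> ?thesis"
    then have "v = 0" using frame_coords[OF fr p pW v(1)] by simp
    then show False using v(2) by simp
  qed
  then obtain k where k: "\<theta> k p \<bullet> v \<noteq> 0" ..
  define WB where "WB = {Q. base_pt Q \<in> W}"
  have WB: "open WB"
    using open_vimage[OF W bounded_linear.continuous_on[OF bounded_linear_base_pt continuous_on_id]]
    by (simp add: WB_def vimage_def)
  have smB: "smooth WB (\<lambda>Q. f (base_pt Q))" if "smooth W f" for f :: "_ \<Rightarrow> real^'a"
    by (rule smooth_compose[OF WB that]) (auto simp: WB_def intro: smooth_intros)
  \<comment> \<open>\<open>mt Q v\<close> generates the line of Q when that line is not orthogonal
    to v, so these are the values of the forms on a smoothly varying generator; their quotients are
    the affine coordinates.\<close>
  define th where "th i Q = \<theta> i (base_pt Q) \<bullet> mt Q v" for i Q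
  have smth: "smooth WB (th i)" for i unfolding th_def by (intro smooth_intros smB sm\<theta>)
  define W0 where "W0 = {Q\<in>WB. th k Q \<noteq> 0}"
  have W0: "open W0" unfolding W0_def by (rule smooth_open_neq_0[OF smth WB])
  have sub0: "W0 \<subseteq> WB" by (auto simp: W0_def)
  define b where "b i Q = th i Q / th k Q" for i Q
  have smb: "smooth W0 (b i)" for i unfolding b_def
    by (intro smooth_intros smooth_subset[OF smth sub0] W0) (auto simp: W0_def)
  \<comment> \<open>The generator of the line on which \<theta> k takes the value 1, extended off
    the prolonged space.\<close>
  define X where "X Q = (\<Sum>i\<in>UNIV. b i Q *\<^sub>R E i (base_pt Q))" for Q
  have smX: "smooth W0 X" unfolding X_def
    by (intro smooth_intros smb smooth_subset[OF smB sub0] smE)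
  \<comment> \<open>Away from the prolonged space the extension \<open>X\<close> could vanish, and
    there \<open>vert\<close> has its singularity.\<close>
  define W1 where "W1 = {Q\<in>W0. X Q \<noteq> 0}"
  have W1: "open W1" unfolding W1_def by (rule smooth_open_neq_0[OF smX W0])
  have sub1: "W1 \<subseteq> W0" by (auto simp: W1_def)
  have "\<exists>f'. (\<forall>q\<in>W. (E i has_derivative f' q) (at q)) \<and> (\<forall>u. smooth W (\<lambda>q. f' q u))" for i
    using smooth_deriv[OF smE W] by metis
  then obtain DE where DE: "\<And>i q. q \<in> W \<Longrightarrow> (E i has_derivative DE i q) (at q)"
      "\<And>i u. smooth W (\<lambda>q. DE i q u)" by metis
  have "\<exists>f'. (\<forall>q\<in>W0. (b i has_derivative f' q) (at q)) \<and> (\<forall>u. smooth W0 (\<lambda>q. f' q u))" for i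
    using smooth_deriv[OF smb W0] by metis
  then obtain Db where Db: "\<And>i q. q \<in> W0 \<Longrightarrow> (b i has_derivative Db i q) (at q)"
      "\<And>i u. smooth W0 (\<lambda>q. Db i q u)" by metis
  \<comment> \<open>The k-th field moves the base point along the line while all coordinates
    \<open>b j\<close> stay constant; each other field turns the line over a fixed base point by
    changing a single coordinate.\<close>
  define E1 where "E1 i Q = (if i = k then emb (X Q) + vert (X Q) (\<Sum>j\<in>UNIV. b j Q *\<^sub>R DE j (base_pt Q) (X Q))
      else vert (X Q) (E i (base_pt Q)))" for i Q
  define \<theta>1 where "\<theta>1 i Q = (if i = k then emb (\<theta> k (base_pt Q)) else (\<Sum>e\<in>Basis. Db i Q e *\<^sub>R e))" for i Q
  have \<theta>1: "\<theta>1 i Q \<bullet> w = (if i = k then \<theta> k (base_pt Q) \<bullet> base_pt w else Db i Q w)" if "Q \<in> W0" for i Q w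
    using linear_as_sum[OF has_derivative_linear[OF Db(1)[OF that]], of i w]
    by (simp add: \<theta>1_def emb_inner inner_sum_left inner_commute[of w] mult.commute)
  have smE1: "smooth W1 (E1 i)" for i
  proof -
    have "smooth W0 (\<lambda>Q. DE j (base_pt Q) (X Q))" for j
      by (rule smooth_apply[where f' = "\<lambda>Q. DE j (base_pt Q)", OF _ smooth_subset[OF smB[OF DE(2)] sub0] smX W0])
        (auto simp: W0_def WB_def intro!: has_derivative_linear DE)
    then have "smooth W1 (\<lambda>Q. vert (X Q) (\<Sum>j\<in>UNIV. b j Q *\<^sub>R DE j (base_pt Q) (X Q)))"
      by (intro smooth_intros smooth_subset[OF smX sub1] smooth_subset[OF _ sub1] smb W1) (auto simp: W1_def)
    moreover have "smooth W1 (\<lambda>Q. vert (X Q) (E i (base_pt Q)))"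
      by (intro smooth_intros smooth_subset[OF smX sub1] smooth_subset[OF smB[OF smE]] W1) (use sub1 sub0 in \<open>auto simp: W1_def\<close>)
    ultimately show ?thesis unfolding E1_def
      by (cases "i = k") (auto intro!: smooth_intros smooth_subset[OF smX sub1])
  qed
  have sm\<theta>1: "smooth W1 (\<theta>1 i)" for i
  proof (cases "i = k")
    case True
    then have "\<theta>1 i = (\<lambda>Q. emb (\<theta> k (base_pt Q)))" by (simp add: \<theta>1_def fun_eq_iff)
    then show ?thesis using smooth_emb[OF smooth_subset[OF smB[OF sm\<theta>]], of W1] sub1 sub0 by auto
  next
    case False
    have "smooth W0 (\<lambda>Q. \<Sum>e\<in>Basis. Db i Q e *\<^sub>R e)" by (intro smooth_intros Db)
    then have "smooth W1 (\<lambda>Q. \<Sum>e\<in>Basis. Db i Q e *\<^sub>R e)" by (rule smooth_subset[OF _ sub1])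
    moreover have "\<theta>1 i = (\<lambda>Q. \<Sum>e\<in>Basis. Db i Q e *\<^sub>R e)" using False by (simp add: \<theta>1_def fun_eq_iff)
    ultimately show ?thesis by simp
  qed
  have le0: "b i (le q u) = (\<theta> i q \<bullet> u) / (\<theta> k q \<bullet> u) \<and> \<theta> k q \<bullet> u \<noteq> 0
      \<and> X (le q u) = (1 / (\<theta> k q \<bullet> u)) *\<^sub>R u \<and> q \<in> W \<and> le q u \<in> W1"
    if "q \<in> Z" "u \<in> \<Delta> q" "u \<noteq> 0" "le q u \<in> W0" for q u i
  proof -
    have q: "q \<in> W" using that by (auto simp: W0_def WB_def)
    have "th i (le q u) = ((u \<bullet> v) / (u \<bullet> u)) * (\<theta> i q \<bullet> u)" for i by (simp add: th_def mt_le)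
    moreover have nz: "th k (le q u) \<noteq> 0" using that by (auto simp: W0_def)
    ultimately have n: "u \<bullet> v \<noteq> 0" "\<theta> k q \<bullet> u \<noteq> 0" and b: "\<And>i. b i (le q u) = (\<theta> i q \<bullet> u) / (\<theta> k q \<bullet> u)"
      using that(3) by (auto simp: b_def)
    have "X (le q u) = (\<Sum>i\<in>UNIV. ((1 / (\<theta> k q \<bullet> u)) * (\<theta> i q \<bullet> u)) *\<^sub>R E i q)"
      by (simp add: X_def b)
    also have "\<dots> = (1 / (\<theta> k q \<bullet> u)) *\<^sub>R (\<Sum>i\<in>UNIV. (\<theta> i q \<bullet> u) *\<^sub>R E i q)"
      by (simp add: scaleR_sum_right)
    also have "\<dots> = (1 / (\<theta> k q \<bullet> u)) *\<^sub>R u" using frame_coords[OF fr that(1) q that(2)] by simp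
    finally show ?thesis using b n q that by (auto simp: W1_def)
  qed
  have X1: "q \<in> W \<and> X Q \<in> \<Delta> q \<and> X Q \<noteq> 0 \<and> Q = le q (X Q) \<and> \<theta> k q \<bullet> X Q = 1 \<and> b i Q = \<theta> i q \<bullet> X Q \<and> q \<in> Z"
    if Q: "Q \<in> prol_space Z \<Delta>" "Q \<in> W0" "q = base_pt Q" for q Q i
  proof -
    obtain r u where r: "r \<in> Z" "u \<in> \<Delta> r" "u \<noteq> 0" "Q = le r u" using Q(1) prol_space_iff[OF reg] by blast
    then have "q = r" by (simp only: Q(3) base_pt_le)
    with r have u: "q \<in> Z" "u \<in> \<Delta> q" "u \<noteq> 0" "Q = le q u" by simp_all
    note l = le0[OF u(1-3), of i, folded u(4), OF Q(2)]
    have c: "1 / (\<theta> k q \<bullet> u) \<noteq> 0" using l by simp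
    have X: "X Q = (1 / (\<theta> k q \<bullet> u)) *\<^sub>R u" using l by blast
    have "X Q \<in> \<Delta> q" unfolding X by (rule subspace_mul[OF regular_subspace[OF reg u(1)] u(2)])
    moreover have "Q = le q (X Q)" unfolding X le_scale[OF c] by (rule u(4))
    moreover have "X Q \<noteq> 0" "\<theta> k q \<bullet> X Q = 1" "b i Q = \<theta> i q \<bullet> X Q" unfolding X using l u(3) by auto
    ultimately show ?thesis using l u(1) by blast
  qed
  \<comment> \<open>A candidate w is realized by a curve: the base point moves with velocity a x and
    the coordinates move linearly with slopes d. The condition d k = 0 keeps the normalization by
    \<theta> k.\<close>
  have lift: "w \<in> prol_dist Z \<Delta> Q \<and> (\<forall>j. Db j Q w = d j)"
    if Q: "Q \<in> prol_space Z \<Delta>" "Q \<in> W0" and qQ: "q = base_pt Q" and x: "x = X Q" and d: "d k = 0"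
      and w: "w = emb (a *\<^sub>R x) + vert x ((\<Sum>j\<in>UNIV. d j *\<^sub>R E j q) + (\<Sum>j\<in>UNIV. b j Q *\<^sub>R DE j q (a *\<^sub>R x)))"
    for Q q x a d w
  proof -
    note X1 = X1[OF Q qQ, folded x]
    have xT: "x \<in> tangent_space Z q" using reg X1 by (auto simp: regular_def)
    obtain \<gamma> where \<gamma>: "\<gamma> 0 = q" "\<And>t. \<gamma> t \<in> Z" "(\<gamma> has_vector_derivative a *\<^sub>R x) (at 0)"
      using tangent_space_scaleE[OF xT] by metis
    define c where "c t = (\<Sum>j\<in>UNIV. (b j Q + t * d j) *\<^sub>R E j (\<gamma> t))" for t
    have c0: "c 0 = x" using x by (simp add: c_def \<gamma>(1) X_def qQ)
    have cD: "(c has_vector_derivative ((\<Sum>j\<in>UNIV. d j *\<^sub>R E j q) + (\<Sum>j\<in>UNIV. b j Q *\<^sub>R DE j q (a *\<^sub>R x)))) (at 0)"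
    proof -
      have "((\<lambda>t. E j (\<gamma> t)) has_vector_derivative DE j q (a *\<^sub>R x)) (at 0)" for j
        by (rule has_vector_derivative_compose[OF \<gamma>(3)]) (simp add: \<gamma>(1) DE X1)
      then have "((\<lambda>t. (b j Q + t * d j) *\<^sub>R E j (\<gamma> t)) has_vector_derivative (b j Q *\<^sub>R DE j q (a *\<^sub>R x) + d j *\<^sub>R E j q)) (at 0)" for j
        by (rule has_vector_derivative_eq_rhs[OF has_vector_derivative_scaleR[rotated]])
          (auto intro!: derivative_eq_intros simp: \<gamma>(1))
      then show ?thesis unfolding c_def
        by (rule has_vector_derivative_eq_rhs[OF has_vector_derivative_sum]) (simp add: sum.distrib)
    qed
    define \<Gamma> where "\<Gamma> t = le (\<gamma> t) (c t)" for t
    have \<Gamma>0: "\<Gamma> 0 = Q" using X1 by (simp add: \<Gamma>_def \<gamma>(1) c0)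
    have \<Gamma>D: "(\<Gamma> has_vector_derivative w) (at 0)" unfolding \<Gamma>_def
      using le_has_vector_derivative[OF \<gamma>(3) cD] X1 by (simp add: c0 w)
    have evW: "\<forall>\<^sub>F t in nhds 0. \<gamma> t \<in> W" by (rule curve_eventually_in[OF \<gamma>(3) W]) (simp add: \<gamma>(1) X1)
    have bk: "b k Q = 1" using X1 by metis
    have thc: "\<theta> i (\<gamma> t) \<bullet> c t = b i Q + t * d i" if "\<gamma> t \<in> W" for i t
      unfolding c_def by (rule dsum) (use that \<gamma> in auto)
    have cmem: "c t \<in> \<Delta> (\<gamma> t)" "c t \<noteq> 0" if "\<gamma> t \<in> W" for t
      using thc[OF that, of k] frame_mem[OF fr \<gamma>(2) that] by (auto simp: c_def d bk)
    have ev1: "\<forall>\<^sub>F t in nhds 0. \<Gamma> t \<in> prol_space Z \<Delta>"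
      using evW by eventually_elim (auto simp: \<Gamma>_def intro!: le_mem_prol[OF reg] cmem \<gamma>)
    have "line_of Q = span {x}" using X1 line_of_le by metis
    then have "base_pt w \<in> line_of Q" by (auto simp: w mem_span_singleton)
    then have "w \<in> prol_dist Z \<Delta> Q" by (rule prol_distI[of \<Gamma>, OF \<Gamma>0 ev1 \<Gamma>D])
    moreover have "Db j Q w = d j" for j
    proof -
      have "\<forall>\<^sub>F t in nhds 0. \<Gamma> t \<in> W0" by (rule curve_eventually_in[OF \<Gamma>D W0]) (simp add: \<Gamma>0 Q)
      then have ev: "\<forall>\<^sub>F t in nhds 0. b j (\<Gamma> t) = b j Q + t * d j" using evW
      proof eventually_elim
        case (elim t)
        then show ?case using le0[OF \<gamma>(2) cmem(1,2)[OF elim(2)], of j] thc[OF elim(2)]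
          by (simp add: \<Gamma>_def d bk)
      qed
      have "((\<lambda>t. b j (\<Gamma> t)) has_vector_derivative Db j Q w) (at 0)"
        by (rule has_vector_derivative_compose[OF \<Gamma>D]) (simp add: \<Gamma>0 Db Q)
      then have "((\<lambda>t. b j Q + t * d j) has_vector_derivative Db j Q w) (at 0)"
        using has_vector_derivative_cong_ev[OF ev] by blast
      moreover have "((\<lambda>t. b j Q + t * d j) has_vector_derivative d j) (at 0)"
        by (auto intro!: derivative_eq_intros)
      ultimately show ?thesis using vector_derivative_unique_at by blast
    qed
    ultimately show ?thesis by blast
  qed
  have comb: "(\<Sum>i\<in>UNIV. c i *\<^sub>R E1 i Q) = emb (c k *\<^sub>R X Q) + vert (X Q)
      ((\<Sum>j\<in>UNIV. (if j = k then 0 else c j) *\<^sub>R E j (base_pt Q)) + (\<Sum>j\<in>UNIV. b j Q *\<^sub>R DE j (base_pt Q) (c k *\<^sub>R X Q)))"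
    if "Q \<in> W0" for c Q
  proof -
    have lin: "DE j (base_pt Q) (c k *\<^sub>R X Q) = c k *\<^sub>R DE j (base_pt Q) (X Q)" for j
      using that linear_scale[OF has_derivative_linear[OF DE(1)]] by (auto simp: W0_def WB_def)
    have 1: "(\<Sum>i\<in>UNIV. c i *\<^sub>R E1 i Q) = c k *\<^sub>R E1 k Q + (\<Sum>i\<in>UNIV-{k}. c i *\<^sub>R E1 i Q)"
      by (simp add: sum.remove[of UNIV k])
    have 2: "(\<Sum>j\<in>UNIV. (if j = k then 0 else c j) *\<^sub>R E j (base_pt Q)) = (\<Sum>j\<in>UNIV-{k}. c j *\<^sub>R E j (base_pt Q))"
      by (simp add: sum.remove[of UNIV k])
    have 3: "(\<Sum>i\<in>UNIV-{k}. c i *\<^sub>R E1 i Q) = vert (X Q) (\<Sum>j\<in>UNIV-{k}. c j *\<^sub>R E j (base_pt Q))"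
      by (simp add: E1_def vert_sum vert_scale_right)
    have 4: "(\<Sum>j\<in>UNIV. b j Q *\<^sub>R DE j (base_pt Q) (c k *\<^sub>R X Q)) = c k *\<^sub>R (\<Sum>j\<in>UNIV. b j Q *\<^sub>R DE j (base_pt Q) (X Q))"
      by (simp add: lin scaleR_sum_right mult.commute)
    show ?thesis unfolding 1 2 3 4 vert_simps emb_simps
      by (simp add: E1_def scaleR_add_right add_ac)
  qed
  have "frame (prol_space Z \<Delta>) (prol_dist Z \<Delta>) W1 E1 \<theta>1"
    unfolding frame_def
  proof (intro conjI ballI allI W1 smE1 sm\<theta>1)
    fix Q assume "Q \<in> prol_space Z \<Delta> \<inter> W1"
    then have Q: "Q \<in> prol_space Z \<Delta>" "Q \<in> W0" using sub1 by auto
    define q where "q = base_pt Q"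
    define x where "x = X Q"
    note XQ = X1[OF Q q_def, folded x_def]
    have L: "(\<Sum>i\<in>UNIV. c i *\<^sub>R E1 i Q) \<in> prol_dist Z \<Delta> Q \<and>
        (\<forall>j. Db j Q (\<Sum>i\<in>UNIV. c i *\<^sub>R E1 i Q) = (if j = k then 0 else c j))" for c
      by (rule lift[OF Q refl refl _ comb[OF Q(2)]]) simp
    show "prol_dist Z \<Delta> Q = range (\<lambda>c. \<Sum>i\<in>UNIV. c i *\<^sub>R E1 i Q)"
    proof (intro subset_antisym subsetI)
      \<comment> \<open>Conversely, an arbitrary curve of line elements is rewritten through the
        normalized generator \<open>X\<close>; the product rule then gives its velocity the form of
        the frame expansion.\<close>
      fix w assume w: "w \<in> prol_dist Z \<Delta> Q"
      then obtain \<Gamma> where \<Gamma>: "\<Gamma> 0 = Q" "\<And>t. \<Gamma> t \<in> prol_space Z \<Delta>" "(\<Gamma> has_vector_derivative w) (at 0)"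
        by (auto simp: prol_dist_def elim: tangent_spaceE)
      have "base_pt w \<in> line_of (le q x)" using w XQ by (auto simp: prol_dist_def)
      then obtain a where a: "base_pt w = a *\<^sub>R x" using XQ by (auto simp: line_of_le span_singleton)
      define \<gamma> where "\<gamma> t = base_pt (\<Gamma> t)" for t
      have \<gamma>D: "(\<gamma> has_vector_derivative a *\<^sub>R x) (at 0)" unfolding \<gamma>_def
        using bounded_linear.has_vector_derivative[OF bounded_linear_base_pt \<Gamma>(3)] a by simp
      have \<gamma>0: "\<gamma> 0 = q" by (simp add: \<gamma>_def \<Gamma>(1) q_def)
      have bD: "((\<lambda>t. b j (\<Gamma> t)) has_vector_derivative Db j Q w) (at 0)" for j
        by (rule has_vector_derivative_compose[OF \<Gamma>(3)]) (simp add: \<Gamma>(1) Db Q)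
      have ED: "((\<lambda>t. E j (\<gamma> t)) has_vector_derivative DE j q (a *\<^sub>R x)) (at 0)" for j
        by (rule has_vector_derivative_compose[OF \<gamma>D]) (simp add: \<gamma>0 DE XQ)
      have "((\<lambda>t. b j (\<Gamma> t) *\<^sub>R E j (\<gamma> t)) has_vector_derivative (b j Q *\<^sub>R DE j q (a *\<^sub>R x) + Db j Q w *\<^sub>R E j q)) (at 0)" for j
        by (rule has_vector_derivative_eq_rhs[OF has_vector_derivative_scaleR[OF
              bD[unfolded has_real_derivative_iff_has_vector_derivative[symmetric]] ED]]) (simp add: \<gamma>0 \<Gamma>(1))
      then have XD: "((\<lambda>t. X (\<Gamma> t)) has_vector_derivative
          ((\<Sum>j\<in>UNIV. Db j Q w *\<^sub>R E j q) + (\<Sum>j\<in>UNIV. b j Q *\<^sub>R DE j q (a *\<^sub>R x)))) (at 0)"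
        unfolding X_def \<gamma>_def[symmetric]
        by (rule has_vector_derivative_eq_rhs[OF has_vector_derivative_sum]) (simp add: sum.distrib)
      have evW: "\<forall>\<^sub>F t in nhds 0. \<Gamma> t \<in> W0" by (rule curve_eventually_in[OF \<Gamma>(3) W0]) (simp add: \<Gamma>(1) Q)
      have ev: "\<forall>\<^sub>F t in nhds 0. le (\<gamma> t) (X (\<Gamma> t)) = \<Gamma> t"
        using evW
      proof (rule eventually_mono)
        fix t assume "\<Gamma> t \<in> W0"
        from X1[OF \<Gamma>(2) this refl, THEN conjunct2, THEN conjunct2, THEN conjunct2, THEN conjunct1]
        show "le (\<gamma> t) (X (\<Gamma> t)) = \<Gamma> t" unfolding \<gamma>_def by (rule sym)
      qed
      have "(\<Gamma> has_vector_derivative (emb (a *\<^sub>R x) + vert x ((\<Sum>j\<in>UNIV. Db j Q w *\<^sub>R E j q) +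
          (\<Sum>j\<in>UNIV. b j Q *\<^sub>R DE j q (a *\<^sub>R x))))) (at 0)"
      proof -
        have "X (\<Gamma> 0) \<noteq> 0" unfolding \<Gamma>(1) using XQ x_def by blast
        from has_vector_derivative_cong_ev[OF ev le_has_vector_derivative[OF \<gamma>D XD this]]
        show ?thesis by (simp only: \<Gamma>(1) x_def)
      qed
      then have w_eq: "w = emb (a *\<^sub>R x) + vert x ((\<Sum>j\<in>UNIV. Db j Q w *\<^sub>R E j q) +
          (\<Sum>j\<in>UNIV. b j Q *\<^sub>R DE j q (a *\<^sub>R x)))"
        using \<Gamma>(3) vector_derivative_unique_at by blast
      have "((\<lambda>t. b k (\<Gamma> t)) has_vector_derivative 0) (at 0)"
      proof (rule has_vector_derivative_cong_ev)
        show "\<forall>\<^sub>F t in nhds 0. 1 = b k (\<Gamma> t)"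
          using evW
        proof (rule eventually_mono)
          fix t assume "\<Gamma> t \<in> W0"
          note X1[OF \<Gamma>(2) this refl, of k]
          then show "1 = b k (\<Gamma> t)" by (elim conjE) linarith
        qed
      qed auto
      then have "Db k Q w = 0" using bD[of k] vector_derivative_unique_at by blast
      then have s: "(if j = k then 0 else (if j = k then a else Db j Q w)) = Db j Q w" for j by simp
      have "w = (\<Sum>i\<in>UNIV. (if i = k then a else Db i Q w) *\<^sub>R E1 i Q)"
        unfolding comb[OF Q(2)] s using w_eq by (simp add: x_def q_def)
      then show "w \<in> range (\<lambda>c. \<Sum>i\<in>UNIV. c i *\<^sub>R E1 i Q)"
        by (rule range_eqI[where f = "\<lambda>c. \<Sum>i\<in>UNIV. c i *\<^sub>R E1 i Q"])
    next
      fix w assume "w \<in> range (\<lambda>c. \<Sum>i\<in>UNIV. c i *\<^sub>R E1 i Q)"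
      then show "w \<in> prol_dist Z \<Delta> Q" using L by auto
    qed
    fix i j :: 3
    have e: "(\<Sum>l\<in>UNIV. (if l = j then 1 else 0) *\<^sub>R E1 l Q) = E1 j Q"
      by (simp add: if_distrib[of "\<lambda>c. c *\<^sub>R _"] cong: if_cong)
    show "\<theta>1 i Q \<bullet> E1 j Q = (if i = j then 1 else 0)"
    proof (cases "i = k")
      case True
      have "\<theta> k q \<bullet> x = 1" using XQ by blast
      then show ?thesis using True by (auto simp: \<theta>1[OF Q(2)] E1_def q_def x_def)
    next
      case False
      then show ?thesis using L[of "\<lambda>l. if l = j then 1 else 0"] unfolding e by (simp add: \<theta>1[OF Q(2)])
    qed
  qed
  moreover
  have pv0: "le p v \<in> W0" using pW k v(2) by (simp add: W0_def WB_def th_def mt_le)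
  then have pv: "le p v \<in> W1" using le0[OF p v] by blast
  moreover have "\<exists>u\<in>\<Delta> p. w = vert v u" if w: "w \<in> prol_dist Z \<Delta> (le p v)" "base_pt w = 0" for w
  proof -
    have "le p v \<in> prol_space Z \<Delta> \<inter> W1" using pv le_mem_prol[OF reg p v] by simp
    then obtain c where c: "w = (\<Sum>i\<in>UNIV. c i *\<^sub>R E1 i (le p v))"
      using \<open>frame (prol_space Z \<Delta>) (prol_dist Z \<Delta>) W1 E1 \<theta>1\<close> w(1) by (auto simp: frame_def)
    define y where "y = (\<Sum>j\<in>UNIV. (if j = k then 0 else c j) *\<^sub>R E j p)"
    have x: "X (le p v) = (1 / (\<theta> k p \<bullet> v)) *\<^sub>R v" "X (le p v) \<noteq> 0" using le0[OF p v pv0] v(2) by auto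
    have 0: "c k *\<^sub>R X (le p v) = 0" using w(2) unfolding c comb[OF pv0] by simp
    then have "c k = 0" using x(2) by simp
    have "DE j p 0 = 0" for j using linear_0[OF has_derivative_linear[OF DE(1)[OF pW]]] by simp
    then have "w = vert (X (le p v)) y" unfolding c comb[OF pv0] 0 by (simp add: y_def emb_simps)
    then have "w = vert v ((\<theta> k p \<bullet> v) *\<^sub>R y)"
      unfolding x using vert_scale_left[of "1 / (\<theta> k p \<bullet> v)" v y] k by (simp add: vert_scale_right)
    moreover have "y \<in> \<Delta> p" unfolding y_def by (rule frame_mem[OF fr p pW])
    ultimately show ?thesis using subspace_mul[OF regular_subspace[OF reg p]] by blast
  qed
  moreover have "\<exists>w\<in>prol_dist Z \<Delta> (le p v). base_pt w = v"
  proof -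
    have "le p v \<in> prol_space Z \<Delta> \<inter> W1" using pv le_mem_prol[OF reg p v] by simp
    then have mem: "(\<Sum>i\<in>UNIV. c i *\<^sub>R E1 i (le p v)) \<in> prol_dist Z \<Delta> (le p v)" for c
      using \<open>frame (prol_space Z \<Delta>) (prol_dist Z \<Delta>) W1 E1 \<theta>1\<close> by (auto simp: frame_def)
    have x: "X (le p v) = (1 / (\<theta> k p \<bullet> v)) *\<^sub>R v" using le0[OF p v pv0] by auto
    have "base_pt (\<Sum>i\<in>UNIV. (\<theta> k p \<bullet> v) *\<^sub>R E1 i (le p v)) = v"
      using k unfolding comb[OF pv0] by (simp add: x)
    then show ?thesis using mem[of "\<lambda>_. \<theta> k p \<bullet> v"] by blast
  qed
  ultimately show ?thesis by blast
qed

theorem regular_prol: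
  assumes "regular Z \<Delta>" shows "regular (prol_space Z \<Delta>) (prol_dist Z \<Delta>)"
  unfolding regular_def
proof (intro conjI ballI)
  fix Q assume "Q \<in> prol_space Z \<Delta>"
  then obtain p u where "p \<in> Z" "u \<in> \<Delta> p" "u \<noteq> 0" "Q = le p u" using prol_space_iff[OF assms] by blast
  then show "\<exists>W E \<theta>. Q \<in> W \<and> frame (prol_space Z \<Delta>) (prol_dist Z \<Delta>) W E \<theta>"
    using prol_frame[OF assms, of p u] by blast
qed (auto simp: prol_dist_def)

lemma regular_UNIV: "regular (UNIV :: (real^3) set) (\<lambda>_. UNIV)"
proof -
  have t: "v \<in> tangent_space UNIV (q :: real^3)" for v q
    by (rule tangent_spaceI[of "\<lambda>t. q + t *\<^sub>R v"]) (auto intro!: derivative_eq_intros)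
  have v: "v = (\<Sum>i\<in>UNIV. (v $ i) *\<^sub>R axis i 1)" for v :: "real^3"
    by (simp add: vec_eq_iff axis_def if_distrib cong: if_cong)
  have "UNIV = range (\<lambda>c. \<Sum>i\<in>UNIV. c i *\<^sub>R axis i (1::real) :: real^3)"
    using v by blast
  then have "frame (UNIV :: (real^3) set) (\<lambda>_. UNIV) UNIV (\<lambda>i _. axis i 1) (\<lambda>i _. axis i 1)"
    by (simp add: frame_def inner_axis_axis smooth_const)
  then show ?thesis using t unfolding regular_def by blast
qed

section \<open>Three-dimensional spaces and the fibers of a prolongation\<close>

definition basis3 :: "'a::real_vector set \<Rightarrow> 'a \<Rightarrow> 'a \<Rightarrow> 'a \<Rightarrow> bool" where
  "basis3 S x y z \<longleftrightarrow> S = {a *\<^sub>R x + b *\<^sub>R y + c *\<^sub>R z | a b c. True} \<and>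
     (\<forall>a b c. a *\<^sub>R x + b *\<^sub>R y + c *\<^sub>R z = 0 \<longrightarrow> a = 0 \<and> b = 0 \<and> c = 0)"

lemma basis3_mem: "basis3 S x y z \<Longrightarrow> a *\<^sub>R x + b *\<^sub>R y + c *\<^sub>R z \<in> S"
  by (auto simp: basis3_def)

lemma basis3_mems:
  assumes "basis3 S x y z" shows "x \<in> S" "y \<in> S" "z \<in> S" "x \<noteq> 0" "y \<noteq> 0" "z \<noteq> 0"
proof -
  have *: "a = 0 \<and> b = 0 \<and> c = 0" if "a *\<^sub>R x + b *\<^sub>R y + c *\<^sub>R z = 0" for a b c
    using assms that by (auto simp: basis3_def)
  show "x \<in> S" "y \<in> S" "z \<in> S"
    using basis3_mem[OF assms, of 1 0 0] basis3_mem[OF assms, of 0 1 0] basis3_mem[OF assms, of 0 0 1] by auto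
  show "x \<noteq> 0" "y \<noteq> 0" "z \<noteq> 0" using *[of 1 0 0] *[of 0 1 0] *[of 0 0 1] by auto
qed

lemma basis3_coords:
  assumes "basis3 S x y z" "v \<in> S" obtains a b c where "v = a *\<^sub>R x + b *\<^sub>R y + c *\<^sub>R z"
  using assms by (auto simp: basis3_def)

lemma basis3_eqD:
  assumes "basis3 S x y z" "a *\<^sub>R x + b *\<^sub>R y + c *\<^sub>R z = a' *\<^sub>R x + b' *\<^sub>R y + c' *\<^sub>R z"
  shows "a = a' \<and> b = b' \<and> c = c'"
proof -
  have "(a - a') *\<^sub>R x + (b - b') *\<^sub>R y + (c - c') *\<^sub>R z = 0" using assms(2) by (simp add: algebra_simps)
  then have "a - a' = 0 \<and> b - b' = 0 \<and> c - c' = 0" using assms(1) unfolding basis3_def by blast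
  then show ?thesis by simp
qed

lemma regular_tangent: "regular Z \<Delta> \<Longrightarrow> q \<in> Z \<Longrightarrow> v \<in> \<Delta> q \<Longrightarrow> v \<in> tangent_space Z q"
  by (auto simp: regular_def)

lemma fiber_curve:
  assumes reg: "regular Z \<Delta>" and q: "q \<in> Z" and u: "u \<in> \<Delta> q" "u \<noteq> 0" and w: "w \<in> \<Delta> q"
  shows "((\<lambda>t. le q (u + t *\<^sub>R w)) has_vector_derivative vert u w) (at 0)"
    and "\<forall>\<^sub>F t in nhds 0. u + t *\<^sub>R w \<in> \<Delta> q \<and> u + t *\<^sub>R w \<noteq> 0"
proof -
  have d: "((\<lambda>t. u + t *\<^sub>R w) has_vector_derivative w) (at 0)" by (auto intro!: derivative_eq_intros)
  show "((\<lambda>t. le q (u + t *\<^sub>R w)) has_vector_derivative vert u w) (at 0)"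
    by (rule has_vector_derivative_eq_rhs[OF le_has_vector_derivative[OF has_vector_derivative_const d]])
      (use u(2) in \<open>auto simp: emb_simps\<close>)
  have "\<forall>\<^sub>F t in nhds 0. u + t *\<^sub>R w \<in> - {0}" by (rule curve_eventually_in[OF d]) (use u(2) in auto)
  then show "\<forall>\<^sub>F t in nhds 0. u + t *\<^sub>R w \<in> \<Delta> q \<and> u + t *\<^sub>R w \<noteq> 0"
    by (rule eventually_mono)
      (use subspace_add[OF regular_subspace[OF reg q]] subspace_mul[OF regular_subspace[OF reg q]] u w in auto)
qed

lemma vert_mem:
  assumes reg: "regular Z \<Delta>" and q: "q \<in> Z" and u: "u \<in> \<Delta> q" "u \<noteq> 0" and w: "w \<in> \<Delta> q"
  shows "vert u w \<in> prol_dist Z \<Delta> (le q u)"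
proof (rule prol_distI[OF _ _ fiber_curve(1)[OF assms]])
  show "\<forall>\<^sub>F t in nhds 0. le q (u + t *\<^sub>R w) \<in> prol_space Z \<Delta>"
    using fiber_curve(2)[OF assms] by (rule eventually_mono) (use le_mem_prol[OF reg q] in auto)
qed (use u in \<open>auto simp: line_of_le mem_span_singleton intro: exI[of _ 0]\<close>)

lemma prol_dist_vertical:
  assumes "regular Z \<Delta>" "q \<in> Z" "u \<in> \<Delta> q" "u \<noteq> 0" "w \<in> prol_dist Z \<Delta> (le q u)" "base_pt w = 0"
  obtains v where "v \<in> \<Delta> q" "w = vert u v"
  using prol_frame[OF assms(1-4)] assms(5,6) by blast

lemma prol_dist_base:
  assumes "u \<noteq> 0" "w \<in> prol_dist Z \<Delta> (le q u)" obtains a where "base_pt w = a *\<^sub>R u"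
  using assms by (auto simp: prol_dist_def line_of_le mem_span_singleton)

lemma prol_dist_subspace:
  "regular Z \<Delta> \<Longrightarrow> Q \<in> prol_space Z \<Delta> \<Longrightarrow> subspace (prol_dist Z \<Delta> Q)"
  by (rule regular_subspace[OF regular_prol])

text \<open>Subtracting the multiple of x with the same base part leaves a vertical vector, that is,
  \<open>vert u\<close> of a vector of \<Delta> q. Since \<open>vert u\<close> kills precisely the
  multiples of u, the images of the other two basis vectors stay independent.\<close>

lemma basis3_prol:
  assumes reg: "regular Z \<Delta>" and q: "q \<in> Z" and B: "basis3 (\<Delta> q) u v w"
    and x: "x \<in> prol_dist Z \<Delta> (le q u)" "base_pt x = u"
  shows "basis3 (prol_dist Z \<Delta> (le q u)) x (vert u v) (vert u w)"
proof -
  note m = basis3_mems[OF B]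
  have sub: "subspace (prol_dist Z \<Delta> (le q u))"
    by (rule prol_dist_subspace[OF reg le_mem_prol[OF reg q m(1,4)]])
  have vm: "vert u v \<in> prol_dist Z \<Delta> (le q u)" "vert u w \<in> prol_dist Z \<Delta> (le q u)"
    using vert_mem[OF reg q m(1,4)] m by auto
  have 1: "\<exists>a b c. y = a *\<^sub>R x + b *\<^sub>R vert u v + c *\<^sub>R vert u w" if y: "y \<in> prol_dist Z \<Delta> (le q u)" for y
  proof -
    obtain a where a: "base_pt y = a *\<^sub>R u" using prol_dist_base[OF m(4) y] .
    have "y - a *\<^sub>R x \<in> prol_dist Z \<Delta> (le q u)" by (intro subspace_diff[OF sub] subspace_mul[OF sub] x y)
    moreover have "base_pt (y - a *\<^sub>R x) = 0" by (simp add: a x)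
    ultimately obtain v' where v': "v' \<in> \<Delta> q" "y - a *\<^sub>R x = vert u v'" using prol_dist_vertical[OF reg q m(1,4)] by metis
    obtain a' b c where "v' = a' *\<^sub>R u + b *\<^sub>R v + c *\<^sub>R w" using basis3_coords[OF B v'(1)] .
    then have "y = a *\<^sub>R x + b *\<^sub>R vert u v + c *\<^sub>R vert u w" using v'(2) by (simp add: vert_simps algebra_simps)
    then show ?thesis by blast
  qed
  have 2: "a = 0 \<and> b = 0 \<and> c = 0" if "a *\<^sub>R x + b *\<^sub>R vert u v + c *\<^sub>R vert u w = 0" for a b c
  proof -
    have "base_pt (a *\<^sub>R x + b *\<^sub>R vert u v + c *\<^sub>R vert u w) = 0" using that by simp
    then have a: "a = 0" using m(4) x(2) by simp
    then have "vert u (b *\<^sub>R v + c *\<^sub>R w) = 0" using that by (simp add: vert_simps)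
    from vert_eq_0D[OF this m(4)] obtain d where "b *\<^sub>R v + c *\<^sub>R w = d *\<^sub>R u" by blast
    then have "0 *\<^sub>R u + b *\<^sub>R v + c *\<^sub>R w = d *\<^sub>R u + 0 *\<^sub>R v + 0 *\<^sub>R w" by simp
    from basis3_eqD[OF B this] show ?thesis using a by simp
  qed
  show ?thesis unfolding basis3_def
  proof (intro conjI allI impI subset_antisym subsetI)
    fix y assume "y \<in> {a *\<^sub>R x + b *\<^sub>R vert u v + c *\<^sub>R vert u w |a b c. True}"
    then show "y \<in> prol_dist Z \<Delta> (le q u)"
      by (auto intro!: subspace_add[OF sub] subspace_mul[OF sub] vm x)
  qed (use 1 2 in \<open>simp_all, blast?\<close>)
qed

subsection \<open>Prolongation of smooth maps\<close>

abbreviation dr :: "(real^'n) set \<Rightarrow> (real^'n \<Rightarrow> real^'n) \<Rightarrow> real^'n \<Rightarrow> real^'n \<Rightarrow> real^'n" where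
  "dr Z f q \<equiv> frechet_derivative f (at q within Z)"

text \<open>Smoothness on a subset means a smooth local extension to the ambient space. The clause
  \<open>Z \<inter> W \<subseteq> S\<close> makes S relatively open in Z, so that curves in Z
  starting in S stay in S for a while.\<close>

definition smap :: "(real^'n) set \<Rightarrow> (real^'n) set \<Rightarrow> (real^'n \<Rightarrow> real^'n) \<Rightarrow> bool" where
  "smap Z S f \<longleftrightarrow> S \<subseteq> Z \<and> (\<forall>q\<in>S. \<exists>W F. open W \<and> q \<in> W \<and> smooth W F \<and> Z \<inter> W \<subseteq> S \<and> (\<forall>r\<in>Z\<inter>W. f r = F r))"

text \<open>Differentials are controlled on \<Delta> only; injectivity there is what makes the image
  of a line in \<Delta> a line again.\<close>

definition morph :: "(real^'n) set \<Rightarrow> (real^'n \<Rightarrow> (real^'n) set) \<Rightarrow> (real^'n) set \<Rightarrow> (real^'n \<Rightarrow> real^'n) \<Rightarrow> bool" where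
  "morph Z \<Delta> S f \<longleftrightarrow> smap Z S f \<and>
     (\<forall>q\<in>S. f q \<in> Z \<and> (\<forall>v\<in>\<Delta> q. dr Z f q v \<in> \<Delta> (f q) \<and> (dr Z f q v = 0 \<longrightarrow> v = 0)))"

lemma smapE:
  assumes "smap Z S f" "q \<in> S"
  obtains W F where "open W" "q \<in> W" "smooth W F" "Z \<inter> W \<subseteq> S" "\<forall>r\<in>Z\<inter>W. f r = F r" "q \<in> Z"
proof -
  have "\<exists>W F. open W \<and> q \<in> W \<and> smooth W F \<and> Z \<inter> W \<subseteq> S \<and> (\<forall>r\<in>Z\<inter>W. f r = F r)" "q \<in> Z"
    using assms by (auto simp: smap_def)
  then show thesis using that by (elim exE conjE) blast
qed

lemma smap_has_derivative:
  assumes "smap Z S f" "q \<in> S" shows "(f has_derivative dr Z f q) (at q within Z)"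
proof -
  obtain W F where F0: "open W" "q \<in> W" "smooth W F" "Z \<inter> W \<subseteq> S" "\<forall>r\<in>Z\<inter>W. f r = F r" and q: "q \<in> Z"
    using smapE[OF assms] by blast
  note F = F0(1-4) F0(5)[rule_format, OF IntI]
  have "(F has_derivative frechet_derivative F (at q)) (at q within Z)"
    using smooth_has_derivative[OF F(3,1,2)] by (rule has_derivative_at_withinI)
  moreover have "\<forall>\<^sub>F r in at q within Z. F r = f r"
    unfolding eventually_at_topological using F by (intro exI[of _ W]) auto
  ultimately have "(f has_derivative frechet_derivative F (at q)) (at q within Z)"
    by (rule has_derivative_transform_eventually) (use F q in auto)
  then show ?thesis using frechet_derivative_works differentiable_def by blast
qed

lemma smap_curve:
  assumes f: "smap Z S f" and c: "c 0 \<in> S" "\<forall>\<^sub>F t in nhds 0. c t \<in> Z" "(c has_vector_derivative v) (at 0)"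
  shows "((\<lambda>t. f (c t)) has_vector_derivative dr Z f (c 0) v) (at 0)"
    and "\<forall>\<^sub>F t in nhds 0. c t \<in> S"
proof -
  obtain W F where W0: "open W" "c 0 \<in> W" "smooth W F" "Z \<inter> W \<subseteq> S" "\<forall>r\<in>Z\<inter>W. f r = F r" "c 0 \<in> Z"
    using smapE[OF f c(1)] by blast
  note W = W0(1-4) W0(5)[rule_format, OF IntI]
  show "\<forall>\<^sub>F t in nhds 0. c t \<in> S"
    using c(2) curve_eventually_in[OF c(3) W(1,2)] by eventually_elim (use W in auto)
  obtain T where T: "open T" "0 \<in> T" "\<forall>t\<in>T. c t \<in> Z" using c(2) by (auto simp: eventually_nhds)
  have "(c has_derivative (\<lambda>t. t *\<^sub>R v)) (at 0 within T)"
    using c(3) unfolding has_vector_derivative_def by (rule has_derivative_at_withinI)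
  moreover have "(f has_derivative dr Z f (c 0)) (at (c 0) within c ` T)"
    by (rule has_derivative_subset[OF smap_has_derivative[OF f c(1)]]) (use T in auto)
  ultimately have "((\<lambda>t. f (c t)) has_derivative (\<lambda>t. dr Z f (c 0) (t *\<^sub>R v))) (at 0 within T)"
    by (rule has_derivative_in_compose)
  then show "((\<lambda>t. f (c t)) has_vector_derivative dr Z f (c 0) v) (at 0)"
    using linear_scale[OF has_derivative_linear[OF smap_has_derivative[OF f c(1)]]]
    by (simp add: has_vector_derivative_def at_within_open[OF T(2,1)])
qed

text \<open>\<open>frechet_derivative\<close> within Z is an arbitrary choice among the possible
  derivatives, so its value on the velocity of a curve in Z is read off from the velocity of the
  image curve, where all choices agree.\<close>

lemma smap_dr_eq:
  assumes f: "smap Z S f" and c: "c 0 \<in> S" "\<forall>\<^sub>F t in nhds 0. c t \<in> Z" "(c has_vector_derivative v) (at 0)"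
    and fc: "\<forall>\<^sub>F t in nhds 0. f (c t) = d t" "(d has_vector_derivative w) (at 0)"
  shows "dr Z f (c 0) v = w"
  using has_vector_derivative_cong_ev[OF fc(1) smap_curve(1)[OF f c]] fc(2) vector_derivative_unique_at by blast

lemma smap_dr_linear: "smap Z S f \<Longrightarrow> q \<in> S \<Longrightarrow> linear (dr Z f q)"
  by (rule has_derivative_linear[OF smap_has_derivative])

lemma smap_dr_ext:
  assumes f: "smap Z S f" "q \<in> S" and F: "open W" "q \<in> W" "\<And>r. r \<in> Z \<Longrightarrow> r \<in> W \<Longrightarrow> f r = F r"
    and F': "(F has_derivative F') (at q)" and v: "v \<in> tangent_space Z q"
  shows "dr Z f q v = F' v"
proof -
  obtain c where c: "c 0 = q" "\<And>t. c t \<in> Z" "(c has_vector_derivative v) (at 0)" using tangent_spaceE[OF v] by metis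
  have "dr Z f (c 0) v = F' v"
  proof (rule smap_dr_eq[OF f(1) _ _ c(3)])
    show "\<forall>\<^sub>F t in nhds 0. f (c t) = F (c t)"
      by (rule eventually_mono[OF curve_eventually_in[OF c(3) F(1)]]) (use c F in auto)
    show "((\<lambda>t. F (c t)) has_vector_derivative F' v) (at 0)"
      by (rule has_vector_derivative_compose[OF c(3)]) (simp add: c F')
  qed (use c f in auto)
  then show ?thesis by (simp add: c)
qed

lemma morph_smap: "morph Z \<Delta> S f \<Longrightarrow> smap Z S f"
  by (simp add: morph_def)
lemma morph_sub: "morph Z \<Delta> S f \<Longrightarrow> q \<in> S \<Longrightarrow> q \<in> Z"
  by (auto simp: morph_def smap_def)
lemma morph_mem: "morph Z \<Delta> S f \<Longrightarrow> q \<in> S \<Longrightarrow> f q \<in> Z"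
  by (simp add: morph_def)
lemma morph_dr_mem: "morph Z \<Delta> S f \<Longrightarrow> q \<in> S \<Longrightarrow> v \<in> \<Delta> q \<Longrightarrow> dr Z f q v \<in> \<Delta> (f q)"
  by (simp add: morph_def)
lemma morph_dr_nz: "morph Z \<Delta> S f \<Longrightarrow> q \<in> S \<Longrightarrow> v \<in> \<Delta> q \<Longrightarrow> v \<noteq> 0 \<Longrightarrow> dr Z f q v \<noteq> 0"
  by (auto simp: morph_def)
lemma morph_dr_linear: "morph Z \<Delta> S f \<Longrightarrow> q \<in> S \<Longrightarrow> linear (dr Z f q)"
  by (rule smap_dr_linear[OF morph_smap])

lemma prol_map_le_linear:
  assumes "linear (dr Z f q)" "u \<noteq> 0" "dr Z f q u \<noteq> 0"
  shows "prol_map Z f (le q u) = le (f q) (dr Z f q u)"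
proof -
  have "dr Z f q ` span {u} = span {dr Z f q u}" using linear_span_image[OF assms(1), of "{u}"] by simp
  then show ?thesis by (simp add: prol_map_def line_of_le[OF assms(2)] line_elt_le[OF assms(3)])
qed

lemma prol_map_le:
  assumes "morph Z \<Delta> S f" "q \<in> S" "u \<in> \<Delta> q" "u \<noteq> 0"
  shows "prol_map Z f (le q u) = le (f q) (dr Z f q u)"
  by (rule prol_map_le_linear[OF morph_dr_linear[OF assms(1,2)] assms(4) morph_dr_nz[OF assms]])

definition over :: "(real^'n) set \<Rightarrow> (real^'n \<Rightarrow> (real^'n) set) \<Rightarrow> (real^'n) set \<Rightarrow> (real^('n prol)) set" where
  "over Z \<Delta> S = {Q \<in> prol_space Z \<Delta>. base_pt Q \<in> S}"

lemma over_iff: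
  assumes "regular Z \<Delta>" "S \<subseteq> Z"
  shows "Q \<in> over Z \<Delta> S \<longleftrightarrow> (\<exists>q u. q \<in> S \<and> u \<in> \<Delta> q \<and> u \<noteq> 0 \<and> Q = le q u)"
  using assms(2) by (auto simp: over_def prol_space_iff[OF assms(1)])

lemma overE:
  assumes "regular Z \<Delta>" "morph Z \<Delta> S f" "Q \<in> over Z \<Delta> S"
  obtains q u where "q \<in> S" "u \<in> \<Delta> q" "u \<noteq> 0" "Q = le q u"
proof -
  have "S \<subseteq> Z" using assms(2) by (simp add: morph_def smap_def)
  then show thesis using over_iff[OF assms(1)] assms(3) that by blast
qed

lemma smap_prol:
  assumes reg: "regular Z \<Delta>" and f: "morph Z \<Delta> S f"
  shows "smap (prol_space Z \<Delta>) (over Z \<Delta> S) (prol_map Z f)"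
  unfolding smap_def
proof (intro conjI ballI)
  show "over Z \<Delta> S \<subseteq> prol_space Z \<Delta>" by (auto simp: over_def)
  fix Q assume "Q \<in> over Z \<Delta> S"
  have SZ: "S \<subseteq> Z" using f by (auto simp: morph_def smap_def)
  obtain q u where qu: "q \<in> S" "u \<in> \<Delta> q" "u \<noteq> 0" "Q = le q u"
    using \<open>Q \<in> over Z \<Delta> S\<close> over_iff[OF reg SZ] by blast
  obtain W F where F0: "open W" "q \<in> W" "smooth W F" "Z \<inter> W \<subseteq> S" "\<forall>r\<in>Z\<inter>W. f r = F r" "q \<in> Z"
    using smapE[OF morph_smap[OF f] qu(1)] by blast
  note F = F0(1-4) F0(5)[rule_format, OF IntI]
  obtain F' where F': "\<And>x. x \<in> W \<Longrightarrow> (F has_derivative F' x) (at x)" "\<And>v. smooth W (\<lambda>x. F' x v)"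
    using smooth_deriv[OF F(3,1)] by blast
  have dF: "dr Z f r v = F' r v" if "r \<in> Z" "r \<in> W" "v \<in> \<Delta> r" for r v
    by (rule smap_dr_ext[OF morph_smap[OF f] _ F(1) that(2) F(5) F'(1) regular_tangent[OF reg that(1,3)]])
      (use that F(4) in auto)
  define WB where "WB = {R. base_pt R \<in> W}"
  have WB: "open WB"
    using open_vimage[OF F(1) bounded_linear.continuous_on[OF bounded_linear_base_pt continuous_on_id]]
    by (simp add: WB_def vimage_def)
  \<comment> \<open>For R near Q, \<open>mt R u\<close> generates the line of R, so F' applied to it
    generates the image line. The formula makes sense on an open set of the ambient space and yields
    the smooth extension.\<close>
  define G where "G R = F' (base_pt R) (mt R u)" for R
  have smG: "smooth WB G" unfolding G_def
  proof (rule smooth_apply[where f' = "\<lambda>R. F' (base_pt R)", OF _ _ _ WB])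
    show "linear (F' (base_pt R))" if "R \<in> WB" for R using that by (auto simp: WB_def intro: has_derivative_linear F')
    show "smooth WB (\<lambda>R. F' (base_pt R) v)" for v
      by (rule smooth_compose[OF WB F'(2)]) (auto simp: WB_def intro: smooth_intros)
    show "smooth WB (\<lambda>R. mt R u)" by (intro smooth_intros)
  qed
  define W1 where "W1 = {R\<in>WB. G R \<noteq> 0}"
  have W1: "open W1" unfolding W1_def by (rule smooth_open_neq_0[OF smG WB])
  have sub: "W1 \<subseteq> WB" by (auto simp: W1_def)
  have smF: "smooth WB (\<lambda>R. F (base_pt R))"
    by (rule smooth_compose[OF WB F(3)]) (auto simp: WB_def intro: smooth_intros)
  have sm: "smooth W1 (\<lambda>R. le (F (base_pt R)) (G R))"
    by (intro smooth_intros smooth_subset[OF smG sub] smooth_subset[OF smF sub] W1) (auto simp: W1_def)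
  have "Q \<in> W1" using qu F(2) morph_dr_nz[OF f qu(1-3)] dF[of q u] SZ by (auto simp: W1_def WB_def G_def mt_le)
  moreover have "prol_space Z \<Delta> \<inter> W1 \<subseteq> over Z \<Delta> S" by (auto simp: over_def W1_def WB_def prol_space_iff[OF reg] intro!: subsetD[OF F(4)])
  moreover have "prol_map Z f R = le (F (base_pt R)) (G R)" if R: "R \<in> prol_space Z \<Delta>" "R \<in> W1" for R
  proof -
    obtain r v where rv: "r \<in> Z" "v \<in> \<Delta> r" "v \<noteq> 0" "R = le r v" using R prol_space_iff[OF reg] by blast
    have r: "r \<in> W" "r \<in> S" using R(2) rv F(4) by (auto simp: W1_def WB_def)
    have mtv: "mt R u = ((v \<bullet> u) / (v \<bullet> v)) *\<^sub>R v" by (simp add: rv(4) mt_le)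
    have "G R = ((v \<bullet> u) / (v \<bullet> v)) *\<^sub>R F' r v"
      unfolding G_def mtv using linear_scale[OF has_derivative_linear[OF F'(1)[OF r(1)]]] by (simp add: rv(4))
    moreover have "G R \<noteq> 0" using R(2) by (simp add: W1_def)
    ultimately have G: "G R = ((v \<bullet> u) / (v \<bullet> v)) *\<^sub>R dr Z f r v" "(v \<bullet> u) / (v \<bullet> v) \<noteq> 0"
      using dF[OF rv(1) r(1) rv(2)] by auto
    show ?thesis unfolding G(1) le_scale[OF G(2)]
      using prol_map_le[OF f r(2) rv(2,3)] F(5)[OF rv(1) r(1)] by (simp add: rv(4))
  qed
  ultimately show "\<exists>W F. open W \<and> Q \<in> W \<and> smooth W F \<and> prol_space Z \<Delta> \<inter> W \<subseteq> over Z \<Delta> S \<and>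
      (\<forall>r\<in>prol_space Z \<Delta> \<inter> W. prol_map Z f r = F r)"
    using W1 sm by blast
qed

lemma dr_prol_base:
  assumes reg: "regular Z \<Delta>" and f: "morph Z \<Delta> S f" and Q: "Q \<in> over Z \<Delta> S"
    and w: "w \<in> tangent_space (prol_space Z \<Delta>) Q"
  shows "base_pt (dr (prol_space Z \<Delta>) (prol_map Z f) Q w) = dr Z f (base_pt Q) (base_pt w)"
proof -
  obtain c where c: "c 0 = Q" "\<And>t. c t \<in> prol_space Z \<Delta>" "(c has_vector_derivative w) (at 0)" using tangent_spaceE[OF w] by metis
  have 1: "((\<lambda>t. prol_map Z f (c t)) has_vector_derivative dr (prol_space Z \<Delta>) (prol_map Z f) (c 0) w) (at 0)"
    by (rule smap_curve[OF smap_prol[OF reg f] _ _ c(3)]) (use c Q in auto)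
  have 2: "((\<lambda>t. base_pt (prol_map Z f (c t))) has_vector_derivative base_pt (dr (prol_space Z \<Delta>) (prol_map Z f) (c 0) w)) (at 0)"
    by (rule bounded_linear.has_vector_derivative[OF bounded_linear_base_pt 1])
  have 3: "((\<lambda>t. base_pt (c t)) has_vector_derivative base_pt w) (at 0)"
    by (rule bounded_linear.has_vector_derivative[OF bounded_linear_base_pt c(3)])
  have "base_pt R \<in> Z" if "R \<in> prol_space Z \<Delta>" for R using that prol_space_iff[OF reg] by force
  then have "dr Z f (base_pt (c 0)) (base_pt w) = base_pt (dr (prol_space Z \<Delta>) (prol_map Z f) (c 0) w)"
    by (intro smap_dr_eq[OF morph_smap[OF f] _ _ 3 _ 2]) (use c Q in \<open>auto simp: over_def prol_map_def\<close>)
  then show ?thesis by (simp add: c)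
qed

text \<open>Over a fixed point f sends the line of u + t v to the line of df u + t df v; comparing
  velocities at t = 0 is enough.\<close>

lemma dr_prol_vert:
  assumes reg: "regular Z \<Delta>" and f: "morph Z \<Delta> S f" and q: "q \<in> S" and u: "u \<in> \<Delta> q" "u \<noteq> 0" and v: "v \<in> \<Delta> q"
  shows "dr (prol_space Z \<Delta>) (prol_map Z f) (le q u) (vert u v) = vert (dr Z f q u) (dr Z f q v)"
proof -
  note qZ = morph_sub[OF f q] and fZ = morph_mem[OF f q] and lin = morph_dr_linear[OF f q]
  note fc = fiber_curve[OF reg qZ u v]
  have SZ: "S \<subseteq> Z" using f by (auto simp: morph_def smap_def)
  have "dr (prol_space Z \<Delta>) (prol_map Z f) (le q (u + 0 *\<^sub>R v)) (vert u v) = vert (dr Z f q u) (dr Z f q v)"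
  proof (rule smap_dr_eq[OF smap_prol[OF reg f] _ _ fc(1)])
    show "le q (u + 0 *\<^sub>R v) \<in> over Z \<Delta> S" using over_iff[OF reg SZ] q u by auto
    show "\<forall>\<^sub>F t in nhds 0. le q (u + t *\<^sub>R v) \<in> prol_space Z \<Delta>"
      using fc(2) by (rule eventually_mono) (auto intro: le_mem_prol[OF reg qZ])
    show "\<forall>\<^sub>F t in nhds 0. prol_map Z f (le q (u + t *\<^sub>R v)) = le (f q) (dr Z f q u + t *\<^sub>R dr Z f q v)"
      using fc(2)
      by (rule eventually_mono) (simp add: prol_map_le[OF f q] linear_add[OF lin] linear_scale[OF lin])
    show "((\<lambda>t. le (f q) (dr Z f q u + t *\<^sub>R dr Z f q v)) has_vector_derivative vert (dr Z f q u) (dr Z f q v)) (at 0)"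
      by (rule fiber_curve(1)[OF reg fZ]) (use morph_dr_mem[OF f q] morph_dr_nz[OF f q] u v in auto)
  qed
  then show ?thesis by simp
qed

theorem morph_prol:
  assumes reg: "regular Z \<Delta>" and f: "morph Z \<Delta> S f"
  shows "morph (prol_space Z \<Delta>) (prol_dist Z \<Delta>) (over Z \<Delta> S) (prol_map Z f)"
proof -
  have mem: "prol_map Z f Q \<in> prol_space Z \<Delta>" if Q: "Q \<in> over Z \<Delta> S" for Q
  proof -
    obtain q u where qu: "q \<in> S" "u \<in> \<Delta> q" "u \<noteq> 0" "Q = le q u" using overE[OF reg f Q] .
    show ?thesis unfolding qu(4) prol_map_le[OF f qu(1-3)]
      by (rule le_mem_prol[OF reg morph_mem[OF f qu(1)] morph_dr_mem[OF f qu(1,2)] morph_dr_nz[OF f qu(1-3)]])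
  qed
  have "dr (prol_space Z \<Delta>) (prol_map Z f) Q w \<in> prol_dist Z \<Delta> (prol_map Z f Q) \<and>
      (dr (prol_space Z \<Delta>) (prol_map Z f) Q w = 0 \<longrightarrow> w = 0)"
    if Q: "Q \<in> over Z \<Delta> S" and w: "w \<in> prol_dist Z \<Delta> Q" for Q w
  proof (intro conjI impI)
  obtain q u where qu: "q \<in> S" "u \<in> \<Delta> q" "u \<noteq> 0" "Q = le q u" using overE[OF reg f Q] .
  note qZ = morph_sub[OF f qu(1)] and nz = morph_dr_nz[OF f qu(1-3)] and lin = morph_dr_linear[OF f qu(1)]
  have wT: "w \<in> tangent_space (prol_space Z \<Delta>) Q" using w by (simp add: prol_dist_def)
  obtain a where a: "base_pt w = a *\<^sub>R u" using prol_dist_base[OF qu(3)] w qu(4) by blast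
  have base: "base_pt (dr (prol_space Z \<Delta>) (prol_map Z f) Q w) = a *\<^sub>R dr Z f q u"
    using dr_prol_base[OF assms Q wT] by (simp add: a qu(4) linear_scale[OF lin])
  obtain c where c: "c 0 = Q" "\<And>t. c t \<in> prol_space Z \<Delta>" "(c has_vector_derivative w) (at 0)" using tangent_spaceE[OF wT] by metis
  have c0: "c 0 \<in> over Z \<Delta> S" using c Q by simp
  note sc = smap_curve[OF smap_prol[OF assms] c0 always_eventually[OF allI[OF c(2)]] c(3)]
  show "dr (prol_space Z \<Delta>) (prol_map Z f) Q w \<in> prol_dist Z \<Delta> (prol_map Z f Q)"
  proof (rule prol_distI[OF _ _ sc(1)[unfolded c(1)]])
    show "\<forall>\<^sub>F t in nhds 0. prol_map Z f (c t) \<in> prol_space Z \<Delta>"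
      using sc(2) by (rule eventually_mono) (rule mem)
    show "base_pt (dr (prol_space Z \<Delta>) (prol_map Z f) Q w) \<in> line_of (prol_map Z f Q)"
      unfolding base unfolding qu(4) prol_map_le[OF f qu(1-3)] line_of_le[OF nz] by (auto simp: mem_span_singleton)
  qed (simp add: c)
  \<comment> \<open>Injectivity one level up: a vector in the kernel has zero base part, hence is
    \<open>vert u v\<close>. Its image vanishes only if the image of v is parallel to that of u, and
    injectivity below then makes v parallel to u.\<close>
  assume 0: "dr (prol_space Z \<Delta>) (prol_map Z f) Q w = 0"
  have a0: "a = 0" using base nz unfolding 0 by simp
  then obtain v where v: "v \<in> \<Delta> q" "w = vert u v"
    using prol_dist_vertical[OF reg qZ qu(2,3)] w a unfolding qu(4) by (metis scaleR_zero_left)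
  have "vert (dr Z f q u) (dr Z f q v) = 0" using 0 dr_prol_vert[OF assms qu(1-3) v(1)] by (simp add: v qu(4))
  from vert_eq_0D[OF this nz] obtain d where "dr Z f q v = d *\<^sub>R dr Z f q u" by blast
  then have "dr Z f q (v - d *\<^sub>R u) = 0" by (simp add: linear_diff[OF lin] linear_scale[OF lin])
  moreover have "v - d *\<^sub>R u \<in> \<Delta> q"
    by (intro subspace_diff[OF regular_subspace[OF reg qZ]] subspace_mul[OF regular_subspace[OF reg qZ]] v qu)
  ultimately have "v = d *\<^sub>R u" using morph_dr_nz[OF f qu(1)] by force
  then show "w = 0" by (simp add: v vert_scale_right)
  qed
  then show ?thesis unfolding morph_def using smap_prol[OF assms] mem by blast
qed

section \<open>Composition of smooth maps and locality of the prolongation\<close>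

lemma smap_comp:
  assumes f: "smap Z S f" and g: "smap Z S' g" and fZ: "\<And>q. q \<in> S \<Longrightarrow> f q \<in> Z"
  shows "smap Z {q\<in>S. f q \<in> S'} (\<lambda>q. g (f q))"
  unfolding smap_def
proof (intro conjI ballI)
  show "{q\<in>S. f q \<in> S'} \<subseteq> Z" using f by (auto simp: smap_def)
  fix q assume "q \<in> {q\<in>S. f q \<in> S'}"
  then have q: "q \<in> S" "f q \<in> S'" by auto
  obtain W F where F0: "open W" "q \<in> W" "smooth W F" "Z \<inter> W \<subseteq> S" "\<forall>r\<in>Z\<inter>W. f r = F r" "q \<in> Z"
    using smapE[OF f q(1)] by blast
  note F = F0(1-4) F0(5)[rule_format, OF IntI]
  obtain V G where G0: "open V" "f q \<in> V" "smooth V G" "Z \<inter> V \<subseteq> S'" "\<forall>r\<in>Z\<inter>V. g r = G r" "f q \<in> Z"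
    using smapE[OF g q(2)] by blast
  note G = G0(1-4) G0(5)[rule_format, OF IntI]
  have qZ: "q \<in> Z" using f q by (auto simp: smap_def)
  have "continuous_on W F" using smooth_isCont[OF F(3,1)] by (simp add: continuous_at_imp_continuous_on)
  then have "open (W \<inter> F -` V)" using F(1) G(1) by (rule continuous_open_preimage)
  moreover have "q \<in> W \<inter> F -` V" using F G qZ by auto
  moreover have "smooth (W \<inter> F -` V) (\<lambda>r. G (F r))"
    by (rule smooth_compose[OF \<open>open (W \<inter> F -` V)\<close> G(3) smooth_subset[OF F(3)]]) auto
  moreover have "r \<in> {q\<in>S. f q \<in> S'} \<and> g (f r) = G (F r)" if "r \<in> Z \<inter> (W \<inter> F -` V)" for r
  proof -
    have "r \<in> S" "f r = F r" "f r \<in> V" using that F by auto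
    then show ?thesis using fZ[of r] G by auto
  qed
  ultimately show "\<exists>W F. open W \<and> q \<in> W \<and> smooth W F \<and> Z \<inter> W \<subseteq> {q \<in> S. f q \<in> S'} \<and> (\<forall>r\<in>Z \<inter> W. g (f r) = F r)"
    by (intro exI[of _ "W \<inter> F -` V"] exI[of _ "\<lambda>r. G (F r)"]) blast
qed

lemma smap_dr_comp:
  assumes f: "smap Z S f" and g: "smap Z S' g" and fZ: "\<And>q. q \<in> S \<Longrightarrow> f q \<in> Z"
    and q: "q \<in> S" "f q \<in> S'" and v: "v \<in> tangent_space Z q"
  shows "dr Z (\<lambda>q. g (f q)) q v = dr Z g (f q) (dr Z f q v)"
proof -
  obtain c where c: "c 0 = q" "\<And>t. c t \<in> Z" "(c has_vector_derivative v) (at 0)" using tangent_spaceE[OF v] by metis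
  have c0: "c 0 \<in> S" using c q by simp
  have cZ: "\<forall>\<^sub>F t in nhds 0. c t \<in> Z" using c(2) by simp
  note sc = smap_curve[OF f c0 cZ c(3)]
  have "((\<lambda>t. g (f (c t))) has_vector_derivative dr Z g (f (c 0)) (dr Z f (c 0) v)) (at 0)"
    by (rule smap_curve(1)[OF g _ _ sc(1)]) (use c q fZ in \<open>auto intro: eventually_mono[OF sc(2)]\<close>)
  then have "dr Z (\<lambda>q. g (f q)) (c 0) v = dr Z g (f (c 0)) (dr Z f (c 0) v)"
    by (intro smap_dr_eq[OF smap_comp[OF f g fZ] _ cZ c(3), where d = "\<lambda>t. g (f (c t))"]) (use c q in auto)
  then show ?thesis by (simp add: c)
qed

lemma prol_map_cong:
  assumes "open W" "base_pt Q \<in> W" "base_pt Q \<in> Z" "\<And>r. r \<in> Z \<Longrightarrow> r \<in> W \<Longrightarrow> f r = g r"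
  shows "prol_map Z f Q = prol_map Z g Q"
proof -
  have ev: "\<forall>\<^sub>F r in at (base_pt Q) within Z. f r = g r"
    unfolding eventually_at_topological using assms by (intro exI[of _ W]) auto
  have "(f has_derivative D) (at (base_pt Q) within Z) \<longleftrightarrow> (g has_derivative D) (at (base_pt Q) within Z)" for D
    using has_derivative_transform_eventually[of f D "base_pt Q" Z g] has_derivative_transform_eventually[of g D "base_pt Q" Z f]
      ev assms by (auto simp: eq_commute)
  then show ?thesis using assms by (simp add: prol_map_def frechet_derivative_def)
qed

subsection \<open>Real-analytic maps are smooth\<close>

text \<open>Termwise differentiation with an M-test. The unordered sum over a countable set is
  enumerated so that the theorem on sequences of derivatives applies; the tails of the series of the
  M i give the uniform convergence.\<close>

lemma has_derivative_has_sum: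
  fixes f :: "'i::countable \<Rightarrow> 'a::real_normed_vector \<Rightarrow> real"
  assumes inf: "infinite (UNIV :: 'i set)" and S: "open S" "convex S"
    and der: "\<And>i x. x \<in> S \<Longrightarrow> (f i has_derivative f' i x) (at x)"
    and bnd: "\<And>i x h. x \<in> S \<Longrightarrow> \<bar>f' i x h\<bar> \<le> M i * norm h" and M: "M summable_on UNIV"
    and F: "\<And>x. x \<in> S \<Longrightarrow> ((\<lambda>i. f i x) has_sum F x) UNIV" and x: "x \<in> S"
  shows "(F has_derivative (\<lambda>h. \<Sum>\<^sub>\<infinity>i. f' i x h)) (at x)"
    and "(\<lambda>i. f' i x h) summable_on UNIV"
proof -
  define e :: "nat \<Rightarrow> 'i" where "e = from_nat_into UNIV"
  have e: "bij_betw e UNIV UNIV" unfolding e_def by (rule bij_betw_from_nat_into[OF _ inf]) simp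
  have Ms: "summable (\<lambda>n. M (e n))"
    using M by (intro summable_on_imp_summable) (simp add: summable_on_reindex_bij_betw[OF e])
  have sm: "(\<lambda>i. f' i x h) summable_on UNIV" if "x \<in> S" for x h
  proof -
    have "(\<lambda>i. M i * norm h) summable_on UNIV" using M by (rule summable_on_cmult_left)
    then have "(\<lambda>i. norm (f' i x h)) summable_on UNIV"
      by (rule Infinite_Sum.abs_summable_on_comparison_test') (use bnd[OF that] in simp)
    then show ?thesis by (rule summable_on_iff_abs_summable_on_real[THEN iffD2])
  qed
  then show "(\<lambda>i. f' i x h) summable_on UNIV" using x .
  define g' where "g' x h = (\<Sum>\<^sub>\<infinity>i. f' i x h)" for x h
  have g': "(\<lambda>n. f' (e n) x h) sums g' x h" if "x \<in> S" for x h
  proof -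
    have "((\<lambda>i. f' i x h) has_sum g' x h) UNIV" unfolding g'_def by (rule has_sum_infsum[OF sm[OF that]])
    then have "((\<lambda>n. f' (e n) x h) has_sum g' x h) UNIV" by (subst has_sum_reindex_bij_betw[OF e])
    then show ?thesis by (rule has_sum_imp_sums)
  qed
  have "\<exists>g. \<forall>x\<in>S. (\<lambda>n. f (e n) x) sums g x \<and> (g has_derivative g' x) (at x within S)"
  proof (rule has_derivative_series[OF S(2)])
    show "(f (e n) has_derivative f' (e n) x) (at x within S)" if "x \<in> S" for n x
      using der[OF that] by (rule has_derivative_at_withinI)
    show "x \<in> S" by (rule x)
    have "((\<lambda>i. f i x) has_sum F x) UNIV" by (rule F[OF x])
    then have "((\<lambda>n. f (e n) x) has_sum F x) UNIV" by (subst has_sum_reindex_bij_betw[OF e])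
    then show "(\<lambda>n. f (e n) x) sums F x" by (rule has_sum_imp_sums)
    fix \<epsilon> :: real assume \<epsilon>: "\<epsilon> > 0"
    have "\<forall>\<^sub>F n in sequentially. norm (suminf (\<lambda>i. M (e (i + n)))) < \<epsilon>"
      using suminf_exist_split[OF \<epsilon> Ms] by (auto simp: eventually_sequentially)
    then show "\<forall>\<^sub>F n in sequentially. \<forall>x\<in>S. \<forall>h. norm ((\<Sum>i<n. f' (e i) x h) - g' x h) \<le> \<epsilon> * norm h"
    proof eventually_elim
      case (elim n)
      show ?case
      proof (intro ballI allI)
        fix x h assume xS: "x \<in> S"
        have sa: "summable (\<lambda>n. f' (e n) x h)" and ga: "g' x h = suminf (\<lambda>n. f' (e n) x h)"
          using g'[OF xS, of h] by (auto simp: sums_iff)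
        have "norm ((\<Sum>i<n. f' (e i) x h) - g' x h) = norm (suminf (\<lambda>i. f' (e (i + n)) x h))"
          unfolding ga suminf_minus_initial_segment[OF sa, of n] by (simp add: norm_minus_commute)
        also have "\<dots> \<le> suminf (\<lambda>i. M (e (i + n)) * norm h)"
        proof (rule norm_suminf_le)
          show "summable (\<lambda>i. M (e (i + n)) * norm h)"
            using summable_ignore_initial_segment[OF Ms, of n] by (rule summable_mult2)
        qed (use bnd[OF xS] in simp)
        also have "\<dots> = suminf (\<lambda>i. M (e (i + n))) * norm h"
          using summable_ignore_initial_segment[OF Ms, of n] by (rule suminf_mult2[symmetric])
        also have "\<dots> \<le> \<epsilon> * norm h" using elim by (intro mult_right_mono) auto
        finally show "norm ((\<Sum>i<n. f' (e i) x h) - g' x h) \<le> \<epsilon> * norm h" .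
      qed
    qed
  qed
  then obtain g where g: "\<And>x. x \<in> S \<Longrightarrow> (\<lambda>n. f (e n) x) sums g x" "\<And>x. x \<in> S \<Longrightarrow> (g has_derivative g' x) (at x within S)" by blast
  have gF: "g y = F y" if "y \<in> S" for y
  proof -
    have "((\<lambda>n. f (e n) y) has_sum F y) UNIV" using F[OF that] by (subst has_sum_reindex_bij_betw[OF e])
    then show ?thesis using has_sum_imp_sums g(1)[OF that] sums_unique2 by blast
  qed
  have "(g has_derivative g' x) (at x)" using g(2)[OF x] at_within_open[OF x S(1)] by simp
  then have "(F has_derivative g' x) (at x)" by (rule has_derivative_transform_within_open[OF _ S(1) x]) (simp add: gF)
  then show "(F has_derivative (\<lambda>h. \<Sum>\<^sub>\<infinity>i. f' i x h)) (at x)" by (simp add: g'_def[abs_def])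
qed

definition mnm :: "('n::finite \<Rightarrow> nat) \<Rightarrow> real^'n \<Rightarrow> real" where
  "mnm \<alpha> y = (\<Prod>i\<in>UNIV. (y $ i) ^ \<alpha> i)"

text \<open>The i-th partial derivative of a monomial. Truncated subtraction does no harm at
  \<alpha> i = 0 because of the factor in front.\<close>

definition dmnm :: "'n::finite \<Rightarrow> ('n \<Rightarrow> nat) \<Rightarrow> real^'n \<Rightarrow> real" where
  "dmnm i \<alpha> y = real (\<alpha> i) * mnm (\<alpha>(i := \<alpha> i - 1)) y"

lemma mnm_has_derivative:
  "((\<lambda>x. mnm \<alpha> (x - a)) has_derivative (\<lambda>h. \<Sum>i\<in>UNIV. h $ i * dmnm i \<alpha> (x - a))) (at x)"
proof -
  have c: "((\<lambda>x. (x - a) $ i) has_derivative (\<lambda>h. h $ i)) (at x)" for i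
    by (auto intro!: derivative_eq_intros bounded_linear_imp_has_derivative bounded_linear_vec_nth)
  have "((\<lambda>x. ((x - a) $ i) ^ \<alpha> i) has_derivative (\<lambda>h. of_nat (\<alpha> i) * h $ i * ((x - a) $ i) ^ (\<alpha> i - 1))) (at x)" for i
    by (rule has_derivative_power[OF c])
  then have "((\<lambda>x. mnm \<alpha> (x - a)) has_derivative
     (\<lambda>h. \<Sum>i\<in>UNIV. (of_nat (\<alpha> i) * h $ i * ((x - a) $ i) ^ (\<alpha> i - 1)) * (\<Prod>j\<in>UNIV - {i}. ((x - a) $ j) ^ \<alpha> j))) (at x)"
    unfolding mnm_def by (rule has_derivative_prod)
  moreover have "mnm (\<alpha>(i := \<alpha> i - 1)) y = (y $ i) ^ (\<alpha> i - 1) * (\<Prod>j\<in>UNIV - {i}. (y $ j) ^ \<alpha> j)" for i y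
    unfolding mnm_def by (subst prod.remove[of UNIV i]) (auto intro!: prod.cong)
  ultimately show ?thesis by (simp add: dmnm_def mult_ac)
qed

lemma mnm_bound:
  assumes "\<And>i. \<bar>y $ i\<bar> \<le> s" shows "\<bar>mnm \<alpha> y\<bar> \<le> s ^ (\<Sum>i\<in>UNIV. \<alpha> i)"
proof -
  have "\<bar>mnm \<alpha> y\<bar> = (\<Prod>i\<in>UNIV. \<bar>y $ i\<bar> ^ \<alpha> i)" by (simp add: mnm_def abs_prod power_abs)
  also have "\<dots> \<le> (\<Prod>i\<in>UNIV. s ^ \<alpha> i)" by (intro prod_mono) (auto intro!: power_mono assms)
  finally show ?thesis by (simp add: power_sum)
qed

text \<open>The exponent that differentiation brings down is at most the degree, and the degree n is
  at most 2^n; so the derivative is controlled by a power of twice the radius.\<close>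

lemma dmnm_bound:
  assumes "\<And>i. \<bar>y $ i\<bar> \<le> s" "s > 0"
  shows "\<bar>dmnm i \<alpha> y\<bar> \<le> (2 * s) ^ (\<Sum>j\<in>UNIV. \<alpha> j) / s"
proof (cases "\<alpha> i = 0")
  case False
  define n where "n = (\<Sum>j\<in>UNIV. \<alpha> j)"
  have n: "n = \<alpha> i + (\<Sum>j\<in>UNIV - {i}. \<alpha> j)" unfolding n_def by (simp add: sum.remove[of UNIV i])
  have "(\<Sum>j\<in>UNIV. (\<alpha>(i := \<alpha> i - 1)) j) = \<alpha> i - 1 + (\<Sum>j\<in>UNIV - {i}. \<alpha> j)"
    by (subst sum.remove[of UNIV i]) (auto intro!: sum.cong)
  then have n1: "(\<Sum>j\<in>UNIV. (\<alpha>(i := \<alpha> i - 1)) j) = n - 1" using n False by simp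
  have "\<bar>dmnm i \<alpha> y\<bar> \<le> real (\<alpha> i) * s ^ (n - 1)"
    using mnm_bound[OF assms(1), where \<alpha> = "\<alpha>(i := \<alpha> i - 1)"] unfolding n1 by (simp add: dmnm_def abs_mult mult_left_mono)
  also have "\<dots> \<le> 2 ^ n * s ^ (n - 1)"
  proof (rule mult_right_mono)
    have "\<alpha> i \<le> n" using n by simp
    then have "real (\<alpha> i) \<le> real n" by simp
    also have "\<dots> \<le> 2 ^ n" using of_nat_less_two_power[of n, where 'a = real] by simp
    finally show "real (\<alpha> i) \<le> 2 ^ n" .
  qed (use assms in simp)
  also have "\<dots> = (2 * s) ^ n / s"
  proof -
    have "n \<noteq> 0" using False n by simp
    then obtain m where "n = Suc m" using not0_implies_Suc by blast
    then show ?thesis using assms(2) by (simp add: power_mult_distrib)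
  qed
  finally show ?thesis by (simp add: n_def)
qed (use assms in \<open>simp add: dmnm_def\<close>)

definition pser :: "real^'n \<Rightarrow> (real^'n \<Rightarrow> real) \<Rightarrow> bool" where
  "pser a f \<longleftrightarrow> (\<exists>c r. r > 0 \<and> (\<forall>x\<in>ball a r. ((\<lambda>\<alpha>. mnm \<alpha> (x - a) * c \<alpha>) has_sum f x) UNIV))"

text \<open>Terms with \<alpha> i = 0 vanish, and lowering the i-th exponent is a bijection from the
  remaining multi-indices onto all of them; so the differentiated series is again a power
  series.\<close>

lemma has_sum_shift:
  fixes c :: "('n::finite \<Rightarrow> nat) \<Rightarrow> real"
  shows "((\<lambda>\<alpha>. dmnm i \<alpha> y * c \<alpha>) has_sum s) UNIV \<longleftrightarrow>
    ((\<lambda>\<beta>. mnm \<beta> y * (real (Suc (\<beta> i)) * c (\<beta>(i := Suc (\<beta> i))))) has_sum s) UNIV"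
proof -
  define S where "S = {\<alpha> :: 'n \<Rightarrow> nat. \<alpha> i \<noteq> 0}"
  have bij: "bij_betw (\<lambda>\<beta>. \<beta>(i := Suc (\<beta> i))) UNIV S"
    by (rule bij_betwI[where g = "\<lambda>\<alpha>. \<alpha>(i := \<alpha> i - 1)"]) (auto simp: S_def)
  have "((\<lambda>\<alpha>. dmnm i \<alpha> y * c \<alpha>) has_sum s) UNIV \<longleftrightarrow> ((\<lambda>\<alpha>. dmnm i \<alpha> y * c \<alpha>) has_sum s) S"
    by (rule has_sum_cong_neutral) (auto simp: S_def dmnm_def)
  also have "\<dots> \<longleftrightarrow> ((\<lambda>\<beta>. dmnm i (\<beta>(i := Suc (\<beta> i))) y * c (\<beta>(i := Suc (\<beta> i)))) has_sum s) UNIV"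
    by (rule has_sum_reindex_bij_betw[OF bij, symmetric])
  finally show ?thesis by (simp add: dmnm_def mult_ac)
qed

lemma has_sum_finite_sum:
  fixes f :: "'i \<Rightarrow> 'j \<Rightarrow> real"
  assumes "\<And>i. i \<in> I \<Longrightarrow> (f i has_sum s i) A"
  shows "((\<lambda>x. \<Sum>i\<in>I. f i x) has_sum (\<Sum>i\<in>I. s i)) A"
  using assms by (induction I rule: infinite_finite_induct) (auto intro: has_sum_add)

lemma infinite_multi_index: "infinite (UNIV :: ('n::finite \<Rightarrow> nat) set)"
proof
  assume "finite (UNIV :: ('n \<Rightarrow> nat) set)"
  then have "finite (range (\<lambda>k (_::'n). k :: nat))" by (rule finite_subset[rotated]) simp
  then show False using finite_imageD[of "\<lambda>k (_::'n). k :: nat" UNIV] by (auto simp: inj_on_def fun_eq_iff)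
qed

lemma pser_deriv:
  fixes f :: "real^'n \<Rightarrow> real"
  assumes "pser a f"
  shows "\<exists>s>0. \<exists>f'. (\<forall>x\<in>ball a s. (f has_derivative (\<lambda>h. \<Sum>i\<in>UNIV. h $ i * f' i x)) (at x)) \<and> (\<forall>i. pser a (f' i))"
proof -
  obtain c r where r: "r > 0" and f: "\<And>x. x \<in> ball a r \<Longrightarrow> ((\<lambda>\<alpha>. mnm \<alpha> (x - a) * c \<alpha>) has_sum f x) UNIV"
    using assms unfolding pser_def by blast
  \<comment> \<open>The point whose coordinates all exceed those of a by \<rho> has distance at most
    CARD('n) * \<rho> = r / 2 from a, so the series converges there. This makes c \<alpha> times
    \<rho> to the degree of \<alpha> absolutely summable.\<close>
  define \<rho> where "\<rho> = r / (2 * real CARD('n))"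
  have card: "real CARD('n) > 0" by simp
  have \<rho>: "\<rho> > 0" unfolding \<rho>_def using r card by (intro divide_pos_pos) simp_all
  have "norm ((\<chi> i. \<rho>) :: real^'n) \<le> (\<Sum>i\<in>(UNIV :: 'n set). \<bar>\<rho>\<bar>)"
    using norm_le_l1_cart[of "(\<chi> i. \<rho>) :: real^'n"] by simp
  also have "\<dots> = r / 2" using r by (simp add: \<rho>_def)
  finally have "a + (\<chi> i. \<rho>) \<in> ball a r" using r by (simp add: dist_norm)
  from f[OF this] have "(\<lambda>\<alpha>. mnm \<alpha> (\<chi> i. \<rho>) * c \<alpha>) summable_on UNIV" by (auto simp: summable_on_def)
  from summable_on_iff_abs_summable_on_real[THEN iffD1, OF this]
  have sum0: "(\<lambda>\<alpha>. \<bar>\<rho> ^ (\<Sum>i\<in>UNIV. \<alpha> i) * c \<alpha>\<bar>) summable_on UNIV"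
    by (simp add: mnm_def power_sum)
  \<comment> \<open>Half of \<rho>, since \<open>dmnm_bound\<close> costs a factor 2 in the
    radius.\<close>
  define s where "s = \<rho> / 2"
  have s: "s > 0" "s < r"
  proof -
    have "\<rho> \<le> r / 2" unfolding \<rho>_def using r by (intro divide_left_mono) (auto simp: Suc_le_eq)
    then show "s > 0" "s < r" using \<rho> r by (auto simp: s_def)
  qed
  define B where "B \<alpha> = \<bar>\<rho> ^ (\<Sum>i\<in>UNIV. \<alpha> i) * c \<alpha>\<bar> / s" for \<alpha>
  have B: "B summable_on UNIV" unfolding B_def divide_inverse by (rule summable_on_cmult_left[OF sum0])
  have comp: "\<bar>(x - a) $ i\<bar> \<le> s" if "x \<in> ball a s" for x i
    using component_le_norm_cart[of "x - a" i] that by (simp add: dist_norm norm_minus_commute)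
  have dB: "\<bar>dmnm i \<alpha> (x - a) * c \<alpha>\<bar> \<le> B \<alpha>" if "x \<in> ball a s" for i \<alpha> x
  proof -
    have "\<bar>dmnm i \<alpha> (x - a)\<bar> \<le> \<rho> ^ (\<Sum>j\<in>UNIV. \<alpha> j) / s"
      using dmnm_bound[of "x - a" s i \<alpha>, OF comp[OF that] s(1)] by (simp add: s_def)
    then have "\<bar>dmnm i \<alpha> (x - a)\<bar> * \<bar>c \<alpha>\<bar> \<le> \<rho> ^ (\<Sum>j\<in>UNIV. \<alpha> j) / s * \<bar>c \<alpha>\<bar>" by (rule mult_right_mono) simp
    then show ?thesis using \<rho> by (simp add: B_def abs_mult)
  qed
  define M where "M \<alpha> = real CARD('n) * B \<alpha>" for \<alpha>
  have M: "M summable_on UNIV" unfolding M_def by (rule summable_on_cmult_right[OF B])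
  define f' where "f' i x = (\<Sum>\<^sub>\<infinity>\<alpha>. dmnm i \<alpha> (x - a) * c \<alpha>)" for i x
  have sumd: "(\<lambda>\<alpha>. dmnm i \<alpha> (x - a) * c \<alpha>) summable_on UNIV" if "x \<in> ball a s" for i x
    by (rule summable_on_iff_abs_summable_on_real[THEN iffD2], rule Infinite_Sum.abs_summable_on_comparison_test'[OF B])
      (use dB[OF that] in simp)
  have "(f has_derivative (\<lambda>h. \<Sum>i\<in>UNIV. h $ i * f' i x)) (at x)" if x: "x \<in> ball a s" for x
  proof -
    have "(f has_derivative (\<lambda>h. \<Sum>\<^sub>\<infinity>\<alpha>. (\<Sum>i\<in>UNIV. h $ i * dmnm i \<alpha> (x - a)) * c \<alpha>)) (at x)"
    proof (rule has_derivative_has_sum(1)[OF infinite_multi_index open_ball convex_ball _ _ M _ x])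
      show "((\<lambda>x. mnm \<alpha> (x - a) * c \<alpha>) has_derivative (\<lambda>h. (\<Sum>i\<in>UNIV. h $ i * dmnm i \<alpha> (x - a)) * c \<alpha>)) (at x)" for \<alpha> x
        by (rule has_derivative_mult_left[OF mnm_has_derivative])
      show "((\<lambda>\<alpha>. mnm \<alpha> (x - a) * c \<alpha>) has_sum f x) UNIV" if "x \<in> ball a s" for x
        by (rule f) (use that s in auto)
      fix \<alpha> x h assume x: "x \<in> ball a s"
      have "\<bar>(\<Sum>i\<in>UNIV. h $ i * dmnm i \<alpha> (x - a)) * c \<alpha>\<bar> = \<bar>\<Sum>i\<in>UNIV. h $ i * (dmnm i \<alpha> (x - a) * c \<alpha>)\<bar>"
        by (simp only: sum_distrib_right mult.assoc)
      also have "\<dots> \<le> (\<Sum>i\<in>(UNIV :: 'n set). norm h * B \<alpha>)"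
        by (rule order.trans[OF sum_abs], rule sum_mono, unfold abs_mult[of "h $ _"], rule mult_mono)
          (auto intro: component_le_norm_cart dB[OF x])
      finally show "\<bar>(\<Sum>i\<in>UNIV. h $ i * dmnm i \<alpha> (x - a)) * c \<alpha>\<bar> \<le> M \<alpha> * norm h" by (simp add: M_def mult_ac)
    qed
    moreover have "(\<Sum>\<^sub>\<infinity>\<alpha>. (\<Sum>i\<in>UNIV. h $ i * dmnm i \<alpha> (x - a)) * c \<alpha>) = (\<Sum>i\<in>UNIV. h $ i * f' i x)" for h
    proof (rule infsumI)
      have "((\<lambda>\<alpha>. \<Sum>i\<in>UNIV. h $ i * (dmnm i \<alpha> (x - a) * c \<alpha>)) has_sum (\<Sum>i\<in>UNIV. h $ i * f' i x)) UNIV"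
        unfolding f'_def by (intro has_sum_finite_sum has_sum_cmult_right has_sum_infsum sumd x)
      then show "((\<lambda>\<alpha>. (\<Sum>i\<in>UNIV. h $ i * dmnm i \<alpha> (x - a)) * c \<alpha>) has_sum (\<Sum>i\<in>UNIV. h $ i * f' i x)) UNIV"
        by (simp only: sum_distrib_right mult.assoc)
    qed
    ultimately show ?thesis by simp
  qed
  moreover have "pser a (f' i)" for i
    unfolding pser_def
  proof (intro exI[of _ "\<lambda>\<beta>. real (Suc (\<beta> i)) * c (\<beta>(i := Suc (\<beta> i)))"] exI[of _ s] conjI ballI s)
    fix x assume "x \<in> ball a s"
    from has_sum_infsum[OF sumd[OF this]]
    show "((\<lambda>\<beta>. mnm \<beta> (x - a) * (real (Suc (\<beta> i)) * c (\<beta>(i := Suc (\<beta> i))))) has_sum f' i x) UNIV"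
      unfolding f'_def has_sum_shift .
  qed
  ultimately show ?thesis using s(1) by blast
qed

lemma pser_cong:
  assumes "pser a f" "open W" "a \<in> W" "\<And>x. x \<in> W \<Longrightarrow> f x = g x" shows "pser a g"
proof -
  obtain c r where r: "r > 0" and f: "\<And>x. x \<in> ball a r \<Longrightarrow> ((\<lambda>\<alpha>. mnm \<alpha> (x - a) * c \<alpha>) has_sum f x) UNIV"
    using assms(1) unfolding pser_def by blast
  obtain s where "s > 0" "ball a s \<subseteq> W" using assms(2,3) openE by blast
  then have "((\<lambda>\<alpha>. mnm \<alpha> (x - a) * c \<alpha>) has_sum g x) UNIV" if "x \<in> ball a (min r s)" for x
    using f[of x] assms(4)[of x] that by auto
  then show ?thesis unfolding pser_def using r \<open>s > 0\<close> by (intro exI[of _ c] exI[of _ "min r s"]) auto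
qed

text \<open>The expansions at different centers are tied together by the partial derivatives of f
  itself: near each center these coincide with the sums of the differentiated series. So they have
  expansions at all points of U, and the induction continues.\<close>

lemma pser_Ck:
  assumes "open U" "\<And>a. a \<in> U \<Longrightarrow> pser a f" shows "Ck n U f"
  using assms(2)
proof (induction n arbitrary: f)
  case (Suc n)
  define g where "g i x = frechet_derivative f (at x) (axis i 1)" for i x
  have loc: "(f has_derivative (\<lambda>h. \<Sum>i\<in>UNIV. h $ i * g i a)) (at a) \<and> pser a (g i)" if a: "a \<in> U" for a i
  proof -
    obtain s f' where s: "s > 0" and f': "\<And>x. x \<in> ball a s \<Longrightarrow> (f has_derivative (\<lambda>h. \<Sum>i\<in>UNIV. h $ i * f' i x)) (at x)"
        "\<And>i. pser a (f' i)"
      using pser_deriv[OF Suc.prems[OF a]] by blast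
    have g: "f' i x = g i x" if "x \<in> ball a s" for i x
    proof -
      have "frechet_derivative f (at x) = (\<lambda>h. \<Sum>i\<in>UNIV. h $ i * f' i x)"
        using frechet_derivative_at[OF f'(1)[OF that]] by simp
      then show ?thesis by (simp add: g_def axis_def if_distrib[of "\<lambda>x. x * _"] cong: if_cong)
    qed
    have "pser a (g i)" by (rule pser_cong[OF f'(2) open_ball _ g]) (use s in auto)
    then show ?thesis using f'(1)[of a] g[of a] s by simp
  qed
  have "Ck n U (\<lambda>x. \<Sum>i\<in>UNIV. v $ i * g i x)" for v
    by (intro Ck_sum Ck_bilinear[OF bounded_bilinear_mult] Ck_const Suc.IH) (use loc in blast)
  then show ?case using loc by (auto intro!: exI[of _ "\<lambda>x h. \<Sum>i\<in>UNIV. h $ i * g i x"])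
qed simp

lemma real_analytic_smooth:
  fixes f :: "real^'n \<Rightarrow> 'b::euclidean_space"
  assumes "f real_analytic_on U" "open U" shows "smooth U f"
proof -
  have "smooth U (\<lambda>x. f x \<bullet> b)" for b
    unfolding smooth_def
  proof (intro allI pser_Ck[OF assms(2)])
    fix a assume "a \<in> U"
    then obtain c r where r: "r > 0" and
      c: "\<And>x. x \<in> ball a r \<Longrightarrow> ((\<lambda>\<alpha>. (\<Prod>i\<in>UNIV. (x $ i - a $ i) ^ \<alpha> i) *\<^sub>R c \<alpha>) has_sum f x) UNIV"
      using assms(1) unfolding real_analytic_on_def by blast
    have "((\<lambda>\<alpha>. mnm \<alpha> (x - a) * (c \<alpha> \<bullet> b)) has_sum f x \<bullet> b) UNIV" if "x \<in> ball a r" for x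
      using has_sum_bounded_linear[OF bounded_linear_inner_left c[OF that], of b] by (simp add: o_def mnm_def)
    then show "pser a (\<lambda>x. f x \<bullet> b)" unfolding pser_def using r by (intro exI[of _ "\<lambda>\<alpha>. c \<alpha> \<bullet> b"] exI[of _ r]) auto
  qed
  then have "smooth U (\<lambda>x. \<Sum>b\<in>Basis. (f x \<bullet> b) *\<^sub>R b)" by (intro smooth_sum smooth_scaleR smooth_const)
  then show ?thesis by (simp add: euclidean_representation)
qed

subsection \<open>Polynomial maps are real-analytic\<close>

definition fser :: "real^'n \<Rightarrow> (real^'n \<Rightarrow> real) \<Rightarrow> bool" where
  "fser a f \<longleftrightarrow> (\<exists>c. finite {\<alpha>. c \<alpha> \<noteq> 0} \<and> (\<forall>x. f x = (\<Sum>\<alpha> | c \<alpha> \<noteq> 0. mnm \<alpha> (x - a) * c \<alpha>)))"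

text \<open>The summands may repeat exponents and be indexed by any finite set. Equal exponents are
  collected here once and for all, so that sums and products of expansions can be indexed by
  disjoint unions and pairs.\<close>

lemma fserI:
  assumes "finite T" "\<And>x. f x = (\<Sum>t\<in>T. mnm (g t) (x - a) * c t)"
  shows "fser a f"
proof -
  define d where "d \<alpha> = (\<Sum>t | t \<in> T \<and> g t = \<alpha>. c t)" for \<alpha>
  have sub: "{\<alpha>. d \<alpha> \<noteq> 0} \<subseteq> g ` T" by (force simp: d_def intro: sum.neutral)
  have "f x = (\<Sum>\<alpha> | d \<alpha> \<noteq> 0. mnm \<alpha> (x - a) * d \<alpha>)" for x
  proof -
    have "f x = (\<Sum>\<alpha>\<in>g ` T. \<Sum>t | t \<in> T \<and> g t = \<alpha>. mnm (g t) (x - a) * c t)"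
      unfolding assms(2) using sum.image_gen[OF assms(1)] .
    also have "\<dots> = (\<Sum>\<alpha>\<in>g ` T. mnm \<alpha> (x - a) * d \<alpha>)" by (simp add: d_def sum_distrib_left)
    also have "\<dots> = (\<Sum>\<alpha> | d \<alpha> \<noteq> 0. mnm \<alpha> (x - a) * d \<alpha>)"
      by (rule sum.mono_neutral_right) (use sub assms(1) in auto)
    finally show ?thesis .
  qed
  moreover have "finite {\<alpha>. d \<alpha> \<noteq> 0}" using sub assms(1) finite_subset by blast
  ultimately show ?thesis unfolding fser_def by blast
qed

lemma fser_const: "fser a (\<lambda>x. k)"
  by (rule fserI[of "{()}" _ "\<lambda>_ _. 0" _ "\<lambda>_. k"]) (auto simp: mnm_def)

lemma fser_add: assumes "fser a f" "fser a g" shows "fser a (\<lambda>x. f x + g x)"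
proof -
  obtain c d where c: "finite {\<alpha>. c \<alpha> \<noteq> 0}" "\<And>x. f x = (\<Sum>\<alpha> | c \<alpha> \<noteq> 0. mnm \<alpha> (x - a) * c \<alpha>)"
    and d: "finite {\<alpha>. d \<alpha> \<noteq> 0}" "\<And>x. g x = (\<Sum>\<alpha> | d \<alpha> \<noteq> 0. mnm \<alpha> (x - a) * d \<alpha>)"
    using assms unfolding fser_def by blast
  show ?thesis
    by (rule fserI[of "{\<alpha>. c \<alpha> \<noteq> 0} <+> {\<alpha>. d \<alpha> \<noteq> 0}" _ "\<lambda>t. case t of Inl \<alpha> \<Rightarrow> \<alpha> | Inr \<alpha> \<Rightarrow> \<alpha>" _
          "\<lambda>t. case t of Inl \<alpha> \<Rightarrow> c \<alpha> | Inr \<alpha> \<Rightarrow> d \<alpha>"])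
      (use c d in \<open>simp_all add: sum.Plus\<close>)
qed

lemma mnm_add: "mnm (\<lambda>i. \<alpha> i + \<beta> i) y = mnm \<alpha> y * mnm \<beta> y"
  by (simp add: mnm_def power_add prod.distrib)

lemma fser_mult: assumes "fser a f" "fser a g" shows "fser a (\<lambda>x. f x * g x)"
proof -
  obtain c d where c: "finite {\<alpha>. c \<alpha> \<noteq> 0}" "\<And>x. f x = (\<Sum>\<alpha> | c \<alpha> \<noteq> 0. mnm \<alpha> (x - a) * c \<alpha>)"
    and d: "finite {\<alpha>. d \<alpha> \<noteq> 0}" "\<And>x. g x = (\<Sum>\<alpha> | d \<alpha> \<noteq> 0. mnm \<alpha> (x - a) * d \<alpha>)"
    using assms unfolding fser_def by blast
  show ?thesis
    by (rule fserI[of "{\<alpha>. c \<alpha> \<noteq> 0} \<times> {\<alpha>. d \<alpha> \<noteq> 0}" _ "\<lambda>(\<alpha>, \<beta>) i. \<alpha> i + \<beta> i" _ "\<lambda>(\<alpha>, \<beta>). c \<alpha> * d \<beta>"])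
      (use c d in \<open>simp_all add: sum_product sum.cartesian_product mnm_add case_prod_unfold mult_ac\<close>)
qed

lemma fser_nth: "fser a (\<lambda>x. x $ j)"
\<comment> \<open>x $ j = (x $ j - a $ j) + a $ j: the index True stands for the linear term, False
  for the constant.\<close>
proof (rule fserI[of "UNIV :: bool set" _ "\<lambda>b i. if b \<and> i = j then 1 else 0" _ "\<lambda>b. if b then 1 else a $ j"])
  fix x :: "real^'a"
  have "mnm (\<lambda>i. if True \<and> i = j then 1 else 0) (x - a) = x $ j - a $ j"
    by (simp add: mnm_def if_distrib[of "power _"] cong: if_cong)
  then show "x $ j = (\<Sum>b\<in>UNIV. mnm (\<lambda>i. if b \<and> i = j then 1 else 0) (x - a) * (if b then 1 else a $ j))"
    by (simp add: UNIV_bool) (simp add: mnm_def)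
qed simp

lemma fser_polynomial:
  fixes f :: "real^'n \<Rightarrow> real"
  shows "real_polynomial_function f \<Longrightarrow> fser a f"
proof (induction rule: real_polynomial_function.induct)
  case (linear f)
  have A: "fser a (\<lambda>x. \<Sum>i\<in>I. x $ i * f (axis i 1))" for I
    by (induction I rule: infinite_finite_induct) (auto intro!: fser_add[OF fser_mult[OF fser_nth fser_const]] intro: fser_const)
  have eq: "f x = (\<Sum>i\<in>UNIV. x $ i * f (axis i 1))" for x
  proof -
    have "f x = f (\<Sum>i\<in>UNIV. x $ i *\<^sub>R axis i 1)"
      by (rule arg_cong[of _ _ f]) (simp add: vec_eq_iff axis_def if_distrib cong: if_cong)
    then show ?thesis using bounded_linear.linear[OF linear] by (simp add: linear_sum linear_scale)
  qed
  have "(\<lambda>x. \<Sum>i\<in>UNIV. x $ i * f (axis i 1)) = f" by (rule ext) (rule eq[symmetric])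
  then show ?case using A[of UNIV] by (simp only:)
qed (auto intro: fser_const fser_add fser_mult)

lemma polynomial_real_analytic:
  fixes f :: "real^'n \<Rightarrow> real^'m"
  assumes "polynomial_function f" shows "f real_analytic_on U"
  unfolding real_analytic_on_def
proof (intro ballI)
  fix a assume "a \<in> U"
  have fk: "fser a (\<lambda>x. f x $ k)" for k
  proof (rule fser_polynomial)
    show "real_polynomial_function (\<lambda>x. f x $ k)"
      using assms[unfolded polynomial_function_def, rule_format, OF bounded_linear_vec_nth[of k]] by (simp add: o_def)
  qed
  have "\<forall>k. \<exists>c. finite {\<alpha>. c \<alpha> \<noteq> 0} \<and> (\<forall>x. f x $ k = (\<Sum>\<alpha> | c \<alpha> \<noteq> 0. mnm \<alpha> (x - a) * c \<alpha>))"
    using fk unfolding fser_def by blast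
  from choice[OF this] obtain c where
    c0: "\<forall>k. finite {\<alpha>. c k \<alpha> \<noteq> 0} \<and> (\<forall>x. f x $ k = (\<Sum>\<alpha> | c k \<alpha> \<noteq> 0. mnm \<alpha> (x - a) * c k \<alpha>))" ..
  note c = c0[rule_format, THEN conjunct1] c0[rule_format, THEN conjunct2, rule_format]
  define d where "d \<alpha> = (\<chi> k. c k \<alpha>)" for \<alpha>
  \<comment> \<open>The components of f have different supports of exponents, so all of them are
    summed over the union.\<close>
  define T where "T = (\<Union>k. {\<alpha>. c k \<alpha> \<noteq> 0})"
  have T: "finite T" unfolding T_def using c(1) by auto
  have fT: "f x = (\<Sum>\<alpha>\<in>T. mnm \<alpha> (x - a) *\<^sub>R d \<alpha>)" for x
  proof -
    have "f x $ k = (\<Sum>\<alpha>\<in>T. mnm \<alpha> (x - a) * c k \<alpha>)" for k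
      unfolding c(2) by (rule sum.mono_neutral_left[OF T]) (auto simp: T_def)
    then show ?thesis by (simp add: vec_eq_iff d_def)
  qed
  have "((\<lambda>\<alpha>. mnm \<alpha> (x - a) *\<^sub>R d \<alpha>) has_sum f x) UNIV" for x
  proof -
    have "((\<lambda>\<alpha>. mnm \<alpha> (x - a) *\<^sub>R d \<alpha>) has_sum f x) T" unfolding fT by (rule has_sum_finite[OF T])
    then show ?thesis by (subst has_sum_cong_neutral[of T UNIV _ "\<lambda>\<alpha>. mnm \<alpha> (x - a) *\<^sub>R d \<alpha>"])
        (auto simp: T_def d_def vec_eq_iff)
  qed
  then show "\<exists>c r. r > 0 \<and> (\<forall>x\<in>ball a r. ((\<lambda>\<alpha>. (\<Prod>i\<in>UNIV. (x $ i - a $ i) ^ \<alpha> i) *\<^sub>R c \<alpha>) has_sum f x) UNIV)"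
    unfolding mnm_def by (intro exI[of _ d] exI[of _ 1]) simp
qed

subsection \<open>Levels of the tower and their orbits\<close>

text \<open>A smooth map with injective differentials, phrased as a morphism of the lowest level so
  that prolongation starts there without a special case.\<close>

definition sdiff :: "(real^3) set \<Rightarrow> (real^3 \<Rightarrow> real^3) \<Rightarrow> bool" where
  "sdiff U \<Phi> \<longleftrightarrow> morph UNIV (\<lambda>_. UNIV) U \<Phi>"

definition polyaut :: "(real^3 \<Rightarrow> real^3) \<Rightarrow> bool" where
  "polyaut \<Phi> \<longleftrightarrow> polynomial_function \<Phi> \<and>
     (\<exists>\<Psi>. polynomial_function \<Psi> \<and> (\<forall>x. \<Psi> (\<Phi> x) = x) \<and> (\<forall>x. \<Phi> (\<Psi> x) = x))"

text \<open>Differentiating \<Psi> (\<Phi> x) = x yields a left inverse of the differential of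
  \<Phi>.\<close>

lemma sdiffI:
  assumes U: "open U" and \<Phi>: "smooth U \<Phi>" and V: "open V" "smooth V \<Psi>" "\<Phi> ` U \<subseteq> V" "\<And>x. x \<in> U \<Longrightarrow> \<Psi> (\<Phi> x) = x"
  shows "sdiff U \<Phi>"
  unfolding sdiff_def morph_def
proof (intro conjI ballI impI)
  show "smap UNIV U \<Phi>" unfolding smap_def using U \<Phi> by blast
  fix q v assume q: "q \<in> U" and 0: "frechet_derivative \<Phi> (at q) v = 0"
  have d: "(\<Phi> has_derivative frechet_derivative \<Phi> (at q)) (at q)" by (rule smooth_has_derivative[OF \<Phi> U q])
  have "\<Phi> q \<in> V" using V(3) q by blast
  then have "(\<Psi> has_derivative frechet_derivative \<Psi> (at (\<Phi> q))) (at (\<Phi> q))" by (rule smooth_has_derivative[OF V(2,1)])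
  from has_derivative_compose[OF d this]
  have "((\<lambda>x. x) has_derivative (\<lambda>v. frechet_derivative \<Psi> (at (\<Phi> q)) (frechet_derivative \<Phi> (at q) v))) (at q)"
    by (rule has_derivative_transform_within_open[OF _ U q]) (simp add: V)
  from has_derivative_unique[OF this has_derivative_ident]
  have "frechet_derivative \<Psi> (at (\<Phi> q)) (frechet_derivative \<Phi> (at q) v) = v" by metis
  moreover have "frechet_derivative \<Psi> (at (\<Phi> q)) 0 = 0"
    using linear_0[OF has_derivative_linear[OF \<open>(\<Psi> has_derivative _) _\<close>]] .
  ultimately show "v = 0" by (simp add: 0)
qed auto

lemma local_diffeo_sdiff: assumes "local_diffeo U \<Phi>" shows "sdiff U \<Phi>"
  using assms unfolding local_diffeo_def
  by (intro sdiffI[of U \<Phi> "\<Phi> ` U" "inv_into U \<Phi>"] real_analytic_smooth) auto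

lemma polyaut_sdiff: assumes "polyaut \<Phi>" shows "sdiff UNIV \<Phi>"
proof -
  obtain \<Psi> where "polynomial_function \<Psi>" "\<forall>x. \<Psi> (\<Phi> x) = x" using assms unfolding polyaut_def by blast
  then show ?thesis using assms unfolding polyaut_def
    by (intro sdiffI[of UNIV \<Phi> UNIV \<Psi>] smooth_polynomial) auto
qed

lemma polyaut_local_diffeo: assumes "polyaut \<Phi>" shows "local_diffeo UNIV \<Phi>"
proof -
  obtain \<Psi> where \<Psi>: "polynomial_function \<Psi>" "\<forall>x. \<Psi> (\<Phi> x) = x" "\<forall>x. \<Phi> (\<Psi> x) = x"
    using assms unfolding polyaut_def by blast
  have inj: "inj \<Phi>" using \<Psi>(2) by (metis injI)
  have s: "range \<Phi> = UNIV" using \<Psi>(3) by (metis surjI)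
  have "inv_into UNIV \<Phi> = \<Psi>" using \<Psi> inj by (metis inv_f_eq ext)
  then show ?thesis using \<Psi> inj s assms by (simp add: local_diffeo_def polynomial_real_analytic polyaut_def)
qed

lemma polyaut_id: "polyaut (\<lambda>x. x)"
  unfolding polyaut_def by (auto intro: exI[of _ "\<lambda>x. x"])

lemma polyaut_comp:
  assumes "polyaut \<Phi>" "polyaut \<Psi>" shows "polyaut (\<lambda>x. \<Psi> (\<Phi> x))"
proof -
  obtain \<Phi>' \<Psi>' where "polynomial_function \<Phi>'" "\<forall>x. \<Phi>' (\<Phi> x) = x" "\<forall>x. \<Phi> (\<Phi>' x) = x"
      "polynomial_function \<Psi>'" "\<forall>x. \<Psi>' (\<Psi> x) = x" "\<forall>x. \<Psi> (\<Psi>' x) = x"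
    using assms unfolding polyaut_def by blast
  then show ?thesis using assms polynomial_function_compose[of \<Phi> \<Psi>] polynomial_function_compose[of \<Psi>' \<Phi>']
    unfolding polyaut_def o_def by (intro conjI exI[of _ "\<lambda>x. \<Phi>' (\<Psi>' x)"]) auto
qed

lemma polyaut_inv:
  assumes "polyaut \<Phi>" obtains \<Psi> where "polyaut \<Psi>" "\<And>x. \<Psi> (\<Phi> x) = x"
proof -
  obtain \<Psi> where "polynomial_function \<Psi>" "\<forall>x. \<Psi> (\<Phi> x) = x" "\<forall>x. \<Phi> (\<Psi> x) = x" "polynomial_function \<Phi>"
    using assms unfolding polyaut_def by blast
  then show thesis using that[of \<Psi>] unfolding polyaut_def by blast
qed

text \<open>The properties of lifting that reproduce themselves under prolongation. At every level
  the domain of a lifted map is the preimage of a subset U of three-space, and \<open>proj\<close>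
  keeps track of it; \<open>comp\<close> and \<open>ident\<close> make lifting functorial.\<close>

locale level =
  fixes Z :: "(real^'n) set" and \<Delta> and \<pi> :: "real^'n \<Rightarrow> real^3" and lift :: "(real^3 \<Rightarrow> real^3) \<Rightarrow> real^'n \<Rightarrow> real^'n"
  assumes reg: "regular Z \<Delta>"
    and morph: "sdiff U \<Phi> \<Longrightarrow> morph Z \<Delta> {q\<in>Z. \<pi> q \<in> U} (lift \<Phi>)"
    and proj: "sdiff U \<Phi> \<Longrightarrow> q \<in> Z \<Longrightarrow> \<pi> q \<in> U \<Longrightarrow> \<pi> (lift \<Phi> q) = \<Phi> (\<pi> q)"
    and comp: "sdiff U \<Phi> \<Longrightarrow> sdiff V \<Psi> \<Longrightarrow> q \<in> Z \<Longrightarrow> \<pi> q \<in> U \<Longrightarrow> \<Phi> (\<pi> q) \<in> V \<Longrightarrow>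
      lift (\<lambda>x. \<Psi> (\<Phi> x)) q = lift \<Psi> (lift \<Phi> q)"
    and ident: "q \<in> Z \<Longrightarrow> lift (\<lambda>x. x) q = q"
begin

lemma lift_mem: "sdiff U \<Phi> \<Longrightarrow> q \<in> Z \<Longrightarrow> \<pi> q \<in> U \<Longrightarrow> lift \<Phi> q \<in> Z"
  using morph_mem[OF morph] by blast

text \<open>Near q the lift of a composition equals the composition of the lifts, so both have the
  same derivatives and the chain rule applies. The condition on the base point of Q is a disjunct
  because Q occurs in the second conclusion only.\<close>

lemma dr_comp:
  assumes "sdiff U \<Phi>" "sdiff V \<Psi>" "q \<in> Z" "\<pi> q \<in> U" "\<Phi> (\<pi> q) \<in> V" "v \<in> \<Delta> q"
  shows "dr Z (lift (\<lambda>x. \<Psi> (\<Phi> x))) q v = dr Z (lift \<Psi>) (lift \<Phi> q) (dr Z (lift \<Phi>) q v)"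
    and "prol_map Z (lift (\<lambda>x. \<Psi> (\<Phi> x))) Q = prol_map Z (\<lambda>q. lift \<Psi> (lift \<Phi> q)) Q \<or> base_pt Q \<noteq> q"
proof -
  define S where "S = {q\<in>{q\<in>Z. \<pi> q \<in> U}. lift \<Phi> q \<in> {q\<in>Z. \<pi> q \<in> V}}"
  have qS: "q \<in> S" unfolding S_def using assms proj[OF assms(1)] lift_mem[OF assms(1)] by auto
  have sm: "smap Z S (\<lambda>q. lift \<Psi> (lift \<Phi> q))" unfolding S_def
    by (rule smap_comp[OF morph_smap[OF morph[OF assms(1)]] morph_smap[OF morph[OF assms(2)]]])
      (use lift_mem[OF assms(1)] in auto)
  have eq: "lift (\<lambda>x. \<Psi> (\<Phi> x)) r = lift \<Psi> (lift \<Phi> r)" if "r \<in> S" for r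
  proof -
    have r: "r \<in> Z" "\<pi> r \<in> U" "\<pi> (lift \<Phi> r) \<in> V" using that by (auto simp: S_def)
    then have "\<Phi> (\<pi> r) \<in> V" using proj[OF assms(1) r(1,2)] by simp
    then show ?thesis by (rule comp[OF assms(1,2) r(1,2)])
  qed
  obtain W F where W: "open W" "q \<in> W" "smooth W F" "Z \<inter> W \<subseteq> S"
    "\<forall>r\<in>Z\<inter>W. lift \<Psi> (lift \<Phi> r) = F r" "q \<in> Z" using smapE[OF sm qS] by blast
  have eqW: "lift (\<lambda>x. \<Psi> (\<Phi> x)) r = lift \<Psi> (lift \<Phi> r)" if "r \<in> Z" "r \<in> W" for r
    using W(4) that by (intro eq) auto
  have fd: "frechet_derivative (lift (\<lambda>x. \<Psi> (\<Phi> x))) (at q within Z) = frechet_derivative (\<lambda>q. lift \<Psi> (lift \<Phi> q)) (at q within Z)"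
  proof -
    have ev: "\<forall>\<^sub>F r in at q within Z. lift (\<lambda>x. \<Psi> (\<Phi> x)) r = lift \<Psi> (lift \<Phi> r)"
      unfolding eventually_at_topological using W eqW by (intro exI[of _ W]) auto
    then have ev': "\<forall>\<^sub>F r in at q within Z. lift \<Psi> (lift \<Phi> r) = lift (\<lambda>x. \<Psi> (\<Phi> x)) r"
      by (rule eventually_mono) simp
    have "(lift (\<lambda>x. \<Psi> (\<Phi> x)) has_derivative D) (at q within Z) \<longleftrightarrow> ((\<lambda>q. lift \<Psi> (lift \<Phi> q)) has_derivative D) (at q within Z)" for D
      using has_derivative_transform_eventually[OF _ ev eq[OF qS] assms(3)]
        has_derivative_transform_eventually[OF _ ev' eq[OF qS, symmetric] assms(3)] by blast
    then show ?thesis by (simp add: frechet_derivative_def)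
  qed
  show "dr Z (lift (\<lambda>x. \<Psi> (\<Phi> x))) q v = dr Z (lift \<Psi>) (lift \<Phi> q) (dr Z (lift \<Phi>) q v)"
    unfolding fd by (rule smap_dr_comp[OF morph_smap[OF morph[OF assms(1)]] morph_smap[OF morph[OF assms(2)]]])
      (use lift_mem[OF assms(1)] qS regular_tangent[OF reg] assms in \<open>auto simp: S_def\<close>)
  show "prol_map Z (lift (\<lambda>x. \<Psi> (\<Phi> x))) Q = prol_map Z (\<lambda>q. lift \<Psi> (lift \<Phi> q)) Q \<or> base_pt Q \<noteq> q"
    using prol_map_cong[OF W(1), of Q Z "lift (\<lambda>x. \<Psi> (\<Phi> x))" "\<lambda>q. lift \<Psi> (lift \<Phi> q)"] W(2) assms(3) eqW by blast
qed

lemma sdiff_id: "sdiff UNIV (\<lambda>x. x)"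
  by (rule polyaut_sdiff[OF polyaut_id])

lemma dr_ident: assumes "q \<in> Z" "v \<in> \<Delta> q" shows "dr Z (lift (\<lambda>x. x)) q v = v"
  by (rule smap_dr_ext[OF morph_smap[OF morph[OF sdiff_id]], where W = UNIV and F = "\<lambda>x. x" and F' = "\<lambda>x. x"])
    (use assms ident regular_tangent[OF reg] in auto)

lemma prol_map_lift:
  assumes "sdiff U \<Phi>" "q \<in> Z" "\<pi> q \<in> U" "u \<in> \<Delta> q" "u \<noteq> 0"
  shows "prol_map Z (lift \<Phi>) (le q u) = le (lift \<Phi> q) (dr Z (lift \<Phi>) q u)"
  by (rule prol_map_le[OF morph[OF assms(1)] _ assms(4,5)]) (use assms in simp)

lemma dr_mem: "sdiff U \<Phi> \<Longrightarrow> q \<in> Z \<Longrightarrow> \<pi> q \<in> U \<Longrightarrow> u \<in> \<Delta> q \<Longrightarrow> dr Z (lift \<Phi>) q u \<in> \<Delta> (lift \<Phi> q)"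
  using morph_dr_mem[OF morph] by blast
lemma dr_nz: "sdiff U \<Phi> \<Longrightarrow> q \<in> Z \<Longrightarrow> \<pi> q \<in> U \<Longrightarrow> u \<in> \<Delta> q \<Longrightarrow> u \<noteq> 0 \<Longrightarrow> dr Z (lift \<Phi>) q u \<noteq> 0"
  using morph_dr_nz[OF morph] by blast
lemma dr_lin: "sdiff U \<Phi> \<Longrightarrow> q \<in> Z \<Longrightarrow> \<pi> q \<in> U \<Longrightarrow> linear (dr Z (lift \<Phi>) q)"
  using morph_dr_linear[OF morph] by blast

lemma prolZ: "Q \<in> prol_space Z \<Delta> \<Longrightarrow> base_pt Q \<in> Z"
  using prol_space_iff[OF reg] by auto

text \<open>The delicate part is composition: the lift of a composition is known to be the
  composition of the lifts only near the given base point, so the prolongations are compared through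
  locality before the chain rule is applied to lines.\<close>

theorem prolong: "level (prol_space Z \<Delta>) (prol_dist Z \<Delta>) (\<pi> \<circ> base_pt) (\<lambda>\<Phi>. prol_map Z (lift \<Phi>))"
proof
  show "regular (prol_space Z \<Delta>) (prol_dist Z \<Delta>)" by (rule regular_prol[OF reg])
next
  fix U \<Phi> assume \<Phi>: "sdiff U \<Phi>"
  have "over Z \<Delta> {q\<in>Z. \<pi> q \<in> U} = {q \<in> prol_space Z \<Delta>. (\<pi> \<circ> base_pt) q \<in> U}" using prolZ by (auto simp: over_def)
  then show "morph (prol_space Z \<Delta>) (prol_dist Z \<Delta>) {q \<in> prol_space Z \<Delta>. (\<pi> \<circ> base_pt) q \<in> U} (prol_map Z (lift \<Phi>))"
    using morph_prol[OF reg morph[OF \<Phi>]] by simp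
next
  fix U \<Phi> q assume \<Phi>: "sdiff U \<Phi>" and q: "q \<in> prol_space Z \<Delta>" "(\<pi> \<circ> base_pt) q \<in> U"
  then show "(\<pi> \<circ> base_pt) (prol_map Z (lift \<Phi>) q) = \<Phi> ((\<pi> \<circ> base_pt) q)"
    using proj[OF \<Phi> prolZ[OF q(1)]] by (simp add: prol_map_def)
next
  fix U \<Phi> V \<Psi> Q assume a: "sdiff U \<Phi>" "sdiff V \<Psi>" "Q \<in> prol_space Z \<Delta>" "(\<pi> \<circ> base_pt) Q \<in> U" "\<Phi> ((\<pi> \<circ> base_pt) Q) \<in> V"
  obtain q u where q: "q \<in> Z" "u \<in> \<Delta> q" "u \<noteq> 0" "Q = le q u" using a(3) prol_space_iff[OF reg] by blast
  have pq: "\<pi> q \<in> U" "\<Phi> (\<pi> q) \<in> V" using a(4,5) by (simp_all add: q(4))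
  define S where "S = {q\<in>{q\<in>Z. \<pi> q \<in> U}. lift \<Phi> q \<in> {q\<in>Z. \<pi> q \<in> V}}"
  have qS: "q \<in> S" unfolding S_def using q pq proj[OF a(1)] lift_mem[OF a(1)] by auto
  have sm: "smap Z S (\<lambda>q. lift \<Psi> (lift \<Phi> q))" unfolding S_def
    by (rule smap_comp[OF morph_smap[OF morph[OF a(1)]] morph_smap[OF morph[OF a(2)]]])
      (use lift_mem[OF a(1)] in auto)
  have d: "dr Z (\<lambda>q. lift \<Psi> (lift \<Phi> q)) q u = dr Z (lift \<Psi>) (lift \<Phi> q) (dr Z (lift \<Phi>) q u)"
    by (rule smap_dr_comp[OF morph_smap[OF morph[OF a(1)]] morph_smap[OF morph[OF a(2)]]])
      (use lift_mem[OF a(1)] qS regular_tangent[OF reg] q pq in \<open>auto simp: S_def\<close>)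
  note lq = lift_mem[OF a(1) q(1) pq(1)] and plq = proj[OF a(1) q(1) pq(1)]
  note m = dr_mem[OF a(1) q(1) pq(1) q(2)] dr_nz[OF a(1) q(1) pq(1) q(2,3)]
  have plV: "\<pi> (lift \<Phi> q) \<in> V" using pq plq by simp
  have "prol_map Z (lift (\<lambda>x. \<Psi> (\<Phi> x))) Q = prol_map Z (\<lambda>q. lift \<Psi> (lift \<Phi> q)) Q"
    using dr_comp(2)[OF a(1,2) q(1) pq q(2), of Q] by (simp add: q(4))
  also have "\<dots> = le (lift \<Psi> (lift \<Phi> q)) (dr Z (lift \<Psi>) (lift \<Phi> q) (dr Z (lift \<Phi>) q u))"
    unfolding q(4) d[symmetric]
    by (rule prol_map_le_linear[OF smap_dr_linear[OF sm qS] q(3)])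
      (simp add: d dr_nz[OF a(2) lq plV m])
  also have "\<dots> = prol_map Z (lift \<Psi>) (prol_map Z (lift \<Phi>) Q)"
    unfolding q(4) prol_map_lift[OF a(1) q(1) pq(1) q(2,3)] prol_map_lift[OF a(2) lq plV m] ..
  finally show "prol_map Z (lift (\<lambda>x. \<Psi> (\<Phi> x))) Q = prol_map Z (lift \<Psi>) (prol_map Z (lift \<Phi>) Q)" .
next
  fix Q assume "Q \<in> prol_space Z \<Delta>"
  then obtain q u where q: "q \<in> Z" "u \<in> \<Delta> q" "u \<noteq> 0" "Q = le q u" using prol_space_iff[OF reg] by blast
  show "prol_map Z (lift (\<lambda>x. x)) Q = Q"
    unfolding q(4) using prol_map_lift[OF sdiff_id q(1) _ q(2,3)] dr_ident[OF q(1,2)] ident[OF q(1)] by simp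
qed

end

lemma level_0: "level (UNIV :: (real^3) set) (\<lambda>_. UNIV) id (\<lambda>\<Phi>. \<Phi>)"
  by unfold_locales (auto simp: regular_UNIV sdiff_def)

lemma sdiff_comp:
  assumes f: "sdiff U f" and g: "sdiff V g" shows "sdiff {x\<in>U. f x \<in> V} (\<lambda>x. g (f x))"
proof -
  interpret L0: level "UNIV :: (real^3) set" "\<lambda>_. UNIV" id "\<lambda>\<Phi>. \<Phi>" by (rule level_0)
  have sm: "smap UNIV {q\<in>U. f q \<in> V} (\<lambda>x. g (f x))"
    by (rule smap_comp[OF f[unfolded sdiff_def, THEN morph_smap] g[unfolded sdiff_def, THEN morph_smap]]) simp
  have "v = 0" if q: "q \<in> U" "f q \<in> V" and 0: "frechet_derivative (\<lambda>x. g (f x)) (at q) v = 0" for q v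
  proof (rule ccontr)
    assume v: "v \<noteq> 0"
    have "frechet_derivative f (at q) v \<noteq> 0" using L0.dr_nz[OF f, of q v] q v by simp
    then have "frechet_derivative g (at (f q)) (frechet_derivative f (at q) v) \<noteq> 0"
      using L0.dr_nz[OF g, of "f q"] q by simp
    moreover have "frechet_derivative (\<lambda>x. g (f x)) (at q) v = frechet_derivative g (at (f q)) (frechet_derivative f (at q) v)"
      using L0.dr_comp(1)[OF f g, of q v] q by simp
    ultimately show False using 0 by simp
  qed
  then show ?thesis using sm unfolding sdiff_def morph_def by auto
qed

text \<open>A set of representatives with a margin: they are reached by polynomial automorphisms,
  but kept apart by every smooth map with injective differentials. The local diffeomorphisms lie
  between these two classes of maps, so N counts their orbits.\<close>

definition cls :: "(real^'n) set \<Rightarrow> (real^'n \<Rightarrow> real^3) \<Rightarrow> ((real^3 \<Rightarrow> real^3) \<Rightarrow> real^'n \<Rightarrow> real^'n) \<Rightarrow> (real^'n) set \<Rightarrow> bool" where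
  "cls Z \<pi> lift N \<longleftrightarrow> finite N \<and> N \<subseteq> Z \<and> (\<forall>p\<in>Z. \<exists>n\<in>N. \<exists>\<Phi>. polyaut \<Phi> \<and> lift \<Phi> p = n) \<and>
     (\<forall>n\<in>N. \<forall>n'\<in>N. \<forall>U \<Phi>. sdiff U \<Phi> \<and> \<pi> n \<in> U \<and> lift \<Phi> n = n' \<longrightarrow> n = n')"

text \<open>The analogue for the lines in \<Delta> m under the stabilizer of m. The factor c
  expresses that only the line matters; it is nonzero automatically, since differentials are
  injective on \<Delta>.\<close>

definition node :: "(real^'n) set \<Rightarrow> (real^'n \<Rightarrow> (real^'n) set) \<Rightarrow> (real^'n \<Rightarrow> real^3) \<Rightarrow>
    ((real^3 \<Rightarrow> real^3) \<Rightarrow> real^'n \<Rightarrow> real^'n) \<Rightarrow> real^'n \<Rightarrow> (real^'n) set \<Rightarrow> bool" where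
  "node Z \<Delta> \<pi> lift m J \<longleftrightarrow> finite J \<and> (\<forall>v\<in>J. v \<in> \<Delta> m \<and> v \<noteq> 0) \<and>
     (\<forall>v\<in>\<Delta> m. v \<noteq> 0 \<longrightarrow> (\<exists>w\<in>J. \<exists>\<Phi> c. polyaut \<Phi> \<and> lift \<Phi> m = m \<and> dr Z (lift \<Phi>) m v = c *\<^sub>R w)) \<and>
     (\<forall>v\<in>J. \<forall>w\<in>J. \<forall>U \<Phi> c. sdiff U \<Phi> \<and> \<pi> m \<in> U \<and> lift \<Phi> m = m \<and> dr Z (lift \<Phi>) m v = c *\<^sub>R w \<longrightarrow> v = w)"

context level begin

text \<open>A line over p is first carried over the representative m of p and then moved inside
  \<Delta> m by the stabilizer of m. Conversely, a map joining two of the new points joins their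
  base points; these agree, so the map lies in a stabilizer.\<close>

lemma step:
  assumes N: "cls Z \<pi> lift N" and J: "\<And>m. m \<in> N \<Longrightarrow> node Z \<Delta> \<pi> lift m (J m)"
  shows "cls (prol_space Z \<Delta>) (\<pi> \<circ> base_pt) (\<lambda>\<Phi>. prol_map Z (lift \<Phi>)) (\<Union>m\<in>N. le m ` J m)"
    and "card (\<Union>m\<in>N. le m ` J m) = (\<Sum>m\<in>N. card (J m))"
proof -
  interpret P: level "prol_space Z \<Delta>" "prol_dist Z \<Delta>" "\<pi> \<circ> base_pt" "\<lambda>\<Phi>. prol_map Z (lift \<Phi>)" by (rule prolong)
  have NZ: "m \<in> Z" if "m \<in> N" for m using N that by (auto simp: cls_def)
  have Jm: "v \<in> \<Delta> m" "v \<noteq> 0" if "m \<in> N" "v \<in> J m" for m v using J[OF that(1)] that(2) by (auto simp: node_def)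
  have fin: "finite N" "finite (J m)" if "m \<in> N" for m using N J[OF that] by (auto simp: cls_def node_def)
  have finN: "finite N" using N by (simp add: cls_def)
  have distN: "n = n'" if "n \<in> N" "n' \<in> N" "sdiff U \<Phi>" "\<pi> n \<in> U" "lift \<Phi> n = n'" for n n' U \<Phi>
    using N that unfolding cls_def by blast
  have distJ: "v = w" if "m \<in> N" "v \<in> J m" "w \<in> J m" "sdiff U \<Phi>" "\<pi> m \<in> U" "lift \<Phi> m = m" "dr Z (lift \<Phi>) m v = c *\<^sub>R w"
    for m v w U \<Phi> c using J[OF that(1)] that(2-) unfolding node_def by blast
  have dist: "m = m' \<and> v = w"
    if m: "m \<in> N" "m' \<in> N" and v: "v \<in> J m" "w \<in> J m'" and \<Phi>: "sdiff U \<Phi>" "\<pi> m \<in> U"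
      and e: "prol_map Z (lift \<Phi>) (le m v) = le m' w" for m m' v w U \<Phi>
  proof -
    have "le (lift \<Phi> m) (dr Z (lift \<Phi>) m v) = le m' w"
      using e prol_map_lift[OF \<Phi>(1) NZ[OF m(1)] \<Phi>(2) Jm[OF m(1) v(1)]] by simp
    then obtain c where c: "lift \<Phi> m = m'" "dr Z (lift \<Phi>) m v = c *\<^sub>R w"
      by (rule le_eqD[OF _ dr_nz[OF \<Phi>(1) NZ[OF m(1)] \<Phi>(2) Jm[OF m(1) v(1)]] Jm(2)[OF m(2) v(2)]])
    then have mm: "m = m'" using distN[OF m \<Phi>] by simp
    then show ?thesis using distJ[OF m(1) v(1) _ \<Phi>, of w c] c v by simp
  qed
  show "cls (prol_space Z \<Delta>) (\<pi> \<circ> base_pt) (\<lambda>\<Phi>. prol_map Z (lift \<Phi>)) (\<Union>m\<in>N. le m ` J m)"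
    unfolding cls_def
  proof (intro conjI)
    show "finite (\<Union>m\<in>N. le m ` J m)" using finN fin by auto
    show "(\<Union>m\<in>N. le m ` J m) \<subseteq> prol_space Z \<Delta>" using le_mem_prol[OF reg] NZ Jm by blast
    show "\<forall>n\<in>\<Union>m\<in>N. le m ` J m. \<forall>n'\<in>\<Union>m\<in>N. le m ` J m. \<forall>U \<Phi>.
       sdiff U \<Phi> \<and> (\<pi> \<circ> base_pt) n \<in> U \<and> prol_map Z (lift \<Phi>) n = n' \<longrightarrow> n = n'"
    proof (intro ballI allI impI)
      fix n n' U \<Phi> assume "n \<in> (\<Union>m\<in>N. le m ` J m)" "n' \<in> (\<Union>m\<in>N. le m ` J m)"
        and a: "sdiff U \<Phi> \<and> (\<pi> \<circ> base_pt) n \<in> U \<and> prol_map Z (lift \<Phi>) n = n'"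
      then obtain m v m' w where *: "m \<in> N" "v \<in> J m" "n = le m v" "m' \<in> N" "w \<in> J m'" "n' = le m' w" by blast
      then show "n = n'" using dist[of m m' v w U \<Phi>] a by simp
    qed
    show "\<forall>p\<in>prol_space Z \<Delta>. \<exists>n\<in>\<Union>m\<in>N. le m ` J m. \<exists>\<Phi>. polyaut \<Phi> \<and> prol_map Z (lift \<Phi>) p = n"
    proof
      fix P assume P: "P \<in> prol_space Z \<Delta>"
      then obtain p u where p: "p \<in> Z" "u \<in> \<Delta> p" "u \<noteq> 0" "P = le p u" using prol_space_iff[OF reg] by blast
      obtain m \<Phi> where m: "m \<in> N" "polyaut \<Phi>" "lift \<Phi> p = m" using N p(1) unfolding cls_def by blast
      note s\<Phi> = polyaut_sdiff[OF m(2)]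
      define u' where "u' = dr Z (lift \<Phi>) p u"
      have u': "u' \<in> \<Delta> m" "u' \<noteq> 0"
        using dr_mem[OF s\<Phi> p(1) _ p(2)] dr_nz[OF s\<Phi> p(1) _ p(2,3)] by (auto simp: u'_def m(3))
      obtain w \<Psi> c where w: "w \<in> J m" "polyaut \<Psi>" "lift \<Psi> m = m" "dr Z (lift \<Psi>) m u' = c *\<^sub>R w"
        using J[OF m(1)] u' unfolding node_def by blast
      note s\<Psi> = polyaut_sdiff[OF w(2)]
      have "c \<noteq> 0" using dr_nz[OF s\<Psi> NZ[OF m(1)] _ u'] w(4) by auto
      have "prol_map Z (lift (\<lambda>x. \<Psi> (\<Phi> x))) P = prol_map Z (lift \<Psi>) (prol_map Z (lift \<Phi>) P)"
        by (rule P.comp[OF s\<Phi> s\<Psi> P]) auto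
      also have "prol_map Z (lift \<Phi>) P = le m u'"
        unfolding p(4) using prol_map_lift[OF s\<Phi> p(1) _ p(2,3)] by (simp add: m(3) u'_def)
      also have "prol_map Z (lift \<Psi>) (le m u') = le m w"
        using prol_map_lift[OF s\<Psi> NZ[OF m(1)] _ u'] w \<open>c \<noteq> 0\<close> by simp
      finally show "\<exists>n\<in>\<Union>m\<in>N. le m ` J m. \<exists>\<Phi>. polyaut \<Phi> \<and> prol_map Z (lift \<Phi>) P = n"
        using polyaut_comp[OF m(2) w(2)] m(1) w(1) by blast
    qed
  qed
  have inj: "inj_on (\<lambda>(m, v). le m v) (Sigma N J)"
  proof (rule inj_onI, clarify)
    fix m v m' w assume a: "m \<in> N" "v \<in> J m" "m' \<in> N" "w \<in> J m'" "le m v = le m' w"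
    have "prol_map Z (lift (\<lambda>x. x)) (le m v) = le m' w"
      using P.ident[OF le_mem_prol[OF reg NZ[OF a(1)] Jm[OF a(1,2)]]] a(5) by simp
    then show "m = m' \<and> v = w" by (intro dist[OF a(1,3,2,4) sdiff_id]) auto
  qed
  have "(\<Union>m\<in>N. le m ` J m) = (\<lambda>(m, v). le m v) ` Sigma N J" by force
  then show "card (\<Union>m\<in>N. le m ` J m) = (\<Sum>m\<in>N. card (J m))"
    using card_image[OF inj] card_SigmaI[OF finN, of J] fin(2) by simp
qed

text \<open>The relation in \<open>orbits\<close> is identified with equality of the normal forms
  \<open>nf\<close>; hence it is an equivalence, and its classes correspond to the elements of
  N.\<close>

lemma card_orbits:
  assumes N: "cls Z \<pi> lift N" shows "card (orbits Z \<pi> lift) = card N"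
proof -
  have NZ: "N \<subseteq> Z" using N by (simp add: cls_def)
  have distN: "n = n'" if "n \<in> N" "n' \<in> N" "sdiff U \<Phi>" "\<pi> n \<in> U" "lift \<Phi> n = n'" for n n' U \<Phi>
    using N that unfolding cls_def by blast
  have "\<forall>p\<in>Z. \<exists>n. n \<in> N \<and> (\<exists>\<Phi>. polyaut \<Phi> \<and> lift \<Phi> p = n)" using N unfolding cls_def by blast
  then obtain nf where nf0: "\<forall>p\<in>Z. nf p \<in> N \<and> (\<exists>\<Phi>. polyaut \<Phi> \<and> lift \<Phi> p = nf p)"
    by (rule bchoice[THEN exE])
  then have nfN: "nf p \<in> N" if "p \<in> Z" for p using that by blast
  have backw: "\<exists>\<Psi>. polyaut \<Psi> \<and> lift \<Psi> (lift \<Phi> p) = p" if \<Phi>: "polyaut \<Phi>" and p: "p \<in> Z" for \<Phi> p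
  proof -
    obtain \<Psi> where \<Psi>: "polyaut \<Psi>" "\<And>x. \<Psi> (\<Phi> x) = x" using polyaut_inv[OF \<Phi>] by blast
    have "lift (\<lambda>x. \<Psi> (\<Phi> x)) p = lift \<Psi> (lift \<Phi> p)"
      by (rule comp[OF polyaut_sdiff[OF \<Phi>] polyaut_sdiff[OF \<Psi>(1)] p]) auto
    then show ?thesis using \<Psi> ident[OF p] by auto
  qed
  \<comment> \<open>Going from \<open>nf p\<close> back to p, along \<Phi> to q and on to
    \<open>nf q\<close> is a smooth map between representatives, so these coincide. The only map
    inverted on the way is the polynomial one from p to \<open>nf p\<close>.\<close>
  have invar: "nf p = nf q" if p: "p \<in> Z" and U: "sdiff U \<Phi>" "\<pi> p \<in> U" and q: "lift \<Phi> p = q" for p q U \<Phi>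
  proof -
    have qZ: "q \<in> Z" using lift_mem[OF U(1) p U(2)] q by simp
    obtain A where A: "polyaut A" "lift A p = nf p" using nf0 p by blast
    obtain A' where A': "polyaut A'" "lift A' (nf p) = p" using backw[OF A(1) p] A(2) by auto
    obtain B where B: "polyaut B" "lift B q = nf q" using nf0 qZ by blast
    have pA: "\<pi> p = A' (\<pi> (nf p))" using proj[OF polyaut_sdiff[OF A'(1)], of "nf p"] A'(2) NZ nfN[OF p] by auto
    have s1: "sdiff {x\<in>UNIV. A' x \<in> U} (\<lambda>x. \<Phi> (A' x))"
      by (rule sdiff_comp[OF polyaut_sdiff[OF A'(1)] U(1)])
    have s2: "sdiff {x\<in>{x\<in>UNIV. A' x \<in> U}. \<Phi> (A' x) \<in> UNIV} (\<lambda>x. B (\<Phi> (A' x)))"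
      by (rule sdiff_comp[OF s1 polyaut_sdiff[OF B(1)]])
    have nZ: "nf p \<in> Z" "\<pi> (nf p) \<in> {x\<in>UNIV. A' x \<in> U}" using NZ nfN[OF p] U(2) pA by auto
    have "lift (\<lambda>x. B (\<Phi> (A' x))) (nf p) = lift B (lift (\<lambda>x. \<Phi> (A' x)) (nf p))"
      by (rule comp[OF s1 polyaut_sdiff[OF B(1)] nZ]) simp
    also have "lift (\<lambda>x. \<Phi> (A' x)) (nf p) = lift \<Phi> (lift A' (nf p))"
      by (rule comp[OF polyaut_sdiff[OF A'(1)] U(1) nZ(1)]) (use nZ in auto)
    finally have "lift (\<lambda>x. B (\<Phi> (A' x))) (nf p) = nf q" using A'(2) q B(2) by simp
    then show ?thesis by (intro distN[OF nfN[OF p] nfN[OF qZ] s2]) (use nZ in auto)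
  qed
  have nfn: "nf n = n" if "n \<in> N" for n
  proof -
    have nZ: "n \<in> Z" using NZ that by blast
    obtain A where A: "polyaut A" "lift A n = nf n" using nf0[rule_format, OF nZ] by blast
    have "n = nf n" by (rule distN[OF that nfN[OF nZ] polyaut_sdiff[OF A(1)] UNIV_I A(2)])
    then show ?thesis by (rule sym)
  qed
  have conv: "\<exists>U \<Phi>. local_diffeo U \<Phi> \<and> \<pi> p \<in> U \<and> lift \<Phi> p = q" if pq: "p \<in> Z" "q \<in> Z" "nf p = nf q" for p q
  proof -
    obtain A where A: "polyaut A" "lift A p = nf p" using nf0 pq(1) by blast
    obtain B where B: "polyaut B" "lift B q = nf q" using nf0 pq(2) by blast
    obtain B' where B': "polyaut B'" "lift B' (nf q) = q" using backw[OF B(1) pq(2)] B(2) by auto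
    have "lift (\<lambda>x. B' (A x)) p = lift B' (lift A p)"
      by (rule comp[OF polyaut_sdiff[OF A(1)] polyaut_sdiff[OF B'(1)] pq(1)]) auto
    then have "lift (\<lambda>x. B' (A x)) p = q" using A B' pq(3) by simp
    then show ?thesis using polyaut_local_diffeo[OF polyaut_comp[OF A(1) B'(1)]] by blast
  qed
  define R where "R = {(p, q). p \<in> Z \<and> q \<in> Z \<and> (\<exists>U \<Phi>. local_diffeo U \<Phi> \<and> \<pi> p \<in> U \<and> lift \<Phi> p = q)}"
  have R: "R = {(p, q). p \<in> Z \<and> q \<in> Z \<and> nf p = nf q}"
    unfolding R_def using invar[OF _ local_diffeo_sdiff] conv by blast
  have "orbits Z \<pi> lift = (\<lambda>n. {q\<in>Z. nf q = n}) ` N"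
  proof -
    have "R `` {p} = {q\<in>Z. nf q = nf p}" if "p \<in> Z" for p using that by (auto simp: R)
    then have "orbits Z \<pi> lift = (\<lambda>p. {q\<in>Z. nf q = nf p}) ` Z"
      unfolding orbits_def R_def[symmetric] quotient_def by auto
    also have "\<dots> = (\<lambda>n. {q\<in>Z. nf q = n}) ` (nf ` Z)" by (simp add: image_image)
    also have "nf ` Z = N"
    proof (intro subset_antisym subsetI)
      fix n assume n: "n \<in> N"
      then have "nf n \<in> nf ` Z" using NZ by blast
      then show "n \<in> nf ` Z" by (simp only: nfn[OF n])
    qed (use nfN in blast)
    finally show ?thesis .
  qed
  moreover have "inj_on (\<lambda>n. {q\<in>Z. nf q = n}) N"
  proof (rule inj_onI)
    fix n n' assume n: "n \<in> N" "n' \<in> N" and eq: "{q \<in> Z. nf q = n} = {q \<in> Z. nf q = n'}"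
    have "n \<in> {q \<in> Z. nf q = n}" using NZ n(1) nfn[OF n(1)] by blast
    then have "nf n = n'" unfolding eq by simp
    then show "n = n'" by (simp only: nfn[OF n(1)])
  qed
  ultimately show ?thesis by (simp add: card_image)
qed

end

subsection \<open>Prolongation of integral curves\<close>

text \<open>The velocity field is a separate argument: it must never vanish, so that the line
  element is defined, and its derivative enters the velocity of the prolonged curve.\<close>

definition icurve :: "(real^'n) set \<Rightarrow> (real^'n \<Rightarrow> (real^'n) set) \<Rightarrow> real set \<Rightarrow> (real \<Rightarrow> real^'n) \<Rightarrow> (real \<Rightarrow> real^'n) \<Rightarrow> bool" where
  "icurve Z \<Delta> S g g' \<longleftrightarrow> open S \<and> 0 \<in> S \<and> smooth S g' \<and>
     (\<forall>t\<in>S. g t \<in> Z \<and> g' t \<in> \<Delta> (g t) \<and> g' t \<noteq> 0 \<and> (g has_vector_derivative g' t) (at t))"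

definition lc :: "(real \<Rightarrow> real^'n) \<Rightarrow> (real \<Rightarrow> real^'n) \<Rightarrow> real \<Rightarrow> real^('n prol)" where
  "lc g g' t = le (g t) (g' t)"

text \<open>The velocity of \<open>lc g g'\<close>. The curve g itself does not occur, because the
  base point of a line element contributes only its velocity g'.\<close>

definition ld :: "(real \<Rightarrow> real^'n) \<Rightarrow> real \<Rightarrow> real^('n prol)" where
  "ld g' t = emb (g' t) + vert (g' t) (vector_derivative g' (at t))"

lemma base_pt_lc [simp]: "base_pt (lc g g' t) = g t" by (simp add: lc_def)
lemma base_pt_ld [simp]: "base_pt (ld g' t) = g' t" by (simp add: ld_def)

lemma has_vector_derivative_shift:
  "(g has_vector_derivative v) (at t) \<Longrightarrow> ((\<lambda>s. g (t + s)) has_vector_derivative v) (at 0)"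
proof -
  have "((\<lambda>s. t + s) has_vector_derivative 1) (at 0)"
    using has_vector_derivative_add[OF has_vector_derivative_const has_vector_derivative_id] by simp
  then show "(g has_vector_derivative v) (at t) \<Longrightarrow> ((\<lambda>s. g (t + s)) has_vector_derivative v) (at 0)"
    using vector_diff_chain_at[of "\<lambda>s. t + s" 1 0 g v] by (simp add: o_def)
qed

lemma eventually_shift: "open S \<Longrightarrow> t \<in> S \<Longrightarrow> \<forall>\<^sub>F s in nhds 0. t + s \<in> (S :: real set)"
  by (rule curve_eventually_in[of "\<lambda>s. t + s" 1]) (auto intro!: derivative_eq_intros)

lemma smooth_hvd: "smooth S g \<Longrightarrow> open S \<Longrightarrow> t \<in> S \<Longrightarrow> (g has_vector_derivative vector_derivative g (at t)) (at t)"
  by (erule (1) smooth_vector_derivative) (metis vector_derivative_at)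

lemma smooth_vd: assumes "smooth S g" "open S" shows "smooth S (\<lambda>t. vector_derivative g (at t))"
proof -
  obtain g' where g': "smooth S g'" "\<And>t. t \<in> S \<Longrightarrow> (g has_vector_derivative g' t) (at t)"
    using smooth_vector_derivative[OF assms] by metis
  show ?thesis by (rule smooth_cong[OF assms(2) _ g'(1)]) (use g'(2) vector_derivative_at in fastforce)
qed

lemma lc_hvd:
  assumes "smooth S g'" "open S" "t \<in> S" "(g has_vector_derivative g' t) (at t)" "g' t \<noteq> 0"
  shows "(lc g g' has_vector_derivative ld g' t) (at t)"
  unfolding lc_def[abs_def] ld_def using le_has_vector_derivative[OF assms(4) smooth_hvd[OF assms(1-3)] assms(5)] .

lemma prol_dist_curve:
  assumes "open S" "t \<in> S" "\<And>s. s \<in> S \<Longrightarrow> G s \<in> prol_space Z \<Delta>" "(G has_vector_derivative w) (at t)"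
    "base_pt w \<in> line_of (G t)"
  shows "w \<in> prol_dist Z \<Delta> (G t)"
  by (rule prol_distI[OF _ _ has_vector_derivative_shift[OF assms(4)]])
    (use assms eventually_mono[OF eventually_shift[OF assms(1,2)]] in auto)

lemma smooth_ld [smooth_intros]:
  "smooth S g' \<Longrightarrow> open S \<Longrightarrow> (\<And>t. t \<in> S \<Longrightarrow> g' t \<noteq> 0) \<Longrightarrow> smooth S (ld g')"
  unfolding ld_def[abs_def] by (intro smooth_intros smooth_vd)

lemma icurve_lift:
  assumes reg: "regular Z \<Delta>" and g: "icurve Z \<Delta> S g g'"
  shows "icurve (prol_space Z \<Delta>) (prol_dist Z \<Delta>) S (lc g g') (ld g')"
  unfolding icurve_def
proof (intro conjI ballI)
  have S: "open S" "smooth S g'" and g': "\<And>t. t \<in> S \<Longrightarrow> g t \<in> Z" "\<And>t. t \<in> S \<Longrightarrow> g' t \<in> \<Delta> (g t)" "\<And>t. t \<in> S \<Longrightarrow> g' t \<noteq> 0"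
    "\<And>t. t \<in> S \<Longrightarrow> (g has_vector_derivative g' t) (at t)"
    using g unfolding icurve_def by blast+
  show "open S" "0 \<in> S" using g unfolding icurve_def by blast+
  show "smooth S (ld g')" by (intro smooth_ld S g')
  fix t assume t: "t \<in> S"
  show m: "lc g g' t \<in> prol_space Z \<Delta>" if "t \<in> S" for t unfolding lc_def by (rule le_mem_prol[OF reg]) (use g' that in auto)
  show h: "(lc g g' has_vector_derivative ld g' t) (at t)" by (rule lc_hvd[OF S(2,1) t g'(4)[OF t] g'(3)[OF t]])
  show "ld g' t \<noteq> 0" using base_pt_ld[of g' t] g'(3)[OF t] by (metis base_pt_simps(4))
  show "ld g' t \<in> prol_dist Z \<Delta> (lc g g' t)"
    by (rule prol_dist_curve[OF S(1) t m h]) (auto simp: lc_def line_of_le[OF g'(3)[OF t]] intro: span_base)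
qed

lemma curve_morph:
  assumes f: "morph Z \<Delta> Sf f" and S: "open S" "t \<in> S"
    and g: "\<And>s. s \<in> S \<Longrightarrow> g s \<in> Z" "g t \<in> Sf" "(g has_vector_derivative v) (at t)"
    and h: "\<And>s. s \<in> S \<Longrightarrow> f (g s) = h s" "(h has_vector_derivative w) (at t)"
  shows "dr Z f (g t) v = w"
proof -
  have "dr Z f (g (t + 0)) v = w"
    by (rule smap_dr_eq[OF morph_smap[OF f], where c = "\<lambda>s. g (t + s)" and d = "\<lambda>s. h (t + s)"])
      (use assms has_vector_derivative_shift eventually_mono[OF eventually_shift[OF S]] in auto)
  then show ?thesis by simp
qed

lemma curve_morph_prol:
  assumes f: "morph Z \<Delta> Sf f" and g: "icurve Z \<Delta> S g g'" and t: "t \<in> S" and gS: "g t \<in> Sf"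
    and h: "\<And>s. s \<in> S \<Longrightarrow> f (g s) = h s" "(h has_vector_derivative w) (at t)"
  shows "dr Z f (g t) (g' t) = w" "prol_map Z f (lc g g' t) = le (h t) w"
proof -
  have S: "open S" and g': "\<And>t. t \<in> S \<Longrightarrow> g t \<in> Z" "\<And>t. t \<in> S \<Longrightarrow> g' t \<in> \<Delta> (g t)" "\<And>t. t \<in> S \<Longrightarrow> g' t \<noteq> 0"
    "\<And>t. t \<in> S \<Longrightarrow> (g has_vector_derivative g' t) (at t)"
    using g unfolding icurve_def by blast+
  show d: "dr Z f (g t) (g' t) = w" by (rule curve_morph[OF f S t g'(1) gS g'(4)[OF t] h])
  show "prol_map Z f (lc g g' t) = le (h t) w"
    unfolding lc_def using prol_map_le[OF f gS g'(2,3)[OF t]] d h(1)[OF t] by simp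
qed

text \<open>A line element does not depend on the speed, so a curve that f maps to itself with a new
  parameter prolongs to a curve with the same property and the same \<tau>.\<close>

lemma reparam:
  assumes f: "morph Z \<Delta> Sf f" and g: "icurve Z \<Delta> UNIV g g'" and S: "open S" "t \<in> S"
    and gS: "\<And>s. s \<in> S \<Longrightarrow> g s \<in> Sf" and fg: "\<And>s. s \<in> S \<Longrightarrow> f (g s) = g (\<tau> s)"
    and \<tau>: "(\<tau> has_real_derivative \<tau>') (at t)" "\<tau>' \<noteq> 0"
  shows "dr Z f (g t) (g' t) = \<tau>' *\<^sub>R g' (\<tau> t)" "prol_map Z f (lc g g' t) = lc g g' (\<tau> t)"
proof -
  have g': "g t \<in> Z" "g' t \<in> \<Delta> (g t)" "g' t \<noteq> 0" "(g has_vector_derivative g' t) (at t)" for t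
    using g unfolding icurve_def by blast+
  have "((\<lambda>s. g (\<tau> s)) has_vector_derivative \<tau>' *\<^sub>R g' (\<tau> t)) (at t)"
    using vector_diff_chain_at[OF \<tau>(1)[unfolded has_real_derivative_iff_has_vector_derivative] g'(4)] by (simp add: o_def)
  from curve_morph[OF f S g'(1) gS[OF S(2)] g'(4) fg this]
  show d: "dr Z f (g t) (g' t) = \<tau>' *\<^sub>R g' (\<tau> t)" .
  show "prol_map Z f (lc g g' t) = lc g g' (\<tau> t)"
    unfolding lc_def using prol_map_le[OF f gS[OF S(2)] g'(2,3)] d fg[OF S(2)] \<tau>(2) by simp
qed

subsection \<open>Curves that agree to a given order\<close>

text \<open>Congruence modulo t^m among smooth functions; the quotient is required to be smooth so
  that congruences can be multiplied and inverted.\<close>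

definition eqm :: "real set \<Rightarrow> nat \<Rightarrow> (real \<Rightarrow> 'a::real_normed_vector) \<Rightarrow> (real \<Rightarrow> 'a) \<Rightarrow> bool" where
  "eqm S m f g \<longleftrightarrow> smooth S f \<and> smooth S g \<and> (\<exists>h. smooth S h \<and> (\<forall>t\<in>S. f t = g t + t ^ m *\<^sub>R h t))"

lemma eqm_refl: "smooth S f \<Longrightarrow> eqm S m f f"
  unfolding eqm_def by (auto intro!: exI[of _ "\<lambda>_. 0"] smooth_const)

lemma eqm_add:
  assumes "eqm S m f f'" "eqm S m g g'" shows "eqm S m (\<lambda>t. f t + g t) (\<lambda>t. f' t + g' t)"
proof -
  obtain h k where "smooth S h" "\<forall>t\<in>S. f t = f' t + t ^ m *\<^sub>R h t" "smooth S k" "\<forall>t\<in>S. g t = g' t + t ^ m *\<^sub>R k t"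
    using assms unfolding eqm_def by blast
  then show ?thesis using assms unfolding eqm_def
    by (intro conjI exI[of _ "\<lambda>t. h t + k t"]) (auto intro!: smooth_intros simp: algebra_simps)
qed

lemma eqm_bilinear:
  assumes p: "bounded_bilinear p" and "eqm S m f f'" "eqm S m g g'"
  shows "eqm S m (\<lambda>t. p (f t) (g t)) (\<lambda>t. p (f' t) (g' t))"
proof -
  obtain h k where h: "smooth S h" "\<forall>t\<in>S. f t = f' t + t ^ m *\<^sub>R h t" and k: "smooth S k" "\<forall>t\<in>S. g t = g' t + t ^ m *\<^sub>R k t"
    using assms unfolding eqm_def by blast
  have sm: "smooth S f" "smooth S f'" "smooth S g" "smooth S g'" using assms unfolding eqm_def by auto
  have "p (f t) (g t) = p (f' t) (g' t) + t ^ m *\<^sub>R (p (h t) (g t) + p (f' t) (k t))" if "t \<in> S" for t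
    using h(2) k(2) that
    by (simp add: bounded_bilinear.add_left[OF p] bounded_bilinear.add_right[OF p]
        bounded_bilinear.scaleR_left[OF p] bounded_bilinear.scaleR_right[OF p] algebra_simps)
  then show ?thesis unfolding eqm_def
    by (intro conjI exI[of _ "\<lambda>t. p (h t) (g t) + p (f' t) (k t)"] smooth_bilinear[OF p] sm smooth_add h(1) k(1)) blast
qed

lemma eqm_inverse:
  fixes f f' :: "real \<Rightarrow> real"
  assumes "eqm S m f f'" "open S" "\<And>t. t \<in> S \<Longrightarrow> f t \<noteq> 0" "\<And>t. t \<in> S \<Longrightarrow> f' t \<noteq> 0"
  shows "eqm S m (\<lambda>t. 1 / f t) (\<lambda>t. 1 / f' t)"
proof -
  obtain h where h: "smooth S h" "\<forall>t\<in>S. f t = f' t + t ^ m *\<^sub>R h t" using assms(1) unfolding eqm_def by blast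
  have sm: "smooth S f" "smooth S f'" using assms(1) unfolding eqm_def by auto
  have "1 / f t = 1 / f' t + t ^ m *\<^sub>R (- h t / (f t * f' t))" if "t \<in> S" for t
  proof -
    have e: "t ^ m * h t = f t - f' t" using h(2) that by simp
    have "t ^ m *\<^sub>R (- h t / (f t * f' t)) = - (t ^ m * h t) / (f t * f' t)" by simp
    then show ?thesis unfolding e using assms(3,4)[OF that] by (simp add: diff_divide_distrib)
  qed
  moreover have "smooth S (\<lambda>t. - h t / (f t * f' t))"
    by (intro smooth_divide smooth_minus smooth_mult h sm assms(2)) (use assms in simp)
  moreover have "smooth S (\<lambda>t. 1 / f t)" "smooth S (\<lambda>t. 1 / f' t)"
    by (intro smooth_divide smooth_const sm assms; simp add: assms)+
  ultimately show ?thesis unfolding eqm_def by blast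
qed

text \<open>\<open>vert\<close> is a rational expression in u whose denominators are powers of u .
  u, so congruences pass through it.\<close>

lemma eqm_vert:
  assumes S: "open S" and u: "eqm S m u u'" and v: "smooth S v"
    and nz: "\<And>t. t \<in> S \<Longrightarrow> u t \<noteq> 0" "\<And>t. t \<in> S \<Longrightarrow> u' t \<noteq> 0"
  shows "eqm S m (\<lambda>t. vert (u t) (v t)) (\<lambda>t. vert (u' t) (v t))"
proof -
  note vv = eqm_refl[OF v, of m]
  have i: "eqm S m (\<lambda>t. 1 / (u t \<bullet> u t)) (\<lambda>t. 1 / (u' t \<bullet> u' t))"
    by (intro eqm_inverse eqm_bilinear[OF bounded_bilinear_inner] u S) (use nz in auto)
  have c: "eqm S m (\<lambda>t. (- 2 * (u t \<bullet> v t)) * (1 / (u t \<bullet> u t) * (1 / (u t \<bullet> u t))))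
     (\<lambda>t. (- 2 * (u' t \<bullet> v t)) * (1 / (u' t \<bullet> u' t) * (1 / (u' t \<bullet> u' t))))"
    by (intro eqm_bilinear[OF bounded_bilinear_mult] eqm_bilinear[OF bounded_bilinear_inner] eqm_refl[OF smooth_const] u vv i)
  have "eqm S m (\<lambda>t. (1 / (u t \<bullet> u t)) *\<^sub>R (tens (u t) (v t) + tens (v t) (u t)) +
      ((- 2 * (u t \<bullet> v t)) * (1 / (u t \<bullet> u t) * (1 / (u t \<bullet> u t)))) *\<^sub>R tens (u t) (u t))
     (\<lambda>t. (1 / (u' t \<bullet> u' t)) *\<^sub>R (tens (u' t) (v t) + tens (v t) (u' t)) +
      ((- 2 * (u' t \<bullet> v t)) * (1 / (u' t \<bullet> u' t) * (1 / (u' t \<bullet> u' t)))) *\<^sub>R tens (u' t) (u' t))"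
    by (intro eqm_add eqm_bilinear[OF bounded_bilinear_scaleR] eqm_bilinear[OF bounded_bilinear_tens] i c u vv)
  then show ?thesis by (simp add: vert_def power2_eq_square)
qed

text \<open>If two curves of line elements agree up to the indicated orders, then so do their velocities,
  and the leading coefficient of the difference is found by applying \<open>vert\<close>.\<close>
lemma pert:
  assumes S: "open S" "0 \<in> S" and sm: "smooth S u" "smooth S w" "smooth S h" "smooth S k"
    and nz: "\<And>t. t \<in> S \<Longrightarrow> u t \<noteq> 0" "\<And>t. t \<in> S \<Longrightarrow> w t \<noteq> 0"
    and w: "\<And>t. t \<in> S \<Longrightarrow> w t = u t + t ^ Suc m *\<^sub>R h t"
    and q: "\<And>t. t \<in> S \<Longrightarrow> q' t = p' t + t ^ m *\<^sub>R k t"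
  shows "\<exists>H. smooth S H \<and> H 0 = emb (k 0) + real (Suc m) *\<^sub>R vert (u 0) (h 0) \<and>
    (\<forall>t\<in>S. emb (q' t) + vert (w t) (vector_derivative w (at t)) =
       emb (p' t) + vert (u t) (vector_derivative u (at t)) + t ^ m *\<^sub>R H t)"
proof -
  define u' where "u' t = vector_derivative u (at t)" for t
  define h' where "h' t = vector_derivative h (at t)" for t
  have sm': "smooth S u'" "smooth S h'" unfolding u'_def h'_def by (intro smooth_vd sm S)+
  have w': "vector_derivative w (at t) = u' t + t ^ m *\<^sub>R (real (Suc m) *\<^sub>R h t + t *\<^sub>R h' t)" if t: "t \<in> S" for t
  proof (rule vector_derivative_at)
    have "((\<lambda>t. t ^ Suc m) has_real_derivative (real (Suc m) * t ^ m)) (at t)"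
      by (rule derivative_eq_intros refl | simp)+
    from has_vector_derivative_add[OF smooth_hvd[OF sm(1) S(1) t] has_vector_derivative_scaleR[OF this smooth_hvd[OF sm(3) S(1) t]]]
    have "((\<lambda>t. u t + t ^ Suc m *\<^sub>R h t) has_vector_derivative (u' t + t ^ m *\<^sub>R (real (Suc m) *\<^sub>R h t + t *\<^sub>R h' t))) (at t)"
      by (rule has_vector_derivative_eq_rhs) (simp add: u'_def h'_def algebra_simps)
    then show "(w has_vector_derivative (u' t + t ^ m *\<^sub>R (real (Suc m) *\<^sub>R h t + t *\<^sub>R h' t))) (at t)"
      by (rule has_vector_derivative_transform_within_open[OF _ S(1) t]) (simp add: w)
  qed
  have "eqm S (Suc m) w u" unfolding eqm_def using sm w by blast
  from eqm_vert[OF S(1) this sm'(1) nz(2,1)]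
  obtain K where K: "smooth S K" "\<And>t. t \<in> S \<Longrightarrow> vert (w t) (u' t) = vert (u t) (u' t) + t ^ Suc m *\<^sub>R K t"
    unfolding eqm_def by blast
  \<comment> \<open>Replacing w by u inside \<open>vert\<close> makes an error of order t^(m+1)
    only, so the \<open>K\<close> term carries an extra t and vanishes at 0.\<close>
  define H where "H t = emb (k t) + vert (w t) (real (Suc m) *\<^sub>R h t + t *\<^sub>R h' t) + t *\<^sub>R K t" for t
  have "smooth S H" unfolding H_def by (intro smooth_intros sm sm' K S(1)) (use nz in auto)
  moreover have "H 0 = emb (k 0) + real (Suc m) *\<^sub>R vert (u 0) (h 0)"
    using w[OF S(2)] by (simp add: H_def vert_scale_right)
  moreover have "emb (q' t) + vert (w t) (vector_derivative w (at t)) =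
       emb (p' t) + vert (u t) (vector_derivative u (at t)) + t ^ m *\<^sub>R H t" if t: "t \<in> S" for t
    unfolding w'[OF t] q[OF t] H_def by (simp add: vert_simps emb_simps K(2)[OF t] u'_def[symmetric] algebra_simps)
  ultimately show ?thesis by blast
qed

text \<open>For prolonged curves the base velocities are u and w themselves, whose difference has
  one order more than required; hence the leading coefficient has no \<open>emb\<close>
  term.\<close>

lemma pert_ld:
  assumes "open S" "0 \<in> S" "smooth S u" "smooth S w" "smooth S h"
    "\<And>t. t \<in> S \<Longrightarrow> u t \<noteq> 0" "\<And>t. t \<in> S \<Longrightarrow> w t \<noteq> 0"
    and w: "\<And>t. t \<in> S \<Longrightarrow> w t = u t + t ^ Suc m *\<^sub>R h t"
  shows "\<exists>H. smooth S H \<and> H 0 = real (Suc m) *\<^sub>R vert (u 0) (h 0) \<and> (\<forall>t\<in>S. ld w t = ld u t + t ^ m *\<^sub>R H t)"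
proof -
  have "w t = u t + t ^ m *\<^sub>R (t *\<^sub>R h t)" if "t \<in> S" for t by (simp add: w[OF that])
  from pert[of S u w h "\<lambda>t. t *\<^sub>R h t" m w u, OF assms(1-5) _ assms(6,7) w this]
  show ?thesis using assms(5) unfolding ld_def by (simp add: smooth_intros emb_simps)
qed

subsection \<open>Lines in the fibers\<close>

definition ind2 :: "'a::real_vector \<Rightarrow> 'a \<Rightarrow> bool" where
  "ind2 x y \<longleftrightarrow> (\<forall>a b. a *\<^sub>R x + b *\<^sub>R y = 0 \<longrightarrow> a = 0 \<and> b = 0)"

lemma ind2_sym: "ind2 x y \<Longrightarrow> ind2 y x"
  unfolding ind2_def by (metis add.commute)

lemma basis3_ind2:
  assumes "basis3 S x y z" shows "ind2 x y" "ind2 y x" "ind2 x z" "ind2 z x" "ind2 y z" "ind2 z y"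
proof -
  have *: "a = 0 \<and> b = 0 \<and> c = 0" if "a *\<^sub>R x + b *\<^sub>R y + c *\<^sub>R z = 0" for a b c
    using assms that by (auto simp: basis3_def)
  show 1: "ind2 x y" "ind2 x z" "ind2 y z"
    unfolding ind2_def using *[where c = 0] *[where b = 0] *[where a = 0] by auto
  show "ind2 y x" "ind2 z x" "ind2 z y" using 1 by (auto intro: ind2_sym)
qed

text \<open>An affine parameter on the projective line in the fiber over p spanned by u and v; only
  the line of v itself is missed.\<close>

definition fl :: "real^'n \<Rightarrow> real^'n \<Rightarrow> real^'n \<Rightarrow> real \<Rightarrow> real^('n prol)" where
  "fl p u v t = le p (u + t *\<^sub>R v)"

definition fl' :: "real^'n \<Rightarrow> real^'n \<Rightarrow> real \<Rightarrow> real^('n prol)" where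
  "fl' u v t = vert (u + t *\<^sub>R v) v"

lemma fl_0: "fl p u v 0 = le p u" "fl' u v 0 = vert u v"
  by (simp_all add: fl_def fl'_def)

lemma ind2_nz: "ind2 u v \<Longrightarrow> u + t *\<^sub>R v \<noteq> 0"
  unfolding ind2_def by (metis one_neq_zero scaleR_one)

lemma fl'_nz: assumes "ind2 u v" shows "fl' u v t \<noteq> 0"
proof
  assume "fl' u v t = 0"
  from vert_eq_0D[OF this[unfolded fl'_def] ind2_nz[OF assms]]
  obtain c where "v = c *\<^sub>R (u + t *\<^sub>R v)" by blast
  then have "c *\<^sub>R u + (c * t - 1) *\<^sub>R v = 0" by (simp add: algebra_simps)
  then have "c = 0 \<and> c * t - 1 = 0" using assms unfolding ind2_def by blast
  then show False by (elim conjE) simp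
qed

lemma fl_icurve:
  assumes reg: "regular Z \<Delta>" and p: "p \<in> Z" and uv: "u \<in> \<Delta> p" "v \<in> \<Delta> p" and ind: "ind2 u v"
  shows "icurve (prol_space Z \<Delta>) (prol_dist Z \<Delta>) UNIV (fl p u v) (fl' u v)"
  unfolding icurve_def
proof (intro conjI ballI)
  have m: "u + t *\<^sub>R v \<in> \<Delta> p" for t
    by (intro subspace_add[OF regular_subspace[OF reg p]] subspace_mul[OF regular_subspace[OF reg p]] uv)
  show "smooth UNIV (fl' u v)" unfolding fl'_def[abs_def] by (intro smooth_intros) (auto simp: ind2_nz[OF ind])
  fix t :: real
  show "fl p u v t \<in> prol_space Z \<Delta>" unfolding fl_def by (rule le_mem_prol[OF reg p m ind2_nz[OF ind]])
  show "fl' u v t \<in> prol_dist Z \<Delta> (fl p u v t)" unfolding fl_def fl'_def by (rule vert_mem[OF reg p m ind2_nz[OF ind] uv(2)])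
  show "fl' u v t \<noteq> 0" by (rule fl'_nz[OF ind])
  have "((\<lambda>t. u + t *\<^sub>R v) has_vector_derivative v) (at t)" by (auto intro!: derivative_eq_intros)
  from le_has_vector_derivative[OF has_vector_derivative_const this ind2_nz[OF ind]]
  show "(fl p u v has_vector_derivative fl' u v t) (at t)" by (simp add: fl_def[abs_def] fl'_def emb_simps)
qed auto

lemma fl_image:
  assumes reg: "regular Z \<Delta>" and f: "morph Z \<Delta> S f" and p: "p \<in> S" "f p = p"
    and uv: "u \<in> \<Delta> p" "v \<in> \<Delta> p" "ind2 u v"
    and A: "dr Z f p u = l *\<^sub>R u" "dr Z f p v = b *\<^sub>R v + k *\<^sub>R u" and t: "l + t * k \<noteq> 0"
  shows "prol_map Z f (fl p u v t) = fl p u v (t * b / (l + t * k))"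
proof -
  note pZ = morph_sub[OF f p(1)]
  have m: "u + t *\<^sub>R v \<in> \<Delta> p"
    by (intro subspace_add[OF regular_subspace[OF reg pZ]] subspace_mul[OF regular_subspace[OF reg pZ]] uv)
  note lin = morph_dr_linear[OF f p(1)]
  have "dr Z f p (u + t *\<^sub>R v) = (l + t * k) *\<^sub>R (u + (t * b / (l + t * k)) *\<^sub>R v)"
  proof -
    have "(l + t * k) * (t * b / (l + t * k)) = t * b" using t by simp
    then have "(l + t * k) *\<^sub>R (u + (t * b / (l + t * k)) *\<^sub>R v) = (l + t * k) *\<^sub>R u + (t * b) *\<^sub>R v"
      by (simp only: scaleR_add_right scaleR_scaleR)
    moreover have "dr Z f p (u + t *\<^sub>R v) = (l + t * k) *\<^sub>R u + (t * b) *\<^sub>R v"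
      by (simp add: linear_add[OF lin] linear_scale[OF lin] A algebra_simps)
    ultimately show ?thesis by (simp only:)
  qed
  then show ?thesis using prol_map_le[OF f p(1) m ind2_nz[OF uv(3)]] t by (simp add: fl_def p(2))
qed

text \<open>The parameter is changed by the fractional linear map t b / (l + t k), which fixes 0
  with derivative b / l whatever k is. By \<open>reparam\<close> the velocity of each prolongation
  of the fiber line is then an eigenvector with this same factor.\<close>

lemma fl_lifts:
  assumes reg: "regular Z \<Delta>" and f: "morph Z \<Delta> S f" and p: "p \<in> S" "f p = p"
    and uv: "u \<in> \<Delta> p" "v \<in> \<Delta> p" "ind2 u v"
    and A: "dr Z f p u = l *\<^sub>R u" "dr Z f p v = b *\<^sub>R v + k *\<^sub>R u" and l: "l \<noteq> 0" and b: "b \<noteq> 0"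
  defines "Z1 \<equiv> prol_space Z \<Delta>" and "D1 \<equiv> prol_dist Z \<Delta>" and "f1 \<equiv> prol_map Z f"
  defines "Z2 \<equiv> prol_space Z1 D1" and "D2 \<equiv> prol_dist Z1 D1" and "f2 \<equiv> prol_map Z1 f1"
  defines "Z3 \<equiv> prol_space Z2 D2" and "f3 \<equiv> prol_map Z2 f2"
  defines "g \<equiv> fl p u v" and "g' \<equiv> fl' u v"
  shows "dr Z2 f2 (lc g g' 0) (ld g' 0) = (b / l) *\<^sub>R ld g' 0"
    and "dr Z3 f3 (lc (lc g g') (ld g') 0) (ld (ld g') 0) = (b / l) *\<^sub>R ld (ld g') 0"
proof -
  define T where "T = {t. l + t * k \<noteq> 0}"
  have T: "open T" "0 \<in> T" using smooth_open_neq_0[of UNIV "\<lambda>t. l + t * k"] l by (auto simp: T_def smooth_intros)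
  define \<tau> where "\<tau> t = t * b / (l + t * k)" for t
  have \<tau>: "(\<tau> has_real_derivative (b * l / (l + t * k)\<^sup>2)) (at t)" "b * l / (l + t * k)\<^sup>2 \<noteq> 0" if "t \<in> T" for t
  proof -
    have nz: "l + t * k \<noteq> 0" using that by (simp add: T_def)
    then show "b * l / (l + t * k)\<^sup>2 \<noteq> 0" using b l by simp
    have "(\<tau> has_real_derivative ((b * (l + t * k) - t * b * k) / ((l + t * k) * (l + t * k)))) (at t)"
      unfolding \<tau>_def using nz by (auto intro!: derivative_eq_intros simp: algebra_simps)
    moreover have "b * (l + t * k) - t * b * k = b * l" by (simp add: algebra_simps)
    ultimately show "(\<tau> has_real_derivative (b * l / (l + t * k)\<^sup>2)) (at t)" by (simp add: power2_eq_square)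
  qed
  have reg1: "regular Z1 D1" unfolding Z1_def D1_def by (rule regular_prol[OF reg])
  have reg2: "regular Z2 D2" unfolding Z2_def D2_def by (rule regular_prol[OF reg1])
  have m1: "morph Z1 D1 (over Z \<Delta> S) f1" unfolding Z1_def D1_def f1_def by (rule morph_prol[OF reg f])
  have m2: "morph Z2 D2 (over Z1 D1 (over Z \<Delta> S)) f2" unfolding Z2_def D2_def f2_def by (rule morph_prol[OF reg1 m1])
  have m3: "morph Z3 (prol_dist Z2 D2) (over Z2 D2 (over Z1 D1 (over Z \<Delta> S))) f3" unfolding Z3_def f3_def by (rule morph_prol[OF reg2 m2])
  have i1: "icurve Z1 D1 UNIV g g'" unfolding Z1_def D1_def g_def g'_def by (rule fl_icurve[OF reg morph_sub[OF f p(1)] uv])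
  have i2: "icurve Z2 D2 UNIV (lc g g') (ld g')" unfolding Z2_def D2_def by (rule icurve_lift[OF reg1 i1])
  have i3: "icurve Z3 (prol_dist Z2 D2) UNIV (lc (lc g g') (ld g')) (ld (ld g'))" unfolding Z3_def by (rule icurve_lift[OF reg2 i2])
  have o1: "g t \<in> over Z \<Delta> S" for t using i1 p(1) by (simp add: icurve_def over_def g_def fl_def Z1_def)
  have o2: "lc g g' t \<in> over Z1 D1 (over Z \<Delta> S)" for t using i2 o1 by (simp add: icurve_def over_def Z2_def)
  have o3: "lc (lc g g') (ld g') t \<in> over Z2 D2 (over Z1 D1 (over Z \<Delta> S))" for t using i3 o2 by (simp add: icurve_def over_def Z3_def)
  have e1: "f1 (g t) = g (\<tau> t)" if "t \<in> T" for t
    unfolding f1_def g_def \<tau>_def by (rule fl_image[OF reg f p uv A]) (use that in \<open>simp add: T_def\<close>)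
  have e2: "f2 (lc g g' t) = lc g g' (\<tau> t)" if "t \<in> T" for t
    unfolding f2_def by (rule reparam(2)[OF m1 i1 T(1) that o1 e1 \<tau>[OF that]])
  have e3: "f3 (lc (lc g g') (ld g') t) = lc (lc g g') (ld g') (\<tau> t)" if "t \<in> T" for t
    unfolding f3_def by (rule reparam(2)[OF m2 i2 T(1) that o2 e2 \<tau>[OF that]])
  have r: "b * l / (l + 0 * k)\<^sup>2 = b / l" "\<tau> 0 = 0" using l by (simp_all add: power2_eq_square \<tau>_def)
  show "dr Z2 f2 (lc g g' 0) (ld g' 0) = (b / l) *\<^sub>R ld g' 0"
    using reparam(1)[OF m2 i2 T o2 e2 \<tau>[OF T(2)]] unfolding r by simp
  show "dr Z3 f3 (lc (lc g g') (ld g') 0) (ld (ld g') 0) = (b / l) *\<^sub>R ld (ld g') 0"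
    using reparam(1)[OF m3 i3 T o3 e3 \<tau>[OF T(2)]] unfolding r by simp
qed

subsection \<open>Orbits of a stabilizer on the lines of a three-dimensional space\<close>

definition cmb :: "'a::real_vector \<Rightarrow> 'a \<Rightarrow> 'a \<Rightarrow> real \<times> real \<times> real \<Rightarrow> 'a" where
  "cmb x y z = (\<lambda>(a, b, c). a *\<^sub>R x + b *\<^sub>R y + c *\<^sub>R z)"

context level begin

definition cov :: "real^'n \<Rightarrow> real^'n \<Rightarrow> real^'n \<Rightarrow> bool" where
  "cov m v w \<longleftrightarrow> (\<exists>\<Phi> k. polyaut \<Phi> \<and> lift \<Phi> m = m \<and> dr Z (lift \<Phi>) m v = k *\<^sub>R w)"

lemma cov_refl: "m \<in> Z \<Longrightarrow> v \<in> \<Delta> m \<Longrightarrow> v = k *\<^sub>R w \<Longrightarrow> cov m v w"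
  unfolding cov_def using polyaut_id ident dr_ident by metis

lemma cov_trans:
  assumes m: "m \<in> Z" and v: "v \<in> \<Delta> m" "v' \<in> \<Delta> m" and c: "cov m v v'" "cov m v' w"
  shows "cov m v w"
proof -
  obtain \<Phi> k where \<Phi>: "polyaut \<Phi>" "lift \<Phi> m = m" "dr Z (lift \<Phi>) m v = k *\<^sub>R v'" using c(1) unfolding cov_def by blast
  obtain \<Psi> l where \<Psi>: "polyaut \<Psi>" "lift \<Psi> m = m" "dr Z (lift \<Psi>) m v' = l *\<^sub>R w" using c(2) unfolding cov_def by blast
  note s = polyaut_sdiff[OF \<Phi>(1)] polyaut_sdiff[OF \<Psi>(1)]
  have "dr Z (lift (\<lambda>x. \<Psi> (\<Phi> x))) m v = dr Z (lift \<Psi>) m (k *\<^sub>R v')"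
    using dr_comp(1)[OF s m UNIV_I UNIV_I v(1)] by (simp add: \<Phi>)
  also have "\<dots> = (k * l) *\<^sub>R w" by (simp add: linear_scale[OF dr_lin[OF s(2) m UNIV_I]] \<Psi>)
  finally have "dr Z (lift (\<lambda>x. \<Psi> (\<Phi> x))) m v = (k * l) *\<^sub>R w" .
  moreover have "lift (\<lambda>x. \<Psi> (\<Phi> x)) m = m" using comp[OF s m UNIV_I UNIV_I] \<Phi> \<Psi> by simp
  ultimately show ?thesis unfolding cov_def using polyaut_comp[OF \<Phi>(1) \<Psi>(1)] by blast
qed

lemma covI: "polyaut \<Phi> \<Longrightarrow> lift \<Phi> m = m \<Longrightarrow> dr Z (lift \<Phi>) m v = k *\<^sub>R w \<Longrightarrow> cov m v w"
  unfolding cov_def by blast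

lemma dr_cmb:
  assumes "sdiff U \<Phi>" "m \<in> Z" "\<pi> m \<in> U"
  shows "dr Z (lift \<Phi>) m (a *\<^sub>R x + b *\<^sub>R y + c *\<^sub>R z) =
    a *\<^sub>R dr Z (lift \<Phi>) m x + b *\<^sub>R dr Z (lift \<Phi>) m y + c *\<^sub>R dr Z (lift \<Phi>) m z"
  using dr_lin[OF assms] by (simp add: linear_add linear_scale)

lemma nodeI:
  assumes m: "m \<in> Z" and B: "basis3 (\<Delta> m) x y z" and T: "finite T" "(0, 0, 0) \<notin> T"
    and cover: "\<And>a b c. (a, b, c) \<noteq> (0, 0, 0) \<Longrightarrow> \<exists>t\<in>T. cov m (a *\<^sub>R x + b *\<^sub>R y + c *\<^sub>R z) (cmb x y z t)"
    and dist: "\<And>U \<Phi> k a b c a' b' c'. sdiff U \<Phi> \<Longrightarrow> \<pi> m \<in> U \<Longrightarrow> lift \<Phi> m = m \<Longrightarrow> (a, b, c) \<in> T \<Longrightarrow> (a', b', c') \<in> T \<Longrightarrow> k \<noteq> 0 \<Longrightarrow>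
      a *\<^sub>R dr Z (lift \<Phi>) m x + b *\<^sub>R dr Z (lift \<Phi>) m y + c *\<^sub>R dr Z (lift \<Phi>) m z =
      (k * a') *\<^sub>R x + (k * b') *\<^sub>R y + (k * c') *\<^sub>R z \<Longrightarrow> a = a' \<and> b = b' \<and> c = c'"
  shows "node Z \<Delta> \<pi> lift m (cmb x y z ` T)" "card (cmb x y z ` T) = card T"
proof -
  have mem: "cmb x y z t \<in> \<Delta> m" for t using basis3_mem[OF B] by (auto simp: cmb_def case_prod_unfold)
  have nz: "a *\<^sub>R x + b *\<^sub>R y + c *\<^sub>R z \<noteq> 0" if "(a, b, c) \<in> T" for a b c
    using that T(2) B unfolding basis3_def by blast
  have inj: "inj_on (cmb x y z) T"
    by (rule inj_onI) (use basis3_eqD[OF B] in \<open>force simp: cmb_def\<close>)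
  then show "card (cmb x y z ` T) = card T" by (rule card_image)
  show "node Z \<Delta> \<pi> lift m (cmb x y z ` T)"
    unfolding node_def
  proof (intro conjI ballI allI impI)
    show "finite (cmb x y z ` T)" using T by simp
  next
    fix v assume "v \<in> cmb x y z ` T"
    then show "v \<in> \<Delta> m" "v \<noteq> 0" using mem nz by (auto simp: cmb_def)
  next
    fix v assume v: "v \<in> \<Delta> m" "v \<noteq> 0"
    obtain a b c where abc: "v = a *\<^sub>R x + b *\<^sub>R y + c *\<^sub>R z" using basis3_coords[OF B v(1)] .
    then have "(a, b, c) \<noteq> (0, 0, 0)" using v(2) by auto
    from cover[OF this] show "\<exists>w\<in>cmb x y z ` T. \<exists>\<Phi> k. polyaut \<Phi> \<and> lift \<Phi> m = m \<and> dr Z (lift \<Phi>) m v = k *\<^sub>R w"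
      unfolding cov_def abc by blast
  next
    fix v w U \<Phi> k assume v: "v \<in> cmb x y z ` T" "w \<in> cmb x y z ` T"
      and a: "sdiff U \<Phi> \<and> \<pi> m \<in> U \<and> lift \<Phi> m = m \<and> dr Z (lift \<Phi>) m v = k *\<^sub>R w"
    obtain a b c where v': "v = a *\<^sub>R x + b *\<^sub>R y + c *\<^sub>R z" "(a, b, c) \<in> T" using v(1) by (auto simp: cmb_def)
    obtain a' b' c' where w': "w = a' *\<^sub>R x + b' *\<^sub>R y + c' *\<^sub>R z" "(a', b', c') \<in> T" using v(2) by (auto simp: cmb_def)
    have sd: "sdiff U \<Phi>" "\<pi> m \<in> U" "lift \<Phi> m = m" using a by auto
    have "v \<in> \<Delta> m" "v \<noteq> 0" using v(1) mem nz[OF v'(2)] v'(1) by auto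
    then have "dr Z (lift \<Phi>) m v \<noteq> 0" using dr_nz[OF sd(1) m sd(2)] by blast
    then have k: "k \<noteq> 0" using a by auto
    have "a = a' \<and> b = b' \<and> c = c'"
      by (rule dist[OF sd v'(2) w'(2) k])
        (use a dr_cmb[OF sd(1) m sd(2), of a x b y c z] in \<open>simp add: v'(1) w'(1) algebra_simps\<close>)
    then show "v = w" by (simp add: v'(1) w'(1))
  qed
qed

lemma nz_coeffs:
  assumes m: "m \<in> Z" and B: "basis3 (\<Delta> m) x y z" and \<Phi>: "sdiff U \<Phi>" "\<pi> m \<in> U"
  shows "dr Z (lift \<Phi>) m x \<noteq> 0" "dr Z (lift \<Phi>) m y \<noteq> 0" "dr Z (lift \<Phi>) m z \<noteq> 0"
  using dr_nz[OF \<Phi>(1) m \<Phi>(2)] basis3_mems[OF B] by auto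

text \<open>If b is nonzero, the shear removes c, and two cases remain according to a; if b = 0, the
  line lies in the plane of x and z, on which the torus has three orbits of lines.\<close>

lemma tri_node:
  assumes m: "m \<in> Z" and B: "basis3 (\<Delta> m) x y z"
    and act: "\<And>U \<Phi>. sdiff U \<Phi> \<Longrightarrow> \<pi> m \<in> U \<Longrightarrow> lift \<Phi> m = m \<Longrightarrow> \<exists>\<mu> \<omega> \<nu> \<rho>. dr Z (lift \<Phi>) m x = \<mu> *\<^sub>R x \<and>
      dr Z (lift \<Phi>) m y = \<omega> *\<^sub>R y + \<nu> *\<^sub>R z \<and> dr Z (lift \<Phi>) m z = \<rho> *\<^sub>R z"
    and tor: "\<And>r s. r \<noteq> 0 \<Longrightarrow> s \<noteq> 0 \<Longrightarrow> \<exists>\<Phi> \<mu>. polyaut \<Phi> \<and> lift \<Phi> m = m \<and> dr Z (lift \<Phi>) m x = \<mu> *\<^sub>R x \<and>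
      dr Z (lift \<Phi>) m y = (\<mu> * r) *\<^sub>R y \<and> dr Z (lift \<Phi>) m z = (\<mu> * s) *\<^sub>R z"
    and shr: "\<And>\<nu>. \<exists>\<Phi>. polyaut \<Phi> \<and> lift \<Phi> m = m \<and> dr Z (lift \<Phi>) m x = x \<and>
      dr Z (lift \<Phi>) m y = y + \<nu> *\<^sub>R z \<and> dr Z (lift \<Phi>) m z = z"
  defines "T \<equiv> {(1,1,0), (0,1,0), (1,0,0), (1,0,1), (0,0,1)}"
  shows "node Z \<Delta> \<pi> lift m (cmb x y z ` T)" "card (cmb x y z ` T) = 5"
proof -
  note mem = basis3_mem[OF B]
  have cv1: "\<exists>t\<in>T. cov m (a *\<^sub>R x + b *\<^sub>R y + c *\<^sub>R z) (cmb x y z t)"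
    if n: "(a, b, c) \<noteq> (0, 0, 0)" and bc: "b = 0 \<or> c = 0" for a b c
  proof -
    define r where "r = (if a \<noteq> 0 \<and> b \<noteq> 0 then a / b else 1)"
    define s where "s = (if a \<noteq> 0 \<and> c \<noteq> 0 then a / c else 1)"
    have "r \<noteq> 0" "s \<noteq> 0" by (auto simp: r_def s_def)
    from tor[OF this] obtain \<Phi> \<mu> where \<Phi>: "polyaut \<Phi>" "lift \<Phi> m = m" "dr Z (lift \<Phi>) m x = \<mu> *\<^sub>R x"
      "dr Z (lift \<Phi>) m y = (\<mu> * r) *\<^sub>R y" "dr Z (lift \<Phi>) m z = (\<mu> * s) *\<^sub>R z" by blast
    have d: "dr Z (lift \<Phi>) m (a *\<^sub>R x + b *\<^sub>R y + c *\<^sub>R z) = (\<mu> * a) *\<^sub>R x + (\<mu> * (b * r)) *\<^sub>R y + (\<mu> * (c * s)) *\<^sub>R z"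
      using dr_cmb[OF polyaut_sdiff[OF \<Phi>(1)] m UNIV_I] by (simp add: \<Phi> mult_ac)
    consider "a \<noteq> 0" "b \<noteq> 0" "c = 0" | "a \<noteq> 0" "b = 0" "c \<noteq> 0" | "a \<noteq> 0" "b = 0" "c = 0" | "a = 0" "b \<noteq> 0" "c = 0" | "a = 0" "b = 0" "c \<noteq> 0"
      using n bc by auto
    then show ?thesis
    proof cases
      case 1 then show ?thesis by (intro bexI[of _ "(1,1,0)"] covI[OF \<Phi>(1,2), of _ "\<mu> * a"]) (unfold d, simp_all add: cmb_def r_def T_def scaleR_add_right scaleR_diff_right)
    next
      case 2 then show ?thesis by (intro bexI[of _ "(1,0,1)"] covI[OF \<Phi>(1,2), of _ "\<mu> * a"]) (unfold d, simp_all add: cmb_def s_def T_def scaleR_add_right scaleR_diff_right)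
    next
      case 3 then show ?thesis by (intro bexI[of _ "(1,0,0)"] covI[OF \<Phi>(1,2), of _ "\<mu> * a"]) (unfold d, simp_all add: cmb_def T_def)
    next
      case 4 then show ?thesis by (intro bexI[of _ "(0,1,0)"] covI[OF \<Phi>(1,2), of _ "\<mu> * (b * r)"]) (unfold d, simp_all add: cmb_def T_def)
    next
      case 5 then show ?thesis by (intro bexI[of _ "(0,0,1)"] covI[OF \<Phi>(1,2), of _ "\<mu> * (c * s)"]) (unfold d, simp_all add: cmb_def T_def)
    qed
  qed
  have cv: "\<exists>t\<in>T. cov m (a *\<^sub>R x + b *\<^sub>R y + c *\<^sub>R z) (cmb x y z t)" if n: "(a, b, c) \<noteq> (0, 0, 0)" for a b c
  proof (cases "b = 0")
    case True then show ?thesis using cv1[OF n] by blast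
  next
    case False
    obtain \<Phi> where \<Phi>: "polyaut \<Phi>" "lift \<Phi> m = m" "dr Z (lift \<Phi>) m x = x"
      "dr Z (lift \<Phi>) m y = y + (- c / b) *\<^sub>R z" "dr Z (lift \<Phi>) m z = z" using shr[of "- c / b"] by blast
    have "dr Z (lift \<Phi>) m (a *\<^sub>R x + b *\<^sub>R y + c *\<^sub>R z) = a *\<^sub>R x + b *\<^sub>R y + 0 *\<^sub>R z"
      using dr_cmb[OF polyaut_sdiff[OF \<Phi>(1)] m UNIV_I] False by (simp add: \<Phi>(3-5) scaleR_add_right scaleR_diff_right)
    then have 1: "cov m (a *\<^sub>R x + b *\<^sub>R y + c *\<^sub>R z) (a *\<^sub>R x + b *\<^sub>R y + 0 *\<^sub>R z)"
      by (intro covI[OF \<Phi>(1,2), of _ 1]) simp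
    obtain t where t: "t \<in> T" "cov m (a *\<^sub>R x + b *\<^sub>R y + 0 *\<^sub>R z) (cmb x y z t)"
      using cv1[of a b 0] False by auto
    show ?thesis using cov_trans[OF m mem mem 1 t(2)] t(1) by blast
  qed
  have fT: "finite T" "(0, 0, 0) \<notin> T" by (auto simp: T_def)
  have ds: "a = a' \<and> b = b' \<and> c = c'"
    if \<Phi>: "sdiff U \<Phi>" "\<pi> m \<in> U" "lift \<Phi> m = m" and t: "(a, b, c) \<in> T" "(a', b', c') \<in> T" and k: "k \<noteq> 0"
      and e: "a *\<^sub>R dr Z (lift \<Phi>) m x + b *\<^sub>R dr Z (lift \<Phi>) m y + c *\<^sub>R dr Z (lift \<Phi>) m z =
      (k * a') *\<^sub>R x + (k * b') *\<^sub>R y + (k * c') *\<^sub>R z" for U \<Phi> k a b c a' b' c'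
  proof -
    obtain \<mu> \<omega> \<nu> \<rho> where A: "dr Z (lift \<Phi>) m x = \<mu> *\<^sub>R x" "dr Z (lift \<Phi>) m y = \<omega> *\<^sub>R y + \<nu> *\<^sub>R z" "dr Z (lift \<Phi>) m z = \<rho> *\<^sub>R z"
      using act[OF \<Phi>] by blast
    have nz: "\<mu> \<noteq> 0" "\<rho> \<noteq> 0" using nz_coeffs[OF m B \<Phi>(1,2)] unfolding A by auto
    have "(a * \<mu>) *\<^sub>R x + (b * \<omega>) *\<^sub>R y + (b * \<nu> + c * \<rho>) *\<^sub>R z = (k * a') *\<^sub>R x + (k * b') *\<^sub>R y + (k * c') *\<^sub>R z"
      using e unfolding A by (simp add: algebra_simps)
    from basis3_eqD[OF B this] have q: "a * \<mu> = k * a'" "b * \<omega> = k * b'" "b * \<nu> + c * \<rho> = k * c'" by auto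
    \<comment> \<open>Otherwise \<rho> y - \<nu> z would be a nonzero vector in the kernel of the
      differential.\<close>
    have "\<omega> \<noteq> 0"
    proof
      assume "\<omega> = 0"
      then have "dr Z (lift \<Phi>) m (0 *\<^sub>R x + \<rho> *\<^sub>R y + (- \<nu>) *\<^sub>R z) = 0" unfolding dr_cmb[OF \<Phi>(1) m \<Phi>(2)] A by simp
      then have "0 *\<^sub>R x + \<rho> *\<^sub>R y + (- \<nu>) *\<^sub>R z = 0" using dr_nz[OF \<Phi>(1) m \<Phi>(2) mem] by blast
      then show False using B nz(2) unfolding basis3_def by blast
    qed
    then show ?thesis using q t nz k by (auto simp: T_def)
  qed
  show "node Z \<Delta> \<pi> lift m (cmb x y z ` T)" by (rule nodeI(1)[OF m B fT cv ds])
  show "card (cmb x y z ` T) = 5" using nodeI(2)[OF m B fT cv ds] by (simp add: T_def)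
qed

text \<open>Only the vanishing pattern of the coordinates is invariant, and the torus realizes all
  ratios, negative ones included; this gives 2^3 - 1 orbits.\<close>

lemma diag_node:
  assumes m: "m \<in> Z" and B: "basis3 (\<Delta> m) x y z"
    and act: "\<And>U \<Phi>. sdiff U \<Phi> \<Longrightarrow> \<pi> m \<in> U \<Longrightarrow> lift \<Phi> m = m \<Longrightarrow> \<exists>\<mu> \<omega> \<rho>. dr Z (lift \<Phi>) m x = \<mu> *\<^sub>R x \<and>
      dr Z (lift \<Phi>) m y = \<omega> *\<^sub>R y \<and> dr Z (lift \<Phi>) m z = \<rho> *\<^sub>R z"
    and tor: "\<And>r s. r \<noteq> 0 \<Longrightarrow> s \<noteq> 0 \<Longrightarrow> \<exists>\<Phi> \<mu>. polyaut \<Phi> \<and> lift \<Phi> m = m \<and> dr Z (lift \<Phi>) m x = \<mu> *\<^sub>R x \<and>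
      dr Z (lift \<Phi>) m y = (\<mu> * r) *\<^sub>R y \<and> dr Z (lift \<Phi>) m z = (\<mu> * s) *\<^sub>R z"
  defines "T \<equiv> {(1,1,1), (1,1,0), (1,0,1), (0,1,1), (1,0,0), (0,1,0), (0,0,1)}"
  shows "node Z \<Delta> \<pi> lift m (cmb x y z ` T)" "card (cmb x y z ` T) = 7"
proof -
  define e where "e a = (if a = 0 then 0 else 1 :: real)" for a :: real
  have cv: "\<exists>t\<in>T. cov m (a *\<^sub>R x + b *\<^sub>R y + c *\<^sub>R z) (cmb x y z t)" if n: "(a, b, c) \<noteq> (0, 0, 0)" for a b c
  proof -
    \<comment> \<open>The first nonzero coordinate serves as common scale; vanishing coordinates are
      scaled by 1 so that the torus parameters are nonzero.\<close>
    define k where "k = (if a \<noteq> 0 then a else if b \<noteq> 0 then b else c)"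
    define r where "r = (if b \<noteq> 0 then k / b else 1)"
    define s where "s = (if c \<noteq> 0 then k / c else 1)"
    have k: "k \<noteq> 0" using n by (auto simp: k_def)
    then have "r \<noteq> 0" "s \<noteq> 0" by (auto simp: r_def s_def)
    from tor[OF this] obtain \<Phi> \<mu> where \<Phi>: "polyaut \<Phi>" "lift \<Phi> m = m" "dr Z (lift \<Phi>) m x = \<mu> *\<^sub>R x"
      "dr Z (lift \<Phi>) m y = (\<mu> * r) *\<^sub>R y" "dr Z (lift \<Phi>) m z = (\<mu> * s) *\<^sub>R z" by blast
    have "a = k * e a" "b * r = k * e b" "c * s = k * e c" using k by (auto simp: k_def r_def s_def e_def)
    then have q: "a * \<mu> = \<mu> * k * e a" "b * (\<mu> * r) = \<mu> * k * e b" "c * (\<mu> * s) = \<mu> * k * e c"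
      by (metis mult.assoc mult.commute)+
    have "dr Z (lift \<Phi>) m (a *\<^sub>R x + b *\<^sub>R y + c *\<^sub>R z) = (\<mu> * k) *\<^sub>R cmb x y z (e a, e b, e c)"
      unfolding dr_cmb[OF polyaut_sdiff[OF \<Phi>(1)] m UNIV_I] \<Phi>(3-5) scaleR_scaleR q by (simp add: cmb_def scaleR_add_right)
    moreover have "(e a, e b, e c) \<in> T" using n by (auto simp: T_def e_def)
    ultimately show ?thesis using covI[OF \<Phi>(1,2)] by blast
  qed
  have fT: "finite T" "(0, 0, 0) \<notin> T" by (auto simp: T_def)
  have ds: "a = a' \<and> b = b' \<and> c = c'"
    if \<Phi>: "sdiff U \<Phi>" "\<pi> m \<in> U" "lift \<Phi> m = m" and t: "(a, b, c) \<in> T" "(a', b', c') \<in> T" and k: "k \<noteq> 0"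
      and e: "a *\<^sub>R dr Z (lift \<Phi>) m x + b *\<^sub>R dr Z (lift \<Phi>) m y + c *\<^sub>R dr Z (lift \<Phi>) m z =
      (k * a') *\<^sub>R x + (k * b') *\<^sub>R y + (k * c') *\<^sub>R z" for U \<Phi> k a b c a' b' c'
  proof -
    obtain \<mu> \<omega> \<rho> where A: "dr Z (lift \<Phi>) m x = \<mu> *\<^sub>R x" "dr Z (lift \<Phi>) m y = \<omega> *\<^sub>R y" "dr Z (lift \<Phi>) m z = \<rho> *\<^sub>R z"
      using act[OF \<Phi>] by blast
    have nz: "\<mu> \<noteq> 0" "\<omega> \<noteq> 0" "\<rho> \<noteq> 0" using nz_coeffs[OF m B \<Phi>(1,2)] unfolding A by auto
    have "(a * \<mu>) *\<^sub>R x + (b * \<omega>) *\<^sub>R y + (c * \<rho>) *\<^sub>R z = (k * a') *\<^sub>R x + (k * b') *\<^sub>R y + (k * c') *\<^sub>R z"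
      using e unfolding A by simp
    from basis3_eqD[OF B this] show ?thesis using t nz k by (auto simp: T_def)
  qed
  show "node Z \<Delta> \<pi> lift m (cmb x y z ` T)" by (rule nodeI(1)[OF m B fT cv ds])
  show "card (cmb x y z ` T) = 7" using nodeI(2)[OF m B fT cv ds] by (simp add: T_def)
qed

text \<open>The only invariant is whether the line lies in the plane of y and z, which stands for
  the vertical plane: a line outside it is sheared to that of x, and the lines inside it form a
  single orbit.\<close>

lemma reg_node:
  assumes m: "m \<in> Z" and B: "basis3 (\<Delta> m) x y z"
    and act: "\<And>U \<Phi>. sdiff U \<Phi> \<Longrightarrow> \<pi> m \<in> U \<Longrightarrow> lift \<Phi> m = m \<Longrightarrow> \<exists>\<mu> p q b c. dr Z (lift \<Phi>) m x = \<mu> *\<^sub>R x + p *\<^sub>R y + q *\<^sub>R z \<and> \<mu> \<noteq> 0 \<and>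
      dr Z (lift \<Phi>) m y = b *\<^sub>R y + c *\<^sub>R z"
    and shr: "\<And>p q. \<exists>\<Phi>. polyaut \<Phi> \<and> lift \<Phi> m = m \<and> dr Z (lift \<Phi>) m x = x + p *\<^sub>R y + q *\<^sub>R z \<and>
      dr Z (lift \<Phi>) m y = y \<and> dr Z (lift \<Phi>) m z = z"
    and gl: "\<And>b c. (b, c) \<noteq> (0, 0) \<Longrightarrow> \<exists>\<Phi>. polyaut \<Phi> \<and> lift \<Phi> m = m \<and> dr Z (lift \<Phi>) m (b *\<^sub>R y + c *\<^sub>R z) = y"
  defines "T \<equiv> {(1,0,0), (0,1,0)}"
  shows "node Z \<Delta> \<pi> lift m (cmb x y z ` T)" "card (cmb x y z ` T) = 2"
proof -
  have cv: "\<exists>t\<in>T. cov m (a *\<^sub>R x + b *\<^sub>R y + c *\<^sub>R z) (cmb x y z t)" if n: "(a, b, c) \<noteq> (0, 0, 0)" for a b c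
  proof (cases "a = 0")
    case True
    then obtain \<Phi> where \<Phi>: "polyaut \<Phi>" "lift \<Phi> m = m" "dr Z (lift \<Phi>) m (b *\<^sub>R y + c *\<^sub>R z) = y" using gl[of b c] n by auto
    then show ?thesis using True by (intro bexI[of _ "(0,1,0)"] covI[OF \<Phi>(1,2), of _ 1]) (simp_all add: T_def cmb_def)
  next
    case False
    obtain \<Phi> where \<Phi>: "polyaut \<Phi>" "lift \<Phi> m = m" "dr Z (lift \<Phi>) m x = x + (- b / a) *\<^sub>R y + (- c / a) *\<^sub>R z"
      "dr Z (lift \<Phi>) m y = y" "dr Z (lift \<Phi>) m z = z" using shr[of "- b / a" "- c / a"] by blast
    have "dr Z (lift \<Phi>) m (a *\<^sub>R x + b *\<^sub>R y + c *\<^sub>R z) = a *\<^sub>R x"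
      using dr_cmb[OF polyaut_sdiff[OF \<Phi>(1)] m UNIV_I] False by (simp add: \<Phi>(3-5) scaleR_add_right scaleR_diff_right)
    then show ?thesis by (intro bexI[of _ "(1,0,0)"] covI[OF \<Phi>(1,2), of _ a]) (simp_all add: T_def cmb_def)
  qed
  have fT: "finite T" "(0, 0, 0) \<notin> T" by (auto simp: T_def)
  have ds: "a = a' \<and> b = b' \<and> c = c'"
    if \<Phi>: "sdiff U \<Phi>" "\<pi> m \<in> U" "lift \<Phi> m = m" and t: "(a, b, c) \<in> T" "(a', b', c') \<in> T" and k: "k \<noteq> 0"
      and e: "a *\<^sub>R dr Z (lift \<Phi>) m x + b *\<^sub>R dr Z (lift \<Phi>) m y + c *\<^sub>R dr Z (lift \<Phi>) m z =
      (k * a') *\<^sub>R x + (k * b') *\<^sub>R y + (k * c') *\<^sub>R z" for U \<Phi> k a b c a' b' c'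
  proof -
    obtain \<mu> p q b1 c1 where A: "dr Z (lift \<Phi>) m x = \<mu> *\<^sub>R x + p *\<^sub>R y + q *\<^sub>R z" "\<mu> \<noteq> 0" "dr Z (lift \<Phi>) m y = b1 *\<^sub>R y + c1 *\<^sub>R z"
      using act[OF \<Phi>] by blast
    have c: "c = 0" "c' = 0" using t by (auto simp: T_def)
    have "(a * \<mu>) *\<^sub>R x + (a * p + b * b1) *\<^sub>R y + (a * q + b * c1) *\<^sub>R z = (k * a') *\<^sub>R x + (k * b') *\<^sub>R y + (k * c') *\<^sub>R z"
      using e unfolding A c by (simp add: algebra_simps)
    from basis3_eqD[OF B this] show ?thesis using t A(2) k by (auto simp: T_def)
  qed
  show "node Z \<Delta> \<pi> lift m (cmb x y z ` T)" by (rule nodeI(1)[OF m B fT cv ds])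
  show "card (cmb x y z ` T) = 2" using nodeI(2)[OF m B fT cv ds] by (simp add: T_def)
qed

text \<open>The two shears join all lines outside the plane of y and z; inside that plane the action
  is diagonal, with three orbits.\<close>

lemma rvr_node:
  assumes m: "m \<in> Z" and B: "basis3 (\<Delta> m) x y z"
    and act: "\<And>U \<Phi>. sdiff U \<Phi> \<Longrightarrow> \<pi> m \<in> U \<Longrightarrow> lift \<Phi> m = m \<Longrightarrow> \<exists>\<mu> p q \<omega> \<rho>. dr Z (lift \<Phi>) m x = \<mu> *\<^sub>R x + p *\<^sub>R y + q *\<^sub>R z \<and> \<mu> \<noteq> 0 \<and>
      dr Z (lift \<Phi>) m y = \<omega> *\<^sub>R y \<and> dr Z (lift \<Phi>) m z = \<rho> *\<^sub>R z"
    and shr1: "\<And>p. \<exists>\<Phi>. polyaut \<Phi> \<and> lift \<Phi> m = m \<and> dr Z (lift \<Phi>) m x = x + p *\<^sub>R y \<and>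
      dr Z (lift \<Phi>) m y = y \<and> dr Z (lift \<Phi>) m z = z"
    and shr2: "\<And>p. \<exists>\<Phi>. polyaut \<Phi> \<and> lift \<Phi> m = m \<and> dr Z (lift \<Phi>) m x = x + p *\<^sub>R z \<and>
      dr Z (lift \<Phi>) m y = y \<and> dr Z (lift \<Phi>) m z = z"
    and tor: "\<And>s. s \<noteq> 0 \<Longrightarrow> \<exists>\<Phi>. polyaut \<Phi> \<and> lift \<Phi> m = m \<and> dr Z (lift \<Phi>) m y = y \<and> dr Z (lift \<Phi>) m z = s *\<^sub>R z"
  defines "T \<equiv> {(1,0,0), (0,1,0), (0,0,1), (0,1,1)}"
  shows "node Z \<Delta> \<pi> lift m (cmb x y z ` T)" "card (cmb x y z ` T) = 4"
proof -
  note mem = basis3_mem[OF B]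
  have cv: "\<exists>t\<in>T. cov m (a *\<^sub>R x + b *\<^sub>R y + c *\<^sub>R z) (cmb x y z t)" if n: "(a, b, c) \<noteq> (0, 0, 0)" for a b c
  proof (cases "a = 0")
    case True
    define s where "s = (if b \<noteq> 0 \<and> c \<noteq> 0 then b / c else 1)"
    have "s \<noteq> 0" by (auto simp: s_def)
    then obtain \<Phi> where \<Phi>: "polyaut \<Phi>" "lift \<Phi> m = m" "dr Z (lift \<Phi>) m y = y" "dr Z (lift \<Phi>) m z = s *\<^sub>R z" using tor by blast
    have d: "dr Z (lift \<Phi>) m (a *\<^sub>R x + b *\<^sub>R y + c *\<^sub>R z) = b *\<^sub>R y + (c * s) *\<^sub>R z"
      unfolding dr_cmb[OF polyaut_sdiff[OF \<Phi>(1)] m UNIV_I] \<Phi>(3,4) using True by simp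
    consider "b \<noteq> 0" "c \<noteq> 0" | "b \<noteq> 0" "c = 0" | "b = 0" "c \<noteq> 0" using n True by auto
    then show ?thesis
    proof cases
      case 1 then show ?thesis by (intro bexI[of _ "(0,1,1)"] covI[OF \<Phi>(1,2), of _ b]) (unfold d, simp_all add: cmb_def s_def T_def scaleR_add_right scaleR_diff_right)
    next
      case 2 then show ?thesis by (intro bexI[of _ "(0,1,0)"] covI[OF \<Phi>(1,2), of _ b]) (unfold d, simp_all add: cmb_def T_def)
    next
      case 3 then show ?thesis by (intro bexI[of _ "(0,0,1)"] covI[OF \<Phi>(1,2), of _ "c * s"]) (unfold d, simp_all add: cmb_def T_def)
    qed
  next
    case False
    obtain \<Phi> where \<Phi>: "polyaut \<Phi>" "lift \<Phi> m = m" "dr Z (lift \<Phi>) m x = x + (- b / a) *\<^sub>R y"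
      "dr Z (lift \<Phi>) m y = y" "dr Z (lift \<Phi>) m z = z" using shr1 by blast
    have 1: "cov m (a *\<^sub>R x + b *\<^sub>R y + c *\<^sub>R z) (a *\<^sub>R x + 0 *\<^sub>R y + c *\<^sub>R z)"
      using dr_cmb[OF polyaut_sdiff[OF \<Phi>(1)] m UNIV_I, of a x b y c z] False
      by (intro covI[OF \<Phi>(1,2), of _ 1]) (simp add: \<Phi>(3-5) scaleR_add_right scaleR_diff_right)
    obtain \<Psi> where \<Psi>: "polyaut \<Psi>" "lift \<Psi> m = m" "dr Z (lift \<Psi>) m x = x + (- c / a) *\<^sub>R z"
      "dr Z (lift \<Psi>) m y = y" "dr Z (lift \<Psi>) m z = z" using shr2 by blast
    have 2: "cov m (a *\<^sub>R x + 0 *\<^sub>R y + c *\<^sub>R z) (cmb x y z (1,0,0))"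
      using dr_cmb[OF polyaut_sdiff[OF \<Psi>(1)] m UNIV_I, of a x 0 y c z] False
      by (intro covI[OF \<Psi>(1,2), of _ a]) (simp add: \<Psi>(3-5) scaleR_add_right scaleR_diff_right cmb_def)
    show ?thesis using cov_trans[OF m mem mem 1 2] by (intro bexI[of _ "(1,0,0)"]) (simp_all add: T_def)
  qed
  have fT: "finite T" "(0, 0, 0) \<notin> T" by (auto simp: T_def)
  have ds: "a = a' \<and> b = b' \<and> c = c'"
    if \<Phi>: "sdiff U \<Phi>" "\<pi> m \<in> U" "lift \<Phi> m = m" and t: "(a, b, c) \<in> T" "(a', b', c') \<in> T" and k: "k \<noteq> 0"
      and e: "a *\<^sub>R dr Z (lift \<Phi>) m x + b *\<^sub>R dr Z (lift \<Phi>) m y + c *\<^sub>R dr Z (lift \<Phi>) m z =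
      (k * a') *\<^sub>R x + (k * b') *\<^sub>R y + (k * c') *\<^sub>R z" for U \<Phi> k a b c a' b' c'
  proof -
    obtain \<mu> p q \<omega> \<rho> where A: "dr Z (lift \<Phi>) m x = \<mu> *\<^sub>R x + p *\<^sub>R y + q *\<^sub>R z" "\<mu> \<noteq> 0"
      "dr Z (lift \<Phi>) m y = \<omega> *\<^sub>R y" "dr Z (lift \<Phi>) m z = \<rho> *\<^sub>R z"
      using act[OF \<Phi>] by blast
    have nz: "\<omega> \<noteq> 0" "\<rho> \<noteq> 0" using nz_coeffs[OF m B \<Phi>(1,2)] unfolding A by auto
    have "(a * \<mu>) *\<^sub>R x + (a * p + b * \<omega>) *\<^sub>R y + (a * q + c * \<rho>) *\<^sub>R z = (k * a') *\<^sub>R x + (k * b') *\<^sub>R y + (k * c') *\<^sub>R z"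
      using e unfolding A by (simp add: algebra_simps)
    from basis3_eqD[OF B this] show ?thesis using t A(2) k nz by (auto simp: T_def)
  qed
  show "node Z \<Delta> \<pi> lift m (cmb x y z ` T)" by (rule nodeI(1)[OF m B fT cv ds])
  show "card (cmb x y z ` T) = 4" using nodeI(2)[OF m B fT cv ds] by (simp add: T_def)
qed

text \<open>Modulo z the action on x and y is diagonal, with three orbits of lines, and the shears
  remove the z component from each of them; the line of z itself is the fourth orbit.\<close>

lemma rvt1_node:
  assumes m: "m \<in> Z" and B: "basis3 (\<Delta> m) x y z"
    and act: "\<And>U \<Phi>. sdiff U \<Phi> \<Longrightarrow> \<pi> m \<in> U \<Longrightarrow> lift \<Phi> m = m \<Longrightarrow> \<exists>\<mu> p \<omega> q \<rho>. dr Z (lift \<Phi>) m x = \<mu> *\<^sub>R x + p *\<^sub>R z \<and> \<mu> \<noteq> 0 \<and>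
      dr Z (lift \<Phi>) m y = \<omega> *\<^sub>R y + q *\<^sub>R z \<and> \<omega> \<noteq> 0 \<and> dr Z (lift \<Phi>) m z = \<rho> *\<^sub>R z"
    and shr1: "\<And>p. \<exists>\<Phi>. polyaut \<Phi> \<and> lift \<Phi> m = m \<and> dr Z (lift \<Phi>) m x = x \<and>
      dr Z (lift \<Phi>) m y = y + p *\<^sub>R z \<and> dr Z (lift \<Phi>) m z = z"
    and shr2: "\<And>p. \<exists>\<Phi>. polyaut \<Phi> \<and> lift \<Phi> m = m \<and> dr Z (lift \<Phi>) m x = x + p *\<^sub>R z \<and> dr Z (lift \<Phi>) m z = z"
    and tor: "\<And>s. s \<noteq> 0 \<Longrightarrow> \<exists>\<Phi> \<mu>. polyaut \<Phi> \<and> lift \<Phi> m = m \<and> dr Z (lift \<Phi>) m x = \<mu> *\<^sub>R x \<and> dr Z (lift \<Phi>) m y = (\<mu> * s) *\<^sub>R y"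
  defines "T \<equiv> {(1,1,0), (1,0,0), (0,1,0), (0,0,1)}"
  shows "node Z \<Delta> \<pi> lift m (cmb x y z ` T)" "card (cmb x y z ` T) = 4"
proof -
  note mem = basis3_mem[OF B]
  have cv: "\<exists>t\<in>T. cov m (a *\<^sub>R x + b *\<^sub>R y + c *\<^sub>R z) (cmb x y z t)" if n: "(a, b, c) \<noteq> (0, 0, 0)" for a b c
  proof (cases "b = 0")
    case True
    show ?thesis
    proof (cases "a = 0")
      case True
      then show ?thesis using \<open>b = 0\<close> mem[of 0 0 c]
        by (intro bexI[of _ "(0,0,1)"] cov_refl[OF m, of _ c]) (simp_all add: T_def cmb_def)
    next
      case False
      obtain \<Phi> where \<Phi>: "polyaut \<Phi>" "lift \<Phi> m = m" "dr Z (lift \<Phi>) m x = x + (- c / a) *\<^sub>R z" "dr Z (lift \<Phi>) m z = z" using shr2 by blast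
      then show ?thesis using dr_cmb[OF polyaut_sdiff[OF \<Phi>(1)] m UNIV_I, of a x 0 y c z] True False
        by (intro bexI[of _ "(1,0,0)"] covI[OF \<Phi>(1,2), of _ a]) (simp_all add: T_def cmb_def scaleR_add_right scaleR_diff_right)
    qed
  next
    case False
    obtain \<Phi> where \<Phi>: "polyaut \<Phi>" "lift \<Phi> m = m" "dr Z (lift \<Phi>) m x = x"
      "dr Z (lift \<Phi>) m y = y + (- c / b) *\<^sub>R z" "dr Z (lift \<Phi>) m z = z" using shr1 by blast
    have 1: "cov m (a *\<^sub>R x + b *\<^sub>R y + c *\<^sub>R z) (a *\<^sub>R x + b *\<^sub>R y + 0 *\<^sub>R z)"
      using dr_cmb[OF polyaut_sdiff[OF \<Phi>(1)] m UNIV_I, of a x b y c z] False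
      by (intro covI[OF \<Phi>(1,2), of _ 1]) (simp add: \<Phi>(3-5) scaleR_add_right scaleR_diff_right)
    show ?thesis
    proof (cases "a = 0")
      case True
      then have "cov m (a *\<^sub>R x + b *\<^sub>R y + 0 *\<^sub>R z) (cmb x y z (0,1,0))"
        by (intro cov_refl[OF m mem, of _ _ _ b]) (simp add: cmb_def)
      then show ?thesis using cov_trans[OF m mem mem 1] by (intro bexI[of _ "(0,1,0)"]) (simp_all add: T_def)
    next
      case a: False
      then obtain \<Psi> \<mu> where \<Psi>: "polyaut \<Psi>" "lift \<Psi> m = m" "dr Z (lift \<Psi>) m x = \<mu> *\<^sub>R x" "dr Z (lift \<Psi>) m y = (\<mu> * (a / b)) *\<^sub>R y"
        using tor[of "a / b"] False by auto
      have "cov m (a *\<^sub>R x + b *\<^sub>R y + 0 *\<^sub>R z) (cmb x y z (1,1,0))"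
        using dr_cmb[OF polyaut_sdiff[OF \<Psi>(1)] m UNIV_I, of a x b y 0 z] False
        by (intro covI[OF \<Psi>(1,2), of _ "\<mu> * a"]) (simp add: \<Psi>(3,4) scaleR_add_right scaleR_diff_right cmb_def mult_ac)
      then show ?thesis using cov_trans[OF m mem mem 1] by (intro bexI[of _ "(1,1,0)"]) (simp_all add: T_def)
    qed
  qed
  have fT: "finite T" "(0, 0, 0) \<notin> T" by (auto simp: T_def)
  have ds: "a = a' \<and> b = b' \<and> c = c'"
    if \<Phi>: "sdiff U \<Phi>" "\<pi> m \<in> U" "lift \<Phi> m = m" and t: "(a, b, c) \<in> T" "(a', b', c') \<in> T" and k: "k \<noteq> 0"
      and e: "a *\<^sub>R dr Z (lift \<Phi>) m x + b *\<^sub>R dr Z (lift \<Phi>) m y + c *\<^sub>R dr Z (lift \<Phi>) m z =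
      (k * a') *\<^sub>R x + (k * b') *\<^sub>R y + (k * c') *\<^sub>R z" for U \<Phi> k a b c a' b' c'
  proof -
    obtain \<mu> p \<omega> q \<rho> where A: "dr Z (lift \<Phi>) m x = \<mu> *\<^sub>R x + p *\<^sub>R z" "\<mu> \<noteq> 0"
      "dr Z (lift \<Phi>) m y = \<omega> *\<^sub>R y + q *\<^sub>R z" "\<omega> \<noteq> 0" "dr Z (lift \<Phi>) m z = \<rho> *\<^sub>R z"
      using act[OF \<Phi>] by blast
    have "(a * \<mu>) *\<^sub>R x + (b * \<omega>) *\<^sub>R y + (a * p + b * q + c * \<rho>) *\<^sub>R z = (k * a') *\<^sub>R x + (k * b') *\<^sub>R y + (k * c') *\<^sub>R z"
      using e unfolding A by (simp add: algebra_simps)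
    from basis3_eqD[OF B this] show ?thesis using t A(2,4) k by (auto simp: T_def)
  qed
  show "node Z \<Delta> \<pi> lift m (cmb x y z ` T)" by (rule nodeI(1)[OF m B fT cv ds])
  show "card (cmb x y z ` T) = 4" using nodeI(2)[OF m B fT cv ds] by (simp add: T_def)
qed

end

section \<open>Changes of basis, and curves inside a fiber\<close>

lemma basis3_swap12: "basis3 S x y z \<Longrightarrow> basis3 S y x z"
  unfolding basis3_def by (auto simp: add.commute add.left_commute) (metis add.commute add.left_commute)+

lemma basis3_swap23: assumes "basis3 S x y z" shows "basis3 S x z y"
proof -
  have e: "a *\<^sub>R x + b *\<^sub>R z + c *\<^sub>R y = a *\<^sub>R x + c *\<^sub>R y + b *\<^sub>R z" for a b c by (simp add: add_ac)
  show ?thesis using assms unfolding basis3_def e by blast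
qed

lemma basis3_add: assumes "basis3 S x y z" shows "basis3 S (x + y) y z"
proof -
  have e: "a *\<^sub>R (x + y) + b *\<^sub>R y + c *\<^sub>R z = a *\<^sub>R x + (a + b) *\<^sub>R y + c *\<^sub>R z" for a b c
    by (simp add: algebra_simps)
  have "S = {a *\<^sub>R (x + y) + b *\<^sub>R y + c *\<^sub>R z |a b c. True}"
  proof (intro subset_antisym subsetI)
    fix v assume "v \<in> S"
    then obtain a b c where "v = a *\<^sub>R x + b *\<^sub>R y + c *\<^sub>R z" by (rule basis3_coords[OF assms])
    then have "v = a *\<^sub>R (x + y) + (b - a) *\<^sub>R y + c *\<^sub>R z" unfolding e by simp
    then show "v \<in> {a *\<^sub>R (x + y) + b *\<^sub>R y + c *\<^sub>R z |a b c. True}" by blast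
  next
    fix v assume "v \<in> {a *\<^sub>R (x + y) + b *\<^sub>R y + c *\<^sub>R z |a b c. True}"
    then show "v \<in> S" unfolding e using basis3_mem[OF assms] by auto
  qed
  moreover have "a = 0 \<and> b = 0 \<and> c = 0" if "a *\<^sub>R (x + y) + b *\<^sub>R y + c *\<^sub>R z = 0" for a b c
  proof -
    have "a = 0 \<and> a + b = 0 \<and> c = 0" using that assms unfolding e basis3_def by blast
    then show ?thesis by auto
  qed
  ultimately show ?thesis unfolding basis3_def by blast
qed

lemma icurveD:
  assumes "icurve Z \<Delta> S g g'" "t \<in> S"
  shows "g t \<in> Z" "g' t \<in> \<Delta> (g t)" "g' t \<noteq> 0" "(g has_vector_derivative g' t) (at t)"
  using assms unfolding icurve_def by blast+

text \<open>On a curve in a fiber, \<open>mt (le p (c' t)) x\<close> is a multiple of the vertical vector \<open>c' t\<close> and so is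
  killed by \<open>base_pt\<close>; differentiating gives these equations.\<close>
lemma fiber_curve_lift_zero:
  assumes S: "open S" "0 \<in> S" "smooth S c'" and nz: "\<And>t. t \<in> S \<Longrightarrow> c' t \<noteq> 0" and v: "\<And>t. t \<in> S \<Longrightarrow> base_pt (c' t) = 0"
  shows "base_pt (mt (ld c' 0) x) = 0" "base_pt (mt (mt (ld (ld c') 0) y) x) = 0"
proof -
  have blin: "bounded_linear (\<lambda>q. base_pt (mt q x))" for x
    by (intro bounded_linear_compose[OF bounded_linear_base_pt] bounded_bilinear.bounded_linear_left[OF bounded_bilinear_mt])
  have z: "base_pt (mt (ld c' t) x) = 0" if t: "t \<in> S" for t x
  proof -
    \<comment> \<open>The base point is set to 0, since \<open>mt\<close> sees only the matrix part
      of a line element.\<close>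
    have h: "((\<lambda>s. le 0 (c' s)) has_vector_derivative (emb 0 + vert (c' t) (vector_derivative c' (at t)))) (at t)"
      by (rule le_has_vector_derivative[OF has_vector_derivative_const smooth_hvd[OF S(3,1) t] nz[OF t]])
    have "((\<lambda>s. base_pt (mt (le 0 (c' s)) x)) has_vector_derivative base_pt (mt (emb 0 + vert (c' t) (vector_derivative c' (at t))) x)) (at t)"
      by (rule bounded_linear.has_vector_derivative[OF blin h])
    moreover have "((\<lambda>s. base_pt (mt (le 0 (c' s)) x)) has_vector_derivative 0) (at t)"
      by (rule has_vector_derivative_transform_within_open[OF has_vector_derivative_const[of 0] S(1) t]) (simp add: mt_le v)
    ultimately have "base_pt (mt (emb 0 + vert (c' t) (vector_derivative c' (at t))) x) = 0" by (rule vector_derivative_unique_at)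
    then show ?thesis by (simp add: ld_def)
  qed
  then show "base_pt (mt (ld c' 0) x) = 0" using S(2) by blast
  have nz2: "ld c' t \<noteq> 0" if "t \<in> S" for t using nz[OF that] base_pt_ld[of c' t] by (metis base_pt_simps(4))
  have sm2: "smooth S (ld c')" by (intro smooth_ld S nz)
  have blin2: "bounded_linear (\<lambda>q. base_pt (mt (mt q y) x))"
    by (intro bounded_linear_compose[OF blin] bounded_bilinear.bounded_linear_left[OF bounded_bilinear_mt])
  have h: "((\<lambda>s. le 0 (ld c' s)) has_vector_derivative (emb 0 + vert (ld c' 0) (vector_derivative (ld c') (at 0)))) (at 0)"
    by (rule le_has_vector_derivative[OF has_vector_derivative_const smooth_hvd[OF sm2 S(1,2)] nz2[OF S(2)]])
  have "((\<lambda>s. base_pt (mt (mt (le 0 (ld c' s)) y) x)) has_vector_derivative base_pt (mt (mt (emb 0 + vert (ld c' 0) (vector_derivative (ld c') (at 0))) y) x)) (at 0)"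
    by (rule bounded_linear.has_vector_derivative[OF blin2 h])
  moreover have "((\<lambda>s. base_pt (mt (mt (le 0 (ld c' s)) y) x)) has_vector_derivative 0) (at 0)"
    by (rule has_vector_derivative_transform_within_open[OF has_vector_derivative_const[of 0] S(1,2)]) (simp add: mt_le z)
  ultimately have "base_pt (mt (mt (emb 0 + vert (ld c' 0) (vector_derivative (ld c') (at 0))) y) x) = 0" by (rule vector_derivative_unique_at)
  then show "base_pt (mt (mt (ld (ld c') 0) y) x) = 0" by (simp add: ld_def[of "ld c'"])
qed

lemma fiber_icurve:
  assumes reg: "regular Z \<Delta>" and p: "p \<in> Z" and S: "open S" "0 \<in> S" and sm: "smooth S u" "smooth S u'"
    and u: "\<And>t. t \<in> S \<Longrightarrow> u t \<in> \<Delta> p" "\<And>t. t \<in> S \<Longrightarrow> u' t \<in> \<Delta> p" "\<And>t. t \<in> S \<Longrightarrow> ind2 (u t) (u' t)"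
    and d: "\<And>t. t \<in> S \<Longrightarrow> (u has_vector_derivative u' t) (at t)"
  shows "icurve (prol_space Z \<Delta>) (prol_dist Z \<Delta>) S (\<lambda>t. le p (u t)) (\<lambda>t. vert (u t) (u' t))"
  unfolding icurve_def
proof (intro conjI ballI S)
  have nz: "u t \<noteq> 0" if "t \<in> S" for t using ind2_nz[OF u(3)[OF that], of 0] by simp
  show "smooth S (\<lambda>t. vert (u t) (u' t))" by (intro smooth_intros sm S nz)
  fix t assume t: "t \<in> S"
  show "le p (u t) \<in> prol_space Z \<Delta>" by (rule le_mem_prol[OF reg p u(1)[OF t] nz[OF t]])
  show "vert (u t) (u' t) \<in> prol_dist Z \<Delta> (le p (u t))" by (rule vert_mem[OF reg p u(1)[OF t] nz[OF t] u(2)[OF t]])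
  show "vert (u t) (u' t) \<noteq> 0" using fl'_nz[OF u(3)[OF t], of 0] by (simp add: fl'_def)
  show "((\<lambda>t. le p (u t)) has_vector_derivative vert (u t) (u' t)) (at t)"
    using le_has_vector_derivative[OF has_vector_derivative_const[of p] d[OF t] nz[OF t]] by (simp add: emb_simps)
qed

section \<open>Stabilizers of line elements, and curves together with their images\<close>

context level begin

lemma fixI:
  assumes "sdiff U \<Phi>" "m \<in> Z" "\<pi> m \<in> U" "v \<in> \<Delta> m" "v \<noteq> 0" "lift \<Phi> m = m" "dr Z (lift \<Phi>) m v = k *\<^sub>R v" "k \<noteq> 0"
  shows "prol_map Z (lift \<Phi>) (le m v) = le m v"
  using prol_map_lift[OF assms(1-5)] assms(6-8) by simp

lemma fixE:
  assumes "sdiff U \<Phi>" "m \<in> Z" "\<pi> m \<in> U" "v \<in> \<Delta> m" "v \<noteq> 0" "prol_map Z (lift \<Phi>) (le m v) = le m v"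
  obtains k where "lift \<Phi> m = m" "k \<noteq> 0" "dr Z (lift \<Phi>) m v = k *\<^sub>R v"
  using le_eqD[OF assms(6)[unfolded prol_map_lift[OF assms(1-5)]] dr_nz[OF assms(1-5)] assms(5)] by metis

lemma dr_vert:
  assumes "sdiff U \<Phi>" "m \<in> Z" "\<pi> m \<in> U" "u \<in> \<Delta> m" "u \<noteq> 0" "v \<in> \<Delta> m"
  shows "dr (prol_space Z \<Delta>) (prol_map Z (lift \<Phi>)) (le m u) (vert u v) = vert (dr Z (lift \<Phi>) m u) (dr Z (lift \<Phi>) m v)"
  by (rule dr_prol_vert[OF reg morph[OF assms(1)] _ assms(4-6)]) (use assms in simp)

text \<open>The differential covers the action on u, which forces the coefficient of x to be the
  eigenvalue k; what is left over is vertical.\<close>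

lemma lift_act:
  assumes \<Phi>: "sdiff U \<Phi>" "m \<in> Z" "\<pi> m \<in> U" and B: "basis3 (\<Delta> m) u v w"
    and x: "x \<in> prol_dist Z \<Delta> (le m u)" "base_pt x = u"
    and A: "lift \<Phi> m = m" "dr Z (lift \<Phi>) m u = k *\<^sub>R u" "k \<noteq> 0"
  obtains n n' where "dr (prol_space Z \<Delta>) (prol_map Z (lift \<Phi>)) (le m u) x = k *\<^sub>R x + n *\<^sub>R vert u v + n' *\<^sub>R vert u w"
proof -
  interpret L1: level "prol_space Z \<Delta>" "prol_dist Z \<Delta>" "\<pi> \<circ> base_pt" "\<lambda>\<Phi>. prol_map Z (lift \<Phi>)" by (rule prolong)
  note u = basis3_mems[OF B]
  have Q: "le m u \<in> prol_space Z \<Delta>" by (rule le_mem_prol[OF reg \<Phi>(2) u(1,4)])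
  have fx: "prol_map Z (lift \<Phi>) (le m u) = le m u" by (rule fixI[OF \<Phi> u(1,4) A])
  have "dr (prol_space Z \<Delta>) (prol_map Z (lift \<Phi>)) (le m u) x \<in> prol_dist Z \<Delta> (le m u)"
    using L1.dr_mem[OF \<Phi>(1) Q _ x(1)] \<Phi>(3) fx by simp
  from basis3_coords[OF basis3_prol[OF reg \<Phi>(2) B x] this] obtain a b c
    where e: "dr (prol_space Z \<Delta>) (prol_map Z (lift \<Phi>)) (le m u) x = a *\<^sub>R x + b *\<^sub>R vert u v + c *\<^sub>R vert u w" .
  have "base_pt (dr (prol_space Z \<Delta>) (prol_map Z (lift \<Phi>)) (le m u) x) = k *\<^sub>R u"
    using dr_prol_base[OF reg morph[OF \<Phi>(1)], of "le m u" x] Q \<Phi>(2,3) x A(2)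
    by (simp add: over_def prol_dist_def)
  then have "(a - k) *\<^sub>R u = 0" unfolding e by (simp add: x(2) algebra_simps)
  then have "a = k" using u(4) by simp
  then show thesis using that e by blast
qed

end

text \<open>The image curve h is recorded with its velocity h' only; that h' does not vanish and
  that its line elements are the images of those of g follows in \<open>imap_dr\<close>.\<close>

definition imap :: "(real^'n) set \<Rightarrow> (real^'n \<Rightarrow> (real^'n) set) \<Rightarrow> (real^'n \<Rightarrow> real^3) \<Rightarrow> (real^'n \<Rightarrow> real^'n) \<Rightarrow> (real^3) set \<Rightarrow>
    real set \<Rightarrow> (real \<Rightarrow> real^'n) \<Rightarrow> (real \<Rightarrow> real^'n) \<Rightarrow> (real \<Rightarrow> real^'n) \<Rightarrow> (real \<Rightarrow> real^'n) \<Rightarrow> bool" where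
  "imap Z \<Delta> \<pi> f G S g g' h h' \<longleftrightarrow> icurve Z \<Delta> S g g' \<and> smooth S h' \<and>
     (\<forall>t\<in>S. \<pi> (g t) \<in> G \<and> f (g t) = h t \<and> (h has_vector_derivative h' t) (at t))"

lemma (in level) imap_dr:
  assumes \<Phi>: "sdiff G \<Phi>" and i: "imap Z \<Delta> \<pi> (lift \<Phi>) G S g g' h h'" and t: "t \<in> S"
  shows "dr Z (lift \<Phi>) (g t) (g' t) = h' t" "h' t \<noteq> 0" "prol_map Z (lift \<Phi>) (lc g g' t) = lc h h' t"
proof -
  have ic: "icurve Z \<Delta> S g g'" and \<pi>: "\<pi> (g t) \<in> G" and h: "\<And>s. s \<in> S \<Longrightarrow> lift \<Phi> (g s) = h s" "(h has_vector_derivative h' t) (at t)"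
    using i t unfolding imap_def by blast+
  note d = icurveD[OF ic t]
  have gS: "g t \<in> {q \<in> Z. \<pi> q \<in> G}" using d(1) \<pi> by simp
  show 1: "dr Z (lift \<Phi>) (g t) (g' t) = h' t"
    by (rule curve_morph_prol(1)[OF morph[OF \<Phi>] ic t gS h])
  show "h' t \<noteq> 0" unfolding 1[symmetric] by (rule dr_nz[OF \<Phi> d(1) \<pi> d(2,3)])
  show "prol_map Z (lift \<Phi>) (lc g g' t) = lc h h' t"
    unfolding lc_def[of h] by (rule curve_morph_prol(2)[OF morph[OF \<Phi>] ic t gS h])
qed

lemma (in level) imap_lift:
  assumes \<Phi>: "sdiff G \<Phi>" and i: "imap Z \<Delta> \<pi> (lift \<Phi>) G S g g' h h'"
  shows "imap (prol_space Z \<Delta>) (prol_dist Z \<Delta>) (\<pi> \<circ> base_pt) (prol_map Z (lift \<Phi>)) G S (lc g g') (ld g') (lc h h') (ld h')"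
  unfolding imap_def
proof (intro conjI ballI)
  have ic: "icurve Z \<Delta> S g g'" and sm: "smooth S h'" using i unfolding imap_def by blast+
  have S: "open S" using ic unfolding icurve_def by blast
  show "icurve (prol_space Z \<Delta>) (prol_dist Z \<Delta>) S (lc g g') (ld g')" by (rule icurve_lift[OF reg ic])
  show "smooth S (ld h')" by (intro smooth_ld sm S imap_dr(2)[OF \<Phi> i])
  fix t assume t: "t \<in> S"
  show "(\<pi> \<circ> base_pt) (lc g g' t) \<in> G" using i t by (simp add: imap_def)
  show "prol_map Z (lift \<Phi>) (lc g g' t) = lc h h' t" by (rule imap_dr(3)[OF \<Phi> i t])
  show "(lc h h' has_vector_derivative ld h' t) (at t)"
    by (rule lc_hvd[OF sm S t _ imap_dr(2)[OF \<Phi> i t]]) (use i t in \<open>simp add: imap_def\<close>)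
qed

text \<open>The velocity of the curve \<open>\<lambda>t. le p (w t)\<close> in a fiber; it does not depend on \<open>p\<close>.\<close>
definition fc' :: "(real \<Rightarrow> real^'n) \<Rightarrow> real \<Rightarrow> real^('n prol)" where
  "fc' w t = vert (w t) (vector_derivative w (at t))"

lemma pert_fc:
  assumes "open S" "0 \<in> S" "smooth S u" "smooth S w" "smooth S h"
    "\<And>t. t \<in> S \<Longrightarrow> u t \<noteq> 0" "\<And>t. t \<in> S \<Longrightarrow> w t \<noteq> 0"
    and w: "\<And>t. t \<in> S \<Longrightarrow> w t = u t + t ^ Suc m *\<^sub>R h t"
  shows "\<exists>H. smooth S H \<and> H 0 = real (Suc m) *\<^sub>R vert (u 0) (h 0) \<and> (\<forall>t\<in>S. fc' w t = fc' u t + t ^ m *\<^sub>R H t)"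
  using pert[of S u w h "\<lambda>t. 0" m "\<lambda>t. 0" "\<lambda>t. 0", OF assms(1-5) smooth_const assms(6,7) w]
  unfolding fc'_def by (simp add: emb_simps)

lemma fc_hvd:
  assumes "smooth S w" "open S" "t \<in> S" "w t \<noteq> 0"
  shows "((\<lambda>t. le p (w t)) has_vector_derivative fc' w t) (at t)"
  using le_has_vector_derivative[OF has_vector_derivative_const[of p] smooth_hvd[OF assms(1-3)] assms(4)]
  by (simp add: fc'_def emb_simps)

lemma smooth_fc: "smooth S w \<Longrightarrow> open S \<Longrightarrow> (\<And>t. t \<in> S \<Longrightarrow> w t \<noteq> 0) \<Longrightarrow> smooth S (fc' w)"
  unfolding fc'_def[abs_def] by (intro smooth_intros smooth_vd)

lemma base_pt_fc [simp]: "base_pt (fc' w t) = 0"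
  by (simp add: fc'_def)

text \<open>The tower over \<open>q\<close> has the regular direction \<open>X\<close> and the vertical directions \<open>U\<close>, \<open>V\<close> at the point
  \<open>Q\<close>. Over \<open>Q\<close>, the point \<open>R\<close> given by \<open>U\<close> carries the vertical directions \<open>W\<close>, \<open>Y\<close> and the direction
  \<open>D\<close> in which the fiber line through \<open>Q\<close> with direction \<open>U\<close> is prolonged.\<close>
locale vn = level Z \<Delta> \<pi> lift
  for Z :: "(real^'n) set" and \<Delta> and \<pi> :: "real^'n \<Rightarrow> real^3" and lift :: "(real^3 \<Rightarrow> real^3) \<Rightarrow> real^'n \<Rightarrow> real^'n" +
  fixes q \<xi> \<eta> \<zeta> :: "real^'n" and X :: "real^('n prol)"
  assumes qZ: "q \<in> Z" and B: "basis3 (\<Delta> q) \<xi> \<eta> \<zeta>"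
    and X: "X \<in> prol_dist Z \<Delta> (le q \<xi>)" "base_pt X = \<xi>"
    and shear: "\<And>k l. \<exists>\<Phi>. polyaut \<Phi> \<and> lift \<Phi> q = q \<and> dr Z (lift \<Phi>) q \<xi> = \<xi> \<and> dr Z (lift \<Phi>) q \<eta> = \<eta> \<and> dr Z (lift \<Phi>) q \<zeta> = \<zeta> \<and>
      dr (prol_space Z \<Delta>) (prol_map Z (lift \<Phi>)) (le q \<xi>) X = X + k *\<^sub>R vert \<xi> \<eta> + l *\<^sub>R vert \<xi> \<zeta>"
    and torus: "\<And>a b c. a \<noteq> 0 \<Longrightarrow> b \<noteq> 0 \<Longrightarrow> c \<noteq> 0 \<Longrightarrow> \<exists>\<Phi>. polyaut \<Phi> \<and> lift \<Phi> q = q \<and> dr Z (lift \<Phi>) q \<xi> = a *\<^sub>R \<xi> \<and>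
      dr Z (lift \<Phi>) q \<eta> = b *\<^sub>R \<eta> \<and> dr Z (lift \<Phi>) q \<zeta> = c *\<^sub>R \<zeta> \<and>
      dr (prol_space Z \<Delta>) (prol_map Z (lift \<Phi>)) (le q \<xi>) X = a *\<^sub>R X"
    and gl: "\<And>b c. (b, c) \<noteq> (0, 0) \<Longrightarrow> \<exists>\<Phi>. polyaut \<Phi> \<and> lift \<Phi> q = q \<and> dr Z (lift \<Phi>) q \<xi> = \<xi> \<and>
      dr Z (lift \<Phi>) q (b *\<^sub>R \<eta> + c *\<^sub>R \<zeta>) = \<eta>"
begin

abbreviation "Z1 \<equiv> prol_space Z \<Delta>"
abbreviation "D1 \<equiv> prol_dist Z \<Delta>"
abbreviation "f1 \<equiv> (\<lambda>\<Phi>. prol_map Z (lift \<Phi>))"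
abbreviation "Z2 \<equiv> prol_space Z1 D1"
abbreviation "D2 \<equiv> prol_dist Z1 D1"
abbreviation "f2 \<equiv> (\<lambda>\<Phi>. prol_map Z1 (f1 \<Phi>))"
abbreviation "Z3 \<equiv> prol_space Z2 D2"
abbreviation "D3 \<equiv> prol_dist Z2 D2"
abbreviation "f3 \<equiv> (\<lambda>\<Phi>. prol_map Z2 (f2 \<Phi>))"
abbreviation "Q \<equiv> le q \<xi>"
abbreviation "U \<equiv> vert \<xi> \<eta>"
abbreviation "V \<equiv> vert \<xi> \<zeta>"
abbreviation "R \<equiv> le Q U"
abbreviation "D \<equiv> ld (fl' \<xi> \<eta>) 0"
abbreviation "W \<equiv> vert U X"
abbreviation "Y \<equiv> vert U V"

interpretation L1: level Z1 D1 "\<pi> \<circ> base_pt" f1 by (rule prolong)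
interpretation L2: level Z2 D2 "\<pi> \<circ> base_pt \<circ> base_pt" f2 by (rule L1.prolong)
interpretation L3: level Z3 D3 "\<pi> \<circ> base_pt \<circ> base_pt \<circ> base_pt" f3 by (rule L2.prolong)

lemmas Bm = basis3_mems[OF B]

lemma Q: "Q \<in> Z1" by (rule le_mem_prol[OF reg qZ Bm(1,4)])
lemma B1: "basis3 (D1 Q) X U V" by (rule basis3_prol[OF reg qZ B X])
lemmas B1m = basis3_mems[OF B1]
lemma R: "R \<in> Z2" by (rule le_mem_prol[OF L1.reg Q B1m(2,5)])

lemma line1: "icurve Z1 D1 UNIV (fl q \<xi> \<eta>) (fl' \<xi> \<eta>)"
  by (rule fl_icurve[OF reg qZ Bm(1,2) basis3_ind2(1)[OF B]])
lemma line2: "icurve Z2 D2 UNIV (lc (fl q \<xi> \<eta>) (fl' \<xi> \<eta>)) (ld (fl' \<xi> \<eta>))"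
  by (rule icurve_lift[OF L1.reg line1])
lemma line2_0: "lc (fl q \<xi> \<eta>) (fl' \<xi> \<eta>) 0 = R"
  by (simp add: lc_def fl_0)
lemma D: "D \<in> D2 R" "base_pt D = U"
  using icurveD(2)[OF line2 UNIV_I, of 0] by (simp_all add: line2_0 fl_0)
lemma B2: "basis3 (D2 R) D W Y"
  by (rule basis3_prol[OF L1.reg Q basis3_swap12[OF B1] D])
lemmas B2m = basis3_mems[OF B2]

text \<open>The action of a symmetry on the three distributions is determined by its action at \<open>q\<close> and on \<open>X\<close>.\<close>
lemma main_act:
  assumes \<Phi>: "sdiff G \<Phi>" "\<pi> q \<in> G" "lift \<Phi> q = q"
    and A: "dr Z (lift \<Phi>) q \<xi> = l *\<^sub>R \<xi>" "l \<noteq> 0" "dr Z (lift \<Phi>) q \<eta> = b *\<^sub>R \<eta> + k *\<^sub>R \<xi>" "b \<noteq> 0"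
      "dr Z (lift \<Phi>) q \<zeta> = a' *\<^sub>R \<xi> + b' *\<^sub>R \<eta> + c' *\<^sub>R \<zeta>"
    and A1: "dr Z1 (f1 \<Phi>) Q X = l *\<^sub>R X + n *\<^sub>R U + n' *\<^sub>R V"
  shows "f1 \<Phi> Q = Q" "dr Z1 (f1 \<Phi>) Q U = (b / l) *\<^sub>R U" "dr Z1 (f1 \<Phi>) Q V = (c' / l) *\<^sub>R V + (b' / l) *\<^sub>R U"
    "f2 \<Phi> R = R" "dr Z2 (f2 \<Phi>) R D = (b / l) *\<^sub>R D"
    "dr Z2 (f2 \<Phi>) R W = (l * l / b) *\<^sub>R W + (n' * l / b) *\<^sub>R Y" "dr Z2 (f2 \<Phi>) R Y = (c' / b) *\<^sub>R Y"
    "dr Z3 (f3 \<Phi>) (le R D) (ld (ld (fl' \<xi> \<eta>)) 0) = (b / l) *\<^sub>R ld (ld (fl' \<xi> \<eta>)) 0"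
proof -
  show 1: "f1 \<Phi> Q = Q" by (rule fixI[OF \<Phi>(1) qZ \<Phi>(2) Bm(1,4) \<Phi>(3) A(1,2)])
  have v: "dr Z1 (f1 \<Phi>) Q (vert \<xi> x) = (1 / l) *\<^sub>R vert \<xi> (dr Z (lift \<Phi>) q x)" if "x \<in> \<Delta> q" for x
    using dr_vert[OF \<Phi>(1) qZ \<Phi>(2) Bm(1,4) that] A(2) by (simp add: A(1) vert_scale_left)
  show U: "dr Z1 (f1 \<Phi>) Q U = (b / l) *\<^sub>R U" unfolding v[OF Bm(2)] A(3) by (simp add: vert_simps)
  show V: "dr Z1 (f1 \<Phi>) Q V = (c' / l) *\<^sub>R V + (b' / l) *\<^sub>R U"
    unfolding v[OF Bm(3)] A(5) by (simp add: vert_simps scaleR_add_right add.commute)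
  have nz: "b / l \<noteq> 0" using A by simp
  have \<pi>Q: "(\<pi> \<circ> base_pt) Q \<in> G" using \<Phi>(2) by simp
  show 2: "f2 \<Phi> R = R" by (rule L1.fixI[OF \<Phi>(1) Q \<pi>Q B1m(2,5) 1 U nz])
  have v2: "dr Z2 (f2 \<Phi>) R (vert U x) = (l / b) *\<^sub>R vert U (dr Z1 (f1 \<Phi>) Q x)" if "x \<in> D1 Q" for x
    using L1.dr_vert[OF \<Phi>(1) Q \<pi>Q B1m(2,5) that] nz by (simp add: U vert_scale_left)
  \<comment> \<open>\<open>vert U\<close> kills U, so of the two shear coefficients of X only n' is
    visible here.\<close>
  show "dr Z2 (f2 \<Phi>) R W = (l * l / b) *\<^sub>R W + (n' * l / b) *\<^sub>R Y"
    unfolding v2[OF B1m(1)] A1 by (simp add: vert_simps scaleR_add_right mult.commute)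
  show "dr Z2 (f2 \<Phi>) R Y = (c' / b) *\<^sub>R Y"
    unfolding v2[OF B1m(3)] V using A by (simp add: vert_simps)
  have qS: "q \<in> {q \<in> Z. \<pi> q \<in> G}" using qZ \<Phi>(2) by simp
  note fl = fl_lifts[OF reg morph[OF \<Phi>(1)] qS \<Phi>(3) Bm(1,2) basis3_ind2(1)[OF B] A(1,3,2,4)]
  show "dr Z2 (f2 \<Phi>) R D = (b / l) *\<^sub>R D" using fl(1) unfolding line2_0 .
  show "dr Z3 (f3 \<Phi>) (le R D) (ld (ld (fl' \<xi> \<eta>)) 0) = (b / l) *\<^sub>R ld (ld (fl' \<xi> \<eta>)) 0"
    using fl(2) unfolding lc_def[of "lc _ _"] line2_0 .
qed

text \<open>Unwinding the tower: fixing R makes U an eigenvector and fixing Q makes \<xi> one. As U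
  = \<open>vert \<xi> \<eta>\<close> determines \<eta> only modulo \<xi>, a multiple k of \<xi>
  remains free.\<close>

lemma gen_act:
  assumes \<Phi>: "sdiff G \<Phi>" "(\<pi> \<circ> base_pt \<circ> base_pt) R \<in> G" "f2 \<Phi> R = R"
  obtains l b k a' b' c' n n' where "\<pi> q \<in> G" "lift \<Phi> q = q" "dr Z (lift \<Phi>) q \<xi> = l *\<^sub>R \<xi>" "l \<noteq> 0"
    "dr Z (lift \<Phi>) q \<eta> = b *\<^sub>R \<eta> + k *\<^sub>R \<xi>" "b \<noteq> 0" "dr Z (lift \<Phi>) q \<zeta> = a' *\<^sub>R \<xi> + b' *\<^sub>R \<eta> + c' *\<^sub>R \<zeta>"
    "dr Z1 (f1 \<Phi>) Q X = l *\<^sub>R X + n *\<^sub>R U + n' *\<^sub>R V"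
proof -
  have \<pi>q: "\<pi> q \<in> G" and \<pi>Q: "(\<pi> \<circ> base_pt) Q \<in> G" using \<Phi>(2) by simp_all
  obtain \<mu> where \<mu>: "f1 \<Phi> Q = Q" "\<mu> \<noteq> 0" "dr Z1 (f1 \<Phi>) Q U = \<mu> *\<^sub>R U"
    using L1.fixE[OF \<Phi>(1) Q \<pi>Q B1m(2,5) \<Phi>(3)] .
  obtain l where l: "lift \<Phi> q = q" "l \<noteq> 0" "dr Z (lift \<Phi>) q \<xi> = l *\<^sub>R \<xi>"
    using fixE[OF \<Phi>(1) qZ \<pi>q Bm(1,4) \<mu>(1)] .
  have "(1 / l) *\<^sub>R vert \<xi> (dr Z (lift \<Phi>) q \<eta>) = \<mu> *\<^sub>R vert \<xi> \<eta>"
    using dr_vert[OF \<Phi>(1) qZ \<pi>q Bm(1,4,2)] \<mu>(3) l by (simp add: vert_scale_left)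
  then have "l *\<^sub>R ((1 / l) *\<^sub>R vert \<xi> (dr Z (lift \<Phi>) q \<eta>)) = l *\<^sub>R (\<mu> *\<^sub>R vert \<xi> \<eta>)" by simp
  then have "vert \<xi> (dr Z (lift \<Phi>) q \<eta> - (l * \<mu>) *\<^sub>R \<eta>) = 0" using l(2) by (simp add: vert_simps)
  from vert_eq_0D[OF this Bm(4)] obtain k where k: "dr Z (lift \<Phi>) q \<eta> - (l * \<mu>) *\<^sub>R \<eta> = k *\<^sub>R \<xi>" by blast
  then have e: "dr Z (lift \<Phi>) q \<eta> = (l * \<mu>) *\<^sub>R \<eta> + k *\<^sub>R \<xi>" by (simp add: algebra_simps)
  have "dr Z (lift \<Phi>) q \<zeta> \<in> \<Delta> q" using dr_mem[OF \<Phi>(1) qZ \<pi>q Bm(3)] l(1) by simp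
  from basis3_coords[OF B this] obtain a' b' c' where z: "dr Z (lift \<Phi>) q \<zeta> = a' *\<^sub>R \<xi> + b' *\<^sub>R \<eta> + c' *\<^sub>R \<zeta>" .
  obtain n n' where "dr Z1 (f1 \<Phi>) Q X = l *\<^sub>R X + n *\<^sub>R U + n' *\<^sub>R V"
    using lift_act[OF \<Phi>(1) qZ \<pi>q B X l(1,3,2)] .
  then show thesis using that[OF \<pi>q l(1,3,2) e _ z] l(2) \<mu>(2) by simp
qed

theorem reg_node1:
  "node Z1 D1 (\<pi> \<circ> base_pt) f1 Q (cmb X U V ` {(1,0,0), (0,1,0)})" "card (cmb X U V ` {(1,0,0), (0,1,0)}) = 2"
proof -
  have act: "\<exists>\<mu> p r b c. dr Z1 (f1 \<Phi>) Q X = \<mu> *\<^sub>R X + p *\<^sub>R U + r *\<^sub>R V \<and> \<mu> \<noteq> 0 \<and> dr Z1 (f1 \<Phi>) Q U = b *\<^sub>R U + c *\<^sub>R V"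
    if \<Phi>: "sdiff G \<Phi>" "(\<pi> \<circ> base_pt) Q \<in> G" "f1 \<Phi> Q = Q" for G \<Phi>
  proof -
    have \<pi>q: "\<pi> q \<in> G" using \<Phi>(2) by simp
    obtain l where l: "lift \<Phi> q = q" "l \<noteq> 0" "dr Z (lift \<Phi>) q \<xi> = l *\<^sub>R \<xi>" using fixE[OF \<Phi>(1) qZ \<pi>q Bm(1,4) \<Phi>(3)] .
    obtain n n' where n: "dr Z1 (f1 \<Phi>) Q X = l *\<^sub>R X + n *\<^sub>R U + n' *\<^sub>R V" using lift_act[OF \<Phi>(1) qZ \<pi>q B X l(1,3,2)] .
    have "dr Z (lift \<Phi>) q \<eta> \<in> \<Delta> q" using dr_mem[OF \<Phi>(1) qZ \<pi>q Bm(2)] l(1) by simp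
    from basis3_coords[OF B this] obtain a b c where "dr Z (lift \<Phi>) q \<eta> = a *\<^sub>R \<xi> + b *\<^sub>R \<eta> + c *\<^sub>R \<zeta>" .
    then have "dr Z1 (f1 \<Phi>) Q U = (b / l) *\<^sub>R U + (c / l) *\<^sub>R V"
      using dr_vert[OF \<Phi>(1) qZ \<pi>q Bm(1,4,2)] l by (simp add: vert_scale_left vert_simps scaleR_add_right)
    then show ?thesis using n l(2) by blast
  qed
  have vt: "dr Z1 (f1 \<Phi>) Q (vert \<xi> x) = vert \<xi> (dr Z (lift \<Phi>) q x)"
    if "polyaut \<Phi>" "dr Z (lift \<Phi>) q \<xi> = \<xi>" "x \<in> \<Delta> q" for \<Phi> x
    using dr_vert[OF polyaut_sdiff[OF that(1)] qZ UNIV_I Bm(1,4) that(3)] that(2) by simp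
  have fx: "f1 \<Phi> Q = Q" if "polyaut \<Phi>" "lift \<Phi> q = q" "dr Z (lift \<Phi>) q \<xi> = \<xi>" for \<Phi>
    by (rule fixI[OF polyaut_sdiff[OF that(1)] qZ UNIV_I Bm(1,4) that(2), of 1]) (simp_all add: that(3))
  have shr: "\<exists>\<Phi>. polyaut \<Phi> \<and> f1 \<Phi> Q = Q \<and> dr Z1 (f1 \<Phi>) Q X = X + p *\<^sub>R U + r *\<^sub>R V \<and> dr Z1 (f1 \<Phi>) Q U = U \<and> dr Z1 (f1 \<Phi>) Q V = V" for p r
  proof -
    obtain \<Phi> where \<Phi>: "polyaut \<Phi>" "lift \<Phi> q = q" "dr Z (lift \<Phi>) q \<xi> = \<xi>" "dr Z (lift \<Phi>) q \<eta> = \<eta>" "dr Z (lift \<Phi>) q \<zeta> = \<zeta>"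
      "dr Z1 (f1 \<Phi>) Q X = X + p *\<^sub>R U + r *\<^sub>R V" using shear[of p r] by blast
    show ?thesis using fx[OF \<Phi>(1-3)] vt[OF \<Phi>(1,3) Bm(2)] vt[OF \<Phi>(1,3) Bm(3)] \<Phi> by auto
  qed
  have gl1: "\<exists>\<Phi>. polyaut \<Phi> \<and> f1 \<Phi> Q = Q \<and> dr Z1 (f1 \<Phi>) Q (b *\<^sub>R U + c *\<^sub>R V) = U" if bc: "(b, c) \<noteq> (0, 0)" for b c
  proof -
    obtain \<Phi> where \<Phi>: "polyaut \<Phi>" "lift \<Phi> q = q" "dr Z (lift \<Phi>) q \<xi> = \<xi>" "dr Z (lift \<Phi>) q (b *\<^sub>R \<eta> + c *\<^sub>R \<zeta>) = \<eta>"
      using gl[OF bc] by blast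
    have "0 *\<^sub>R \<xi> + b *\<^sub>R \<eta> + c *\<^sub>R \<zeta> \<in> \<Delta> q" by (rule basis3_mem[OF B])
    then show ?thesis using fx[OF \<Phi>(1-3)] vt[OF \<Phi>(1,3), of "b *\<^sub>R \<eta> + c *\<^sub>R \<zeta>"] \<Phi> by (auto simp: vert_simps)
  qed
  show "node Z1 D1 (\<pi> \<circ> base_pt) f1 Q (cmb X U V ` {(1,0,0), (0,1,0)})"
    by (rule L1.reg_node(1)[OF Q B1 act shr gl1])
  show "card (cmb X U V ` {(1,0,0), (0,1,0)}) = 2"
    by (rule L1.reg_node(2)[OF Q B1 act shr gl1])
qed

text \<open>\<open>vert\<close> takes quotients of weights: U and V have the weights b / a and c /
  a, hence W has a / (b / a) and Y has c / b.\<close>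

lemma torus_act:
  assumes "a \<noteq> 0" "b \<noteq> 0" "c \<noteq> 0"
  obtains \<Phi> where "polyaut \<Phi>" "lift \<Phi> q = q" "dr Z (lift \<Phi>) q \<xi> = a *\<^sub>R \<xi>" "dr Z (lift \<Phi>) q \<eta> = b *\<^sub>R \<eta>" "dr Z (lift \<Phi>) q \<zeta> = c *\<^sub>R \<zeta>"
    "dr Z1 (f1 \<Phi>) Q X = a *\<^sub>R X" "f1 \<Phi> Q = Q" "dr Z1 (f1 \<Phi>) Q U = (b / a) *\<^sub>R U" "dr Z1 (f1 \<Phi>) Q V = (c / a) *\<^sub>R V"
    "f2 \<Phi> R = R" "dr Z2 (f2 \<Phi>) R D = (b / a) *\<^sub>R D"
    "dr Z2 (f2 \<Phi>) R W = (a * a / b) *\<^sub>R W" "dr Z2 (f2 \<Phi>) R Y = (c / b) *\<^sub>R Y"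
    "dr Z3 (f3 \<Phi>) (le R D) (ld (ld (fl' \<xi> \<eta>)) 0) = (b / a) *\<^sub>R ld (ld (fl' \<xi> \<eta>)) 0"
proof -
  obtain \<Phi> where \<Phi>: "polyaut \<Phi>" "lift \<Phi> q = q" "dr Z (lift \<Phi>) q \<xi> = a *\<^sub>R \<xi>" "dr Z (lift \<Phi>) q \<eta> = b *\<^sub>R \<eta>" "dr Z (lift \<Phi>) q \<zeta> = c *\<^sub>R \<zeta>"
    "dr Z1 (f1 \<Phi>) Q X = a *\<^sub>R X" using torus[OF assms] by blast
  have "dr Z (lift \<Phi>) q \<eta> = b *\<^sub>R \<eta> + 0 *\<^sub>R \<xi>" "dr Z (lift \<Phi>) q \<zeta> = 0 *\<^sub>R \<xi> + 0 *\<^sub>R \<eta> + c *\<^sub>R \<zeta>"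
    "dr Z1 (f1 \<Phi>) Q X = a *\<^sub>R X + 0 *\<^sub>R U + 0 *\<^sub>R V" using \<Phi> by simp_all
  from main_act[OF polyaut_sdiff[OF \<Phi>(1)] UNIV_I \<Phi>(2,3) assms(1) this(1) assms(2) this(2,3)] \<Phi>
  show thesis by (intro that[of \<Phi>]) simp_all
qed

text \<open>Of the shears of X only the one along V is used, since \<open>vert U\<close> does not
  see the one along U.\<close>

lemma shear_act:
  obtains \<Phi> where "polyaut \<Phi>" "lift \<Phi> q = q" "dr Z (lift \<Phi>) q \<xi> = \<xi>" "dr Z (lift \<Phi>) q \<eta> = \<eta>" "dr Z (lift \<Phi>) q \<zeta> = \<zeta>"
    "f1 \<Phi> Q = Q" "dr Z1 (f1 \<Phi>) Q U = U" "dr Z1 (f1 \<Phi>) Q V = V" "f2 \<Phi> R = R" "dr Z2 (f2 \<Phi>) R D = D"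
    "dr Z2 (f2 \<Phi>) R W = W + \<nu> *\<^sub>R Y" "dr Z2 (f2 \<Phi>) R Y = Y"
    "dr Z3 (f3 \<Phi>) (le R D) (ld (ld (fl' \<xi> \<eta>)) 0) = ld (ld (fl' \<xi> \<eta>)) 0"
proof -
  obtain \<Phi> where \<Phi>: "polyaut \<Phi>" "lift \<Phi> q = q" "dr Z (lift \<Phi>) q \<xi> = \<xi>" "dr Z (lift \<Phi>) q \<eta> = \<eta>" "dr Z (lift \<Phi>) q \<zeta> = \<zeta>"
    "dr Z1 (f1 \<Phi>) Q X = X + 0 *\<^sub>R U + \<nu> *\<^sub>R V" using shear[of 0 \<nu>] by blast
  have "dr Z (lift \<Phi>) q \<xi> = 1 *\<^sub>R \<xi>" "dr Z (lift \<Phi>) q \<eta> = 1 *\<^sub>R \<eta> + 0 *\<^sub>R \<xi>" "dr Z (lift \<Phi>) q \<zeta> = 0 *\<^sub>R \<xi> + 0 *\<^sub>R \<eta> + 1 *\<^sub>R \<zeta>"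
    "dr Z1 (f1 \<Phi>) Q X = 1 *\<^sub>R X + 0 *\<^sub>R U + \<nu> *\<^sub>R V" using \<Phi> by simp_all
  from main_act[OF polyaut_sdiff[OF \<Phi>(1)] UNIV_I \<Phi>(2) this(1) one_neq_zero this(2) one_neq_zero this(3,4)] \<Phi>
  show thesis by (intro that[of \<Phi>]) simp_all
qed

text \<open>W and Y span the vertical plane, D and Y the velocities of prolonged curves in the fiber
  over q. Both planes are preserved, and so is the line of D, because fiber lines go to fiber lines.
  The five orbits are: generic, vertical, tangent to a prolonged fiber line, otherwise tangent to
  the fiber, and the intersection of the two planes.\<close>

theorem v_node:
  "node Z2 D2 (\<pi> \<circ> base_pt \<circ> base_pt) f2 R (cmb D W Y ` {(1,1,0), (0,1,0), (1,0,0), (1,0,1), (0,0,1)})"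
  "card (cmb D W Y ` {(1,1,0), (0,1,0), (1,0,0), (1,0,1), (0,0,1)}) = 5"
proof -
  have act: "\<exists>\<mu> \<omega> \<nu> \<rho>. dr Z2 (f2 \<Phi>) R D = \<mu> *\<^sub>R D \<and> dr Z2 (f2 \<Phi>) R W = \<omega> *\<^sub>R W + \<nu> *\<^sub>R Y \<and> dr Z2 (f2 \<Phi>) R Y = \<rho> *\<^sub>R Y"
    if \<Phi>: "sdiff G \<Phi>" "(\<pi> \<circ> base_pt \<circ> base_pt) R \<in> G" "f2 \<Phi> R = R" for G \<Phi>
  proof -
    obtain l b k a' b' c' n n' where g: "\<pi> q \<in> G" "lift \<Phi> q = q" "dr Z (lift \<Phi>) q \<xi> = l *\<^sub>R \<xi>" "l \<noteq> 0"
      "dr Z (lift \<Phi>) q \<eta> = b *\<^sub>R \<eta> + k *\<^sub>R \<xi>" "b \<noteq> 0" "dr Z (lift \<Phi>) q \<zeta> = a' *\<^sub>R \<xi> + b' *\<^sub>R \<eta> + c' *\<^sub>R \<zeta>"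
      "dr Z1 (f1 \<Phi>) Q X = l *\<^sub>R X + n *\<^sub>R U + n' *\<^sub>R V" using gen_act[OF \<Phi>] .
    show ?thesis using main_act(5-7)[OF \<Phi>(1) g] by blast
  qed
  \<comment> \<open>Equal weights on \<xi> and \<eta> give D the eigenvalue 1, W the eigenvalue r
    and Y the eigenvalue s.\<close>
  have tor: "\<exists>\<Phi> \<mu>. polyaut \<Phi> \<and> f2 \<Phi> R = R \<and> dr Z2 (f2 \<Phi>) R D = \<mu> *\<^sub>R D \<and> dr Z2 (f2 \<Phi>) R W = (\<mu> * r) *\<^sub>R W \<and>
      dr Z2 (f2 \<Phi>) R Y = (\<mu> * s) *\<^sub>R Y" if rs: "r \<noteq> 0" "s \<noteq> 0" for r s
    by (rule torus_act[of r r "s * r"]) (use rs in \<open>auto intro!: exI[of _ 1]\<close>)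
  have shr: "\<exists>\<Phi>. polyaut \<Phi> \<and> f2 \<Phi> R = R \<and> dr Z2 (f2 \<Phi>) R D = D \<and> dr Z2 (f2 \<Phi>) R W = W + \<nu> *\<^sub>R Y \<and> dr Z2 (f2 \<Phi>) R Y = Y" for \<nu>
    by (rule shear_act[of \<nu>]) blast
  show "node Z2 D2 (\<pi> \<circ> base_pt \<circ> base_pt) f2 R (cmb D W Y ` {(1,1,0), (0,1,0), (1,0,0), (1,0,1), (0,0,1)})"
    by (rule L2.tri_node(1)[OF R B2 act tor shr])
  show "card (cmb D W Y ` {(1,1,0), (0,1,0), (1,0,0), (1,0,1), (0,0,1)}) = 5"
    by (rule L2.tri_node(2)[OF R B2 act tor shr])
qed

section \<open>Points one level above R and the lines over them\<close>

lemma v3: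
  assumes \<Phi>: "sdiff G \<Phi>" "\<pi> q \<in> G" and \<tau>: "\<tau> \<in> D2 R" "\<tau> \<noteq> 0" and x: "x \<in> D2 R" and A: "dr Z2 (f2 \<Phi>) R \<tau> = k *\<^sub>R \<tau>" "k \<noteq> 0"
  shows "dr Z3 (f3 \<Phi>) (le R \<tau>) (vert \<tau> x) = (1 / k) *\<^sub>R vert \<tau> (dr Z2 (f2 \<Phi>) R x)"
  using L2.dr_vert[OF \<Phi>(1) R _ \<tau> x] \<Phi>(2) A by (simp add: vert_scale_left)

lemma fix3:
  assumes \<Phi>: "sdiff G \<Phi>" "(\<pi> \<circ> base_pt \<circ> base_pt \<circ> base_pt) (le R \<tau>) \<in> G" "f3 \<Phi> (le R \<tau>) = le R \<tau>"
    and \<tau>: "\<tau> \<in> D2 R" "\<tau> \<noteq> 0"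
  obtains \<kappa> l b k a' b' c' n n' where "\<kappa> \<noteq> 0" "dr Z2 (f2 \<Phi>) R \<tau> = \<kappa> *\<^sub>R \<tau>" "\<pi> q \<in> G" "lift \<Phi> q = q" "dr Z (lift \<Phi>) q \<xi> = l *\<^sub>R \<xi>" "l \<noteq> 0"
    "dr Z (lift \<Phi>) q \<eta> = b *\<^sub>R \<eta> + k *\<^sub>R \<xi>" "b \<noteq> 0" "dr Z (lift \<Phi>) q \<zeta> = a' *\<^sub>R \<xi> + b' *\<^sub>R \<eta> + c' *\<^sub>R \<zeta>"
    "dr Z1 (f1 \<Phi>) Q X = l *\<^sub>R X + n *\<^sub>R U + n' *\<^sub>R V"
proof -
  have \<pi>R: "(\<pi> \<circ> base_pt \<circ> base_pt) R \<in> G" using \<Phi>(2) by simp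
  obtain \<kappa> where \<kappa>: "f2 \<Phi> R = R" "\<kappa> \<noteq> 0" "dr Z2 (f2 \<Phi>) R \<tau> = \<kappa> *\<^sub>R \<tau>"
    using L2.fixE[OF \<Phi>(1) R \<pi>R \<tau> \<Phi>(3)] .
  show thesis using gen_act[OF \<Phi>(1) \<pi>R \<kappa>(1)] that[OF \<kappa>(2,3)] by metis
qed

lemma fix3I:
  assumes "polyaut \<Phi>" "f2 \<Phi> R = R" "\<tau> \<in> D2 R" "\<tau> \<noteq> 0" "dr Z2 (f2 \<Phi>) R \<tau> = k *\<^sub>R \<tau>" "k \<noteq> 0"
  shows "f3 \<Phi> (le R \<tau>) = le R \<tau>"
  by (rule L2.fixI[OF polyaut_sdiff[OF assms(1)] R UNIV_I assms(3,4,2,5,6)])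

lemma mem3: "\<tau> \<in> D2 R \<Longrightarrow> \<tau> \<noteq> 0 \<Longrightarrow> le R \<tau> \<in> Z3"
  by (rule le_mem_prol[OF L2.reg R])

abbreviation "DD \<equiv> ld (ld (fl' \<xi> \<eta>)) 0"

lemma DD: "DD \<in> D3 (le R D)" "base_pt DD = D"
  using icurveD(2)[OF icurve_lift[OF L2.reg line2] UNIV_I, of 0] by (simp_all add: lc_def[of "lc _ _"] line2_0)

text \<open>The twice prolonged fiber line passes through \<open>le R D\<close> with velocity DD, a
  preserved direction; the vertical plane inherits the shear of W along Y, so the action is
  triangular as it is at R.\<close>

theorem rvt0_node:
  "node Z3 D3 (\<pi> \<circ> base_pt \<circ> base_pt \<circ> base_pt) f3 (le R D) (cmb DD (vert D W) (vert D Y) ` {(1,1,0), (0,1,0), (1,0,0), (1,0,1), (0,0,1)})"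
  "card (cmb DD (vert D W) (vert D Y) ` {(1,1,0), (0,1,0), (1,0,0), (1,0,1), (0,0,1)}) = 5"
proof -
  note m = mem3[OF B2m(1,4)] and B3 = basis3_prol[OF L2.reg R B2 DD]
  have act: "\<exists>\<mu> \<omega> \<nu> \<rho>. dr Z3 (f3 \<Phi>) (le R D) DD = \<mu> *\<^sub>R DD \<and> dr Z3 (f3 \<Phi>) (le R D) (vert D W) = \<omega> *\<^sub>R vert D W + \<nu> *\<^sub>R vert D Y \<and>
      dr Z3 (f3 \<Phi>) (le R D) (vert D Y) = \<rho> *\<^sub>R vert D Y"
    if \<Phi>: "sdiff G \<Phi>" "(\<pi> \<circ> base_pt \<circ> base_pt \<circ> base_pt) (le R D) \<in> G" "f3 \<Phi> (le R D) = le R D" for G \<Phi>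
  proof -
    obtain \<kappa> l b k a' b' c' n n' where \<kappa>: "\<kappa> \<noteq> 0" "dr Z2 (f2 \<Phi>) R D = \<kappa> *\<^sub>R D"
      and g: "\<pi> q \<in> G" "lift \<Phi> q = q" "dr Z (lift \<Phi>) q \<xi> = l *\<^sub>R \<xi>" "l \<noteq> 0"
      "dr Z (lift \<Phi>) q \<eta> = b *\<^sub>R \<eta> + k *\<^sub>R \<xi>" "b \<noteq> 0" "dr Z (lift \<Phi>) q \<zeta> = a' *\<^sub>R \<xi> + b' *\<^sub>R \<eta> + c' *\<^sub>R \<zeta>"
      "dr Z1 (f1 \<Phi>) Q X = l *\<^sub>R X + n *\<^sub>R U + n' *\<^sub>R V" using fix3[OF \<Phi> B2m(1,4)] .
    note M = main_act[OF \<Phi>(1) g]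
    show ?thesis
      using M(8) v3[OF \<Phi>(1) g(1) B2m(1,4,2) \<kappa>(2,1)] v3[OF \<Phi>(1) g(1) B2m(1,4,3) \<kappa>(2,1)]
      unfolding M(6,7) vert_simps scaleR_add_right scaleR_scaleR by blast
  qed
  have tor: "\<exists>\<Phi> \<mu>. polyaut \<Phi> \<and> f3 \<Phi> (le R D) = le R D \<and> dr Z3 (f3 \<Phi>) (le R D) DD = \<mu> *\<^sub>R DD \<and>
      dr Z3 (f3 \<Phi>) (le R D) (vert D W) = (\<mu> * r) *\<^sub>R vert D W \<and> dr Z3 (f3 \<Phi>) (le R D) (vert D Y) = (\<mu> * s) *\<^sub>R vert D Y"
    if rs: "r \<noteq> 0" "s \<noteq> 0" for r s
  proof -
    have nz: "s * r \<noteq> 0" using rs by simp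
    obtain \<Phi> where \<Phi>: "polyaut \<Phi>" "f2 \<Phi> R = R" "dr Z2 (f2 \<Phi>) R D = (r / r) *\<^sub>R D"
      "dr Z2 (f2 \<Phi>) R W = (r * r / r) *\<^sub>R W" "dr Z2 (f2 \<Phi>) R Y = (s * r / r) *\<^sub>R Y"
      "dr Z3 (f3 \<Phi>) (le R D) DD = (r / r) *\<^sub>R DD" by (rule torus_act[OF rs(1,1) nz])
    note s = polyaut_sdiff[OF \<Phi>(1)]
    have k: "r / r \<noteq> 0" using rs by simp
    show ?thesis using fix3I[OF \<Phi>(1,2) B2m(1,4) \<Phi>(3) k] \<Phi>(1,6) v3[OF s UNIV_I B2m(1,4,2) \<Phi>(3) k] v3[OF s UNIV_I B2m(1,4,3) \<Phi>(3) k] rs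
      unfolding \<Phi>(4,5) by (intro exI[of _ \<Phi>] exI[of _ 1]) (simp add: vert_simps)
  qed
  have shr: "\<exists>\<Phi>. polyaut \<Phi> \<and> f3 \<Phi> (le R D) = le R D \<and> dr Z3 (f3 \<Phi>) (le R D) DD = DD \<and>
      dr Z3 (f3 \<Phi>) (le R D) (vert D W) = vert D W + \<nu> *\<^sub>R vert D Y \<and> dr Z3 (f3 \<Phi>) (le R D) (vert D Y) = vert D Y" for \<nu>
  proof -
    obtain \<Phi> where \<Phi>: "polyaut \<Phi>" "f2 \<Phi> R = R" "dr Z2 (f2 \<Phi>) R D = D"
      "dr Z2 (f2 \<Phi>) R W = W + \<nu> *\<^sub>R Y" "dr Z2 (f2 \<Phi>) R Y = Y" "dr Z3 (f3 \<Phi>) (le R D) DD = DD" by (rule shear_act[of \<nu>])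
    note s = polyaut_sdiff[OF \<Phi>(1)]
    have d: "dr Z2 (f2 \<Phi>) R D = 1 *\<^sub>R D" using \<Phi>(3) by simp
    show ?thesis using fix3I[OF \<Phi>(1,2) B2m(1,4) d one_neq_zero] \<Phi>(1,6) v3[OF s UNIV_I B2m(1,4,2) d one_neq_zero] v3[OF s UNIV_I B2m(1,4,3) d one_neq_zero]
      unfolding \<Phi>(4,5) by (intro exI[of _ \<Phi>]) (simp add: vert_simps)
  qed
  show "node Z3 D3 (\<pi> \<circ> base_pt \<circ> base_pt \<circ> base_pt) f3 (le R D) (cmb DD (vert D W) (vert D Y) ` {(1,1,0), (0,1,0), (1,0,0), (1,0,1), (0,0,1)})"
    by (rule L3.tri_node(1)[OF m B3 act tor shr])
  show "card (cmb DD (vert D W) (vert D Y) ` {(1,1,0), (0,1,0), (1,0,0), (1,0,1), (0,0,1)}) = 5"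
    by (rule L3.tri_node(2)[OF m B3 act tor shr])
qed

text \<open>The fiber line over Q through R with direction v, prolonged once, passes through
  \<open>le R (vert U v)\<close> and provides a canonical direction there.\<close>

lemma line_lift:
  assumes v: "v \<in> D1 Q" "ind2 U v"
  shows "ld (fl' U v) 0 \<in> D3 (le R (vert U v))" "base_pt (ld (fl' U v) 0) = vert U v"
  using icurveD(2)[OF icurve_lift[OF L2.reg fl_icurve[OF L1.reg Q B1m(2) v]] UNIV_I, of 0]
  by (simp_all add: lc_def fl_0)

lemma line_lift_act:
  assumes \<Phi>: "sdiff G \<Phi>" "\<pi> q \<in> G" "f1 \<Phi> Q = Q" and v: "v \<in> D1 Q" "ind2 U v"
    and A: "dr Z1 (f1 \<Phi>) Q U = l *\<^sub>R U" "dr Z1 (f1 \<Phi>) Q v = b *\<^sub>R v + k *\<^sub>R U" "l \<noteq> 0" "b \<noteq> 0"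
  shows "dr Z3 (f3 \<Phi>) (le R (vert U v)) (ld (fl' U v) 0) = (b / l) *\<^sub>R ld (fl' U v) 0"
proof -
  have QS: "Q \<in> {q \<in> Z1. (\<pi> \<circ> base_pt) q \<in> G}" using Q \<Phi>(2) by simp
  have e: "lc (fl Q U v) (fl' U v) 0 = le R (vert U v)" by (simp add: lc_def fl_0)
  from fl_lifts(1)[OF L1.reg L1.morph[OF \<Phi>(1)] QS \<Phi>(3) B1m(2) v A] show ?thesis unfolding e .
qed

text \<open>Fixing \<open>le R W\<close> forces n' = 0, so X goes to a combination of X and U, and
  the fiber line over Q through U and X is preserved. Its prolongation gives the third
  eigendirection besides those coming from D and Y.\<close>

theorem rvv_node:
  "node Z3 D3 (\<pi> \<circ> base_pt \<circ> base_pt \<circ> base_pt) f3 (le R W)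
    (cmb (ld (fl' U X) 0) (vert W D) (vert W Y) ` {(1,1,1), (1,1,0), (1,0,1), (0,1,1), (1,0,0), (0,1,0), (0,0,1)})"
  "card (cmb (ld (fl' U X) 0) (vert W D) (vert W Y) ` {(1,1,1), (1,1,0), (1,0,1), (0,1,1), (1,0,0), (0,1,0), (0,0,1)}) = 7"
proof -
  note ind = basis3_ind2(2)[OF B1]
  note m = mem3[OF B2m(2,5)] and B3 = basis3_prol[OF L2.reg R basis3_swap12[OF B2] line_lift[OF B1m(1) ind]]
  have act: "\<exists>\<mu> \<omega> \<rho>. dr Z3 (f3 \<Phi>) (le R W) (ld (fl' U X) 0) = \<mu> *\<^sub>R ld (fl' U X) 0 \<and> dr Z3 (f3 \<Phi>) (le R W) (vert W D) = \<omega> *\<^sub>R vert W D \<and>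
      dr Z3 (f3 \<Phi>) (le R W) (vert W Y) = \<rho> *\<^sub>R vert W Y"
    if \<Phi>: "sdiff G \<Phi>" "(\<pi> \<circ> base_pt \<circ> base_pt \<circ> base_pt) (le R W) \<in> G" "f3 \<Phi> (le R W) = le R W" for G \<Phi>
  proof -
    obtain \<kappa> l b k a' b' c' n n' where \<kappa>: "\<kappa> \<noteq> 0" "dr Z2 (f2 \<Phi>) R W = \<kappa> *\<^sub>R W"
      and g: "\<pi> q \<in> G" "lift \<Phi> q = q" "dr Z (lift \<Phi>) q \<xi> = l *\<^sub>R \<xi>" "l \<noteq> 0"
      "dr Z (lift \<Phi>) q \<eta> = b *\<^sub>R \<eta> + k *\<^sub>R \<xi>" "b \<noteq> 0" "dr Z (lift \<Phi>) q \<zeta> = a' *\<^sub>R \<xi> + b' *\<^sub>R \<eta> + c' *\<^sub>R \<zeta>"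
      "dr Z1 (f1 \<Phi>) Q X = l *\<^sub>R X + n *\<^sub>R U + n' *\<^sub>R V" using fix3[OF \<Phi> B2m(2,5)] .
    note M = main_act[OF \<Phi>(1) g]
    have "0 *\<^sub>R D + (l * l / b) *\<^sub>R W + (n' * l / b) *\<^sub>R Y = 0 *\<^sub>R D + \<kappa> *\<^sub>R W + 0 *\<^sub>R Y" using M(6) \<kappa>(2) by simp
    from basis3_eqD[OF B2 this] have "n' = 0" using g(4,6) by simp
    then have X: "dr Z1 (f1 \<Phi>) Q X = l *\<^sub>R X + n *\<^sub>R U" using g(8) by simp
    have nz: "b / l \<noteq> 0" using g by simp
    show ?thesis using line_lift_act[OF \<Phi>(1) g(1) M(1) B1m(1) ind M(2) X nz g(4)]
        v3[OF \<Phi>(1) g(1) B2m(2,5,1) \<kappa>(2,1)] v3[OF \<Phi>(1) g(1) B2m(2,5,3) \<kappa>(2,1)]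
      unfolding M(5,7) vert_simps scaleR_scaleR by blast
  qed
  have tor: "\<exists>\<Phi> \<mu>. polyaut \<Phi> \<and> f3 \<Phi> (le R W) = le R W \<and> dr Z3 (f3 \<Phi>) (le R W) (ld (fl' U X) 0) = \<mu> *\<^sub>R ld (fl' U X) 0 \<and>
      dr Z3 (f3 \<Phi>) (le R W) (vert W D) = (\<mu> * r) *\<^sub>R vert W D \<and> dr Z3 (f3 \<Phi>) (le R W) (vert W Y) = (\<mu> * s) *\<^sub>R vert W Y"
    if rs: "r \<noteq> 0" "s \<noteq> 0" for r s
  proof -
    \<comment> \<open>The weights r, r^2 and s r^2 give W and the velocity of the prolonged line the
      eigenvalue 1, D the eigenvalue r and Y the eigenvalue s.\<close>
    have nz: "r * r \<noteq> 0" "s * (r * r) \<noteq> 0" using rs by simp_all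
    obtain \<Phi> where \<Phi>: "polyaut \<Phi>" "f1 \<Phi> Q = Q" "dr Z1 (f1 \<Phi>) Q U = (r * r / r) *\<^sub>R U" "dr Z1 (f1 \<Phi>) Q X = r *\<^sub>R X"
      "f2 \<Phi> R = R" "dr Z2 (f2 \<Phi>) R D = (r * r / r) *\<^sub>R D"
      "dr Z2 (f2 \<Phi>) R W = (r * r / (r * r)) *\<^sub>R W" "dr Z2 (f2 \<Phi>) R Y = (s * (r * r) / (r * r)) *\<^sub>R Y" by (rule torus_act[OF rs(1) nz])
    note s = polyaut_sdiff[OF \<Phi>(1)]
    have k: "r * r / (r * r) \<noteq> 0" "r * r / r \<noteq> 0" using rs by simp_all
    have X: "dr Z1 (f1 \<Phi>) Q X = r *\<^sub>R X + 0 *\<^sub>R U" using \<Phi>(4) by simp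
    show ?thesis using fix3I[OF \<Phi>(1,5) B2m(2,5) \<Phi>(7) k(1)] \<Phi>(1) line_lift_act[OF s UNIV_I \<Phi>(2) B1m(1) ind \<Phi>(3) X k(2) rs(1)]
        v3[OF s UNIV_I B2m(2,5,1) \<Phi>(7) k(1)] v3[OF s UNIV_I B2m(2,5,3) \<Phi>(7) k(1)] rs
      unfolding \<Phi>(6,8) by (intro exI[of _ \<Phi>] exI[of _ 1]) (simp add: vert_simps)
  qed
  show "node Z3 D3 (\<pi> \<circ> base_pt \<circ> base_pt \<circ> base_pt) f3 (le R W)
    (cmb (ld (fl' U X) 0) (vert W D) (vert W Y) ` {(1,1,1), (1,1,0), (1,0,1), (0,1,1), (1,0,0), (0,1,0), (0,0,1)})"
    by (rule L3.diag_node(1)[OF m B3 act tor])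
  show "card (cmb (ld (fl' U X) 0) (vert W D) (vert W Y) ` {(1,1,1), (1,1,0), (1,0,1), (0,1,1), (1,0,0), (0,1,0), (0,0,1)}) = 7"
    by (rule L3.diag_node(2)[OF m B3 act tor])
qed

text \<open>The fiber line over Q through U and V consists of vertical directions and is preserved,
  because U is an eigenvector. Since \<open>vert Y\<close> kills the shear of W along Y, the action
  is diagonal.\<close>

theorem rvl_node:
  "node Z3 D3 (\<pi> \<circ> base_pt \<circ> base_pt \<circ> base_pt) f3 (le R Y)
    (cmb (ld (fl' U V) 0) (vert Y D) (vert Y W) ` {(1,1,1), (1,1,0), (1,0,1), (0,1,1), (1,0,0), (0,1,0), (0,0,1)})"
  "card (cmb (ld (fl' U V) 0) (vert Y D) (vert Y W) ` {(1,1,1), (1,1,0), (1,0,1), (0,1,1), (1,0,0), (0,1,0), (0,0,1)}) = 7"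
proof -
  note ind = basis3_ind2(5)[OF B1]
  note m = mem3[OF B2m(3,6)] and B3 = basis3_prol[OF L2.reg R basis3_swap12[OF basis3_swap23[OF B2]] line_lift[OF B1m(3) ind]]
  have act: "\<exists>\<mu> \<omega> \<rho>. dr Z3 (f3 \<Phi>) (le R Y) (ld (fl' U V) 0) = \<mu> *\<^sub>R ld (fl' U V) 0 \<and> dr Z3 (f3 \<Phi>) (le R Y) (vert Y D) = \<omega> *\<^sub>R vert Y D \<and>
      dr Z3 (f3 \<Phi>) (le R Y) (vert Y W) = \<rho> *\<^sub>R vert Y W"
    if \<Phi>: "sdiff G \<Phi>" "(\<pi> \<circ> base_pt \<circ> base_pt \<circ> base_pt) (le R Y) \<in> G" "f3 \<Phi> (le R Y) = le R Y" for G \<Phi>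
  proof -
    obtain \<kappa> l b k a' b' c' n n' where \<kappa>: "\<kappa> \<noteq> 0" "dr Z2 (f2 \<Phi>) R Y = \<kappa> *\<^sub>R Y"
      and g: "\<pi> q \<in> G" "lift \<Phi> q = q" "dr Z (lift \<Phi>) q \<xi> = l *\<^sub>R \<xi>" "l \<noteq> 0"
      "dr Z (lift \<Phi>) q \<eta> = b *\<^sub>R \<eta> + k *\<^sub>R \<xi>" "b \<noteq> 0" "dr Z (lift \<Phi>) q \<zeta> = a' *\<^sub>R \<xi> + b' *\<^sub>R \<eta> + c' *\<^sub>R \<zeta>"
      "dr Z1 (f1 \<Phi>) Q X = l *\<^sub>R X + n *\<^sub>R U + n' *\<^sub>R V" using fix3[OF \<Phi> B2m(3,6)] .
    note M = main_act[OF \<Phi>(1) g]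
    have "(c' / b) *\<^sub>R Y = \<kappa> *\<^sub>R Y" using M(7) \<kappa>(2) by (simp only:)
    then have "c' / b = \<kappa>" using B2m(6) by simp
    then have "c' \<noteq> 0" using \<kappa>(1) by auto
    then have nz: "b / l \<noteq> 0" "c' / l \<noteq> 0" using g by simp_all
    show ?thesis using line_lift_act[OF \<Phi>(1) g(1) M(1) B1m(3) ind M(2,3) nz]
        v3[OF \<Phi>(1) g(1) B2m(3,6,1) \<kappa>(2,1)] v3[OF \<Phi>(1) g(1) B2m(3,6,2) \<kappa>(2,1)]
      unfolding M(5,6) vert_simps vert_self scaleR_scaleR scaleR_zero_right add_0_right by blast
  qed
  have tor: "\<exists>\<Phi> \<mu>. polyaut \<Phi> \<and> f3 \<Phi> (le R Y) = le R Y \<and> dr Z3 (f3 \<Phi>) (le R Y) (ld (fl' U V) 0) = \<mu> *\<^sub>R ld (fl' U V) 0 \<and>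
      dr Z3 (f3 \<Phi>) (le R Y) (vert Y D) = (\<mu> * r) *\<^sub>R vert Y D \<and> dr Z3 (f3 \<Phi>) (le R Y) (vert Y W) = (\<mu> * s) *\<^sub>R vert Y W"
    if rs: "r \<noteq> 0" "s \<noteq> 0" for r s
  proof -
    \<comment> \<open>The weights satisfy b / a = r, a^2 / b = s and c = b; then Y and the velocity
      of the prolonged line have the eigenvalue 1.\<close>
    define a where "a = r * s"
    define b where "b = r * a"
    have nz: "a \<noteq> 0" "b \<noteq> 0" using rs by (simp_all add: a_def b_def)
    have ab: "b / a = r" "a * a / b = s" "b / b = 1" using rs nz by (auto simp: b_def a_def)
    obtain \<Phi> where \<Phi>: "polyaut \<Phi>" "f1 \<Phi> Q = Q" "dr Z1 (f1 \<Phi>) Q U = (b / a) *\<^sub>R U" "dr Z1 (f1 \<Phi>) Q V = (b / a) *\<^sub>R V"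
      "f2 \<Phi> R = R" "dr Z2 (f2 \<Phi>) R D = (b / a) *\<^sub>R D"
      "dr Z2 (f2 \<Phi>) R W = (a * a / b) *\<^sub>R W" "dr Z2 (f2 \<Phi>) R Y = (b / b) *\<^sub>R Y" by (rule torus_act[OF nz nz(2)])
    note s = polyaut_sdiff[OF \<Phi>(1)] and \<Phi>' = \<Phi>(3,4,6-8)[unfolded ab]
    have V: "dr Z1 (f1 \<Phi>) Q V = r *\<^sub>R V + 0 *\<^sub>R U" using \<Phi>'(2) by simp
    show ?thesis using fix3I[OF \<Phi>(1,5) B2m(3,6) \<Phi>'(5) one_neq_zero] \<Phi>(1) line_lift_act[OF s UNIV_I \<Phi>(2) B1m(3) ind \<Phi>'(1) V rs(1,1)]
        v3[OF s UNIV_I B2m(3,6,1) \<Phi>'(5) one_neq_zero] v3[OF s UNIV_I B2m(3,6,2) \<Phi>'(5) one_neq_zero] rs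
      unfolding \<Phi>'(3,4) by (intro exI[of _ \<Phi>] exI[of _ 1]) (simp add: vert_simps)
  qed
  show "node Z3 D3 (\<pi> \<circ> base_pt \<circ> base_pt \<circ> base_pt) f3 (le R Y)
    (cmb (ld (fl' U V) 0) (vert Y D) (vert Y W) ` {(1,1,1), (1,1,0), (1,0,1), (0,1,1), (1,0,0), (0,1,0), (0,0,1)})"
    by (rule L3.diag_node(1)[OF m B3 act tor])
  show "card (cmb (ld (fl' U V) 0) (vert Y D) (vert Y W) ` {(1,1,1), (1,1,0), (1,0,1), (0,1,1), (1,0,0), (0,1,0), (0,0,1)}) = 7"
    by (rule L3.diag_node(2)[OF m B3 act tor])
qed

text \<open>No direction over D + W is singled out, so E is an arbitrary lift and its shears along
  both vertical directions are assumed. The parameters k and n leave room for maps that also move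
  \<eta> along \<xi> and X along U, which affects none of D, W and Y.\<close>

theorem rvr_node:
  assumes E: "E \<in> D3 (le R (D + W))" "base_pt E = D + W"
    and s1: "\<And>p. \<exists>\<Phi> k n. polyaut \<Phi> \<and> lift \<Phi> q = q \<and> dr Z (lift \<Phi>) q \<xi> = \<xi> \<and> dr Z (lift \<Phi>) q \<eta> = \<eta> + k *\<^sub>R \<xi> \<and>
      dr Z (lift \<Phi>) q \<zeta> = \<zeta> \<and> dr Z1 (f1 \<Phi>) Q X = X + n *\<^sub>R U \<and> dr Z3 (f3 \<Phi>) (le R (D + W)) E = E + p *\<^sub>R vert (D + W) W"
    and s2: "\<And>p. \<exists>\<Phi> k n. polyaut \<Phi> \<and> lift \<Phi> q = q \<and> dr Z (lift \<Phi>) q \<xi> = \<xi> \<and> dr Z (lift \<Phi>) q \<eta> = \<eta> + k *\<^sub>R \<xi> \<and>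
      dr Z (lift \<Phi>) q \<zeta> = \<zeta> \<and> dr Z1 (f1 \<Phi>) Q X = X + n *\<^sub>R U \<and> dr Z3 (f3 \<Phi>) (le R (D + W)) E = E + p *\<^sub>R vert (D + W) Y"
  shows "node Z3 D3 (\<pi> \<circ> base_pt \<circ> base_pt \<circ> base_pt) f3 (le R (D + W))
    (cmb E (vert (D + W) W) (vert (D + W) Y) ` {(1,0,0), (0,1,0), (0,0,1), (0,1,1)})"
  "card (cmb E (vert (D + W) W) (vert (D + W) Y) ` {(1,0,0), (0,1,0), (0,0,1), (0,1,1)}) = 4"
proof -
  note BW = basis3_add[OF B2]
  note Wm = basis3_mems[OF BW]
  note m = mem3[OF Wm(1,4)] and B3 = basis3_prol[OF L2.reg R BW E]
  have act: "\<exists>\<mu> p r \<omega> \<rho>. dr Z3 (f3 \<Phi>) (le R (D + W)) E = \<mu> *\<^sub>R E + p *\<^sub>R vert (D + W) W + r *\<^sub>R vert (D + W) Y \<and> \<mu> \<noteq> 0 \<and>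
      dr Z3 (f3 \<Phi>) (le R (D + W)) (vert (D + W) W) = \<omega> *\<^sub>R vert (D + W) W \<and> dr Z3 (f3 \<Phi>) (le R (D + W)) (vert (D + W) Y) = \<rho> *\<^sub>R vert (D + W) Y"
    if \<Phi>: "sdiff G \<Phi>" "(\<pi> \<circ> base_pt \<circ> base_pt \<circ> base_pt) (le R (D + W)) \<in> G" "f3 \<Phi> (le R (D + W)) = le R (D + W)" for G \<Phi>
  proof -
    obtain \<kappa> l b k a' b' c' n n' where \<kappa>: "\<kappa> \<noteq> 0" "dr Z2 (f2 \<Phi>) R (D + W) = \<kappa> *\<^sub>R (D + W)"
      and g: "\<pi> q \<in> G" "lift \<Phi> q = q" "dr Z (lift \<Phi>) q \<xi> = l *\<^sub>R \<xi>" "l \<noteq> 0"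
      "dr Z (lift \<Phi>) q \<eta> = b *\<^sub>R \<eta> + k *\<^sub>R \<xi>" "b \<noteq> 0" "dr Z (lift \<Phi>) q \<zeta> = a' *\<^sub>R \<xi> + b' *\<^sub>R \<eta> + c' *\<^sub>R \<zeta>"
      "dr Z1 (f1 \<Phi>) Q X = l *\<^sub>R X + n *\<^sub>R U + n' *\<^sub>R V" using fix3[OF \<Phi> Wm(1,4)] .
    note M = main_act[OF \<Phi>(1) g]
    have \<pi>R: "(\<pi> \<circ> base_pt \<circ> base_pt) R \<in> G" using g(1) by simp
    have "(b / l) *\<^sub>R D + (l * l / b) *\<^sub>R W + (n' * l / b) *\<^sub>R Y = \<kappa> *\<^sub>R D + \<kappa> *\<^sub>R W + 0 *\<^sub>R Y"
      using \<kappa>(2) linear_add[OF L2.dr_lin[OF \<Phi>(1) R \<pi>R], of D W] M(5,6) by (simp add: scaleR_add_right add.assoc)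
    from basis3_eqD[OF B2 this] have "n' = 0" using g(4,6) by simp
    then have W: "dr Z2 (f2 \<Phi>) R W = (l * l / b) *\<^sub>R W" using M(6) by simp
    obtain p r where "dr Z3 (f3 \<Phi>) (le R (D + W)) E = \<kappa> *\<^sub>R E + p *\<^sub>R vert (D + W) W + r *\<^sub>R vert (D + W) Y"
      using L2.lift_act[OF \<Phi>(1) R \<pi>R BW E M(4) \<kappa>(2,1)] .
    then show ?thesis using \<kappa>(1)
        v3[OF \<Phi>(1) g(1) Wm(1,4,2) \<kappa>(2,1)] v3[OF \<Phi>(1) g(1) Wm(1,4,3) \<kappa>(2,1)]
      unfolding M(7) W vert_simps scaleR_scaleR by blast
  qed
  have shrx: "f3 \<Phi> (le R (D + W)) = le R (D + W) \<and> dr Z3 (f3 \<Phi>) (le R (D + W)) (vert (D + W) W) = vert (D + W) W \<and>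
      dr Z3 (f3 \<Phi>) (le R (D + W)) (vert (D + W) Y) = c *\<^sub>R vert (D + W) Y"
    if \<Phi>: "polyaut \<Phi>" "lift \<Phi> q = q" "dr Z (lift \<Phi>) q \<xi> = \<xi>" "dr Z (lift \<Phi>) q \<eta> = \<eta> + k *\<^sub>R \<xi>"
      "dr Z (lift \<Phi>) q \<zeta> = c *\<^sub>R \<zeta>" "dr Z1 (f1 \<Phi>) Q X = X + n *\<^sub>R U" for \<Phi> k n c
  proof -
    note s = polyaut_sdiff[OF \<Phi>(1)]
    have "dr Z (lift \<Phi>) q \<xi> = 1 *\<^sub>R \<xi>" "dr Z (lift \<Phi>) q \<eta> = 1 *\<^sub>R \<eta> + k *\<^sub>R \<xi>" "dr Z (lift \<Phi>) q \<zeta> = 0 *\<^sub>R \<xi> + 0 *\<^sub>R \<eta> + c *\<^sub>R \<zeta>"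
      "dr Z1 (f1 \<Phi>) Q X = 1 *\<^sub>R X + n *\<^sub>R U + 0 *\<^sub>R V" using \<Phi> by simp_all
    note M = main_act[OF s UNIV_I \<Phi>(2) this(1) one_neq_zero this(2) one_neq_zero this(3,4)]
    have d: "dr Z2 (f2 \<Phi>) R (D + W) = 1 *\<^sub>R (D + W)"
      using linear_add[OF L2.dr_lin[OF s R UNIV_I], of D W] M(5,6) by simp
    show ?thesis using fix3I[OF \<Phi>(1) M(4) Wm(1,4) d one_neq_zero] M(6,7)
        v3[OF s UNIV_I Wm(1,4,2) d one_neq_zero] v3[OF s UNIV_I Wm(1,4,3) d one_neq_zero] by (simp add: vert_simps)
  qed
  have shr1: "\<exists>\<Phi>. polyaut \<Phi> \<and> f3 \<Phi> (le R (D + W)) = le R (D + W) \<and> dr Z3 (f3 \<Phi>) (le R (D + W)) E = E + p *\<^sub>R vert (D + W) W \<and>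
      dr Z3 (f3 \<Phi>) (le R (D + W)) (vert (D + W) W) = vert (D + W) W \<and> dr Z3 (f3 \<Phi>) (le R (D + W)) (vert (D + W) Y) = vert (D + W) Y" for p
  proof -
    obtain \<Phi> k n where \<Phi>: "polyaut \<Phi>" "lift \<Phi> q = q" "dr Z (lift \<Phi>) q \<xi> = \<xi>" "dr Z (lift \<Phi>) q \<eta> = \<eta> + k *\<^sub>R \<xi>"
      "dr Z (lift \<Phi>) q \<zeta> = 1 *\<^sub>R \<zeta>" "dr Z1 (f1 \<Phi>) Q X = X + n *\<^sub>R U" "dr Z3 (f3 \<Phi>) (le R (D + W)) E = E + p *\<^sub>R vert (D + W) W"
      using s1[of p] by auto
    show ?thesis using shrx[OF \<Phi>(1-6)] \<Phi>(1,7) by auto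
  qed
  have shr2: "\<exists>\<Phi>. polyaut \<Phi> \<and> f3 \<Phi> (le R (D + W)) = le R (D + W) \<and> dr Z3 (f3 \<Phi>) (le R (D + W)) E = E + p *\<^sub>R vert (D + W) Y \<and>
      dr Z3 (f3 \<Phi>) (le R (D + W)) (vert (D + W) W) = vert (D + W) W \<and> dr Z3 (f3 \<Phi>) (le R (D + W)) (vert (D + W) Y) = vert (D + W) Y" for p
  proof -
    obtain \<Phi> k n where \<Phi>: "polyaut \<Phi>" "lift \<Phi> q = q" "dr Z (lift \<Phi>) q \<xi> = \<xi>" "dr Z (lift \<Phi>) q \<eta> = \<eta> + k *\<^sub>R \<xi>"
      "dr Z (lift \<Phi>) q \<zeta> = 1 *\<^sub>R \<zeta>" "dr Z1 (f1 \<Phi>) Q X = X + n *\<^sub>R U" "dr Z3 (f3 \<Phi>) (le R (D + W)) E = E + p *\<^sub>R vert (D + W) Y"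
      using s2[of p] by auto
    show ?thesis using shrx[OF \<Phi>(1-6)] \<Phi>(1,7) by auto
  qed
  have tor: "\<exists>\<Phi>. polyaut \<Phi> \<and> f3 \<Phi> (le R (D + W)) = le R (D + W) \<and>
      dr Z3 (f3 \<Phi>) (le R (D + W)) (vert (D + W) W) = vert (D + W) W \<and> dr Z3 (f3 \<Phi>) (le R (D + W)) (vert (D + W) Y) = s *\<^sub>R vert (D + W) Y"
    if s: "s \<noteq> 0" for s
  proof -
    obtain \<Phi> where \<Phi>: "polyaut \<Phi>" "lift \<Phi> q = q" "dr Z (lift \<Phi>) q \<xi> = 1 *\<^sub>R \<xi>" "dr Z (lift \<Phi>) q \<eta> = 1 *\<^sub>R \<eta>" "dr Z (lift \<Phi>) q \<zeta> = s *\<^sub>R \<zeta>"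
      "dr Z1 (f1 \<Phi>) Q X = 1 *\<^sub>R X" by (rule torus_act[OF one_neq_zero one_neq_zero s])
    show ?thesis using shrx[OF \<Phi>(1,2), of 0 s 0] \<Phi> by auto
  qed
  show "node Z3 D3 (\<pi> \<circ> base_pt \<circ> base_pt \<circ> base_pt) f3 (le R (D + W))
    (cmb E (vert (D + W) W) (vert (D + W) Y) ` {(1,0,0), (0,1,0), (0,0,1), (0,1,1)})"
    by (rule L3.rvr_node(1)[OF m B3 act shr1 shr2 tor])
  show "card (cmb E (vert (D + W) W) (vert (D + W) Y) ` {(1,0,0), (0,1,0), (0,0,1), (0,1,1)}) = 4"
    by (rule L3.rvr_node(2)[OF m B3 act shr1 shr2 tor])
qed

text \<open>A conic in the fiber over \<open>q\<close> whose second prolongation at \<open>0\<close> has the velocity \<open>D + Y\<close>.\<close>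
definition cn :: "real \<Rightarrow> real^'n" where "cn t = \<xi> + t *\<^sub>R \<eta> + (t\<^sup>2 / 2) *\<^sub>R \<zeta>"

lemma cn:
  "smooth UNIV cn" "cn t \<in> \<Delta> q" "cn t \<noteq> 0" "cn 0 = \<xi>" "vector_derivative cn (at t) = \<eta> + t *\<^sub>R \<zeta>"
  "icurve Z1 D1 UNIV (\<lambda>t. le q (cn t)) (fc' cn)"
proof -
  show sm: "smooth UNIV cn" unfolding cn_def[abs_def] divide_inverse by (intro smooth_intros)
  have d: "(cn has_vector_derivative (\<eta> + t *\<^sub>R \<zeta>)) (at t)" for t
    unfolding cn_def[abs_def] by (auto intro!: derivative_eq_intros simp: has_vector_derivative_def algebra_simps)
  then show v: "vector_derivative cn (at t) = \<eta> + t *\<^sub>R \<zeta>" for t by (rule vector_derivative_at)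
  show 1: "cn t \<in> \<Delta> q" for t using basis3_mem[OF B, of 1 t "t\<^sup>2 / 2"] by (simp add: cn_def)
  have ind: "ind2 (cn t) (\<eta> + t *\<^sub>R \<zeta>)" for t
    unfolding ind2_def
  proof (intro allI impI)
    fix a b assume "a *\<^sub>R cn t + b *\<^sub>R (\<eta> + t *\<^sub>R \<zeta>) = 0"
    then have "a *\<^sub>R \<xi> + (a * t + b) *\<^sub>R \<eta> + (a * (t\<^sup>2 / 2) + b * t) *\<^sub>R \<zeta> = 0" by (simp add: cn_def algebra_simps)
    then have "a = 0 \<and> a * t + b = 0" using B unfolding basis3_def by blast
    then show "a = 0 \<and> b = 0" by (elim conjE) simp
  qed
  show "cn t \<noteq> 0" using ind2_nz[OF ind, of t 0] by simp
  show "cn 0 = \<xi>" by (simp add: cn_def)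
  have m: "\<eta> + t *\<^sub>R \<zeta> \<in> \<Delta> q" for t using basis3_mem[OF B, of 0 1 t] by simp
  have sm': "smooth UNIV (\<lambda>t. \<eta> + t *\<^sub>R \<zeta>)" by (intro smooth_intros)
  from fiber_icurve[OF reg qZ open_UNIV UNIV_I sm sm' 1 m ind d]
  show "icurve Z1 D1 UNIV (\<lambda>t. le q (cn t)) (fc' cn)" unfolding fc'_def[abs_def] v .
qed

lemma cn_lift: "fc' cn 0 = U" "ld (fc' cn) 0 = D + Y"
proof -
  show fc0: "fc' cn 0 = U" by (simp add: fc'_def cn)
  \<comment> \<open>The factor 1 / 2 in the conic cancels the factor 2 that \<open>pert_fc\<close>
    brings, so that the deviation from the fiber line starts with exactly V.\<close>
  have e: "cn t = (\<xi> + t *\<^sub>R \<eta>) + t ^ Suc 1 *\<^sub>R ((1 / 2) *\<^sub>R \<zeta>)" for t by (simp add: cn_def power2_eq_square)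
  have sm: "smooth UNIV (\<lambda>t. \<xi> + t *\<^sub>R \<eta>)" by (intro smooth_intros)
  note nz = ind2_nz[OF basis3_ind2(1)[OF B]]
  obtain H where H: "smooth UNIV H" "H 0 = real (Suc 1) *\<^sub>R vert (\<xi> + 0 *\<^sub>R \<eta>) ((1 / 2) *\<^sub>R \<zeta>)"
      "\<forall>t\<in>UNIV. fc' cn t = fc' (\<lambda>t. \<xi> + t *\<^sub>R \<eta>) t + t ^ 1 *\<^sub>R H t"
    using pert_fc[OF open_UNIV UNIV_I sm cn(1) smooth_const nz cn(3) e] by blast
  have H0: "H 0 = V" using H(2) by (simp add: vert_scale_right)
  have "vector_derivative (\<lambda>t. \<xi> + t *\<^sub>R \<eta>) (at t) = \<eta>" for t
    by (rule vector_derivative_at) (auto intro!: derivative_eq_intros)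
  then have fl: "fc' (\<lambda>t. \<xi> + t *\<^sub>R \<eta>) t = fl' \<xi> \<eta> t" for t by (simp add: fc'_def fl'_def)
  have e': "fc' cn t = fl' \<xi> \<eta> t + t ^ Suc 0 *\<^sub>R H t" for t using H(3) by (simp add: fl)
  have smf: "smooth UNIV (fl' \<xi> \<eta>)" "smooth UNIV (fc' cn)" using line1 cn(6) by (simp_all add: icurve_def)
  have nzf: "fl' \<xi> \<eta> t \<noteq> 0" "fc' cn t \<noteq> 0" for t using icurveD(3)[OF line1] icurveD(3)[OF cn(6)] by simp_all
  from pert_ld[OF open_UNIV UNIV_I smf H(1) nzf e'] obtain K where
    "K 0 = real (Suc 0) *\<^sub>R vert (fl' \<xi> \<eta> 0) (H 0)" "\<forall>t\<in>UNIV. ld (fc' cn) t = ld (fl' \<xi> \<eta>) t + t ^ 0 *\<^sub>R K t" by blast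
  then show "ld (fc' cn) 0 = D + Y" by (simp add: H0 fl_0)
qed

abbreviation "F \<equiv> ld (ld (fc' cn)) 0"

lemma F: "F \<in> D3 (le R (D + Y))" "base_pt F = D + Y"
proof -
  have "lc (\<lambda>t. le q (cn t)) (fc' cn) 0 = R" by (simp add: lc_def cn cn_lift)
  then show "F \<in> D3 (le R (D + Y))" "base_pt F = D + Y"
    using icurveD(2)[OF icurve_lift[OF L2.reg icurve_lift[OF L1.reg cn(6)]] UNIV_I, of 0]
    by (simp_all add: lc_def[of "lc _ _"] cn_lift)
qed

text \<open>The image of the conic matters as a curve of lines only, so the generator w may be
  normalized freely, with a factor k that depends on t.\<close>

lemma conic_act:
  assumes \<Phi>: "sdiff G \<Phi>" "\<pi> q \<in> G" "lift \<Phi> q = q" and S: "open S" "0 \<in> S" and w: "smooth S w"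
    and A: "\<And>t. t \<in> S \<Longrightarrow> \<exists>k. k \<noteq> 0 \<and> dr Z (lift \<Phi>) q (cn t) = k *\<^sub>R w t"
  shows "dr Z3 (f3 \<Phi>) (le R (D + Y)) F = ld (ld (fc' w)) 0" "\<And>t. t \<in> S \<Longrightarrow> fc' w t \<noteq> 0" "\<And>t. t \<in> S \<Longrightarrow> w t \<noteq> 0"
proof -
  show nz: "w t \<noteq> 0" if "t \<in> S" for t using A[OF that] dr_nz[OF \<Phi>(1) qZ \<Phi>(2) cn(2,3), of t] by auto
  have m: "f1 \<Phi> (le q (cn t)) = le q (w t)" if t: "t \<in> S" for t
    using A[OF t] prol_map_lift[OF \<Phi>(1) qZ \<Phi>(2) cn(2,3), of t] by (auto simp: \<Phi>(3))
  have ic: "icurve Z1 D1 S (\<lambda>t. le q (cn t)) (fc' cn)"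
    using cn(6) S smooth_subset[of UNIV "fc' cn" S] by (auto simp: icurve_def)
  have i: "imap Z1 D1 (\<pi> \<circ> base_pt) (f1 \<Phi>) G S (\<lambda>t. le q (cn t)) (fc' cn) (\<lambda>t. le q (w t)) (fc' w)"
    unfolding imap_def using ic smooth_fc[OF w S(1) nz] m fc_hvd[OF w S(1) _ nz] \<Phi>(2) by simp
  note i' = L2.imap_lift[OF \<Phi>(1) L1.imap_lift[OF \<Phi>(1) i]]
  show "fc' w t \<noteq> 0" if "t \<in> S" for t by (rule L1.imap_dr(2)[OF \<Phi>(1) i that])
  show "dr Z3 (f3 \<Phi>) (le R (D + Y)) F = ld (ld (fc' w)) 0"
    using L3.imap_dr(1)[OF \<Phi>(1) i' S(2)] by (simp add: lc_def cn cn_lift)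
qed

text \<open>A homothety of \<Delta> q fixes every line in it, hence the whole fiber over q.\<close>

lemma conic_fixed:
  assumes \<Phi>: "sdiff G \<Phi>" "\<pi> q \<in> G" "lift \<Phi> q = q" and k: "k \<noteq> 0"
    and A: "dr Z (lift \<Phi>) q \<xi> = k *\<^sub>R \<xi>" "dr Z (lift \<Phi>) q \<eta> = k *\<^sub>R \<eta>" "dr Z (lift \<Phi>) q \<zeta> = k *\<^sub>R \<zeta>"
  shows "dr Z3 (f3 \<Phi>) (le R (D + Y)) F = F"
proof (rule conic_act(1)[OF \<Phi> open_UNIV UNIV_I cn(1)])
  show "\<exists>k. k \<noteq> 0 \<and> dr Z (lift \<Phi>) q (cn t) = k *\<^sub>R cn t" for t
    using k by (intro exI[of _ k]) (simp add: cn_def linear_add[OF dr_lin[OF \<Phi>(1) qZ \<Phi>(2)]] linear_scale[OF dr_lin[OF \<Phi>(1) qZ \<Phi>(2)]] A algebra_simps)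
qed

text \<open>The functional \<open>\<lambda>p. base_pt (mt (mt p (D + Y)) U)\<close> vanishes on the velocities of prolonged curves in the
  fiber and on the last vertical vector, but not on the first: it cuts out an invariant plane.\<close>
lemma D_image:
  "base_pt (mt D x) = 0" "base_pt (mt Y x) = 0" "base_pt (mt (mt (vert (D + Y) W) (D + Y)) U) = \<xi>"
  "base_pt (mt (mt (vert (D + Y) Y) (D + Y)) U) = 0"
proof -
  have B': "basis3 (D2 R) (D + Y) W Y" by (rule basis3_swap23[OF basis3_add[OF basis3_swap23[OF B2]]])
  have u: "D + Y \<noteq> 0" by (rule basis3_mems(4)[OF B'])
  show d: "base_pt (mt D x) = 0" for x
    using line1 by (intro fiber_curve_lift_zero(1)[of UNIV]) (auto simp: icurve_def fl'_def)
  show y: "base_pt (mt Y x) = 0" for x by (simp add: mt_vert)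
  have v: "mt (vert u v) u = v - ((u \<bullet> v) / (u \<bullet> u)) *\<^sub>R u" if "u \<noteq> 0" for u v :: "real^'m"
    using that by (simp add: mt_vert power2_eq_square algebra_simps inner_commute flip: scaleR_add_left)
  show "base_pt (mt (mt (vert (D + Y) W) (D + Y)) U) = \<xi>" "base_pt (mt (mt (vert (D + Y) Y) (D + Y)) U) = 0"
    using B1m(5) by (simp_all add: v[OF u] v d y X(2))
qed

text \<open>The conic is not preserved, but the functional in \<open>D_image\<close> shows that its
  velocity F moves along \<open>vert (D + Y) Y\<close> only. That shear is realized by a map that
  changes the conic at third order; shears of X and homotheties fix the conic line by line and
  supply the rest.\<close>

theorem rvt1_node:
  assumes par: "\<And>k. \<exists>\<Phi>. polyaut \<Phi> \<and> lift \<Phi> q = q \<and> dr Z (lift \<Phi>) q \<xi> = \<xi> \<and> dr Z (lift \<Phi>) q \<eta> = \<eta> + k *\<^sub>R \<xi> \<and>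
      dr Z (lift \<Phi>) q \<zeta> = \<zeta> + (2 * k) *\<^sub>R \<eta>"
  shows "node Z3 D3 (\<pi> \<circ> base_pt \<circ> base_pt \<circ> base_pt) f3 (le R (D + Y))
    (cmb F (vert (D + Y) W) (vert (D + Y) Y) ` {(1,1,0), (1,0,0), (0,1,0), (0,0,1)})"
  "card (cmb F (vert (D + Y) W) (vert (D + Y) Y) ` {(1,1,0), (1,0,0), (0,1,0), (0,0,1)}) = 4"
proof -
  note B' = basis3_swap23[OF basis3_add[OF basis3_swap23[OF B2]]]
  note Tm = basis3_mems[OF B']
  note m = mem3[OF Tm(1,4)] and B3 = basis3_prol[OF L2.reg R B' F]
  have act: "\<exists>\<mu> p \<omega> r \<rho>. dr Z3 (f3 \<Phi>) (le R (D + Y)) F = \<mu> *\<^sub>R F + p *\<^sub>R vert (D + Y) Y \<and> \<mu> \<noteq> 0 \<and>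
      dr Z3 (f3 \<Phi>) (le R (D + Y)) (vert (D + Y) W) = \<omega> *\<^sub>R vert (D + Y) W + r *\<^sub>R vert (D + Y) Y \<and> \<omega> \<noteq> 0 \<and>
      dr Z3 (f3 \<Phi>) (le R (D + Y)) (vert (D + Y) Y) = \<rho> *\<^sub>R vert (D + Y) Y"
    if \<Phi>: "sdiff G \<Phi>" "(\<pi> \<circ> base_pt \<circ> base_pt \<circ> base_pt) (le R (D + Y)) \<in> G" "f3 \<Phi> (le R (D + Y)) = le R (D + Y)" for G \<Phi>
  proof -
    obtain \<kappa> l b k a' b' c' n n' where \<kappa>: "\<kappa> \<noteq> 0" "dr Z2 (f2 \<Phi>) R (D + Y) = \<kappa> *\<^sub>R (D + Y)"
      and g: "\<pi> q \<in> G" "lift \<Phi> q = q" "dr Z (lift \<Phi>) q \<xi> = l *\<^sub>R \<xi>" "l \<noteq> 0"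
      "dr Z (lift \<Phi>) q \<eta> = b *\<^sub>R \<eta> + k *\<^sub>R \<xi>" "b \<noteq> 0" "dr Z (lift \<Phi>) q \<zeta> = a' *\<^sub>R \<xi> + b' *\<^sub>R \<eta> + c' *\<^sub>R \<zeta>"
      "dr Z1 (f1 \<Phi>) Q X = l *\<^sub>R X + n *\<^sub>R U + n' *\<^sub>R V" using fix3[OF \<Phi> Tm(1,4)] .
    note M = main_act[OF \<Phi>(1) g]
    have \<pi>R: "(\<pi> \<circ> base_pt \<circ> base_pt) R \<in> G" using g(1) by simp
    obtain p r where p: "dr Z3 (f3 \<Phi>) (le R (D + Y)) F = \<kappa> *\<^sub>R F + p *\<^sub>R vert (D + Y) W + r *\<^sub>R vert (D + Y) Y"
      using L2.lift_act[OF \<Phi>(1) R \<pi>R B' F M(4) \<kappa>(2,1)] .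
    define w where "w t = dr Z (lift \<Phi>) q (cn t)" for t
    have w: "smooth UNIV w" unfolding w_def[abs_def]
      by (rule smooth_linear_compose[OF linear_conv_bounded_linear[THEN iffD1, OF dr_lin[OF \<Phi>(1) qZ g(1)]] cn(1)])
    have "\<exists>k. k \<noteq> 0 \<and> dr Z (lift \<Phi>) q (cn t) = k *\<^sub>R w t" for t by (rule exI[of _ 1]) (simp add: w_def)
    note c = conic_act[OF \<Phi>(1) g(1,2) open_UNIV UNIV_I w this]
    have "base_pt (mt (mt (dr Z3 (f3 \<Phi>) (le R (D + Y)) F) (D + Y)) U) = 0"
      unfolding c(1) by (rule fiber_curve_lift_zero(2)[OF open_UNIV UNIV_I smooth_fc[OF w open_UNIV] c(2)]) (use c(3) in simp_all)
    moreover have "base_pt (mt (mt F (D + Y)) U) = 0"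
      by (rule fiber_curve_lift_zero(2)[OF open_UNIV UNIV_I smooth_fc[OF cn(1) open_UNIV]]) (use icurveD(3)[OF cn(6)] cn(3) in simp_all)
    ultimately have "p *\<^sub>R \<xi> = 0" unfolding p by (simp only: mt_simps base_pt_simps D_image) simp
    then have "p = 0" using Bm(4) by simp
    then have 1: "dr Z3 (f3 \<Phi>) (le R (D + Y)) F = \<kappa> *\<^sub>R F + r *\<^sub>R vert (D + Y) Y" using p by simp
    have 2: "dr Z3 (f3 \<Phi>) (le R (D + Y)) (vert (D + Y) W) = (1 / \<kappa> * (l * l / b)) *\<^sub>R vert (D + Y) W + (1 / \<kappa> * (n' * l / b)) *\<^sub>R vert (D + Y) Y"
      unfolding v3[OF \<Phi>(1) g(1) Tm(1,4,2) \<kappa>(2,1)] M(6) by (simp add: vert_simps scaleR_add_right)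
    have 3: "dr Z3 (f3 \<Phi>) (le R (D + Y)) (vert (D + Y) Y) = (1 / \<kappa> * (c' / b)) *\<^sub>R vert (D + Y) Y"
      unfolding v3[OF \<Phi>(1) g(1) Tm(1,4,3) \<kappa>(2,1)] M(7) by (simp add: vert_simps)
    have "1 / \<kappa> * (l * l / b) \<noteq> 0" using \<kappa>(1) g(4,6) by simp
    with 1 2 3 \<kappa>(1) show ?thesis by blast
  qed
  have shr1: "\<exists>\<Phi>. polyaut \<Phi> \<and> f3 \<Phi> (le R (D + Y)) = le R (D + Y) \<and> dr Z3 (f3 \<Phi>) (le R (D + Y)) F = F \<and>
      dr Z3 (f3 \<Phi>) (le R (D + Y)) (vert (D + Y) W) = vert (D + Y) W + p *\<^sub>R vert (D + Y) Y \<and>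
      dr Z3 (f3 \<Phi>) (le R (D + Y)) (vert (D + Y) Y) = vert (D + Y) Y" for p
  proof -
    obtain \<Phi> where \<Phi>: "polyaut \<Phi>" "lift \<Phi> q = q" "dr Z (lift \<Phi>) q \<xi> = 1 *\<^sub>R \<xi>" "dr Z (lift \<Phi>) q \<eta> = 1 *\<^sub>R \<eta>" "dr Z (lift \<Phi>) q \<zeta> = 1 *\<^sub>R \<zeta>"
      "f2 \<Phi> R = R" "dr Z2 (f2 \<Phi>) R D = D" "dr Z2 (f2 \<Phi>) R W = W + p *\<^sub>R Y" "dr Z2 (f2 \<Phi>) R Y = Y"
      by (rule shear_act[of p]) simp
    note s = polyaut_sdiff[OF \<Phi>(1)]
    have d: "dr Z2 (f2 \<Phi>) R (D + Y) = 1 *\<^sub>R (D + Y)" using linear_add[OF L2.dr_lin[OF s R UNIV_I], of D Y] \<Phi>(7,9) by simp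
    show ?thesis using \<Phi>(1) fix3I[OF \<Phi>(1,6) Tm(1,4) d one_neq_zero] conic_fixed[OF s UNIV_I \<Phi>(2) one_neq_zero \<Phi>(3-5)]
        v3[OF s UNIV_I Tm(1,4,2) d one_neq_zero] v3[OF s UNIV_I Tm(1,4,3) d one_neq_zero]
      unfolding \<Phi>(8,9) by (intro exI[of _ \<Phi>]) (simp add: vert_simps)
  qed
  \<comment> \<open>Homotheties of \<Delta> q fix the conic and D + Y, while W has the weight s * s
    / s = s.\<close>
  have tor: "\<exists>\<Phi> \<mu>. polyaut \<Phi> \<and> f3 \<Phi> (le R (D + Y)) = le R (D + Y) \<and> dr Z3 (f3 \<Phi>) (le R (D + Y)) F = \<mu> *\<^sub>R F \<and>
      dr Z3 (f3 \<Phi>) (le R (D + Y)) (vert (D + Y) W) = (\<mu> * s) *\<^sub>R vert (D + Y) W" if s0: "s \<noteq> 0" for s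
  proof -
    have e: "s / s = 1" "s * s / s = s" using s0 by simp_all
    obtain \<Phi> where \<Phi>: "polyaut \<Phi>" "lift \<Phi> q = q" "dr Z (lift \<Phi>) q \<xi> = s *\<^sub>R \<xi>" "dr Z (lift \<Phi>) q \<eta> = s *\<^sub>R \<eta>" "dr Z (lift \<Phi>) q \<zeta> = s *\<^sub>R \<zeta>"
      "f2 \<Phi> R = R" "dr Z2 (f2 \<Phi>) R D = (s / s) *\<^sub>R D" "dr Z2 (f2 \<Phi>) R W = (s * s / s) *\<^sub>R W" "dr Z2 (f2 \<Phi>) R Y = (s / s) *\<^sub>R Y"
      by (rule torus_act[OF s0 s0 s0])
    note s = polyaut_sdiff[OF \<Phi>(1)]
    have d: "dr Z2 (f2 \<Phi>) R (D + Y) = 1 *\<^sub>R (D + Y)" using linear_add[OF L2.dr_lin[OF s R UNIV_I], of D Y] \<Phi>(7,9)[unfolded e] by simp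
    show ?thesis using \<Phi>(1) fix3I[OF \<Phi>(1,6) Tm(1,4) d one_neq_zero] conic_fixed[OF s UNIV_I \<Phi>(2) s0 \<Phi>(3-5)]
        v3[OF s UNIV_I Tm(1,4,2) d one_neq_zero]
      unfolding \<Phi>(8) e by (intro exI[of _ \<Phi>] exI[of _ 1]) (simp add: vert_simps)
  qed
  have shr2: "\<exists>\<Phi>. polyaut \<Phi> \<and> f3 \<Phi> (le R (D + Y)) = le R (D + Y) \<and> dr Z3 (f3 \<Phi>) (le R (D + Y)) F = F + p *\<^sub>R vert (D + Y) Y \<and>
      dr Z3 (f3 \<Phi>) (le R (D + Y)) (vert (D + Y) Y) = vert (D + Y) Y" for p
  proof -
    \<comment> \<open>To leading order the conic changes by - k / 2 times t^3 \<zeta>; taking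
      velocities three times multiplies this by 3, 2 and 1, so p = - 3 k.\<close>
    define k where "k = - p / 3"
    obtain \<Phi> where \<Phi>: "polyaut \<Phi>" "lift \<Phi> q = q" "dr Z (lift \<Phi>) q \<xi> = \<xi>" "dr Z (lift \<Phi>) q \<eta> = \<eta> + k *\<^sub>R \<xi>"
      "dr Z (lift \<Phi>) q \<zeta> = \<zeta> + (2 * k) *\<^sub>R \<eta>" using par[of k] by blast
    note s = polyaut_sdiff[OF \<Phi>(1)]
    obtain n n' where n: "dr Z1 (f1 \<Phi>) Q X = 1 *\<^sub>R X + n *\<^sub>R U + n' *\<^sub>R V"
      by (rule lift_act[OF s qZ UNIV_I B X \<Phi>(2), of 1]) (simp_all add: \<Phi>(3))
    have A: "dr Z (lift \<Phi>) q \<xi> = 1 *\<^sub>R \<xi>" "dr Z (lift \<Phi>) q \<eta> = 1 *\<^sub>R \<eta> + k *\<^sub>R \<xi>"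
      "dr Z (lift \<Phi>) q \<zeta> = 0 *\<^sub>R \<xi> + (2 * k) *\<^sub>R \<eta> + 1 *\<^sub>R \<zeta>" using \<Phi> by simp_all
    note M = main_act[OF s UNIV_I \<Phi>(2) A(1) one_neq_zero A(2) one_neq_zero A(3) n]
    have d: "dr Z2 (f2 \<Phi>) R (D + Y) = 1 *\<^sub>R (D + Y)" using linear_add[OF L2.dr_lin[OF s R UNIV_I], of D Y] M(5,7) by simp
    define S where "S = {t :: real. 1 + t * k \<noteq> 0}"
    have S: "open S" "0 \<in> S" using smooth_open_neq_0[of UNIV "\<lambda>t. 1 + t * k"] by (auto simp: S_def smooth_intros)
    \<comment> \<open>The image of \<open>cn t\<close> is (1 + t k) times this vector: thanks to the
      coefficient 2 k of \<eta> in the image of \<zeta> the parameter t survives unchanged and only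
      the \<zeta> coordinate differs.\<close>
    define w where "w t = \<xi> + t *\<^sub>R \<eta> + (t\<^sup>2 / (2 * (1 + t * k))) *\<^sub>R \<zeta>" for t
    define h where "h t = (- k / (2 * (1 + t * k))) *\<^sub>R \<zeta>" for t
    have sm: "smooth S w" "smooth S h" unfolding w_def[abs_def] h_def[abs_def] by (intro smooth_intros S; simp add: S_def)+
    have "\<exists>l. l \<noteq> 0 \<and> dr Z (lift \<Phi>) q (cn t) = l *\<^sub>R w t" if t: "t \<in> S" for t
    proof (intro exI conjI)
      show nz: "1 + t * k \<noteq> 0" using t by (simp add: S_def)
      have "d * (x / (2 * d)) = x / 2" if "d \<noteq> 0" for d x :: real using that by simp
      from this[OF nz] have e: "(1 + t * k) * (t\<^sup>2 / (2 * (1 + t * k))) = t\<^sup>2 / 2" .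
      have "(1 + t * k) *\<^sub>R w t = (1 + t * k) *\<^sub>R \<xi> + ((1 + t * k) * t) *\<^sub>R \<eta> + (t\<^sup>2 / 2) *\<^sub>R \<zeta>"
        unfolding w_def scaleR_add_right scaleR_scaleR e ..
      then show "dr Z (lift \<Phi>) q (cn t) = (1 + t * k) *\<^sub>R w t"
        by (simp add: cn_def linear_add[OF dr_lin[OF s qZ UNIV_I]] linear_scale[OF dr_lin[OF s qZ UNIV_I]] \<Phi> algebra_simps power2_eq_square)
    qed
    note image = this
    have c: "dr Z3 (f3 \<Phi>) (le R (D + Y)) F = ld (ld (fc' w)) 0" "\<And>t. t \<in> S \<Longrightarrow> fc' w t \<noteq> 0" "\<And>t. t \<in> S \<Longrightarrow> w t \<noteq> 0"
      by (rule conic_act[OF s UNIV_I \<Phi>(2) S sm(1) image]; assumption)+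
    have w: "w t = cn t + t ^ Suc 2 *\<^sub>R h t" if "t \<in> S" for t
    proof -
      have "t\<^sup>2 / (2 * (1 + t * k)) = t\<^sup>2 / 2 + t ^ Suc 2 * (- k / (2 * (1 + t * k)))"
        using that by (simp add: S_def field_simps power2_eq_square power3_eq_cube)
      then show ?thesis unfolding w_def cn_def h_def by (simp only: scaleR_add_left scaleR_scaleR add.assoc)
    qed
    have cnS: "smooth S cn" "smooth S (fc' cn)" "smooth S (fc' w)"
      using smooth_subset[OF cn(1)] smooth_fc[OF sm(1) S(1) c(3)] smooth_fc[OF _ S(1) cn(3)] by auto
    have nz1: "fc' cn t \<noteq> 0" for t using icurveD(3)[OF cn(6)] by simp
    obtain H where H: "smooth S H" "H 0 = real (Suc 2) *\<^sub>R vert (cn 0) (h 0)" "\<forall>t\<in>S. fc' w t = fc' cn t + t ^ 2 *\<^sub>R H t"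
      using pert_fc[OF S cnS(1) sm cn(3) c(3) w] by blast
    have "\<And>t. t \<in> S \<Longrightarrow> fc' w t = fc' cn t + t ^ Suc 1 *\<^sub>R H t" using H(3) by (simp add: power2_eq_square)
    from pert_ld[OF S cnS(2,3) H(1) nz1 c(2) this] obtain K where
      K: "smooth S K" "K 0 = real (Suc 1) *\<^sub>R vert (fc' cn 0) (H 0)" "\<forall>t\<in>S. ld (fc' w) t = ld (fc' cn) t + t ^ 1 *\<^sub>R K t" by blast
    have nz2: "ld (fc' cn) t \<noteq> 0" "ld (fc' w) t \<noteq> 0" if "t \<in> S" for t
      using base_pt_ld[of "fc' cn" t] base_pt_ld[of "fc' w" t] nz1[of t] c(2)[OF that] by (metis base_pt_simps(4))+
    have "\<And>t. t \<in> S \<Longrightarrow> ld (fc' w) t = ld (fc' cn) t + t ^ Suc 0 *\<^sub>R K t" using K(3) by simp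
    from pert_ld[OF S smooth_ld[OF cnS(2) S(1) nz1] smooth_ld[OF cnS(3) S(1) c(2)] K(1) nz2 this] obtain N where
      N: "N 0 = real (Suc 0) *\<^sub>R vert (ld (fc' cn) 0) (K 0)" "\<forall>t\<in>S. ld (ld (fc' w)) t = ld (ld (fc' cn)) t + t ^ 0 *\<^sub>R N t" by blast
    have "H 0 = (- 3 * k / 2) *\<^sub>R V" unfolding H(2) h_def cn(4) vert_scale_right by simp
    then have "K 0 = (- 3 * k) *\<^sub>R Y" unfolding K(2) cn_lift by (simp only: vert_scale_right) simp
    then have "N 0 = p *\<^sub>R vert (D + Y) Y" unfolding N(1) cn_lift by (simp only: vert_scale_right) (simp add: k_def)
    then have 1: "dr Z3 (f3 \<Phi>) (le R (D + Y)) F = F + p *\<^sub>R vert (D + Y) Y" using N(2) S(2) c(1) by simp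
    show ?thesis using \<Phi>(1) fix3I[OF \<Phi>(1) M(4) Tm(1,4) d one_neq_zero] 1 v3[OF s UNIV_I Tm(1,4,3) d one_neq_zero] M(7) by auto
  qed
  show "node Z3 D3 (\<pi> \<circ> base_pt \<circ> base_pt \<circ> base_pt) f3 (le R (D + Y))
    (cmb F (vert (D + Y) W) (vert (D + Y) Y) ` {(1,1,0), (1,0,0), (0,1,0), (0,0,1)})"
    by (rule L3.rvt1_node(1)[OF m B3 act shr1 shr2 tor])
  show "card (cmb F (vert (D + Y) W) (vert (D + Y) Y) ` {(1,1,0), (1,0,0), (0,1,0), (0,0,1)}) = 4"
    by (rule L3.rvt1_node(2)[OF m B3 act shr1 shr2 tor])
qed

end

subsection \<open>Polynomial automorphisms of three-space\<close>

definition pt :: "real \<Rightarrow> real \<Rightarrow> real \<Rightarrow> real^3" where "pt a b c = vector [a, b, c]"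

lemma pt_nth [simp]: "pt a b c $ 1 = a" "pt a b c $ 2 = b" "pt a b c $ 3 = c"
  by (simp_all add: pt_def)

lemma pt_eqI: "x $ 1 = y $ 1 \<Longrightarrow> x $ 2 = y $ 2 \<Longrightarrow> x $ 3 = y $ 3 \<Longrightarrow> x = y" for x y :: "real^3"
  by (simp add: vec_eq_iff forall_3)

lemma pt_simps [simp]:
  "pt a b c + pt a' b' c' = pt (a + a') (b + b') (c + c')" "r *\<^sub>R pt a b c = pt (r * a) (r * b) (r * c)"
  "pt a b c = pt a' b' c' \<longleftrightarrow> a = a' \<and> b = b' \<and> c = c'" "pt a b c = 0 \<longleftrightarrow> a = 0 \<and> b = 0 \<and> c = 0"
  "0 = pt a b c \<longleftrightarrow> a = 0 \<and> b = 0 \<and> c = 0" "pt 0 0 0 = 0"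
  by (auto intro!: pt_eqI) (metis pt_nth zero_index)+

lemma pt_coords: "pt (x $ 1) (x $ 2) (x $ 3) = x" by (rule pt_eqI) simp_all

abbreviation "ex \<equiv> pt 1 0 0"
abbreviation "ey \<equiv> pt 0 1 0"
abbreviation "ez \<equiv> pt 0 0 1"

lemma pt_sum: "pt a b c = a *\<^sub>R ex + b *\<^sub>R ey + c *\<^sub>R ez" by simp

lemma pt_hvd:
  assumes "(a has_real_derivative a') (at t)" "(b has_real_derivative b') (at t)" "(c has_real_derivative c') (at t)"
  shows "((\<lambda>t. pt (a t) (b t) (c t)) has_vector_derivative pt a' b' c') (at t)"
proof -
  note c = has_vector_derivative_scaleR[OF _ has_vector_derivative_const]
  from has_vector_derivative_add[OF has_vector_derivative_add[OF c[OF assms(1), of ex] c[OF assms(2), of ey]] c[OF assms(3), of ez]]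
  show ?thesis by simp
qed

lemma smooth_pt [smooth_intros]:
  assumes "smooth S a" "smooth S b" "smooth S c" shows "smooth S (\<lambda>t. pt (a t) (b t) (c t))"
  unfolding pt_sum[of "a _"] by (intro smooth_intros assms)

lemma basis_UNIV: "basis3 UNIV ex ey ez"
  unfolding basis3_def
proof
  show "UNIV = {a *\<^sub>R ex + b *\<^sub>R ey + c *\<^sub>R ez |a b c. True}" unfolding pt_sum[symmetric] using pt_coords by (metis (mono_tags, lifting) UNIV_eq_I mem_Collect_eq)
qed simp

definition pm :: "(real \<Rightarrow> real \<Rightarrow> real \<Rightarrow> real^3) \<Rightarrow> real^3 \<Rightarrow> real^3" where
  "pm F x = F (x $ 1) (x $ 2) (x $ 3)"

definition poly3 :: "(real \<Rightarrow> real \<Rightarrow> real \<Rightarrow> real) \<Rightarrow> bool" where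
  "poly3 f \<longleftrightarrow> real_polynomial_function (\<lambda>v :: real^3. f (v $ 1) (v $ 2) (v $ 3))"

lemma poly3_intros:
  "poly3 (\<lambda>x y z. c)" "poly3 (\<lambda>x y z. x)" "poly3 (\<lambda>x y z. y)" "poly3 (\<lambda>x y z. z)"
  "poly3 f \<Longrightarrow> poly3 g \<Longrightarrow> poly3 (\<lambda>x y z. f x y z + g x y z)" "poly3 f \<Longrightarrow> poly3 g \<Longrightarrow> poly3 (\<lambda>x y z. f x y z - g x y z)"
  "poly3 f \<Longrightarrow> poly3 g \<Longrightarrow> poly3 (\<lambda>x y z. f x y z * g x y z)" "poly3 f \<Longrightarrow> poly3 (\<lambda>x y z. f x y z ^ n)"
  unfolding poly3_def
  by (simp_all add: real_polynomial_function.intros(2-4) real_polynomial_function.intros(1)[OF bounded_linear_vec_nth]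
      real_polynomial_function_diff real_polynomial_function_power)

lemma polynomial_pm:
  assumes "poly3 f" "poly3 g" "poly3 h" shows "polynomial_function (pm (\<lambda>x y z. pt (f x y z) (g x y z) (h x y z)))"
  unfolding polynomial_function_iff_Basis_inner
proof
  fix b :: "real^3" assume "b \<in> Basis"
  then obtain i where i: "b = axis i 1" by (auto simp: Basis_vec_def)
  have e: "pm F x \<bullet> b = F (x $ 1) (x $ 2) (x $ 3) $ i" for F x by (simp add: i inner_axis pm_def)
  have "i = 1 \<or> i = 2 \<or> i = 3" by (rule exhaust_3)
  then show "real_polynomial_function (\<lambda>x. pm (\<lambda>x y z. pt (f x y z) (g x y z) (h x y z)) x \<bullet> b)"
    unfolding e using assms by (auto simp: poly3_def)
qed

lemma polyautI:
  assumes "poly3 f" "poly3 g" "poly3 h" "poly3 f'" "poly3 g'" "poly3 h'"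
    and "\<And>x y z. f' (f x y z) (g x y z) (h x y z) = x \<and> g' (f x y z) (g x y z) (h x y z) = y \<and> h' (f x y z) (g x y z) (h x y z) = z"
    and "\<And>x y z. f (f' x y z) (g' x y z) (h' x y z) = x \<and> g (f' x y z) (g' x y z) (h' x y z) = y \<and> h (f' x y z) (g' x y z) (h' x y z) = z"
  shows "polyaut (pm (\<lambda>x y z. pt (f x y z) (g x y z) (h x y z)))"
  unfolding polyaut_def
  by (intro conjI exI[of _ "pm (\<lambda>x y z. pt (f' x y z) (g' x y z) (h' x y z))"] polynomial_pm assms allI)
    (simp_all add: pm_def assms(7,8) pt_coords)

lemma dr_eq:
  assumes \<Phi>: "polyaut \<Phi>" and d: "((\<lambda>t. \<Phi> (p + t *\<^sub>R v)) has_vector_derivative w) (at 0)"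
  shows "dr UNIV \<Phi> p v = w"
proof -
  interpret L0: level P0 \<Delta>0 id "\<lambda>\<Phi>. \<Phi>" by (rule level_0)
  have g: "((\<lambda>t. p + t *\<^sub>R v) has_vector_derivative v) (at 0)" by (auto intro!: derivative_eq_intros)
  from curve_morph[OF L0.morph[OF polyaut_sdiff[OF \<Phi>]] open_UNIV UNIV_I _ _ g _ d]
  show ?thesis by simp
qed

subsection \<open>The levels of the Monster tower\<close>

lemma level_1: "level P1 \<Delta>1 base_pt lift1"
  using level.prolong[OF level_0] unfolding P1_def[symmetric] \<Delta>1_def[symmetric] lift1_def[symmetric] id_comp eta_contract_eq .
lemma level_2: "level P2 \<Delta>2 (base_pt \<circ> base_pt) lift2"
  using level.prolong[OF level_1] unfolding P2_def[symmetric] \<Delta>2_def[symmetric] lift2_def[symmetric] .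
lemma level_3: "level P3 \<Delta>3 (base_pt \<circ> base_pt \<circ> base_pt) lift3"
  using level.prolong[OF level_2] unfolding P3_def[symmetric] \<Delta>3_def[symmetric] lift3_def[symmetric] .

interpretation L0: level P0 \<Delta>0 id "\<lambda>\<Phi>. \<Phi>" by (rule level_0)
interpretation L1: level P1 \<Delta>1 base_pt lift1 by (rule level_1)
interpretation L2: level P2 \<Delta>2 "base_pt \<circ> base_pt" lift2 by (rule level_2)
interpretation L3: level P3 \<Delta>3 "base_pt \<circ> base_pt \<circ> base_pt" lift3 by (rule level_3)

lemmas imap_lift1 = L0.imap_lift[folded P1_def \<Delta>1_def lift1_def, unfolded id_comp]
lemmas imap_lift2 = L1.imap_lift[folded P2_def \<Delta>2_def lift2_def]
lemmas imap_lift3 = L2.imap_lift[folded P3_def \<Delta>3_def lift3_def]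
lemmas prol_map_lift1 = L0.prol_map_lift[folded lift1_def]
lemmas prol_map_lift2 = L1.prol_map_lift[folded lift2_def]
lemmas icurve_lift1 = icurve_lift[OF L0.reg, folded P1_def \<Delta>1_def]
lemmas icurve_lift2 = icurve_lift[OF L1.reg, folded P2_def \<Delta>2_def]
lemmas icurve_lift3 = icurve_lift[OF L2.reg, folded P3_def \<Delta>3_def]
lemmas dr_vert1 = L0.dr_vert[folded P1_def lift1_def]
lemmas dr_vert2 = L1.dr_vert[folded P2_def lift2_def]

section \<open>Regular points on the prolongations of the x-axis\<close>

abbreviation "X1 \<equiv> emb ex"
abbreviation "X2 \<equiv> emb X1"
abbreviation "X3 \<equiv> emb X2"
abbreviation "p1 \<equiv> le 0 ex"
abbreviation "p2 \<equiv> le p1 X1"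
abbreviation "p3 \<equiv> le p2 X2"

lemma ld_const: "ld (\<lambda>_. v) = (\<lambda>_. emb v)"
  by (rule ext) (simp add: ld_def)

lemma line_icurve: "icurve P0 \<Delta>0 UNIV (\<lambda>t. t *\<^sub>R ex) (\<lambda>_. ex)"
  unfolding icurve_def by (auto simp: smooth_const simp del: pt_simps(2) intro!: derivative_eq_intros)

lemma line_mem: "p1 \<in> P1" "X1 \<in> \<Delta>1 p1" "p2 \<in> P2" "X2 \<in> \<Delta>2 p2" "p3 \<in> P3" "X3 \<in> \<Delta>3 p3"
proof -
  note i1 = icurve_lift1[OF line_icurve, unfolded ld_const]
  note i2 = icurve_lift2[OF i1, unfolded ld_const]
  note i3 = icurve_lift3[OF i2, unfolded ld_const]
  show "p1 \<in> P1" "X1 \<in> \<Delta>1 p1" using icurveD(1,2)[OF i1 UNIV_I, of 0] by (simp_all add: lc_def)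
  show "p2 \<in> P2" "X2 \<in> \<Delta>2 p2" using icurveD(1,2)[OF i2 UNIV_I, of 0] by (simp_all add: lc_def)
  show "p3 \<in> P3" "X3 \<in> \<Delta>3 p3" using icurveD(1,2)[OF i3 UNIV_I, of 0] by (simp_all add: lc_def)
qed

text \<open>The x-axis has constant velocity, so its prolongations run through p1, p2, p3 with
  velocities X1, X2, X3. The action on these three vectors is therefore read off from the iterated
  velocities of a single image curve.\<close>

lemma line_act:
  assumes \<Phi>: "polyaut \<Phi>" and h: "\<And>t. \<Phi> (t *\<^sub>R ex) = h t" "\<And>t. (h has_vector_derivative h' t) (at t)" "smooth UNIV h'"
  shows "dr UNIV \<Phi> 0 ex = h' 0" "h' t \<noteq> 0" "lift1 \<Phi> p1 = le (h 0) (h' 0)" "dr P1 (lift1 \<Phi>) p1 X1 = ld h' 0"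
    "lift2 \<Phi> p2 = le (le (h 0) (h' 0)) (ld h' 0)" "dr P2 (lift2 \<Phi>) p2 X2 = ld (ld h') 0"
    "dr P3 (lift3 \<Phi>) p3 X3 = ld (ld (ld h')) 0" "ld h' t \<noteq> 0" "ld (ld h') t \<noteq> 0"
proof -
  note s = polyaut_sdiff[OF \<Phi>]
  have i0: "imap P0 \<Delta>0 id \<Phi> UNIV UNIV (\<lambda>t. t *\<^sub>R ex) (\<lambda>_. ex) h h'"
    unfolding imap_def using line_icurve h by (simp del: pt_simps)
  note i1 = imap_lift1[OF s i0, unfolded ld_const]
  note i2 = imap_lift2[OF s i1, unfolded ld_const]
  note i3 = imap_lift3[OF s i2, unfolded ld_const]
  show "dr UNIV \<Phi> 0 ex = h' 0" using L0.imap_dr(1)[OF s i0 UNIV_I, of 0] by (simp del: pt_simps(2))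
  show "h' t \<noteq> 0" "ld h' t \<noteq> 0" "ld (ld h') t \<noteq> 0"
    by (rule L0.imap_dr(2)[OF s i0 UNIV_I] L1.imap_dr(2)[OF s i1 UNIV_I] L2.imap_dr(2)[OF s i2 UNIV_I])+
  show "lift1 \<Phi> p1 = le (h 0) (h' 0)" "lift2 \<Phi> p2 = le (le (h 0) (h' 0)) (ld h' 0)"
    using i1 i2 unfolding imap_def by (auto simp: lc_def simp del: pt_simps(2) dest!: spec[of _ 0])
  show "dr P1 (lift1 \<Phi>) p1 X1 = ld h' 0" using L1.imap_dr(1)[OF s i1 UNIV_I, of 0] by (simp add: lc_def del: pt_simps(2))
  show "dr P2 (lift2 \<Phi>) p2 X2 = ld (ld h') 0" using L2.imap_dr(1)[OF s i2 UNIV_I, of 0] by (simp add: lc_def del: pt_simps(2))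
  show "dr P3 (lift3 \<Phi>) p3 X3 = ld (ld (ld h')) 0" using L3.imap_dr(1)[OF s i3 UNIV_I, of 0] by (simp add: lc_def del: pt_simps(2))
qed

abbreviation "U1 \<equiv> vert ex ey"
abbreviation "V1 \<equiv> vert ex ez"

lemma basis_1: "basis3 (\<Delta>1 p1) X1 U1 V1"
  using basis3_prol[OF L0.reg UNIV_I basis_UNIV, of X1 0] line_mem(2) unfolding \<Delta>1_def by simp
lemma basis_2: "basis3 (\<Delta>2 p2) X2 (vert X1 U1) (vert X1 V1)"
  using basis3_prol[OF L1.reg line_mem(1) basis_1, of X2] line_mem(4) unfolding \<Delta>2_def by simp

lemma X_nz: "X1 \<noteq> 0" "X2 \<noteq> 0"
  using basis3_mems(4)[OF basis_1] basis3_mems(4)[OF basis_2] by simp_all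

lemma vert_act:
  assumes \<Phi>: "polyaut \<Phi>" "\<Phi> 0 = 0" "dr UNIV \<Phi> 0 ex = a *\<^sub>R ex" "a \<noteq> 0"
  shows "lift1 \<Phi> p1 = p1" "dr P1 (lift1 \<Phi>) p1 (vert ex v) = (1 / a) *\<^sub>R vert ex (dr UNIV \<Phi> 0 v)"
    "dr P1 (lift1 \<Phi>) p1 X1 = a *\<^sub>R X1 \<Longrightarrow> lift2 \<Phi> p2 = p2"
    "dr P1 (lift1 \<Phi>) p1 X1 = a *\<^sub>R X1 \<Longrightarrow>
      dr P2 (lift2 \<Phi>) p2 (vert X1 (vert ex v)) = (1 / a) *\<^sub>R vert X1 ((1 / a) *\<^sub>R vert ex (dr UNIV \<Phi> 0 v))"
proof -
  note s = polyaut_sdiff[OF \<Phi>(1)]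
  have ex0: "ex \<noteq> 0" by simp
  show 1: "lift1 \<Phi> p1 = p1" using prol_map_lift1[OF s UNIV_I UNIV_I UNIV_I ex0, of 0] le_scale[OF \<Phi>(4)] \<Phi>(2,3) by (simp del: pt_simps)
  show 2: "dr P1 (lift1 \<Phi>) p1 (vert ex v) = (1 / a) *\<^sub>R vert ex (dr UNIV \<Phi> 0 v)" for v
    using dr_vert1[OF s UNIV_I UNIV_I UNIV_I ex0, of v 0] \<Phi> vert_scale_left[OF \<Phi>(4), of ex] by (simp del: pt_simps)
  assume X: "dr P1 (lift1 \<Phi>) p1 X1 = a *\<^sub>R X1"
  show "lift2 \<Phi> p2 = p2" using prol_map_lift2[OF s line_mem(1) UNIV_I line_mem(2) X_nz(1)] 1 X \<Phi>(4) by simp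
  have "vert ex v \<in> \<Delta>1 p1"
    using vert_mem[OF L0.reg UNIV_I UNIV_I ex0 UNIV_I] unfolding \<Delta>1_def by blast
  from dr_vert2[OF s line_mem(1) UNIV_I line_mem(2) X_nz(1) this]
  show "dr P2 (lift2 \<Phi>) p2 (vert X1 (vert ex v)) = (1 / a) *\<^sub>R vert X1 ((1 / a) *\<^sub>R vert ex (dr UNIV \<Phi> 0 v))"
    using X \<Phi>(4) 2 by (simp add: vert_scale_left)
qed

text \<open>The unperturbed field is constant and prolongs to the constant \<open>emb v\<close>, so
  the estimate can be iterated.\<close>

lemma ld_pert:
  assumes w: "\<And>t. w t = v + t ^ Suc m *\<^sub>R h t" and h: "smooth UNIV h" and nz: "\<And>t. w t \<noteq> 0"
  shows "\<exists>H. smooth UNIV H \<and> H 0 = real (Suc m) *\<^sub>R vert v (h 0) \<and> (\<forall>t. ld w t = emb v + t ^ m *\<^sub>R H t)"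
proof -
  have "w = (\<lambda>t. v + t ^ Suc m *\<^sub>R h t)" using w by blast
  then have sm: "smooth UNIV w" using h by (simp only: smooth_intros)
  have v: "v \<noteq> 0" using w[of 0] nz[of 0] by simp
  show ?thesis using pert_ld[OF open_UNIV UNIV_I smooth_const sm h v nz w] by (simp add: ld_const)
qed

text \<open>It moves the x-axis only at order \<open>k + 2\<close>, so that it acts trivially up to level \<open>k\<close>.\<close>
definition shear_map :: "nat \<Rightarrow> real \<Rightarrow> real \<Rightarrow> real^3 \<Rightarrow> real^3" where
  "shear_map k c d = pm (\<lambda>x y z. pt x (y + c * x ^ (k + 2)) (z + d * x ^ (k + 2)))"

lemma shear_map:
  fixes k c d
  defines "\<Phi> \<equiv> shear_map k c d" and "h' \<equiv> \<lambda>t. ex + t ^ Suc k *\<^sub>R pt 0 (real (k + 2) * c) (real (k + 2) * d)"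
  shows "polyaut \<Phi>" "\<Phi> 0 = 0" "dr UNIV \<Phi> 0 ex = 1 *\<^sub>R ex" "dr UNIV \<Phi> 0 ey = ey" "dr UNIV \<Phi> 0 ez = ez"
    "dr P1 (lift1 \<Phi>) p1 X1 = ld h' 0" "dr P2 (lift2 \<Phi>) p2 X2 = ld (ld h') 0"
    "dr P3 (lift3 \<Phi>) p3 X3 = ld (ld (ld h')) 0" "h' t \<noteq> 0" "ld h' t \<noteq> 0" "ld (ld h') t \<noteq> 0"
proof -
  show pa: "polyaut \<Phi>" unfolding \<Phi>_def shear_map_def
    by (rule polyautI[where f' = "\<lambda>x y z. x" and g' = "\<lambda>x y z. y - c * x ^ (k + 2)" and h' = "\<lambda>x y z. z - d * x ^ (k + 2)"])
      (intro poly3_intros | simp)+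
  show "\<Phi> 0 = 0" by (simp add: \<Phi>_def shear_map_def pm_def)
  show "dr UNIV \<Phi> 0 ey = ey" "dr UNIV \<Phi> 0 ez = ez"
    by (rule dr_eq[OF pa]; simp add: \<Phi>_def shear_map_def pm_def; intro pt_hvd; auto intro!: derivative_eq_intros)+
  have 1: "\<Phi> (t *\<^sub>R ex) = pt t (c * t ^ (k + 2)) (d * t ^ (k + 2))" for t by (simp add: \<Phi>_def shear_map_def pm_def)
  have 2: "((\<lambda>t. pt t (c * t ^ (k + 2)) (d * t ^ (k + 2))) has_vector_derivative h' t) (at t)" for t
  proof -
    have e: "h' t = pt 1 (c * (real (k + 2) * t ^ (k + 2 - Suc 0))) (d * (real (k + 2) * t ^ (k + 2 - Suc 0)))" by (simp add: h'_def mult_ac)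
    show ?thesis unfolding e by (intro pt_hvd DERIV_cmult DERIV_pow DERIV_ident)
  qed
  have 3: "smooth UNIV h'" unfolding h'_def by (intro smooth_intros)
  note l = line_act[OF pa 1 2 3]
  show "dr UNIV \<Phi> 0 ex = 1 *\<^sub>R ex" using l(1) by (simp add: h'_def)
  show "dr P1 (lift1 \<Phi>) p1 X1 = ld h' 0" "dr P2 (lift2 \<Phi>) p2 X2 = ld (ld h') 0"
    "dr P3 (lift3 \<Phi>) p3 X3 = ld (ld (ld h')) 0" "h' t \<noteq> 0" "ld h' t \<noteq> 0" "ld (ld h') t \<noteq> 0" by (rule l)+
qed

text \<open>The x-axis goes to itself with constant velocity a ex, so every lifted velocity is
  multiplied by a, while each application of \<open>vert\<close> divides by a.\<close>

lemma linear_act: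
  assumes \<Phi>: "polyaut \<Phi>" "linear \<Phi>" "\<Phi> ex = a *\<^sub>R ex" "a \<noteq> 0"
  shows "\<Phi> 0 = 0" "dr UNIV \<Phi> 0 v = \<Phi> v" "lift1 \<Phi> p1 = p1" "dr P1 (lift1 \<Phi>) p1 X1 = a *\<^sub>R X1"
    "dr P1 (lift1 \<Phi>) p1 (vert ex v) = (1 / a) *\<^sub>R vert ex (\<Phi> v)"
    "lift2 \<Phi> p2 = p2" "dr P2 (lift2 \<Phi>) p2 X2 = a *\<^sub>R X2" "dr P3 (lift3 \<Phi>) p3 X3 = a *\<^sub>R X3"
    "dr P2 (lift2 \<Phi>) p2 (vert X1 (vert ex v)) = (1 / a) *\<^sub>R vert X1 ((1 / a) *\<^sub>R vert ex (\<Phi> v))"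
proof -
  show 0: "\<Phi> 0 = 0" by (rule linear_0[OF \<Phi>(2)])
  have d: "dr UNIV \<Phi> 0 v = \<Phi> v" for v
    by (rule dr_eq[OF \<Phi>(1)]) (auto simp: linear_scale[OF \<Phi>(2)] intro!: derivative_eq_intros)
  then show "dr UNIV \<Phi> 0 v = \<Phi> v" .
  have l: "\<Phi> (t *\<^sub>R ex) = t *\<^sub>R (a *\<^sub>R ex)" for t using linear_scale[OF \<Phi>(2), of t ex] \<Phi>(3) by (simp only:)
  have l': "((\<lambda>t. t *\<^sub>R (a *\<^sub>R ex)) has_vector_derivative a *\<^sub>R ex) (at t)" for t
    by (auto simp del: pt_simps intro!: derivative_eq_intros)
  note L = line_act[OF \<Phi>(1) l l' smooth_const, unfolded ld_const emb_simps]
  show X: "dr P1 (lift1 \<Phi>) p1 X1 = a *\<^sub>R X1" "dr P2 (lift2 \<Phi>) p2 X2 = a *\<^sub>R X2" "dr P3 (lift3 \<Phi>) p3 X3 = a *\<^sub>R X3" by (rule L)+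
  note v = vert_act[OF \<Phi>(1) 0 L(1) \<Phi>(4), unfolded d]
  show "lift1 \<Phi> p1 = p1" "dr P1 (lift1 \<Phi>) p1 (vert ex v) = (1 / a) *\<^sub>R vert ex (\<Phi> v)" "lift2 \<Phi> p2 = p2"
    "dr P2 (lift2 \<Phi>) p2 (vert X1 (vert ex v)) = (1 / a) *\<^sub>R vert X1 ((1 / a) *\<^sub>R vert ex (\<Phi> v))"
    by (rule v X)+
qed

section \<open>The maps that establish the locale \<open>vn\<close> at 0, p1 and p2\<close>

definition diag_map :: "real \<Rightarrow> real \<Rightarrow> real \<Rightarrow> real^3 \<Rightarrow> real^3" where
  "diag_map a b c = pm (\<lambda>x y z. pt (a * x) (b * y) (c * z))"

lemma diag_map:
  assumes "a \<noteq> 0" "b \<noteq> 0" "c \<noteq> 0"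
  shows "polyaut (diag_map a b c)" "linear (diag_map a b c)" "diag_map a b c ex = a *\<^sub>R ex"
    "diag_map a b c ey = b *\<^sub>R ey" "diag_map a b c ez = c *\<^sub>R ez"
proof -
  show "polyaut (diag_map a b c)" unfolding diag_map_def
    by (rule polyautI[where f' = "\<lambda>x y z. (1 / a) * x" and g' = "\<lambda>x y z. (1 / b) * y" and h' = "\<lambda>x y z. (1 / c) * z"])
      (intro poly3_intros | simp add: assms)+
  show "linear (diag_map a b c)" by (rule linearI) (simp_all add: diag_map_def pm_def algebra_simps)
qed (simp_all add: diag_map_def pm_def)

text \<open>With y + i z as complex coordinate and s = 1 / (b^2 + c^2) this is division by b + i
  c.\<close>

definition gl_map :: "real \<Rightarrow> real \<Rightarrow> real \<Rightarrow> real^3 \<Rightarrow> real^3" where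
  "gl_map s b c = pm (\<lambda>x y z. pt x (s * (b * y + c * z)) (s * (b * z - c * y)))"

lemma gl_map:
  assumes s: "s * (b * b + c * c) = 1"
  shows "polyaut (gl_map s b c)" "linear (gl_map s b c)" "gl_map s b c ex = 1 *\<^sub>R ex"
    "gl_map s b c (b *\<^sub>R ey + c *\<^sub>R ez) = ey"
proof -
  have "b * (s * (b * y + c * z)) - c * (s * (b * z - c * y)) = s * (b * b + c * c) * y"
    "c * (s * (b * y + c * z)) + b * (s * (b * z - c * y)) = s * (b * b + c * c) * z"
    "s * (b * (b * y - c * z) + c * (c * y + b * z)) = s * (b * b + c * c) * y"
    "s * (b * (c * y + b * z) - c * (b * y - c * z)) = s * (b * b + c * c) * z" for y z by (simp_all add: algebra_simps)
  note e = this[unfolded s mult_1]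
  show "polyaut (gl_map s b c)" unfolding gl_map_def
    by (rule polyautI[where f' = "\<lambda>x y z. x" and g' = "\<lambda>x y z. b * y - c * z" and h' = "\<lambda>x y z. c * y + b * z"])
      ((intro poly3_intros)+, simp_all only: e simp_thms)
  show "linear (gl_map s b c)" by (rule linearI) (simp_all add: gl_map_def pm_def algebra_simps)
  show "gl_map s b c (b *\<^sub>R ey + c *\<^sub>R ez) = ey" using s by (simp add: gl_map_def pm_def)
qed (simp add: gl_map_def pm_def)

lemma ex_gl_map:
  assumes "(b, c) \<noteq> (0, 0)" obtains s where "s * (b * b + c * c) = (1 :: real)"
proof -
  have "b * b + c * c \<noteq> 0" using assms by (simp add: sum_squares_eq_zero_iff)
  then show thesis by (intro that[of "1 / (b * b + c * c)"]) simp
qed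

text \<open>Each prolongation lowers the order of the perturbation by one and multiplies it by the
  order it had; from order k + 1 this leaves the coefficient (k + 1)! at 0 after k + 1
  prolongations, and nothing earlier.\<close>

lemma line_jets:
  assumes h: "\<And>t. h t = ex + t ^ Suc k *\<^sub>R v" and nz: "\<And>t. h t \<noteq> 0" "\<And>t. ld h t \<noteq> 0" "\<And>t. ld (ld h) t \<noteq> 0"
  shows "k = 0 \<Longrightarrow> ld h 0 = X1 + vert ex v"
    "k = 1 \<Longrightarrow> ld h 0 = X1" "k = 1 \<Longrightarrow> ld (ld h) 0 = X2 + 2 *\<^sub>R vert X1 (vert ex v)"
    "k = 2 \<Longrightarrow> ld (ld h) 0 = X2" "k = 2 \<Longrightarrow> ld (ld (ld h)) 0 = X3 + 6 *\<^sub>R vert X2 (vert X1 (vert ex v))"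
proof -
  obtain H where H: "smooth UNIV H" "H 0 = real (Suc k) *\<^sub>R vert ex v" "\<And>t. ld h t = X1 + t ^ k *\<^sub>R H t"
    using ld_pert[OF h smooth_const nz(1)] by blast
  show "k = 0 \<Longrightarrow> ld h 0 = X1 + vert ex v" using H(2,3) by simp
  show 1: "k = 1 \<Longrightarrow> ld h 0 = X1" using H(3) by simp
  have K: "\<exists>K. smooth UNIV K \<and> K 0 = real (Suc m) *\<^sub>R vert X1 (H 0) \<and> (\<forall>t. ld (ld h) t = X2 + t ^ m *\<^sub>R K t)" if "k = Suc m" for m
  proof -
    have e: "ld h t = X1 + t ^ Suc m *\<^sub>R H t" for t using H(3) that by simp
    show ?thesis using ld_pert[OF e H(1) nz(2)] by blast
  qed
  show "k = 1 \<Longrightarrow> ld (ld h) 0 = X2 + 2 *\<^sub>R vert X1 (vert ex v)" using K[of 0] H(2) by (auto simp: vert_scale_right)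
  assume k: "k = 2"
  then obtain K where K: "smooth UNIV K" "K 0 = real (Suc 1) *\<^sub>R vert X1 (H 0)" "\<And>t. ld (ld h) t = X2 + t ^ 1 *\<^sub>R K t"
    using K[of 1] by auto
  show "ld (ld h) 0 = X2" using K(3)[of 0] by simp
  have "ld (ld h) t = X2 + t ^ Suc 0 *\<^sub>R K t" for t using K(3) by simp
  from ld_pert[OF this K(1) nz(3)] have "ld (ld (ld h)) 0 = X3 + vert X2 (K 0)" by auto
  then show "ld (ld (ld h)) 0 = X3 + 6 *\<^sub>R vert X2 (vert X1 (vert ex v))" by (simp add: K(2) H(2) k vert_scale_right)
qed

lemma vn0: "vn P0 \<Delta>0 id (\<lambda>\<Phi>. \<Phi>) 0 ex ey ez X1"
proof (intro vn.intro vn_axioms.intro level_0 basis_UNIV UNIV_I, unfold P1_def[symmetric] \<Delta>1_def[symmetric] lift1_def[symmetric])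
  show "X1 \<in> \<Delta>1 p1" "base_pt X1 = ex" using line_mem by simp_all
  fix k l :: real
  \<comment> \<open>The velocity of (t, c t^2, d t^2) deviates from ex by t times (0, 2 c, 2 d),
    hence the division by 2.\<close>
  note s = shear_map[where k = 0 and c = "k / 2" and d = "l / 2"]
  have e: "vert ex (pt 0 (real (0 + 2) * (k / 2)) (real (0 + 2) * (l / 2))) = k *\<^sub>R U1 + l *\<^sub>R V1"
    using vert_add[of ex "k *\<^sub>R ey" "l *\<^sub>R ez"] unfolding vert_scale_right by simp
  show "\<exists>\<Phi>. polyaut \<Phi> \<and> \<Phi> 0 = 0 \<and> dr UNIV \<Phi> 0 ex = ex \<and> dr UNIV \<Phi> 0 ey = ey \<and> dr UNIV \<Phi> 0 ez = ez \<and>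
      dr P1 (lift1 \<Phi>) p1 X1 = X1 + k *\<^sub>R U1 + l *\<^sub>R V1"
    using s(1-5) s(6)[unfolded line_jets(1)[OF refl s(9-11) refl] e] unfolding scaleR_one add.assoc by blast
next
  fix a b c :: real assume n: "a \<noteq> 0" "b \<noteq> 0" "c \<noteq> 0"
  note d = diag_map[OF n]
  note a = linear_act[OF d(1-3) n(1)]
  show "\<exists>\<Phi>. polyaut \<Phi> \<and> \<Phi> 0 = 0 \<and> dr UNIV \<Phi> 0 ex = a *\<^sub>R ex \<and> dr UNIV \<Phi> 0 ey = b *\<^sub>R ey \<and> dr UNIV \<Phi> 0 ez = c *\<^sub>R ez \<and>
      dr P1 (lift1 \<Phi>) p1 X1 = a *\<^sub>R X1"
    using d(1) a(1) a(2)[of ex, unfolded d] a(2)[of ey, unfolded d] a(2)[of ez, unfolded d] a(4) by blast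
next
  fix b c :: real assume n: "(b, c) \<noteq> (0, 0)"
  obtain s where s: "s * (b * b + c * c) = 1" using ex_gl_map[OF n] .
  note d = gl_map[OF s]
  note a = linear_act[OF d(1-3) one_neq_zero]
  show "\<exists>\<Phi>. polyaut \<Phi> \<and> \<Phi> 0 = 0 \<and> dr UNIV \<Phi> 0 ex = ex \<and> dr UNIV \<Phi> 0 (b *\<^sub>R ey + c *\<^sub>R ez) = ey"
    using d(1) a(1) a(2)[of ex, unfolded d scaleR_one] a(2)[of "b *\<^sub>R ey + c *\<^sub>R ez", unfolded d] by blast
qed

lemma vn1: "vn P1 \<Delta>1 base_pt lift1 p1 X1 U1 V1 X2"
proof (intro vn.intro vn_axioms.intro level_1 basis_1 line_mem(1), unfold P2_def[symmetric] \<Delta>2_def[symmetric] lift2_def[symmetric])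
  show "X2 \<in> \<Delta>2 p2" "base_pt X2 = X1" using line_mem by simp_all
  fix k l :: real
  \<comment> \<open>6 = 3 * 2: the derivative of t^3 and the factor 2! from
    \<open>line_jets\<close>.\<close>
  note s = shear_map[where k = 1 and c = "k / 6" and d = "l / 6"]
  have e: "2 *\<^sub>R vert X1 (vert ex (pt 0 (real (1 + 2) * (k / 6)) (real (1 + 2) * (l / 6)))) = k *\<^sub>R vert X1 U1 + l *\<^sub>R vert X1 V1"
  proof -
    have p: "pt 0 (real (1 + 2) * (k / 6)) (real (1 + 2) * (l / 6)) = (k / 2) *\<^sub>R ey + (l / 2) *\<^sub>R ez" by simp
    show ?thesis unfolding p vert_add vert_scale_right by (simp add: scaleR_add_right)
  qed
  note j = line_jets[OF refl s(9-11), unfolded e]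
  note v = vert_act[OF s(1-3) one_neq_zero]
  have A: "dr P1 (lift1 (shear_map 1 (k / 6) (l / 6))) p1 X1 = X1" "dr P1 (lift1 (shear_map 1 (k / 6) (l / 6))) p1 U1 = U1"
    "dr P1 (lift1 (shear_map 1 (k / 6) (l / 6))) p1 V1 = V1"
    using s(6) j(2)[OF refl] v(2)[of ey] v(2)[of ez] s(4,5) by simp_all
  show "\<exists>\<Phi>. polyaut \<Phi> \<and> lift1 \<Phi> p1 = p1 \<and> dr P1 (lift1 \<Phi>) p1 X1 = X1 \<and> dr P1 (lift1 \<Phi>) p1 U1 = U1 \<and> dr P1 (lift1 \<Phi>) p1 V1 = V1 \<and>
      dr P2 (lift2 \<Phi>) p2 X2 = X2 + k *\<^sub>R vert X1 U1 + l *\<^sub>R vert X1 V1"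
    using s(1) v(1) A s(7)[unfolded j(3)[OF refl]] unfolding add.assoc by blast
next
  fix a b c :: real assume n: "a \<noteq> 0" "b \<noteq> 0" "c \<noteq> 0"
  \<comment> \<open>U1 and V1 are scaled by the weights of y and z divided by a, so these weights
    carry an extra factor a.\<close>
  then have n': "a * b \<noteq> 0" "a * c \<noteq> 0" by simp_all
  note d = diag_map[OF n(1) n']
  note L = linear_act[OF d(1-3) n(1)]
  have A: "dr P1 (lift1 (diag_map a (a * b) (a * c))) p1 U1 = b *\<^sub>R U1" "dr P1 (lift1 (diag_map a (a * b) (a * c))) p1 V1 = c *\<^sub>R V1"
    using L(5)[of ey] L(5)[of ez] n unfolding d vert_scale_right by simp_all
  show "\<exists>\<Phi>. polyaut \<Phi> \<and> lift1 \<Phi> p1 = p1 \<and> dr P1 (lift1 \<Phi>) p1 X1 = a *\<^sub>R X1 \<and> dr P1 (lift1 \<Phi>) p1 U1 = b *\<^sub>R U1 \<and>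
      dr P1 (lift1 \<Phi>) p1 V1 = c *\<^sub>R V1 \<and> dr P2 (lift2 \<Phi>) p2 X2 = a *\<^sub>R X2"
    using d(1) L(3,4,7) A by blast
next
  fix b c :: real assume n: "(b, c) \<noteq> (0, 0)"
  obtain s where s: "s * (b * b + c * c) = 1" using ex_gl_map[OF n] .
  note d = gl_map[OF s]
  note L = linear_act[OF d(1-3) one_neq_zero]
  have A: "dr P1 (lift1 (gl_map s b c)) p1 (b *\<^sub>R U1 + c *\<^sub>R V1) = U1"
    using L(5)[of "b *\<^sub>R ey + c *\<^sub>R ez"] unfolding d vert_add vert_scale_right by simp
  show "\<exists>\<Phi>. polyaut \<Phi> \<and> lift1 \<Phi> p1 = p1 \<and> dr P1 (lift1 \<Phi>) p1 X1 = X1 \<and> dr P1 (lift1 \<Phi>) p1 (b *\<^sub>R U1 + c *\<^sub>R V1) = U1"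
    using d(1) L(3) L(4)[unfolded scaleR_one] A by blast
qed

abbreviation "U2 \<equiv> vert X1 U1"
abbreviation "V2 \<equiv> vert X1 V1"

lemma vn2: "vn P2 \<Delta>2 (base_pt \<circ> base_pt) lift2 p2 X2 U2 V2 X3"
proof (intro vn.intro vn_axioms.intro level_2 basis_2 line_mem(3), unfold P3_def[symmetric] \<Delta>3_def[symmetric] lift3_def[symmetric])
  show "X3 \<in> \<Delta>3 p3" "base_pt X3 = X2" using line_mem by simp_all
  fix k l :: real
  \<comment> \<open>24 = 4 * 6: the derivative of t^4 and the factor 3! from
    \<open>line_jets\<close>.\<close>
  note s = shear_map[where k = 2 and c = "k / 24" and d = "l / 24"]
  have e: "6 *\<^sub>R vert X2 (vert X1 (vert ex (pt 0 (real (2 + 2) * (k / 24)) (real (2 + 2) * (l / 24))))) = k *\<^sub>R vert X2 U2 + l *\<^sub>R vert X2 V2"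
  proof -
    have p: "pt 0 (real (2 + 2) * (k / 24)) (real (2 + 2) * (l / 24)) = (k / 6) *\<^sub>R ey + (l / 6) *\<^sub>R ez" by simp
    show ?thesis unfolding p vert_add vert_scale_right by (simp add: scaleR_add_right)
  qed
  let ?\<Phi> = "shear_map 2 (k / 24) (l / 24)"
  note j = line_jets[OF refl s(9-11), unfolded e]
  note v = vert_act[OF s(1-3) one_neq_zero]
  have A1: "dr P1 (lift1 ?\<Phi>) p1 X1 = 1 *\<^sub>R X1" using s(6)
    ld_pert[OF refl smooth_const s(9)] by auto
  have A: "dr P2 (lift2 ?\<Phi>) p2 X2 = X2" "dr P2 (lift2 ?\<Phi>) p2 U2 = U2" "dr P2 (lift2 ?\<Phi>) p2 V2 = V2"
    using s(7) j(4)[OF refl] v(4)[OF A1, of ey] v(4)[OF A1, of ez] s(4,5) by simp_all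
  show "\<exists>\<Phi>. polyaut \<Phi> \<and> lift2 \<Phi> p2 = p2 \<and> dr P2 (lift2 \<Phi>) p2 X2 = X2 \<and> dr P2 (lift2 \<Phi>) p2 U2 = U2 \<and> dr P2 (lift2 \<Phi>) p2 V2 = V2 \<and>
      dr P3 (lift3 \<Phi>) p3 X3 = X3 + k *\<^sub>R vert X2 U2 + l *\<^sub>R vert X2 V2"
    using s(1) v(3)[OF A1] A s(8)[unfolded j(5)[OF refl]] unfolding add.assoc by blast
next
  fix a b c :: real assume n: "a \<noteq> 0" "b \<noteq> 0" "c \<noteq> 0"
  \<comment> \<open>U2 and V2 arise from two applications of \<open>vert\<close>, each of which
    divides by a.\<close>
  then have n': "a * (a * b) \<noteq> 0" "a * (a * c) \<noteq> 0" by simp_all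
  note d = diag_map[OF n(1) n']
  note L = linear_act[OF d(1-3) n(1)]
  let ?\<Phi> = "diag_map a (a * (a * b)) (a * (a * c))"
  have A: "dr P2 (lift2 ?\<Phi>) p2 U2 = b *\<^sub>R U2" "dr P2 (lift2 ?\<Phi>) p2 V2 = c *\<^sub>R V2"
    using L(9)[of ey] L(9)[of ez] n unfolding d vert_scale_right by simp_all
  show "\<exists>\<Phi>. polyaut \<Phi> \<and> lift2 \<Phi> p2 = p2 \<and> dr P2 (lift2 \<Phi>) p2 X2 = a *\<^sub>R X2 \<and> dr P2 (lift2 \<Phi>) p2 U2 = b *\<^sub>R U2 \<and>
      dr P2 (lift2 \<Phi>) p2 V2 = c *\<^sub>R V2 \<and> dr P3 (lift3 \<Phi>) p3 X3 = a *\<^sub>R X3"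
    using d(1) L(6,7,8) A by blast
next
  fix b c :: real assume n: "(b, c) \<noteq> (0, 0)"
  obtain s where s: "s * (b * b + c * c) = 1" using ex_gl_map[OF n] .
  note d = gl_map[OF s]
  note L = linear_act[OF d(1-3) one_neq_zero]
  have A: "dr P2 (lift2 (gl_map s b c)) p2 (b *\<^sub>R U2 + c *\<^sub>R V2) = U2"
    using L(9)[of "b *\<^sub>R ey + c *\<^sub>R ez"] unfolding d vert_add vert_scale_right by (simp add: vert_simps)
  show "\<exists>\<Phi>. polyaut \<Phi> \<and> lift2 \<Phi> p2 = p2 \<and> dr P2 (lift2 \<Phi>) p2 X2 = X2 \<and> dr P2 (lift2 \<Phi>) p2 (b *\<^sub>R U2 + c *\<^sub>R V2) = U2"
    using d(1) L(6) L(7)[unfolded scaleR_one] A by blast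
qed

subsection \<open>The points over the vertical line\<close>

abbreviation "D0 \<equiv> ld (fl' ex ey) 0"
abbreviation "W0 \<equiv> vert U1 X1"
abbreviation "Y0 \<equiv> vert U1 V1"
abbreviation "p2V \<equiv> le p1 U1"

text \<open>The cusp \<open>rb\<close> with its line field \<open>rf\<close>; its prolongations reach the point \<open>le p2V (D0 + W0)\<close>.\<close>
definition rb :: "real \<Rightarrow> real^3" where "rb t = pt (t\<^sup>2 / 2) (t ^ 3 / 3) 0"
definition rf :: "real \<Rightarrow> real^3" where "rf t = pt 1 t 0"
definition rg :: "real \<Rightarrow> real^(3 prol)" where "rg t = le (rb t) (rf t)"
definition rg' :: "real \<Rightarrow> real^(3 prol)" where "rg' t = t *\<^sub>R emb (rf t) + vert (rf t) ey"

lemma rf: "rf t \<noteq> 0" "rf t = ex + t *\<^sub>R ey" "rf 0 = ex" "(rf has_vector_derivative ey) (at t)"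
  "(rb has_vector_derivative t *\<^sub>R rf t) (at t)" "smooth UNIV rf" "vector_derivative rf (at t) = ey"
proof -
  show "rf t \<noteq> 0" "rf t = ex + t *\<^sub>R ey" "rf 0 = ex" by (simp_all add: rf_def)
  show d: "(rf has_vector_derivative ey) (at t)" unfolding rf_def[abs_def] by (rule pt_hvd) (auto intro!: derivative_eq_intros)
  show "(rb has_vector_derivative t *\<^sub>R rf t) (at t)" unfolding rb_def[abs_def] rf_def pt_simps
    by (rule pt_hvd) (auto intro!: derivative_eq_intros simp: power2_eq_square)
  show "smooth UNIV rf" unfolding rf_def[abs_def] by (intro smooth_intros)
  show "vector_derivative rf (at t) = ey" by (rule vector_derivative_at[OF d])
qed

text \<open>The cusp stops at t = 0, where its velocity t times \<open>rf t\<close> vanishes, but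
  its tangent line keeps turning; lifted to line elements it becomes an immersed curve, vertical
  exactly at 0.\<close>

lemma rg_icurve: "icurve P1 \<Delta>1 UNIV rg rg'"
  unfolding icurve_def
proof (intro conjI ballI)
  show "smooth UNIV rg'" unfolding rg'_def[abs_def] by (intro smooth_intros rf(6) open_UNIV) (rule rf(1))
  have m: "rg t \<in> P1" for t unfolding rg_def P1_def by (rule le_mem_prol[OF L0.reg UNIV_I UNIV_I rf(1)])
  fix t :: real
  show "rg t \<in> P1" by (rule m)
  show d: "(rg has_vector_derivative rg' t) (at t)"
    using le_has_vector_derivative[OF rf(5,4) rf(1)] unfolding rg_def[abs_def] rg'_def emb_simps .
  show "rg' t \<in> \<Delta>1 (rg t)" unfolding \<Delta>1_def
    by (rule prol_dist_curve[OF open_UNIV UNIV_I m[unfolded P1_def] d])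
      (simp add: rg_def rg'_def line_of_le[OF rf(1)] span_mul span_base)
  show "rg' t \<noteq> 0"
  proof
    assume 0: "rg' t = 0"
    then have "base_pt (rg' t) = 0" by simp
    then have "t = 0" using rf(1)[of t] by (simp add: rg'_def)
    then show False using 0 basis3_mems(5)[OF basis_1] by (simp add: rg'_def rf(3))
  qed
qed auto

abbreviation "E0 \<equiv> ld (ld rg') 0"

lemma rg_jets: "rg 0 = p1" "rg' 0 = U1" "lc rg rg' 0 = p2V" "ld rg' 0 = D0 + W0"
  "lc (lc rg rg') (ld rg') 0 = le p2V (D0 + W0)" "E0 \<in> \<Delta>3 (le p2V (D0 + W0))" "base_pt E0 = D0 + W0"
proof -
  show 1: "rg 0 = p1" "rg' 0 = U1" by (simp_all add: rg_def rg'_def rf(3) rb_def)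
  show 2: "lc rg rg' 0 = p2V" by (simp add: lc_def 1)
  note l = fl_icurve[OF L0.reg UNIV_I UNIV_I UNIV_I basis3_ind2(1)[OF basis_UNIV], of 0]
  have sm: "smooth UNIV (fl' ex ey)" "smooth UNIV rg'" using l rg_icurve by (simp_all add: icurve_def)
  have smh: "smooth UNIV (\<lambda>t. emb (rf t))" by (intro smooth_intros rf(6))
  \<comment> \<open>Compared with the fiber line the lifted cusp has the additional velocity t times
    \<open>emb (rf t)\<close>, which under prolongation turns into \<open>vert U1 X1\<close>, that
    is W0.\<close>
  have e: "rg' t = fl' ex ey t + t ^ Suc 0 *\<^sub>R emb (rf t)" for t
    unfolding rg'_def fl'_def rf(2)[symmetric] by simp
  from pert_ld[OF open_UNIV UNIV_I sm smh icurveD(3)[OF l] icurveD(3)[OF rg_icurve] e]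
  obtain H where "H 0 = real (Suc 0) *\<^sub>R vert (fl' ex ey 0) (emb (rf 0))" "\<forall>t\<in>UNIV. ld rg' t = ld (fl' ex ey) t + t ^ 0 *\<^sub>R H t"
    by blast
  then show 3: "ld rg' 0 = D0 + W0" by (simp add: fl_0 rf(3))
  show 4: "lc (lc rg rg') (ld rg') 0 = le p2V (D0 + W0)" by (simp add: lc_def[of "lc _ _"] 2 3)
  show "E0 \<in> \<Delta>3 (le p2V (D0 + W0))" using icurveD(2)[OF icurve_lift3[OF icurve_lift2[OF rg_icurve]] UNIV_I, of 0] by (simp add: 4)
  show "base_pt E0 = D0 + W0" by (simp add: 3)
qed

text \<open>The image of the cusp is compared with the cusp itself: its line field agrees up to
  order t^3 and its velocity up to order t^2. Taking velocities of line elements three times lowers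
  these orders to zero and brings in the factors 3, 2 and 1.\<close>

lemma rvr_act:
  assumes \<Phi>: "polyaut \<Phi>" and S: "open S" "0 \<in> S" and sm: "smooth S w" "smooth S h" "smooth S k"
    and w: "\<And>t. t \<in> S \<Longrightarrow> w t = rf t + t ^ 3 *\<^sub>R h t"
    and a: "\<And>t. t \<in> S \<Longrightarrow> \<exists>l. l \<noteq> 0 \<and> dr UNIV \<Phi> (rb t) (rf t) = l *\<^sub>R w t"
    and b: "\<And>t. t \<in> S \<Longrightarrow> ((\<lambda>s. \<Phi> (rb s)) has_vector_derivative t *\<^sub>R rf t + t\<^sup>2 *\<^sub>R k t) (at t)"
  shows "dr P3 (lift3 \<Phi>) (le p2V (D0 + W0)) E0 = E0 + vert (D0 + W0) (2 *\<^sub>R vert U1 (emb (k 0) + 3 *\<^sub>R vert ex (h 0)))"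
proof -
  note s = polyaut_sdiff[OF \<Phi>]
  have nz: "w t \<noteq> 0" if "t \<in> S" for t using a[OF that] L0.dr_nz[OF s UNIV_I UNIV_I UNIV_I rf(1), of "rb t" t] by auto
  define u where "u t = le (\<Phi> (rb t)) (w t)" for t
  define u' where "u' t = emb (t *\<^sub>R rf t + t\<^sup>2 *\<^sub>R k t) + vert (w t) (vector_derivative w (at t))" for t
  have smu: "smooth S u'" unfolding u'_def[abs_def]
    by (intro smooth_intros smooth_vd sm S nz smooth_subset[OF rf(6)]) auto
  have smr: "smooth S rf" "smooth S rg'" using rg_icurve smooth_subset[OF rf(6)] smooth_subset[of UNIV rg' S] by (auto simp: icurve_def)
  have "lift1 \<Phi> (rg t) = u t" if t: "t \<in> S" for t
    using a[OF t] prol_map_lift1[OF s UNIV_I UNIV_I UNIV_I rf(1), of "rb t" t] by (auto simp: rg_def u_def)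
  moreover have "(u has_vector_derivative u' t) (at t)" if t: "t \<in> S" for t
    unfolding u_def[abs_def] u'_def by (rule le_has_vector_derivative[OF b[OF t] smooth_hvd[OF sm(1) S(1) t] nz[OF t]])
  moreover have ic: "icurve P1 \<Delta>1 S rg rg'" using rg_icurve S smr by (auto simp: icurve_def)
  ultimately have i: "imap P1 \<Delta>1 base_pt (lift1 \<Phi>) UNIV S rg rg' u u'" unfolding imap_def using smu by simp
  note i2 = imap_lift2[OF s i]
  note i3 = imap_lift3[OF s i2]
  have nz1: "rg' t \<noteq> 0" "ld rg' t \<noteq> 0" for t
    using icurveD(3)[OF rg_icurve] icurveD(3)[OF icurve_lift2[OF rg_icurve]] by simp_all
  have nz2: "u' t \<noteq> 0" "ld u' t \<noteq> 0" if "t \<in> S" for t using L1.imap_dr(2)[OF s i that] L2.imap_dr(2)[OF s i2 that] by simp_all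
  have e3: "dr P3 (lift3 \<Phi>) (le p2V (D0 + W0)) E0 = ld (ld u') 0"
    using L3.imap_dr(1)[OF s i3 S(2)] unfolding rg_jets(5) .
  have "w t = rf t + t ^ Suc 2 *\<^sub>R h t" if "t \<in> S" for t using w[OF that] by (simp add: numeral_3_eq_3 numeral_2_eq_2)
  from pert[where q' = "\<lambda>t. t *\<^sub>R rf t + t\<^sup>2 *\<^sub>R k t" and p' = "\<lambda>t. t *\<^sub>R rf t", OF S smr(1) sm rf(1) nz this refl] obtain H where H: "smooth S H"
      "H 0 = emb (k 0) + real (Suc 2) *\<^sub>R vert (rf 0) (h 0)"
      "\<forall>t\<in>S. u' t = emb (t *\<^sub>R rf t) + vert (rf t) (vector_derivative rf (at t)) + t ^ 2 *\<^sub>R H t"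
    unfolding u'_def by blast
  have "u' t = rg' t + t ^ Suc 1 *\<^sub>R H t" if "t \<in> S" for t
    using H(3) that unfolding rg'_def rf(7) emb_simps by (simp add: power2_eq_square)
  from pert_ld[OF S smr(2) smu H(1) nz1(1) nz2(1) this] obtain K where K: "smooth S K" "K 0 = real (Suc 1) *\<^sub>R vert (rg' 0) (H 0)"
      "\<forall>t\<in>S. ld u' t = ld rg' t + t ^ 1 *\<^sub>R K t" by blast
  have "ld u' t = ld rg' t + t ^ Suc 0 *\<^sub>R K t" if "t \<in> S" for t using K(3) that by simp
  from pert_ld[OF S smooth_ld[OF smr(2) S(1) nz1(1)] smooth_ld[OF smu S(1) nz2(1)] K(1) nz1(2) nz2(2) this] obtain N where
      "N 0 = real (Suc 0) *\<^sub>R vert (ld rg' 0) (K 0)" "\<forall>t\<in>S. ld (ld u') t = ld (ld rg') t + t ^ 0 *\<^sub>R N t" by blast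
  then have "ld (ld u') 0 = E0 + vert (D0 + W0) (K 0)" using S(2) by (simp add: rg_jets)
  then show ?thesis unfolding e3 K(2) H(2) rg_jets(2) rf(3) by simp
qed

lemma rvr_shear_z:
  "\<exists>\<Phi> k n. polyaut \<Phi> \<and> \<Phi> 0 = 0 \<and> dr UNIV \<Phi> 0 ex = ex \<and> dr UNIV \<Phi> 0 ey = ey + k *\<^sub>R ex \<and> dr UNIV \<Phi> 0 ez = ez \<and>
    dr P1 (lift1 \<Phi>) p1 X1 = X1 + n *\<^sub>R U1 \<and>
    dr P3 (lift3 \<Phi>) (le p2V (D0 + W0)) E0 = E0 + p *\<^sub>R vert (D0 + W0) Y0"
proof -
  \<comment> \<open>Along the cusp the differential of x y on the line field is t * t^2 / 2 + t^3 /
    3 = (5 / 6) t^3, and 3 * 2 * 5 / 6 = 5.\<close>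
  define \<kappa> where "\<kappa> = p / 5"
  define \<Phi> where "\<Phi> = pm (\<lambda>x y z. pt x y (z + \<kappa> * (x * y)))"
  have pa: "polyaut \<Phi>" unfolding \<Phi>_def
    by (rule polyautI[where f' = "\<lambda>x y z. x" and g' = "\<lambda>x y z. y" and h' = "\<lambda>x y z. z - \<kappa> * (x * y)"]) (intro poly3_intros | simp)+
  have d: "dr UNIV \<Phi> 0 ey = ey" "dr UNIV \<Phi> 0 ez = ez"
    by (rule dr_eq[OF pa]; simp add: \<Phi>_def pm_def; intro pt_hvd; auto intro!: derivative_eq_intros)+
  have l: "\<Phi> (t *\<^sub>R ex) = t *\<^sub>R ex" "((\<lambda>t. t *\<^sub>R ex) has_vector_derivative ex) (at t)" for t
    by (simp add: \<Phi>_def pm_def) (auto simp del: pt_simps intro!: derivative_eq_intros)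
  note L = line_act[OF pa l smooth_const, unfolded ld_const]
  define w where "w t = pt 1 t (5 / 6 * \<kappa> * t ^ 3)" for t
  define k where "k t = pt 0 0 (5 / 6 * \<kappa> * t\<^sup>2)" for t
  have sm: "smooth UNIV w" "smooth UNIV k" unfolding w_def[abs_def] k_def[abs_def] by (intro smooth_intros)+
  have w: "w t = rf t + t ^ 3 *\<^sub>R pt 0 0 (5 / 6 * \<kappa>)" for t by (simp add: w_def rf_def mult_ac)
  have a: "dr UNIV \<Phi> (rb t) (rf t) = w t" for t
  proof (rule dr_eq[OF pa])
    have e: "\<Phi> (rb t + s *\<^sub>R rf t) = pt (t\<^sup>2 / 2 + s) (t ^ 3 / 3 + s * t) (\<kappa> * ((t\<^sup>2 / 2 + s) * (t ^ 3 / 3 + s * t)))" for s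
      by (simp add: \<Phi>_def pm_def rb_def rf_def)
    show "((\<lambda>s. \<Phi> (rb t + s *\<^sub>R rf t)) has_vector_derivative w t) (at 0)"
      unfolding e w_def by (rule pt_hvd) (auto intro!: derivative_eq_intros simp: power2_eq_square power3_eq_cube algebra_simps)
  qed
  have b: "((\<lambda>s. \<Phi> (rb s)) has_vector_derivative t *\<^sub>R rf t + t\<^sup>2 *\<^sub>R k t) (at t)" for t
  proof -
    have e: "\<Phi> (rb s) = pt (s\<^sup>2 / 2) (s ^ 3 / 3) (\<kappa> * (s\<^sup>2 / 2 * (s ^ 3 / 3)))" for s by (simp add: \<Phi>_def pm_def rb_def)
    show ?thesis unfolding e rf_def k_def pt_simps
      by (rule pt_hvd) (auto intro!: derivative_eq_intros simp: power2_eq_square power3_eq_cube algebra_simps)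
  qed
  have "\<exists>l. l \<noteq> 0 \<and> dr UNIV \<Phi> (rb t) (rf t) = l *\<^sub>R w t" for t by (rule exI[of _ 1]) (simp add: a)
  note r = rvr_act[OF pa open_UNIV UNIV_I sm(1) smooth_const sm(2) w this b]
  have "pt 0 0 (5 / 6 * \<kappa>) = (5 / 6 * \<kappa>) *\<^sub>R ez" "k 0 = 0" by (simp_all add: k_def)
  then have "dr P3 (lift3 \<Phi>) (le p2V (D0 + W0)) E0 = E0 + p *\<^sub>R vert (D0 + W0) Y0"
    unfolding r by (simp only: vert_simps emb_simps scaleR_scaleR add_0_left) (simp add: \<kappa>_def)
  moreover have "dr UNIV \<Phi> 0 ey = ey + 0 *\<^sub>R ex" "dr P1 (lift1 \<Phi>) p1 X1 = X1 + 0 *\<^sub>R U1" "\<Phi> 0 = 0"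
    using d L(4) l(1)[of 0] by simp_all
  ultimately show ?thesis using pa L(1) d(2) by blast
qed

lemma rvr_shear_x:
  "\<exists>\<Phi> k n. polyaut \<Phi> \<and> \<Phi> 0 = 0 \<and> dr UNIV \<Phi> 0 ex = ex \<and> dr UNIV \<Phi> 0 ey = ey + k *\<^sub>R ex \<and> dr UNIV \<Phi> 0 ez = ez \<and>
    dr P1 (lift1 \<Phi>) p1 X1 = X1 + n *\<^sub>R U1 \<and>
    dr P3 (lift3 \<Phi>) (le p2V (D0 + W0)) E0 = E0 + p *\<^sub>R vert (D0 + W0) W0"
proof -
  \<comment> \<open>The leading correction to the velocity of the image curve is \<kappa> t^2 ex,
    and the last two prolongations multiply it by 2 and 1.\<close>
  define \<kappa> where "\<kappa> = p / 2"
  \<comment> \<open>The shear x + \<kappa> y alone changes the slope t of the line field to t / (1 +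
    \<kappa> t) = t - \<kappa> t^2 + ...; the quadratic term in the second coordinate cancels the
    t^2, which leaves agreement up to order t^3.\<close>
  define \<Phi> where "\<Phi> = pm (\<lambda>x y z. pt (x + \<kappa> * y) (y + \<kappa> * (x + \<kappa> * y)\<^sup>2) z)"
  have pa: "polyaut \<Phi>" unfolding \<Phi>_def
    by (rule polyautI[where f' = "\<lambda>x y z. x - \<kappa> * (y - \<kappa> * x\<^sup>2)" and g' = "\<lambda>x y z. y - \<kappa> * x\<^sup>2" and h' = "\<lambda>x y z. z"]) (intro poly3_intros | simp)+
  have d: "dr UNIV \<Phi> 0 ey = ey + \<kappa> *\<^sub>R ex" "dr UNIV \<Phi> 0 ez = ez"
    by (rule dr_eq[OF pa]; simp add: \<Phi>_def pm_def; intro pt_hvd; auto intro!: derivative_eq_intros)+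
  have l: "\<Phi> (t *\<^sub>R ex) = pt t (\<kappa> * t\<^sup>2) 0" for t by (simp add: \<Phi>_def pm_def)
  define l' where "l' t = ex + t ^ Suc 0 *\<^sub>R pt 0 (2 * \<kappa>) 0" for t
  have l': "((\<lambda>t. pt t (\<kappa> * t\<^sup>2) 0) has_vector_derivative l' t) (at t)" for t
    unfolding l'_def pt_simps by (rule pt_hvd) (auto intro!: derivative_eq_intros)
  have "smooth UNIV l'" unfolding l'_def[abs_def] by (intro smooth_intros)
  note L = line_act[OF pa l l' this]
  have X: "dr P1 (lift1 \<Phi>) p1 X1 = X1 + (2 * \<kappa>) *\<^sub>R U1"
    using L(4) line_jets(1)[OF l'_def L(2,8,9) refl] vert_scale_right[of ex "2 * \<kappa>" ey] by simp
  define S where "S = {t :: real. 1 + \<kappa> * t \<noteq> 0}"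
  have S: "open S" "0 \<in> S" using smooth_open_neq_0[of UNIV "\<lambda>t. 1 + \<kappa> * t"] by (auto simp: S_def smooth_intros)
  define h where "h t = pt 0 (\<kappa>\<^sup>2 / (1 + \<kappa> * t) + 2 / 3 * \<kappa>\<^sup>2) 0" for t
  define w where "w t = rf t + t ^ 3 *\<^sub>R h t" for t
  define k where "k t = pt \<kappa> (2 * \<kappa> * (1 / 2 + 1 / 3 * \<kappa> * t) * (t + \<kappa> * t\<^sup>2)) 0" for t
  have smh: "smooth S h" unfolding h_def[abs_def] by (intro smooth_intros S) (simp add: S_def)
  have sm: "smooth S w" "smooth S k" unfolding w_def[abs_def] k_def[abs_def] by (intro smooth_intros smh smooth_subset[OF rf(6)] subset_UNIV)+
  have a: "dr UNIV \<Phi> (rb t) (rf t) = pt (1 + \<kappa> * t) (t + 2 * \<kappa> * (t\<^sup>2 / 2 + \<kappa> * (t ^ 3 / 3)) * (1 + \<kappa> * t)) 0" for t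
  proof (rule dr_eq[OF pa])
    have e: "\<Phi> (rb t + s *\<^sub>R rf t) = pt ((t\<^sup>2 / 2 + s) + \<kappa> * (t ^ 3 / 3 + s * t))
        ((t ^ 3 / 3 + s * t) + \<kappa> * ((t\<^sup>2 / 2 + s) + \<kappa> * (t ^ 3 / 3 + s * t))\<^sup>2) 0" for s
      by (simp add: \<Phi>_def pm_def rb_def rf_def)
    show "((\<lambda>s. \<Phi> (rb t + s *\<^sub>R rf t)) has_vector_derivative
        pt (1 + \<kappa> * t) (t + 2 * \<kappa> * (t\<^sup>2 / 2 + \<kappa> * (t ^ 3 / 3)) * (1 + \<kappa> * t)) 0) (at 0)"
      unfolding e by (rule pt_hvd) (auto intro!: derivative_eq_intros)
  qed
  have aw: "\<exists>l. l \<noteq> 0 \<and> dr UNIV \<Phi> (rb t) (rf t) = l *\<^sub>R w t" if t: "t \<in> S" for t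
  proof (intro exI conjI)
    show nz: "1 + \<kappa> * t \<noteq> 0" using t by (simp add: S_def)
    have "c * (t + t ^ 3 * (\<kappa>\<^sup>2 / c + 2 / 3 * \<kappa>\<^sup>2)) = c * t + \<kappa>\<^sup>2 * t ^ 3 + c * (2 / 3 * \<kappa>\<^sup>2 * t ^ 3)" if "c \<noteq> 0" for c
      using that by (simp add: field_simps)
    from this[OF nz] have "t + 2 * \<kappa> * (t\<^sup>2 / 2 + \<kappa> * (t ^ 3 / 3)) * (1 + \<kappa> * t) =
        (1 + \<kappa> * t) * (t + t ^ 3 * (\<kappa>\<^sup>2 / (1 + \<kappa> * t) + 2 / 3 * \<kappa>\<^sup>2))"
      by (simp add: algebra_simps power2_eq_square power3_eq_cube)
    moreover have "(1 + \<kappa> * t) *\<^sub>R w t = pt (1 + \<kappa> * t) ((1 + \<kappa> * t) * (t + t ^ 3 * (\<kappa>\<^sup>2 / (1 + \<kappa> * t) + 2 / 3 * \<kappa>\<^sup>2))) 0"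
      unfolding w_def h_def rf_def by simp
    ultimately show "dr UNIV \<Phi> (rb t) (rf t) = (1 + \<kappa> * t) *\<^sub>R w t" unfolding a by (simp only:)
  qed
  have b: "((\<lambda>s. \<Phi> (rb s)) has_vector_derivative t *\<^sub>R rf t + t\<^sup>2 *\<^sub>R k t) (at t)" for t
  proof -
    have e: "\<Phi> (rb s) = pt (s\<^sup>2 / 2 + \<kappa> * (s ^ 3 / 3)) (s ^ 3 / 3 + \<kappa> * (s\<^sup>2 / 2 + \<kappa> * (s ^ 3 / 3))\<^sup>2) 0" for s by (simp add: \<Phi>_def pm_def rb_def)
    show ?thesis unfolding e rf_def k_def pt_simps
      by (rule pt_hvd) (auto intro!: derivative_eq_intros simp: power2_eq_square power3_eq_cube field_simps)
  qed
  have r: "dr P3 (lift3 \<Phi>) (le p2V (D0 + W0)) E0 = E0 + vert (D0 + W0) (2 *\<^sub>R vert U1 (emb (k 0) + 3 *\<^sub>R vert ex (h 0)))"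
    by (rule rvr_act[OF pa S sm(1) smh sm(2) w_def aw b])
  \<comment> \<open>The line field contributes a multiple of \<open>vert U1 U1\<close> = 0 to the
    final formula, so only the part from \<open>k 0\<close> survives.\<close>
  have e: "h 0 = (5 / 3 * \<kappa>\<^sup>2) *\<^sub>R ey" "k 0 = \<kappa> *\<^sub>R ex" by (simp_all add: k_def h_def)
  have "dr P3 (lift3 \<Phi>) (le p2V (D0 + W0)) E0 = E0 + p *\<^sub>R vert (D0 + W0) W0"
    unfolding r e by (simp only: vert_simps vert_self emb_simps scaleR_scaleR scaleR_zero_right add_0_right) (simp add: \<kappa>_def)
  moreover have "dr UNIV \<Phi> 0 ex = ex" "\<Phi> 0 = 0" using L(1) l[of 0] by (simp_all add: l'_def)
  ultimately show ?thesis using pa d X by blast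
qed

lemma rvt1_linear:
  "\<exists>\<Phi>. polyaut \<Phi> \<and> \<Phi> 0 = 0 \<and> dr UNIV \<Phi> 0 ex = ex \<and> dr UNIV \<Phi> 0 ey = ey + k *\<^sub>R ex \<and> dr UNIV \<Phi> 0 ez = ez + (2 * k) *\<^sub>R ey"
proof -
  define \<Phi> where "\<Phi> = pm (\<lambda>x y z. pt (x + k * y) (y + 2 * k * z) z)"
  have pa: "polyaut \<Phi>" unfolding \<Phi>_def
    by (rule polyautI[where f' = "\<lambda>x y z. x - k * (y - 2 * k * z)" and g' = "\<lambda>x y z. y - 2 * k * z" and h' = "\<lambda>x y z. z"])
      (intro poly3_intros | simp)+
  have lin: "linear \<Phi>" by (rule linearI) (simp_all add: \<Phi>_def pm_def algebra_simps)
  have e: "\<Phi> ex = 1 *\<^sub>R ex" by (simp add: \<Phi>_def pm_def)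
  note a = linear_act(1,2)[OF pa lin e one_neq_zero]
  show ?thesis using pa a(1) by (intro exI[of _ \<Phi>]) (simp add: a(2), simp add: \<Phi>_def pm_def)
qed

subsection \<open>Counting the orbits\<close>

lemma cls_0: "cls P0 id (\<lambda>\<Phi>. \<Phi>) {0}"
proof -
  have "\<exists>\<Phi>. polyaut \<Phi> \<and> \<Phi> p = 0" for p
  proof (intro exI conjI)
    show "polyaut (pm (\<lambda>x y z. pt (x - p $ 1) (y - p $ 2) (z - p $ 3)))"
      by (rule polyautI[where f' = "\<lambda>x y z. x + p $ 1" and g' = "\<lambda>x y z. y + p $ 2" and h' = "\<lambda>x y z. z + p $ 3"]) (intro poly3_intros | simp)+
  qed (simp add: pm_def)
  then show ?thesis unfolding cls_def by simp
qed

lemma node_0: "node P0 \<Delta>0 id (\<lambda>\<Phi>. \<Phi>) 0 {ex}"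
proof -
  have "\<exists>\<Phi> c. polyaut \<Phi> \<and> \<Phi> 0 = 0 \<and> dr UNIV \<Phi> 0 v = c *\<^sub>R ex" if v: "v \<noteq> 0" for v :: "real^3"
  proof -
    \<comment> \<open>A linear form x + a y + b z that does not vanish on v; it becomes the first
      coordinate and is then used to clear the other two.\<close>
    obtain a b where "v $ 1 + a * v $ 2 + b * v $ 3 \<noteq> 0"
    proof (cases "v $ 1 = 0")
      case True
      have "v $ 2 \<noteq> 0 \<or> v $ 3 \<noteq> 0" using True v by (auto simp: vec_eq_iff forall_3)
      then have "v $ 2 * v $ 2 + v $ 3 * v $ 3 \<noteq> 0" by (simp add: sum_squares_eq_zero_iff)
      then show ?thesis using True by (intro that[of "v $ 2" "v $ 3"]) simp
    next
      case False then show ?thesis by (intro that[of 0 0]) simp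
    qed
    then obtain s where s: "s = v $ 1 + a * v $ 2 + b * v $ 3" "s \<noteq> 0" by blast
    define r where "r = v $ 2 / s"
    define t where "t = v $ 3 / s"
    define \<Phi> where "\<Phi> = pm (\<lambda>x y z. pt (x + a * y + b * z) (y - r * (x + a * y + b * z)) (z - t * (x + a * y + b * z)))"
    have pa: "polyaut \<Phi>" unfolding \<Phi>_def
      by (rule polyautI[where f' = "\<lambda>x y z. x - a * (y + r * x) - b * (z + t * x)" and g' = "\<lambda>x y z. y + r * x" and h' = "\<lambda>x y z. z + t * x"])
        (intro poly3_intros | simp)+
    have lin: "linear \<Phi>" by (rule linearI) (simp_all add: \<Phi>_def pm_def algebra_simps)
    have "\<Phi> v = s *\<^sub>R ex" using s by (simp add: \<Phi>_def pm_def r_def t_def)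
    moreover have "dr UNIV \<Phi> 0 v = \<Phi> v"
      by (rule dr_eq[OF pa]) (auto simp: linear_scale[OF lin] intro!: derivative_eq_intros)
    ultimately show ?thesis using pa linear_0[OF lin] by metis
  qed
  then show ?thesis unfolding node_def by auto
qed

lemma cmb_image:
  "cmb x y z ` {(1,0,0), (0,1,0)} = {x, y}"
  "cmb x y z ` {(1,1,0), (0,1,0), (1,0,0), (1,0,1), (0,0,1)} = {x + y, y, x, x + z, z}"
  by (simp_all add: cmb_def)

lemmas node_folds = P1_def \<Delta>1_def lift1_def P2_def \<Delta>2_def lift2_def P3_def \<Delta>3_def lift3_def

lemma node_p1: "node P1 \<Delta>1 base_pt lift1 p1 {X1, U1}" "card {X1, U1} = 2"
  using vn.reg_node1[OF vn0, folded node_folds] unfolding cmb_image by simp_all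

lemma node_p2: "node P2 \<Delta>2 (base_pt \<circ> base_pt) lift2 p2 {X2, U2}" "card {X2, U2} = 2"
  using vn.reg_node1[OF vn1, folded node_folds] unfolding cmb_image by simp_all

lemma node_p2V: "node P2 \<Delta>2 (base_pt \<circ> base_pt) lift2 p2V {D0 + W0, W0, D0, D0 + Y0, Y0}" "card {D0 + W0, W0, D0, D0 + Y0, Y0} = 5"
  using vn.v_node[OF vn0, folded node_folds] unfolding cmb_image by simp_all

definition has_node :: "real^(3 prol prol prol) \<Rightarrow> nat \<Rightarrow> bool" where
  "has_node m n \<longleftrightarrow> (\<exists>J. node P3 \<Delta>3 (base_pt \<circ> base_pt \<circ> base_pt) lift3 m J \<and> card J = n)"

text \<open>In the usual coding (R regular, V vertical, T tangency, L both) these are the points RRR, RRV,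
  RVR, RVV, the two orbits of RVT, and RVL.\<close>
lemma nodes_3:
  "has_node (le p2 X2) 2" "has_node (le p2 U2) 5" "has_node (le p2V (D0 + W0)) 4" "has_node (le p2V W0) 7"
  "has_node (le p2V D0) 5" "has_node (le p2V (D0 + Y0)) 4" "has_node (le p2V Y0) 7"
proof -
  have I: "has_node m n" if "node P3 \<Delta>3 (base_pt \<circ> base_pt \<circ> base_pt) lift3 m J" "card J = n" for m n J
    using that unfolding has_node_def by blast
  show "has_node (le p2 X2) 2" by (rule I[OF vn.reg_node1[OF vn2, folded node_folds]])
  show "has_node (le p2 U2) 5" by (rule I[OF vn.v_node[OF vn1, folded node_folds]])
  show "has_node (le p2V D0) 5" by (rule I[OF vn.rvt0_node[OF vn0, folded node_folds, unfolded id_comp]])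
  show "has_node (le p2V W0) 7" by (rule I[OF vn.rvv_node[OF vn0, folded node_folds, unfolded id_comp]])
  show "has_node (le p2V Y0) 7" by (rule I[OF vn.rvl_node[OF vn0, folded node_folds, unfolded id_comp]])
  show "has_node (le p2V (D0 + Y0)) 4" by (rule I[OF vn.rvt1_node[OF vn0, folded node_folds, unfolded id_comp, OF rvt1_linear]])
  show "has_node (le p2V (D0 + W0)) 4"
    by (rule I[OF vn.rvr_node[OF vn0, folded node_folds, unfolded id_comp, OF rg_jets(6,7) rvr_shear_x rvr_shear_z]])
qed

lemma cls_1: "cls P1 base_pt lift1 {p1}"
  using L0.step(1)[OF cls_0, of "\<lambda>_. {ex}"] node_0 unfolding P1_def lift1_def by simp

lemma cls_2: "cls P2 (base_pt \<circ> base_pt) lift2 {p2, p2V}" "card {p2, p2V} = 2"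
  using L1.step[OF cls_1, of "\<lambda>_. {X1, U1}"] node_p1 unfolding P2_def[symmetric] lift2_def[symmetric] by simp_all

lemma cls_3:
  defines "N \<equiv> {le p2 X2, le p2 U2, le p2V (D0 + W0), le p2V W0, le p2V D0, le p2V (D0 + Y0), le p2V Y0}"
  shows "cls P3 (base_pt \<circ> base_pt \<circ> base_pt) lift3 N" "card N = 7"
proof -
  define J where "J m = (if m = p2 then {X2, U2} else {D0 + W0, W0, D0, D0 + Y0, Y0})" for m
  have ne: "p2 \<noteq> p2V" using cls_2(2) by auto
  then have J: "J p2 = {X2, U2}" "J p2V = {D0 + W0, W0, D0, D0 + Y0, Y0}" by (simp_all add: J_def)
  have n: "node P2 \<Delta>2 (base_pt \<circ> base_pt) lift2 m (J m)" if "m \<in> {p2, p2V}" for m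
    using that node_p2(1) node_p2V(1) J by auto
  note s = L2.step[OF cls_2(1) n, folded node_folds]
  have e: "(\<Union>m\<in>{p2, p2V}. le m ` J m) = N" unfolding UN_insert J N_def by auto
  show "cls P3 (base_pt \<circ> base_pt \<circ> base_pt) lift3 N" using s(1) unfolding e by simp
  have "(\<Sum>m\<in>{p2, p2V}. card (J m)) = card (J p2) + card (J p2V)" using ne by simp
  then show "card N = 7" using s(2) unfolding e J node_p2(2) node_p2V(2) by simp
qed

lemma cls_4: "\<exists>N. cls P4 (base_pt \<circ> base_pt \<circ> base_pt \<circ> base_pt) lift4 N \<and> card N = 34"
proof -
  let ?xs = "[le p2 X2, le p2 U2, le p2V (D0 + W0), le p2V W0, le p2V D0, le p2V (D0 + Y0), le p2V Y0]"
  let ?ns = "[2, 5, 4, 7, 5, 4, 7] :: nat list"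
  have d: "distinct ?xs" using cls_3(2) by (intro card_distinct) simp
  \<comment> \<open>The counts are attached to the points through an association list; as the seven
    points are distinct, the sum over their set is the sum of the list of counts.\<close>
  define c where "c m = the (map_of (zip ?xs ?ns) m)" for m
  have c: "map c ?xs = ?ns" using d by (auto simp: c_def)
  have "has_node m (c m)" if "m \<in> set ?xs" for m
    using that nodes_3 c by (auto simp del: le_scale)
  then have "\<forall>m\<in>set ?xs. \<exists>J. node P3 \<Delta>3 (base_pt \<circ> base_pt \<circ> base_pt) lift3 m J \<and> card J = c m" unfolding has_node_def by blast
  then obtain J where J: "\<forall>m\<in>set ?xs. node P3 \<Delta>3 (base_pt \<circ> base_pt \<circ> base_pt) lift3 m (J m) \<and> card (J m) = c m" by metis
  have N: "cls P3 (base_pt \<circ> base_pt \<circ> base_pt) lift3 (set ?xs)" using cls_3(1) by simp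
  have n: "node P3 \<Delta>3 (base_pt \<circ> base_pt \<circ> base_pt) lift3 m (J m)" if "m \<in> set ?xs" for m using J that by blast
  have "(\<Sum>m\<in>set ?xs. card (J m)) = (\<Sum>m\<in>set ?xs. c m)" using J by (intro sum.cong) auto
  also have "\<dots> = sum_list (map c ?xs)" by (rule sum.distinct_set_conv_list[OF d])
  also have "\<dots> = 34" unfolding c by simp
  finally show ?thesis using L3.step[OF N n] unfolding P4_def lift4_def by auto
qed

theorem theorem3p1:
  shows "card (orbits P1 base_pt lift1) = 1
    \<and> card (orbits P2 (base_pt \<circ> base_pt) lift2) = 2
    \<and> card (orbits P3 (base_pt \<circ> base_pt \<circ> base_pt) lift3) = 7
    \<and> card (orbits P4 (base_pt \<circ> base_pt \<circ> base_pt \<circ> base_pt) lift4) = 34"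
proof (intro conjI)
  show "card (orbits P1 base_pt lift1) = 1" using L1.card_orbits[OF cls_1] by simp
  show "card (orbits P2 (base_pt \<circ> base_pt) lift2) = 2" using L2.card_orbits[OF cls_2(1)] cls_2(2) by simp
  show "card (orbits P3 (base_pt \<circ> base_pt \<circ> base_pt) lift3) = 7" using L3.card_orbits[OF cls_3(1)] cls_3(2) by simp
  obtain N where N: "cls P4 (base_pt \<circ> base_pt \<circ> base_pt \<circ> base_pt) lift4 N" "card N = 34" using cls_4 by blast
  have "level P4 (prol_dist P3 \<Delta>3) (base_pt \<circ> base_pt \<circ> base_pt \<circ> base_pt) lift4"
    using L3.prolong unfolding P4_def lift4_def[abs_def] .
  then show "card (orbits P4 (base_pt \<circ> base_pt \<circ> base_pt \<circ> base_pt) lift4) = 34"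
    using level.card_orbits[OF _ N(1)] N(2) by simp
qed

end
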